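(* Let $k$ be a field, let $\Gamma=\mathbb Z$ and $\Lambda=\{-1,0\}\subset\mathbb Z$. Let $B$ and $B'$ be finite-dimensional $k$-bialgebras, and let $FB$ and $FB'$ be the trivial filtrations $k\cdot 1_B\subseteq B$ and $k\cdot 1_{B'}\subseteq B'$. The categories $\operatorname{glid}_\Lambda FB$ and $\operatorname{glid}_\Lambda FB'$ are ($k$-linearly) monoidally equivalent if and only if $B$ and $B'$ are isomorphic as bialgebras.
   Context: The trivial (standard one-step) filtration $k\cdot1_B\subseteq B$ is the $\mathbb Z$-filtration with $F_iB=0$ for $i<0$, $F_0B=k\cdot 1_B$, and $F_iB=B$ for $i\ge1$. With $\Lambda=\{-1,0\}$, the $k$-linear category $\mathcal F_\Lambda B$ has objects $-1,0$ and $\operatorname{Hom}(\alpha,\beta)=F_{\beta-\alpha}B$ if $\alpha\le\beta$ and $0$ otherwise, with composition given by multiplication in $B$. So $\operatorname{End}(-1)=\operatorname{End}(0)=k$, $\operatorname{Hom}(-1,0)=B$ and $\operatorname{Hom}(0,-1)=0$. The category $\overline{\mathcal F}_\Lambda B$ has objects $-1,0,\infty$, contains $\mathcal F_\Lambda B$ as a full subcategory, and has $\operatorname{Hom}(\alpha,\infty)=B$ for $\alpha\in\{-1,0,\infty\}$ and $\operatorname{Hom}(\infty,\alpha)=0$ for $\alpha\ne\infty$, with composition given by multiplication in $B$. For $\alpha\le\beta$ or $\beta=\infty$, write $1_{\alpha,\beta}\in\operatorname{Hom}(\alpha,\beta)$ for the element $1_B$. $\operatorname{Preglid}_\Lambda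 FB$ is the category of $k$-linear functors $M\colon\overline{\mathcal F}_\Lambda B\to\mathrm{Vect}_k$ (equivalently, additive functors to abelian groups) for which all $M(1_{\alpha,\beta})$ are monomorphisms. Let $\Sigma$ be the class of its morphisms $f$ such that $f_{-1}$ and $f_0$ are isomorphisms. Then $\operatorname{Glid}_\Lambda FB=(\operatorname{Preglid}_\Lambda FB)[\Sigma^{-1}]$, with localization functor $Q$. The category $\operatorname{glid}_\Lambda FB$ is its full subcategory of Noetherian objects (those in which every ascending sequence of subobjects is stationary). Monoidal structure: $\operatorname{Preglid}_\Lambda FB$ is monoidal with $(M\otimes N)(\lambda)=M(\lambda)\otimes_kN(\lambda)$, where $b\in\operatorname{Hom}(\lambda,\mu)\subseteq B$ acts by $\sum M(b_{(1)})\otimes N(b_{(2)})$ for $\Delta(b)=\sum b_{(1)}\otimes b_{(2)}$; the unit object has value $k$ everywhere with $b$ acting by the counit. If $s,t\in\Sigma$ then $s\otimes t\in\Sigma$, so $\operatorname{Glid}_\Lambda FB$ inherits the monoidal structure for which $Q$ (the identity on objects) is monoidal; $\operatorname{glid}_\Lambda FB$ is a monoidal subcategory. *)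

theory Defs
  imports "Jordan_Normal_Form.Missing_VectorSpace" "HOL-Library.FuncSet"
begin

section \<open>Tensor products of vector spaces\<close>

text \<open>
  The library's record of modules extends the record of rings, although only its additive part
  matters for a module. The two multiplicative fields are left unspecified here; spaces that differ
  only in them are isomorphic by the identity map.
\<close>

definition mk_space :: "'v set \<Rightarrow> 'v \<Rightarrow> ('v \<Rightarrow> 'v \<Rightarrow> 'v) \<Rightarrow> ('k \<Rightarrow> 'v \<Rightarrow> 'v) \<Rightarrow> ('k, 'v) module"
  where "mk_space A z p s =
    \<lparr>carrier = A, mult = undefined, one = undefined, zero = z, add = p, smult = s\<rparr>"

text \<open>
  A list \<open>[(v\<^sub>1, w\<^sub>1), \<dots>, (v\<^sub>n, w\<^sub>n)]\<close> stands for the formal sum of the \<open>v\<^sub>i \<otimes> w\<^sub>i\<close>. The tensor product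
  of \<open>V\<close> and \<open>W\<close> is the quotient of the monoid of formal sums by the congruence \<open>tens_eq K V W\<close>;
  each congruence class is represented by a chosen element of it, its normal form.
\<close>

inductive tens_eq ::
  "('k, 'r) ring_scheme \<Rightarrow> ('k, 'v, 'y) module_scheme \<Rightarrow> ('k, 'w, 'z) module_scheme \<Rightarrow>
     ('v \<times> 'w) list \<Rightarrow> ('v \<times> 'w) list \<Rightarrow> bool"
  for K and V and W where
  te_refl: "set l \<subseteq> carrier V \<times> carrier W \<Longrightarrow> tens_eq K V W l l"
| te_sym: "tens_eq K V W l m \<Longrightarrow> tens_eq K V W m l"
| te_trans: "tens_eq K V W l m \<Longrightarrow> tens_eq K V W m n \<Longrightarrow> tens_eq K V W l n"
| te_append: "tens_eq K V W l l' \<Longrightarrow> tens_eq K V W m m' \<Longrightarrow> tens_eq K V W (l @ m) (l' @ m')"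
| te_commute: "set l \<subseteq> carrier V \<times> carrier W \<Longrightarrow> set m \<subseteq> carrier V \<times> carrier W \<Longrightarrow>
    tens_eq K V W (l @ m) (m @ l)"
| te_add_left: "v \<in> carrier V \<Longrightarrow> v' \<in> carrier V \<Longrightarrow> w \<in> carrier W \<Longrightarrow>
    tens_eq K V W [(v \<oplus>\<^bsub>V\<^esub> v', w)] [(v, w), (v', w)]"
| te_add_right: "v \<in> carrier V \<Longrightarrow> w \<in> carrier W \<Longrightarrow> w' \<in> carrier W \<Longrightarrow>
    tens_eq K V W [(v, w \<oplus>\<^bsub>W\<^esub> w')] [(v, w), (v, w')]"
| te_smult: "c \<in> carrier K \<Longrightarrow> v \<in> carrier V \<Longrightarrow> w \<in> carrier W \<Longrightarrow>
    tens_eq K V W [(c \<odot>\<^bsub>V\<^esub> v, w)] [(v, c \<odot>\<^bsub>W\<^esub> w)]"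
| te_zero: "w \<in> carrier W \<Longrightarrow> tens_eq K V W [(\<zero>\<^bsub>V\<^esub>, w)] []"

definition tens_nf ::
  "('k, 'r) ring_scheme \<Rightarrow> ('k, 'v, 'y) module_scheme \<Rightarrow> ('k, 'w, 'z) module_scheme \<Rightarrow>
     ('v \<times> 'w) list \<Rightarrow> ('v \<times> 'w) list"
  where "tens_nf K V W l = (SOME m. tens_eq K V W l m)"

definition tensor ::
  "('k, 'r) ring_scheme \<Rightarrow> ('k, 'v, 'y) module_scheme \<Rightarrow> ('k, 'w, 'z) module_scheme \<Rightarrow>
     ('k, ('v \<times> 'w) list) module"
  where "tensor K V W =
    mk_space (tens_nf K V W ` {l. set l \<subseteq> carrier V \<times> carrier W})
      (tens_nf K V W [])
      (\<lambda>l m. tens_nf K V W (l @ m))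
      (\<lambda>c l. tens_nf K V W (map (\<lambda>(v, w). (c \<odot>\<^bsub>V\<^esub> v, w)) l))"

definition pure_tensor ::
  "('k, 'r) ring_scheme \<Rightarrow> ('k, 'v, 'y) module_scheme \<Rightarrow> ('k, 'w, 'z) module_scheme \<Rightarrow>
     'v \<Rightarrow> 'w \<Rightarrow> ('v \<times> 'w) list"
  where "pure_tensor K V W v w = tens_nf K V W [(v, w)]"

text \<open>
  The linear map to \<open>Z\<close> that a bilinear map \<open>\<beta>\<close> induces on the tensor product, written as
  \<open>\<Sum> \<beta> x\<^sub>(\<^sub>1\<^sub>) x\<^sub>(\<^sub>2\<^sub>)\<close> in Sweedler notation.
\<close>

definition tens_lift :: "('z, 'r) ring_scheme \<Rightarrow> ('v \<Rightarrow> 'w \<Rightarrow> 'z) \<Rightarrow> ('v \<times> 'w) list \<Rightarrow> 'z"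
  where "tens_lift Z \<beta> x = foldr (\<lambda>(v, w) s. \<beta> v w \<oplus>\<^bsub>Z\<^esub> s) x \<zero>\<^bsub>Z\<^esub>"


section \<open>Bialgebras\<close>

text \<open>The ring fields of the module record carry the multiplication and the unit.\<close>

record ('k, 'b) bialg = "('k, 'b) module" +
  comult :: "'b \<Rightarrow> ('b \<times> 'b) list"
  counit :: "'b \<Rightarrow> 'k"

locale bialgebra = vectorspace K B + B: ring B
  for K :: "('k, 'r) ring_scheme" and B :: "('k, 'b, 'z) bialg_scheme" +
  assumes smult_mult_left: "\<And>c x y. c \<in> carrier K \<Longrightarrow> x \<in> carrier B \<Longrightarrow> y \<in> carrier B \<Longrightarrow>
      (c \<odot>\<^bsub>B\<^esub> x) \<otimes>\<^bsub>B\<^esub> y = c \<odot>\<^bsub>B\<^esub> (x \<otimes>\<^bsub>B\<^esub> y)"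
    and smult_mult_right: "\<And>c x y. c \<in> carrier K \<Longrightarrow> x \<in> carrier B \<Longrightarrow> y \<in> carrier B \<Longrightarrow>
      x \<otimes>\<^bsub>B\<^esub> (c \<odot>\<^bsub>B\<^esub> y) = c \<odot>\<^bsub>B\<^esub> (x \<otimes>\<^bsub>B\<^esub> y)"
    and comult_linear: "linear_map K B (tensor K B B) (comult B)"
    and counit_smult: "\<And>c x. c \<in> carrier K \<Longrightarrow> x \<in> carrier B \<Longrightarrow>
      counit B (c \<odot>\<^bsub>B\<^esub> x) = c \<otimes>\<^bsub>K\<^esub> counit B x"
    and coassociative: "\<And>b. b \<in> carrier B \<Longrightarrow>
      tens_lift (tensor K B (tensor K B B))
        (\<lambda>x z. tens_lift (tensor K B (tensor K B B))
           (\<lambda>u v. pure_tensor K B (tensor K B B) u (pure_tensor K B B v z)) (comult B x))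
        (comult B b) =
      tens_lift (tensor K B (tensor K B B))
        (\<lambda>x y. pure_tensor K B (tensor K B B) x (comult B y)) (comult B b)"
    and counit_left: "\<And>b. b \<in> carrier B \<Longrightarrow>
      tens_lift B (\<lambda>x y. counit B x \<odot>\<^bsub>B\<^esub> y) (comult B b) = b"
    and counit_right: "\<And>b. b \<in> carrier B \<Longrightarrow>
      tens_lift B (\<lambda>x y. counit B y \<odot>\<^bsub>B\<^esub> x) (comult B b) = b"
    and comult_mult: "\<And>a b. a \<in> carrier B \<Longrightarrow> b \<in> carrier B \<Longrightarrow>
      comult B (a \<otimes>\<^bsub>B\<^esub> b) =
      tens_lift (tensor K B B)
        (\<lambda>a1 a2. tens_lift (tensor K B B)
           (\<lambda>b1 b2. pure_tensor K B B (a1 \<otimes>\<^bsub>B\<^esub> b1) (a2 \<otimes>\<^bsub>B\<^esub> b2)) (comult B b))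
        (comult B a)"
    and comult_one: "comult B \<one>\<^bsub>B\<^esub> = pure_tensor K B B \<one>\<^bsub>B\<^esub> \<one>\<^bsub>B\<^esub>"
    and counit_ring_hom: "counit B \<in> ring_hom B K"

definition bialg_isomorphic ::
  "('k, 'r) ring_scheme \<Rightarrow> ('k, 'b, 'y) bialg_scheme \<Rightarrow> ('k, 'c, 'z) bialg_scheme \<Rightarrow> bool"
  where "bialg_isomorphic K B B' \<longleftrightarrow> (\<exists>\<phi>.
    bij_betw \<phi> (carrier B) (carrier B') \<and> linear_map K B B' \<phi> \<and> \<phi> \<in> ring_hom B B' \<and>
    (\<forall>b\<in>carrier B. counit B' (\<phi> b) = counit B b \<and>
       comult B' (\<phi> b) =
         tens_lift (tensor K B' B') (\<lambda>x y. pure_tensor K B' B' (\<phi> x) (\<phi> y)) (comult B b)))"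


section \<open>Linear and monoidal categories\<close>

text \<open>
  Hom-spaces are vector spaces that need not be disjoint, so identities, compositions and tensor
  products of morphisms take the objects involved as arguments: \<open>Cmp C X Y Z g f\<close> is the composite
  of \<open>f: X \<rightarrow> Y\<close> and \<open>g: Y \<rightarrow> Z\<close>.
\<close>

record ('k, 'o, 'm) lincat =
  Ob :: "'o set"
  Hom :: "'o \<Rightarrow> 'o \<Rightarrow> ('k, 'm) module"
  Idn :: "'o \<Rightarrow> 'm"
  Cmp :: "'o \<Rightarrow> 'o \<Rightarrow> 'o \<Rightarrow> 'm \<Rightarrow> 'm \<Rightarrow> 'm"

text \<open>
  \<open>TenA C X X' Y Y' f g: X \<otimes> Y \<rightarrow> X' \<otimes> Y'\<close> is the tensor product of \<open>f: X \<rightarrow> X'\<close> and \<open>g: Y \<rightarrow> Y'\<close>;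
  \<open>Asc C X Y Z: (X \<otimes> Y) \<otimes> Z \<rightarrow> X \<otimes> (Y \<otimes> Z)\<close>, \<open>LUn C X: I \<otimes> X \<rightarrow> X\<close> and \<open>RUn C X: X \<otimes> I \<rightarrow> X\<close>.
\<close>

record ('k, 'o, 'm) moncat = "('k, 'o, 'm) lincat" +
  TenO :: "'o \<Rightarrow> 'o \<Rightarrow> 'o"
  TenA :: "'o \<Rightarrow> 'o \<Rightarrow> 'o \<Rightarrow> 'o \<Rightarrow> 'm \<Rightarrow> 'm \<Rightarrow> 'm"
  Unt :: "'o"
  Asc :: "'o \<Rightarrow> 'o \<Rightarrow> 'o \<Rightarrow> 'm"
  LUn :: "'o \<Rightarrow> 'm"
  RUn :: "'o \<Rightarrow> 'm"

definition cat_mono :: "('k, 'o, 'm, 'z) lincat_scheme \<Rightarrow> 'o \<Rightarrow> 'o \<Rightarrow> 'm \<Rightarrow> bool"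
  where "cat_mono C X Y f \<longleftrightarrow> f \<in> carrier (Hom C X Y) \<and>
    (\<forall>W\<in>Ob C. \<forall>g\<in>carrier (Hom C W X). \<forall>h\<in>carrier (Hom C W X).
       Cmp C W X Y f g = Cmp C W X Y f h \<longrightarrow> g = h)"

definition cat_iso :: "('k, 'o, 'm, 'z) lincat_scheme \<Rightarrow> 'o \<Rightarrow> 'o \<Rightarrow> 'm \<Rightarrow> bool"
  where "cat_iso C X Y f \<longleftrightarrow> f \<in> carrier (Hom C X Y) \<and>
    (\<exists>g\<in>carrier (Hom C Y X). Cmp C X Y X g f = Idn C X \<and> Cmp C Y X Y f g = Idn C Y)"

text \<open>
  Ascending sequences of subobjects of \<open>X\<close>, represented by monomorphisms \<open>m n: S n \<rightarrow> X\<close>; one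
  subobject is contained in another if its monomorphism factors through the other one.
\<close>

definition subobject_le ::
  "('k, 'o, 'm, 'z) lincat_scheme \<Rightarrow> 'o \<Rightarrow> 'o \<Rightarrow> 'm \<Rightarrow> 'o \<Rightarrow> 'm \<Rightarrow> bool"
  where "subobject_le C X S m T n \<longleftrightarrow> (\<exists>h\<in>carrier (Hom C S T). Cmp C S T X n h = m)"

definition noetherian_object :: "('k, 'o, 'm, 'z) lincat_scheme \<Rightarrow> 'o \<Rightarrow> bool"
  where "noetherian_object C X \<longleftrightarrow>
    (\<forall>(S :: nat \<Rightarrow> 'o) m.
       (\<forall>n. S n \<in> Ob C \<and> cat_mono C (S n) X (m n)) \<and>
       (\<forall>n. subobject_le C X (S n) (m n) (S (Suc n)) (m (Suc n))) \<longrightarrow>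
       (\<exists>N. \<forall>n\<ge>N. subobject_le C X (S n) (m n) (S N) (m N)))"

record ('o, 'm, 'p, 'n) ftor =
  fob :: "'o \<Rightarrow> 'p"
  far :: "'o \<Rightarrow> 'o \<Rightarrow> 'm \<Rightarrow> 'n"

definition linear_functor ::
  "('k, 'r) ring_scheme \<Rightarrow> ('k, 'o, 'm, 'y) lincat_scheme \<Rightarrow> ('k, 'p, 'n, 'z) lincat_scheme \<Rightarrow>
     ('o, 'm, 'p, 'n) ftor \<Rightarrow> bool"
  where "linear_functor K C D F \<longleftrightarrow>
    (\<forall>X\<in>Ob C. fob F X \<in> Ob D) \<and>
    (\<forall>X\<in>Ob C. \<forall>Y\<in>Ob C. linear_map K (Hom C X Y) (Hom D (fob F X) (fob F Y)) (far F X Y)) \<and>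
    (\<forall>X\<in>Ob C. far F X X (Idn C X) = Idn D (fob F X)) \<and>
    (\<forall>X\<in>Ob C. \<forall>Y\<in>Ob C. \<forall>Z\<in>Ob C. \<forall>f\<in>carrier (Hom C X Y). \<forall>g\<in>carrier (Hom C Y Z).
       far F X Z (Cmp C X Y Z g f) =
       Cmp D (fob F X) (fob F Y) (fob F Z) (far F Y Z g) (far F X Y f))"

definition id_functor :: "('o, 'm, 'o, 'm) ftor"
  where "id_functor = \<lparr>fob = (\<lambda>X. X), far = (\<lambda>X Y f. f)\<rparr>"

definition comp_functor ::
  "('p, 'n, 'q, 'l) ftor \<Rightarrow> ('o, 'm, 'p, 'n) ftor \<Rightarrow> ('o, 'm, 'q, 'l) ftor"
  where "comp_functor G F =
    \<lparr>fob = (\<lambda>X. fob G (fob F X)), far = (\<lambda>X Y f. far G (fob F X) (fob F Y) (far F X Y f))\<rparr>"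

definition natural_iso ::
  "('k, 'o, 'm, 'y) lincat_scheme \<Rightarrow> ('k, 'p, 'n, 'z) lincat_scheme \<Rightarrow>
     ('o, 'm, 'p, 'n) ftor \<Rightarrow> ('o, 'm, 'p, 'n) ftor \<Rightarrow> ('o \<Rightarrow> 'n) \<Rightarrow> bool"
  where "natural_iso C D F G \<eta> \<longleftrightarrow>
    (\<forall>X\<in>Ob C. cat_iso D (fob F X) (fob G X) (\<eta> X)) \<and>
    (\<forall>X\<in>Ob C. \<forall>Y\<in>Ob C. \<forall>f\<in>carrier (Hom C X Y).
       Cmp D (fob F X) (fob F Y) (fob G Y) (\<eta> Y) (far F X Y f) =
       Cmp D (fob F X) (fob G X) (fob G Y) (far G X Y f) (\<eta> X))"

definition linear_equivalence ::
  "('k, 'r) ring_scheme \<Rightarrow> ('k, 'o, 'm, 'y) lincat_scheme \<Rightarrow> ('k, 'p, 'n, 'z) lincat_scheme \<Rightarrow>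
     ('o, 'm, 'p, 'n) ftor \<Rightarrow> bool"
  where "linear_equivalence K C D F \<longleftrightarrow> linear_functor K C D F \<and>
    (\<exists>G \<eta> \<epsilon>. linear_functor K D C G \<and>
       natural_iso C C id_functor (comp_functor G F) \<eta> \<and>
       natural_iso D D (comp_functor F G) id_functor \<epsilon>)"

text \<open>
  \<open>J X Y: F X \<otimes> F Y \<rightarrow> F (X \<otimes> Y)\<close> and \<open>u: I \<rightarrow> F I\<close> are the structure isomorphisms of a (strong)
  monoidal functor.
\<close>

definition monoidal_functor ::
  "('k, 'r) ring_scheme \<Rightarrow> ('k, 'o, 'm, 'y) moncat_scheme \<Rightarrow> ('k, 'p, 'n, 'z) moncat_scheme \<Rightarrow>
     ('o, 'm, 'p, 'n) ftor \<Rightarrow> ('o \<Rightarrow> 'o \<Rightarrow> 'n) \<Rightarrow> 'n \<Rightarrow> bool"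
  where "monoidal_functor K C D F J u \<longleftrightarrow>
    linear_functor K C D F \<and>
    (\<forall>X\<in>Ob C. \<forall>Y\<in>Ob C.
       cat_iso D (TenO D (fob F X) (fob F Y)) (fob F (TenO C X Y)) (J X Y)) \<and>
    (\<forall>X\<in>Ob C. \<forall>X'\<in>Ob C. \<forall>Y\<in>Ob C. \<forall>Y'\<in>Ob C.
       \<forall>f\<in>carrier (Hom C X X'). \<forall>g\<in>carrier (Hom C Y Y').
       Cmp D (TenO D (fob F X) (fob F Y)) (fob F (TenO C X Y)) (fob F (TenO C X' Y'))
         (far F (TenO C X Y) (TenO C X' Y') (TenA C X X' Y Y' f g)) (J X Y) =
       Cmp D (TenO D (fob F X) (fob F Y)) (TenO D (fob F X') (fob F Y')) (fob F (TenO C X' Y'))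
         (J X' Y')
         (TenA D (fob F X) (fob F X') (fob F Y) (fob F Y') (far F X X' f) (far F Y Y' g))) \<and>
    cat_iso D (Unt D) (fob F (Unt C)) u \<and>
    (\<forall>X\<in>Ob C. \<forall>Y\<in>Ob C. \<forall>Z\<in>Ob C.
       let FX = fob F X; FY = fob F Y; FZ = fob F Z;
           XY = TenO C X Y; YZ = TenO C Y Z;
           A = TenO D (TenO D FX FY) FZ; E = fob F (TenO C X YZ)
       in Cmp D A (fob F (TenO C XY Z)) E
            (far F (TenO C XY Z) (TenO C X YZ) (Asc C X Y Z))
            (Cmp D A (TenO D (fob F XY) FZ) (fob F (TenO C XY Z))
               (J XY Z)
               (TenA D (TenO D FX FY) (fob F XY) FZ FZ (J X Y) (Idn D FZ))) =
          Cmp D A (TenO D FX (fob F YZ)) E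
            (J X YZ)
            (Cmp D A (TenO D FX (TenO D FY FZ)) (TenO D FX (fob F YZ))
               (TenA D FX FX (TenO D FY FZ) (fob F YZ) (Idn D FX) (J Y Z))
               (Asc D FX FY FZ))) \<and>
    (\<forall>X\<in>Ob C.
       let FX = fob F X; I = Unt C; A = TenO D (Unt D) FX
       in Cmp D A (fob F (TenO C I X)) FX
            (far F (TenO C I X) X (LUn C X))
            (Cmp D A (TenO D (fob F I) FX) (fob F (TenO C I X))
               (J I X)
               (TenA D (Unt D) (fob F I) FX FX u (Idn D FX))) =
          LUn D FX) \<and>
    (\<forall>X\<in>Ob C.
       let FX = fob F X; I = Unt C; A = TenO D FX (Unt D)
       in Cmp D A (fob F (TenO C X I)) FX
            (far F (TenO C X I) X (RUn C X))
            (Cmp D A (TenO D FX (fob F I)) (fob F (TenO C X I))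
               (J X I)
               (TenA D FX FX (Unt D) (fob F I) (Idn D FX) u)) =
          RUn D FX)"

definition linearly_monoidally_equivalent ::
  "('k, 'r) ring_scheme \<Rightarrow> ('k, 'o, 'm, 'y) moncat_scheme \<Rightarrow> ('k, 'p, 'n, 'z) moncat_scheme \<Rightarrow>
     bool"
  where "linearly_monoidally_equivalent K C D \<longleftrightarrow>
    (\<exists>F J u. monoidal_functor K C D F J u \<and> linear_equivalence K C D F)"


section \<open>Localization\<close>

text \<open>
  The Gabriel--Zisman construction of the localization of \<open>C\<close> at a class \<open>S\<close> of morphisms: its
  morphisms are zigzags modulo the congruence \<open>zigzag_eq\<close>. A step \<open>Fwd X Y f\<close> traverses
  \<open>f: X \<rightarrow> Y\<close> from \<open>X\<close> to \<open>Y\<close>, a step \<open>Bwd X Y s\<close> traverses \<open>s: X \<rightarrow> Y\<close> in \<open>S\<close> from \<open>Y\<close> to \<open>X\<close>, and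
  the steps of a zigzag are listed in the order in which they are traversed.
\<close>

datatype ('o, 'm) step = Fwd 'o 'o 'm | Bwd 'o 'o 'm

inductive zigzag ::
  "('k, 'o, 'm, 'z) lincat_scheme \<Rightarrow> ('o \<Rightarrow> 'o \<Rightarrow> 'm set) \<Rightarrow> 'o \<Rightarrow> 'o \<Rightarrow> ('o, 'm) step list \<Rightarrow> bool"
  for C and S where
  zz_nil: "X \<in> Ob C \<Longrightarrow> zigzag C S X X []"
| zz_fwd: "X \<in> Ob C \<Longrightarrow> Y \<in> Ob C \<Longrightarrow> f \<in> carrier (Hom C X Y) \<Longrightarrow> zigzag C S Y Z p \<Longrightarrow>
    zigzag C S X Z (Fwd X Y f # p)"
| zz_bwd: "X \<in> Ob C \<Longrightarrow> Y \<in> Ob C \<Longrightarrow> s \<in> S X Y \<Longrightarrow> zigzag C S X Z p \<Longrightarrow>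
    zigzag C S Y Z (Bwd X Y s # p)"

inductive zigzag_eq ::
  "('k, 'o, 'm, 'z) lincat_scheme \<Rightarrow> ('o \<Rightarrow> 'o \<Rightarrow> 'm set) \<Rightarrow> 'o \<Rightarrow> 'o \<Rightarrow>
     ('o, 'm) step list \<Rightarrow> ('o, 'm) step list \<Rightarrow> bool"
  for C and S where
  ze_refl: "zigzag C S X Y p \<Longrightarrow> zigzag_eq C S X Y p p"
| ze_sym: "zigzag_eq C S X Y p q \<Longrightarrow> zigzag_eq C S X Y q p"
| ze_trans: "zigzag_eq C S X Y p q \<Longrightarrow> zigzag_eq C S X Y q r \<Longrightarrow> zigzag_eq C S X Y p r"
| ze_append: "zigzag_eq C S X Y p p' \<Longrightarrow> zigzag_eq C S Y Z q q' \<Longrightarrow>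
    zigzag_eq C S X Z (p @ q) (p' @ q')"
| ze_id: "X \<in> Ob C \<Longrightarrow> zigzag_eq C S X X [Fwd X X (Idn C X)] []"
| ze_comp: "X \<in> Ob C \<Longrightarrow> Y \<in> Ob C \<Longrightarrow> Z \<in> Ob C \<Longrightarrow>
    f \<in> carrier (Hom C X Y) \<Longrightarrow> g \<in> carrier (Hom C Y Z) \<Longrightarrow>
    zigzag_eq C S X Z [Fwd X Y f, Fwd Y Z g] [Fwd X Z (Cmp C X Y Z g f)]"
| ze_inv_left: "X \<in> Ob C \<Longrightarrow> Y \<in> Ob C \<Longrightarrow> s \<in> S X Y \<Longrightarrow>
    zigzag_eq C S X X [Fwd X Y s, Bwd X Y s] []"
| ze_inv_right: "X \<in> Ob C \<Longrightarrow> Y \<in> Ob C \<Longrightarrow> s \<in> S X Y \<Longrightarrow>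
    zigzag_eq C S Y Y [Bwd X Y s, Fwd X Y s] []"

definition zz_class ::
  "('k, 'o, 'm, 'z) lincat_scheme \<Rightarrow> ('o \<Rightarrow> 'o \<Rightarrow> 'm set) \<Rightarrow> 'o \<Rightarrow> 'o \<Rightarrow>
     ('o, 'm) step list \<Rightarrow> ('o, 'm) step list set"
  where "zz_class C S X Y p = {q. zigzag_eq C S X Y p q}"

text \<open>The localization functor \<open>Q\<close> on morphisms; on objects it is the identity.\<close>

definition loc_Q ::
  "('k, 'o, 'm, 'z) lincat_scheme \<Rightarrow> ('o \<Rightarrow> 'o \<Rightarrow> 'm set) \<Rightarrow> 'o \<Rightarrow> 'o \<Rightarrow> 'm \<Rightarrow> ('o, 'm) step list set"
  where "loc_Q C S X Y f = zz_class C S X Y [Fwd X Y f]"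

definition loc_comp ::
  "('k, 'o, 'm, 'z) lincat_scheme \<Rightarrow> ('o \<Rightarrow> 'o \<Rightarrow> 'm set) \<Rightarrow> 'o \<Rightarrow> 'o \<Rightarrow> 'o \<Rightarrow>
     ('o, 'm) step list set \<Rightarrow> ('o, 'm) step list set \<Rightarrow> ('o, 'm) step list set"
  where "loc_comp C S X Y Z y x = (\<Union>p\<in>x. \<Union>q\<in>y. zz_class C S X Z (p @ q))"

text \<open>
  The linear structure for which \<open>Q\<close> is linear. Two morphisms \<open>X \<rightarrow> Y\<close> of the localization are
  added after bringing them to a common denominator,
  \<open>Q f \<circ> (Q s)\<^sup>-\<^sup>1 + Q g \<circ> (Q s)\<^sup>-\<^sup>1 = Q (f + g) \<circ> (Q s)\<^sup>-\<^sup>1\<close> with \<open>s: W \<rightarrow> X\<close> in \<open>S\<close>,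
  and a scalar \<open>c\<close> acts as the composition with \<open>Q (c \<cdot> id\<^sub>Y)\<close>. The sum is meaningful if \<open>S\<close> admits
  a calculus of right fractions.
\<close>

definition loc_add ::
  "('k, 'o, 'm, 'z) lincat_scheme \<Rightarrow> ('o \<Rightarrow> 'o \<Rightarrow> 'm set) \<Rightarrow> 'o \<Rightarrow> 'o \<Rightarrow>
     ('o, 'm) step list set \<Rightarrow> ('o, 'm) step list set \<Rightarrow> ('o, 'm) step list set"
  where "loc_add C S X Y x y =
    (THE z. \<exists>W\<in>Ob C. \<exists>s\<in>S W X. \<exists>f\<in>carrier (Hom C W Y). \<exists>g\<in>carrier (Hom C W Y).
       x = zz_class C S X Y [Bwd W X s, Fwd W Y f] \<and>
       y = zz_class C S X Y [Bwd W X s, Fwd W Y g] \<and>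
       z = zz_class C S X Y [Bwd W X s, Fwd W Y (f \<oplus>\<^bsub>Hom C W Y\<^esub> g)])"

definition loc_hom ::
  "('k, 'o, 'm, 'z) lincat_scheme \<Rightarrow> ('o \<Rightarrow> 'o \<Rightarrow> 'm set) \<Rightarrow> 'o \<Rightarrow> 'o \<Rightarrow>
     ('k, ('o, 'm) step list set) module"
  where "loc_hom C S X Y =
    mk_space {zz_class C S X Y p |p. zigzag C S X Y p}
      (loc_Q C S X Y \<zero>\<^bsub>Hom C X Y\<^esub>)
      (loc_add C S X Y)
      (\<lambda>c x. loc_comp C S X Y Y (loc_Q C S Y Y (c \<odot>\<^bsub>Hom C Y Y\<^esub> Idn C Y)) x)"

text \<open>
  If \<open>S\<close> is closed under tensor products, then the localization inherits the monoidal structure: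
  \<open>x \<otimes> y\<close> is \<open>(id \<otimes> y) \<circ> (x \<otimes> id)\<close>, computed stepwise along zigzags that represent \<open>x\<close> and \<open>y\<close>.
\<close>

fun step_tensor_right :: "('k, 'o, 'm, 'z) moncat_scheme \<Rightarrow> 'o \<Rightarrow> ('o, 'm) step \<Rightarrow> ('o, 'm) step"
  where
    "step_tensor_right C Y (Fwd A A' f) =
       Fwd (TenO C A Y) (TenO C A' Y) (TenA C A A' Y Y f (Idn C Y))"
  | "step_tensor_right C Y (Bwd A A' s) =
       Bwd (TenO C A Y) (TenO C A' Y) (TenA C A A' Y Y s (Idn C Y))"

fun step_tensor_left :: "('k, 'o, 'm, 'z) moncat_scheme \<Rightarrow> 'o \<Rightarrow> ('o, 'm) step \<Rightarrow> ('o, 'm) step"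
  where
    "step_tensor_left C X (Fwd A A' f) =
       Fwd (TenO C X A) (TenO C X A') (TenA C X X A A' (Idn C X) f)"
  | "step_tensor_left C X (Bwd A A' s) =
       Bwd (TenO C X A) (TenO C X A') (TenA C X X A A' (Idn C X) s)"

definition loc_tensor ::
  "('k, 'o, 'm, 'z) moncat_scheme \<Rightarrow> ('o \<Rightarrow> 'o \<Rightarrow> 'm set) \<Rightarrow> 'o \<Rightarrow> 'o \<Rightarrow> 'o \<Rightarrow> 'o \<Rightarrow>
     ('o, 'm) step list set \<Rightarrow> ('o, 'm) step list set \<Rightarrow> ('o, 'm) step list set"
  where "loc_tensor C S X X' Y Y' x y =
    (\<Union>p\<in>x. \<Union>q\<in>y. zz_class C S (TenO C X Y) (TenO C X' Y')
       (map (step_tensor_right C Y) p @ map (step_tensor_left C X') q))"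

definition localization ::
  "('k, 'o, 'm) moncat \<Rightarrow> ('o \<Rightarrow> 'o \<Rightarrow> 'm set) \<Rightarrow> ('k, 'o, ('o, 'm) step list set) moncat"
  where "localization C S =
    \<lparr>Ob = Ob C,
     Hom = loc_hom C S,
     Idn = (\<lambda>X. loc_Q C S X X (Idn C X)),
     Cmp = loc_comp C S,
     TenO = TenO C,
     TenA = loc_tensor C S,
     Unt = Unt C,
     Asc = (\<lambda>X Y Z. loc_Q C S (TenO C (TenO C X Y) Z) (TenO C X (TenO C Y Z)) (Asc C X Y Z)),
     LUn = (\<lambda>X. loc_Q C S (TenO C (Unt C) X) X (LUn C X)),
     RUn = (\<lambda>X. loc_Q C S (TenO C X (Unt C)) X (RUn C X))\<rparr>"


section \<open>The monoidal category of vector spaces\<close>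

text \<open>
  The vector spaces over \<open>K\<close> are those whose underlying set is a set of elements of the following
  type. The type plays the part of a universe. It is closed under tensor products, contains the
  one-dimensional space \<open>K\<close>, and is as large as desired, since the type \<open>'a\<close> is arbitrary.
\<close>

datatype ('k, 'a) elt =
    Atom 'a
  | Scal (scal: 'k)
  | Tens (terms: "(('k, 'a) elt \<times> ('k, 'a) elt) list")

type_synonym ('k, 'a) space = "('k, ('k, 'a) elt) module"
type_synonym ('k, 'a) space_map = "('k, 'a) elt \<Rightarrow> ('k, 'a) elt"

definition vect_hom :: "('k, 'r) ring_scheme \<Rightarrow> ('k, 'a) space \<Rightarrow> ('k, 'a) space \<Rightarrow>
    ('k, ('k, 'a) space_map) module"
  where "vect_hom K V W =
    mk_space {f. linear_map K V W f \<and> f \<in> extensional (carrier V)}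
      (\<lambda>v\<in>carrier V. \<zero>\<^bsub>W\<^esub>)
      (\<lambda>f g. \<lambda>v\<in>carrier V. f v \<oplus>\<^bsub>W\<^esub> g v)
      (\<lambda>c f. \<lambda>v\<in>carrier V. c \<odot>\<^bsub>W\<^esub> f v)"

definition vect_tensor :: "('k, 'r) ring_scheme \<Rightarrow> ('k, 'a) space \<Rightarrow> ('k, 'a) space \<Rightarrow> ('k, 'a) space"
  where "vect_tensor K V W =
    mk_space (Tens ` carrier (tensor K V W))
      (Tens \<zero>\<^bsub>tensor K V W\<^esub>)
      (\<lambda>x y. Tens (terms x \<oplus>\<^bsub>tensor K V W\<^esub> terms y))
      (\<lambda>c x. Tens (c \<odot>\<^bsub>tensor K V W\<^esub> terms x))"

definition vect_pure ::
  "('k, 'r) ring_scheme \<Rightarrow> ('k, 'a) space \<Rightarrow> ('k, 'a) space \<Rightarrow>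
     ('k, 'a) elt \<Rightarrow> ('k, 'a) elt \<Rightarrow> ('k, 'a) elt"
  where "vect_pure K V W v w = Tens (pure_tensor K V W v w)"

definition vect_unit :: "('k, 'r) ring_scheme \<Rightarrow> ('k, 'a) space"
  where "vect_unit K =
    mk_space (Scal ` carrier K) (Scal \<zero>\<^bsub>K\<^esub>)
      (\<lambda>x y. Scal (scal x \<oplus>\<^bsub>K\<^esub> scal y)) (\<lambda>c x. Scal (c \<otimes>\<^bsub>K\<^esub> scal x))"

definition vect :: "('k, 'r) ring_scheme \<Rightarrow> ('k, ('k, 'a) space, ('k, 'a) space_map) moncat"
  where "vect K =
    \<lparr>Ob = {V. vectorspace K V},
     Hom = vect_hom K,
     Idn = (\<lambda>V. \<lambda>v\<in>carrier V. v),
     Cmp = (\<lambda>U V W g f. compose (carrier U) g f),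
     TenO = vect_tensor K,
     TenA = (\<lambda>V V' W W' f g. \<lambda>x\<in>carrier (vect_tensor K V W).
       tens_lift (vect_tensor K V' W') (\<lambda>v w. vect_pure K V' W' (f v) (g w)) (terms x)),
     Unt = vect_unit K,
     Asc = (\<lambda>U V W. \<lambda>x\<in>carrier (vect_tensor K (vect_tensor K U V) W).
       tens_lift (vect_tensor K U (vect_tensor K V W))
         (\<lambda>y w. tens_lift (vect_tensor K U (vect_tensor K V W))
            (\<lambda>u v. vect_pure K U (vect_tensor K V W) u (vect_pure K V W v w)) (terms y))
         (terms x)),
     LUn = (\<lambda>V. \<lambda>x\<in>carrier (vect_tensor K (vect_unit K) V).
       tens_lift V (\<lambda>c v. scal c \<odot>\<^bsub>V\<^esub> v) (terms x)),
     RUn = (\<lambda>V. \<lambda>x\<in>carrier (vect_tensor K V (vect_unit K)).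
       tens_lift V (\<lambda>v c. scal c \<odot>\<^bsub>V\<^esub> v) (terms x))\<rparr>"


section \<open>Glider representations of filtered bialgebras\<close>

definition trivial_filtration ::
  "('k, 'r) ring_scheme \<Rightarrow> ('k, 'b, 'z) module_scheme \<Rightarrow> int \<Rightarrow> 'b set"
  where "trivial_filtration K B i =
    (if i < 0 then {\<zero>\<^bsub>B\<^esub>}
     else if i = 0 then {c \<odot>\<^bsub>B\<^esub> \<one>\<^bsub>B\<^esub> |c. c \<in> carrier K}
     else carrier B)"

datatype idx = At int | Infty

fun idx_le :: "idx \<Rightarrow> idx \<Rightarrow> bool" where
  "idx_le (At i) (At j) \<longleftrightarrow> i \<le> j"
| "idx_le _ Infty \<longleftrightarrow> True"
| "idx_le Infty (At j) \<longleftrightarrow> False"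

fun filt_hom :: "('k, 'b, 'z) module_scheme \<Rightarrow> (int \<Rightarrow> 'b set) \<Rightarrow> idx \<Rightarrow> idx \<Rightarrow> 'b set" where
  "filt_hom B F (At i) (At j) = (if i \<le> j then F (j - i) else {\<zero>\<^bsub>B\<^esub>})"
| "filt_hom B F _ Infty = carrier B"
| "filt_hom B F Infty (At j) = {\<zero>\<^bsub>B\<^esub>}"

definition Fbar ::
  "('k, 'b, 'z) module_scheme \<Rightarrow> (int \<Rightarrow> 'b set) \<Rightarrow> int set \<Rightarrow> ('k, idx, 'b) lincat"
  where "Fbar B F \<Lambda> =
    \<lparr>Ob = insert Infty (At ` \<Lambda>),
     Hom = (\<lambda>\<alpha> \<beta>. mk_space (filt_hom B F \<alpha> \<beta>) \<zero>\<^bsub>B\<^esub> (\<oplus>\<^bsub>B\<^esub>) (\<odot>\<^bsub>B\<^esub>)),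
     Idn = (\<lambda>\<alpha>. \<one>\<^bsub>B\<^esub>),
     Cmp = (\<lambda>\<alpha> \<beta> \<gamma>. (\<otimes>\<^bsub>B\<^esub>))\<rparr>"

type_synonym ('k, 'b, 'a) glider = "(idx, 'b, ('k, 'a) space, ('k, 'a) space_map) ftor"
type_synonym ('k, 'a) glider_map = "idx \<Rightarrow> ('k, 'a) space_map"

text \<open>
  Functions are total in HOL: the last two conditions fix the values of a functor outside its
  domain of definition.
\<close>

definition preglider ::
  "('k, 'r) ring_scheme \<Rightarrow> ('k, 'b, 'z) module_scheme \<Rightarrow> (int \<Rightarrow> 'b set) \<Rightarrow> int set \<Rightarrow>
     ('k, 'b, 'a) glider \<Rightarrow> bool"
  where "preglider K B F \<Lambda> M \<longleftrightarrow>
    linear_functor K (Fbar B F \<Lambda>) (vect K) M \<and>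
    (\<forall>\<alpha>\<in>Ob (Fbar B F \<Lambda>). \<forall>\<beta>\<in>Ob (Fbar B F \<Lambda>). idx_le \<alpha> \<beta> \<longrightarrow>
       cat_mono (vect K) (fob M \<alpha>) (fob M \<beta>) (far M \<alpha> \<beta> \<one>\<^bsub>B\<^esub>)) \<and>
    fob M \<in> extensional (Ob (Fbar B F \<Lambda>)) \<and>
    (\<forall>\<alpha> \<beta>. far M \<alpha> \<beta> \<in> extensional
       {b. \<alpha> \<in> Ob (Fbar B F \<Lambda>) \<and> \<beta> \<in> Ob (Fbar B F \<Lambda>) \<and> b \<in> carrier (Hom (Fbar B F \<Lambda>) \<alpha> \<beta>)})"

definition preglid_hom ::
  "('k, 'r) ring_scheme \<Rightarrow> ('k, 'b, 'z) module_scheme \<Rightarrow> (int \<Rightarrow> 'b set) \<Rightarrow> int set \<Rightarrow>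
     ('k, 'b, 'a) glider \<Rightarrow> ('k, 'b, 'a) glider \<Rightarrow> ('k, ('k, 'a) glider_map) module"
  where "preglid_hom K B F \<Lambda> M N =
    mk_space
      {f. f \<in> (\<Pi>\<^sub>E \<alpha>\<in>Ob (Fbar B F \<Lambda>). carrier (vect_hom K (fob M \<alpha>) (fob N \<alpha>))) \<and>
          (\<forall>\<alpha>\<in>Ob (Fbar B F \<Lambda>). \<forall>\<beta>\<in>Ob (Fbar B F \<Lambda>). \<forall>b\<in>carrier (Hom (Fbar B F \<Lambda>) \<alpha> \<beta>).
             Cmp (vect K) (fob M \<alpha>) (fob M \<beta>) (fob N \<beta>) (f \<beta>) (far M \<alpha> \<beta> b) =
             Cmp (vect K) (fob M \<alpha>) (fob N \<alpha>) (fob N \<beta>) (far N \<alpha> \<beta> b) (f \<alpha>))}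
      (\<lambda>\<alpha>\<in>Ob (Fbar B F \<Lambda>). \<zero>\<^bsub>vect_hom K (fob M \<alpha>) (fob N \<alpha>)\<^esub>)
      (\<lambda>f g. \<lambda>\<alpha>\<in>Ob (Fbar B F \<Lambda>). f \<alpha> \<oplus>\<^bsub>vect_hom K (fob M \<alpha>) (fob N \<alpha>)\<^esub> g \<alpha>)
      (\<lambda>c f. \<lambda>\<alpha>\<in>Ob (Fbar B F \<Lambda>). c \<odot>\<^bsub>vect_hom K (fob M \<alpha>) (fob N \<alpha>)\<^esub> f \<alpha>)"

text \<open>
  The action of \<open>b\<close> in \<open>Hom(\<alpha>, \<beta>)\<close> on \<open>M \<otimes> N\<close>. The tensor \<open>\<Delta>(b)\<close> is written as a sum of pure
  tensors with factors in \<open>Hom(\<alpha>, \<beta>)\<close>, as \<open>M\<close> and \<open>N\<close> are not defined on the other elements.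
\<close>

definition glider_tensor_act ::
  "('k, 'r) ring_scheme \<Rightarrow> ('k, 'b, 'z) bialg_scheme \<Rightarrow> (int \<Rightarrow> 'b set) \<Rightarrow>
     ('k, 'b, 'a) glider \<Rightarrow> ('k, 'b, 'a) glider \<Rightarrow> idx \<Rightarrow> idx \<Rightarrow> 'b \<Rightarrow> ('k, 'a) space_map"
  where "glider_tensor_act K B F M N \<alpha> \<beta> b =
    tens_lift
      (vect_hom K (vect_tensor K (fob M \<alpha>) (fob N \<alpha>)) (vect_tensor K (fob M \<beta>) (fob N \<beta>)))
      (\<lambda>b1 b2. TenA (vect K) (fob M \<alpha>) (fob M \<beta>) (fob N \<alpha>) (fob N \<beta>)
                 (far M \<alpha> \<beta> b1) (far N \<alpha> \<beta> b2))
      (SOME l. tens_eq K B B (comult B b) l \<and>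
         set l \<subseteq> filt_hom B F \<alpha> \<beta> \<times> filt_hom B F \<alpha> \<beta>)"

definition mk_glider ::
  "('k, 'b, 'z) module_scheme \<Rightarrow> (int \<Rightarrow> 'b set) \<Rightarrow> int set \<Rightarrow> (idx \<Rightarrow> ('k, 'a) space) \<Rightarrow>
     (idx \<Rightarrow> idx \<Rightarrow> 'b \<Rightarrow> ('k, 'a) space_map) \<Rightarrow> ('k, 'b, 'a) glider"
  where "mk_glider B F \<Lambda> V r =
    \<lparr>fob = (\<lambda>\<alpha>\<in>Ob (Fbar B F \<Lambda>). V \<alpha>),
     far = (\<lambda>\<alpha> \<beta>. \<lambda>b\<in>{b. \<alpha> \<in> Ob (Fbar B F \<Lambda>) \<and> \<beta> \<in> Ob (Fbar B F \<Lambda>) \<and>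
                         b \<in> carrier (Hom (Fbar B F \<Lambda>) \<alpha> \<beta>)}. r \<alpha> \<beta> b)\<rparr>"

definition preglid ::
  "('k, 'r) ring_scheme \<Rightarrow> ('k, 'b, 'z) bialg_scheme \<Rightarrow> (int \<Rightarrow> 'b set) \<Rightarrow> int set \<Rightarrow>
     ('k, ('k, 'b, 'a) glider, ('k, 'a) glider_map) moncat"
  where "preglid K B F \<Lambda> =
    \<lparr>Ob = {M. preglider K B F \<Lambda> M},
     Hom = preglid_hom K B F \<Lambda>,
     Idn = (\<lambda>M. \<lambda>\<alpha>\<in>Ob (Fbar B F \<Lambda>). Idn (vect K) (fob M \<alpha>)),
     Cmp = (\<lambda>L M N g f. \<lambda>\<alpha>\<in>Ob (Fbar B F \<Lambda>).
       Cmp (vect K) (fob L \<alpha>) (fob M \<alpha>) (fob N \<alpha>) (g \<alpha>) (f \<alpha>)),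
     TenO = (\<lambda>M N. mk_glider B F \<Lambda> (\<lambda>\<alpha>. TenO (vect K) (fob M \<alpha>) (fob N \<alpha>))
       (glider_tensor_act K B F M N)),
     TenA = (\<lambda>M M' N N' f g. \<lambda>\<alpha>\<in>Ob (Fbar B F \<Lambda>).
       TenA (vect K) (fob M \<alpha>) (fob M' \<alpha>) (fob N \<alpha>) (fob N' \<alpha>) (f \<alpha>) (g \<alpha>)),
     Unt = mk_glider B F \<Lambda> (\<lambda>\<alpha>. Unt (vect K))
       (\<lambda>\<alpha> \<beta> b. counit B b \<odot>\<^bsub>Hom (vect K) (Unt (vect K)) (Unt (vect K))\<^esub>
                   Idn (vect K) (Unt (vect K))),
     Asc = (\<lambda>L M N. \<lambda>\<alpha>\<in>Ob (Fbar B F \<Lambda>). Asc (vect K) (fob L \<alpha>) (fob M \<alpha>) (fob N \<alpha>)),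
     LUn = (\<lambda>M. \<lambda>\<alpha>\<in>Ob (Fbar B F \<Lambda>). LUn (vect K) (fob M \<alpha>)),
     RUn = (\<lambda>M. \<lambda>\<alpha>\<in>Ob (Fbar B F \<Lambda>). RUn (vect K) (fob M \<alpha>))\<rparr>"

definition glid_Sigma ::
  "('k, 'r) ring_scheme \<Rightarrow> ('k, 'b, 'z) bialg_scheme \<Rightarrow> (int \<Rightarrow> 'b set) \<Rightarrow> int set \<Rightarrow>
     ('k, 'b, 'a) glider \<Rightarrow> ('k, 'b, 'a) glider \<Rightarrow> ('k, 'a) glider_map set"
  where "glid_Sigma K B F \<Lambda> M N =
    {f \<in> carrier (Hom (preglid K B F \<Lambda>) M N).
       \<forall>i\<in>\<Lambda>. cat_iso (vect K) (fob M (At i)) (fob N (At i)) (f (At i))}"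

type_synonym ('k, 'b, 'a) glid_category =
  "('k, ('k, 'b, 'a) glider,
    (('k, 'b, 'a) glider, ('k, 'a) glider_map) step list set) moncat"

definition Glid ::
  "('k, 'r) ring_scheme \<Rightarrow> ('k, 'b, 'z) bialg_scheme \<Rightarrow> (int \<Rightarrow> 'b set) \<Rightarrow> int set \<Rightarrow>
     ('k, 'b, 'a) glid_category"
  where "Glid K B F \<Lambda> = localization (preglid K B F \<Lambda>) (glid_Sigma K B F \<Lambda>)"

definition glid ::
  "('k, 'r) ring_scheme \<Rightarrow> ('k, 'b, 'z) bialg_scheme \<Rightarrow> (int \<Rightarrow> 'b set) \<Rightarrow> int set \<Rightarrow>
     ('k, 'b, 'a) glid_category"
  where "glid K B F \<Lambda> =
    Glid K B F \<Lambda>\<lparr>Ob := {M \<in> Ob (Glid K B F \<Lambda>). noetherian_object (Glid K B F \<Lambda>) M}\<rparr>"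

end

theory Submission
  imports Defs
begin

text \<open>
  A morphism of the localization is determined by its component at \<open>0\<close>: the morphisms from \<open>X\<close> to \<open>Y\<close>
  are the linear maps \<open>f: X(0) \<rightarrow> Y(0)\<close> such that for every \<open>x\<close> in \<open>X(-1)\<close> there is a \<open>y\<close> in \<open>Y(-1)\<close> with
  \<open>f(b x) = b y\<close> for all \<open>b\<close>. Such an \<open>f\<close> is the fraction formed by the two projections of its graph.

  Let \<open>F\<close> be a monoidal equivalence and \<open>T = (0, k, k)\<close>, so that \<open>Hom(T, N) = N(0)\<close>. A nonzero
  morphism from the corresponding glider \<open>T'\<close> to \<open>F T\<close> comes from a nonzero morphism to \<open>T\<close>. The
  latter splits, whence \<open>F T\<close> is isomorphic to \<open>T'\<close>, and \<open>F\<close> induces natural linear bijections \<open>\<theta>\<close>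
  from \<open>N(0)\<close> to \<open>(F N)(0)\<close>. If \<open>N(-1) \<rightarrow> N(0)\<close> is onto, then \<open>B\<close> acts on \<open>N(0)\<close>; these
  saturated gliders are recognized inside the category, because every morphism from a saturated
  glider that is bijective at \<open>0\<close> is an isomorphism, and because every glider maps bijectively at \<open>0\<close> to
  a saturated one. Hence \<open>F\<close> maps the regular glider \<open>R = (B, B, B)\<close> to a saturated one, and the action
  of \<open>b'\<close> on \<open>\<theta>(1)\<close> defines an element \<open>\<rho>(b')\<close> of \<open>B\<close>. The morphisms out of \<open>R\<close> show that \<open>F\<close> carries the
  action of \<open>\<rho>(b')\<close> on every saturated glider to that of \<open>b'\<close>. Thus \<open>\<rho>\<close> is multiplicative, the structure
  maps of \<open>F\<close> make it compatible with counit and comultiplication, and the glider that \<open>F\<close> maps to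
  \<open>(B', B', B')\<close> shows that it is bijective.
\<close>

section \<open>Linear algebra\<close>

text \<open>The obstacle is that \<open>F\<close> is an abstract equivalence: it need not respect
  underlying spaces, and in general \<open>B\<close> does not act on N(0), because b N(-1) is only
  required to lie in N(0). Saturation restores an action, and every glider maps bijectively at 0 to
  a saturated one because the largest \<open>B\<close>-submodule contained in N(0) has a linear
  complement, on which \<open>B\<close> can act through the counit. Finite dimension enters twice: R
  has to be Noetherian, and it has to be coded in the type \<open>elt\<close> whatever
  \<open>'a\<close> is, which coordinates achieve. The bijections \<open>th\<close> depend on a
  generator of (F T)(0), so they respect tensor products only up to one nonzero scalar; the two
  comultiplications are compared by a linear identity, so the scalar cancels. The map
  \<open>rho\<close> goes from \<open>B'\<close> to \<open>B\<close>. For the converse direction of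
  the theorem the action is restricted along the isomorphism; spaces and tensor products do not
  change at all, so the structure maps of the monoidal functor are identities.\<close>

lemma mk_space_simps [simp]:
  "carrier (mk_space A z p s) = A" "\<zero>\<^bsub>mk_space A z p s\<^esub> = z"
  "add (mk_space A z p s) = p" "smult (mk_space A z p s) = s"
  by (simp_all add: mk_space_def)

text \<open>Bare linearity, without the vector-space hypotheses that \<open>linear_map\<close>
  carries, so that linear maps compose without side conditions.\<close>

definition lin ::
  "('k, 'r) ring_scheme \<Rightarrow> ('k, 'v, 'x) module_scheme \<Rightarrow> ('k, 'w, 'y) module_scheme \<Rightarrow>
     ('v \<Rightarrow> 'w) \<Rightarrow> bool"
  where "lin K V W f \<longleftrightarrow> (\<forall>v\<in>carrier V. f v \<in> carrier W) \<and>
    (\<forall>v\<in>carrier V. \<forall>w\<in>carrier V. f (v \<oplus>\<^bsub>V\<^esub> w) = f v \<oplus>\<^bsub>W\<^esub> f w) \<and>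
    (\<forall>c\<in>carrier K. \<forall>v\<in>carrier V. f (c \<odot>\<^bsub>V\<^esub> v) = c \<odot>\<^bsub>W\<^esub> f v)"

lemma linear_map_iff:
  "linear_map K V W f \<longleftrightarrow> vectorspace K V \<and> vectorspace K W \<and> lin K V W f"
  unfolding linear_map_def mod_hom_def mod_hom_axioms_def module_hom_def lin_def vectorspace_def
  by blast

lemma linI:
  assumes "\<And>v. v \<in> carrier V \<Longrightarrow> f v \<in> carrier W"
    and "\<And>v w. v \<in> carrier V \<Longrightarrow> w \<in> carrier V \<Longrightarrow> f (v \<oplus>\<^bsub>V\<^esub> w) = f v \<oplus>\<^bsub>W\<^esub> f w"
    and "\<And>c v. c \<in> carrier K \<Longrightarrow> v \<in> carrier V \<Longrightarrow> f (c \<odot>\<^bsub>V\<^esub> v) = c \<odot>\<^bsub>W\<^esub> f v"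
  shows "lin K V W f"
  using assms by (simp add: lin_def)

lemma lin_closed: "lin K V W f \<Longrightarrow> v \<in> carrier V \<Longrightarrow> f v \<in> carrier W"
  and lin_add: "lin K V W f \<Longrightarrow> v \<in> carrier V \<Longrightarrow> w \<in> carrier V \<Longrightarrow> f (v \<oplus>\<^bsub>V\<^esub> w) = f v \<oplus>\<^bsub>W\<^esub> f w"
  and lin_smult: "lin K V W f \<Longrightarrow> c \<in> carrier K \<Longrightarrow> v \<in> carrier V \<Longrightarrow> f (c \<odot>\<^bsub>V\<^esub> v) = c \<odot>\<^bsub>W\<^esub> f v"
  by (simp_all add: lin_def)

lemma lin_cong:
  assumes "vectorspace K V" "\<And>v. v \<in> carrier V \<Longrightarrow> f v = g v"
  shows "lin K V W f \<longleftrightarrow> lin K V W g"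
proof -
  interpret V: vectorspace K V by fact
  show ?thesis by (simp add: lin_def assms(2))
qed

lemma lin_zero:
  assumes "vectorspace K V" "vectorspace K W" "lin K V W f"
  shows "f \<zero>\<^bsub>V\<^esub> = \<zero>\<^bsub>W\<^esub>"
proof -
  interpret linear_map K V W f using assms by (simp add: linear_map_iff)
  show ?thesis by simp
qed

lemma lin_inj_onI:
  assumes "vectorspace K V" "vectorspace K W" "lin K V W f"
    and "\<And>v. v \<in> carrier V \<Longrightarrow> f v = \<zero>\<^bsub>W\<^esub> \<Longrightarrow> v = \<zero>\<^bsub>V\<^esub>"
  shows "inj_on f (carrier V)"
proof (rule inj_onI)
  interpret linear_map K V W f using assms by (simp add: linear_map_iff)
  fix x y assume xy: "x \<in> carrier V" "y \<in> carrier V" "f x = f y"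
  have "f (x \<ominus>\<^bsub>V\<^esub> y) = f x \<ominus>\<^bsub>W\<^esub> f y" using xy by (rule_tac f_minus) auto
  also have "\<dots> = \<zero>\<^bsub>W\<^esub>" using xy by (simp add: a_minus_def W.module.M.r_neg)
  finally have "x \<ominus>\<^bsub>V\<^esub> y = \<zero>\<^bsub>V\<^esub>" using assms(4) xy by simp
  then show "x = y" using xy by simp
qed

lemma lin_comp: "lin K U V f \<Longrightarrow> lin K V W g \<Longrightarrow> lin K U W (\<lambda>x. g (f x))"
  by (simp add: lin_def)

lemma lin_id: "lin K V V (\<lambda>x. x)"
  by (simp add: lin_def)

lemma lin_const_zero:
  assumes "vectorspace K W" shows "lin K V W (\<lambda>x. \<zero>\<^bsub>W\<^esub>)"
proof -
  interpret W: vectorspace K W by fact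
  show ?thesis by (simp add: lin_def)
qed

lemma lin_plus:
  assumes "vectorspace K V" "vectorspace K W" "lin K V W f" "lin K V W g"
  shows "lin K V W (\<lambda>x. f x \<oplus>\<^bsub>W\<^esub> g x)"
proof -
  interpret V: vectorspace K V by fact
  interpret W: vectorspace K W by fact
  show ?thesis using assms(3,4) unfolding lin_def
    by (auto simp: W.module.M.a_ac W.module.smult_r_distr)
qed

lemma lin_scale:
  assumes "vectorspace K V" "vectorspace K W" "lin K V W f" "c \<in> carrier K"
  shows "lin K V W (\<lambda>x. c \<odot>\<^bsub>W\<^esub> f x)"
proof -
  interpret V: vectorspace K V by fact
  interpret W: vectorspace K W by fact
  show ?thesis
  proof (rule linI)
    fix d v assume d: "d \<in> carrier K" and v: "v \<in> carrier V"
    have "c \<odot>\<^bsub>W\<^esub> (d \<odot>\<^bsub>W\<^esub> f v) = (c \<otimes>\<^bsub>K\<^esub> d) \<odot>\<^bsub>W\<^esub> f v"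
      using assms(4) d lin_closed[OF assms(3) v] by (simp add: W.module.smult_assoc1)
    also have "\<dots> = (d \<otimes>\<^bsub>K\<^esub> c) \<odot>\<^bsub>W\<^esub> f v" using V.module.R.m_comm assms(4) d by simp
    also have "\<dots> = d \<odot>\<^bsub>W\<^esub> (c \<odot>\<^bsub>W\<^esub> f v)"
      using assms(4) d lin_closed[OF assms(3) v] by (simp add: W.module.smult_assoc1)
    finally show "c \<odot>\<^bsub>W\<^esub> f (d \<odot>\<^bsub>V\<^esub> v) = d \<odot>\<^bsub>W\<^esub> (c \<odot>\<^bsub>W\<^esub> f v)"
      using lin_smult[OF assms(3) d v] by simp
  qed (use assms(3,4) in \<open>auto simp: lin_def W.module.smult_r_distr\<close>)
qed

text \<open>An injective map that respects the operations pulls every identity of \<open>V\<close>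
  back to \<open>W\<close>. Negatives need no hypothesis of their own: they are multiples by
  -1.\<close>

lemma vectorspace_transport:
  fixes W :: "('k, 'w, 'y) module_scheme"
  assumes "vectorspace K V"
    and cl: "\<And>x. x \<in> carrier W \<Longrightarrow> g x \<in> carrier V" and inj: "inj_on g (carrier W)"
    and z: "\<zero>\<^bsub>W\<^esub> \<in> carrier W" "g \<zero>\<^bsub>W\<^esub> = \<zero>\<^bsub>V\<^esub>"
    and a: "\<And>x y. x \<in> carrier W \<Longrightarrow> y \<in> carrier W \<Longrightarrow> x \<oplus>\<^bsub>W\<^esub> y \<in> carrier W"
      "\<And>x y. x \<in> carrier W \<Longrightarrow> y \<in> carrier W \<Longrightarrow> g (x \<oplus>\<^bsub>W\<^esub> y) = g x \<oplus>\<^bsub>V\<^esub> g y"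
    and s: "\<And>c x. c \<in> carrier K \<Longrightarrow> x \<in> carrier W \<Longrightarrow> c \<odot>\<^bsub>W\<^esub> x \<in> carrier W"
      "\<And>c x. c \<in> carrier K \<Longrightarrow> x \<in> carrier W \<Longrightarrow> g (c \<odot>\<^bsub>W\<^esub> x) = c \<odot>\<^bsub>V\<^esub> g x"
  shows "vectorspace K W"
proof -
  interpret V: vectorspace K V by fact
  have eq: "x = y" if "g x = g y" "x \<in> carrier W" "y \<in> carrier W" for x y
    using inj that by (auto dest: inj_onD)
  show ?thesis
  proof (rule vs_criteria)
    show "field K" by (rule V.field.field_axioms)
    show "\<forall>v\<in>carrier W. \<exists>neg_v\<in>carrier W. v \<oplus>\<^bsub>W\<^esub> neg_v = \<zero>\<^bsub>W\<^esub>"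
    proof
      fix v assume v: "v \<in> carrier W"
      have m: "\<ominus>\<^bsub>K\<^esub> \<one>\<^bsub>K\<^esub> \<in> carrier K" by simp
      have "v \<oplus>\<^bsub>W\<^esub> ((\<ominus>\<^bsub>K\<^esub> \<one>\<^bsub>K\<^esub>) \<odot>\<^bsub>W\<^esub> v) = \<zero>\<^bsub>W\<^esub>"
        by (rule eq) (use v m cl in \<open>simp_all add: a s z V.module.smult_minus_1 V.module.M.r_neg\<close>)
      then show "\<exists>neg_v\<in>carrier W. v \<oplus>\<^bsub>W\<^esub> neg_v = \<zero>\<^bsub>W\<^esub>" using s(1)[OF m v] by blast
    qed
  qed (auto intro!: eq simp: a s z cl V.module.M.a_ac V.module.smult_r_distr V.module.smult_l_distr
      V.module.smult_assoc1)
qed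

section \<open>Subspaces, complements and one-sided inverses\<close>

definition lsub :: "('k, 'r) ring_scheme \<Rightarrow> ('k, 'v, 'x) module_scheme \<Rightarrow> 'v set \<Rightarrow> bool"
  where "lsub K V U \<longleftrightarrow> U \<subseteq> carrier V \<and> \<zero>\<^bsub>V\<^esub> \<in> U \<and> (\<forall>x\<in>U. \<forall>y\<in>U. x \<oplus>\<^bsub>V\<^esub> y \<in> U) \<and>
    (\<forall>c\<in>carrier K. \<forall>x\<in>U. c \<odot>\<^bsub>V\<^esub> x \<in> U)"

lemma lsub_submodule: "vectorspace K V \<Longrightarrow> submodule K U V \<longleftrightarrow> lsub K V U"
  by (auto simp: submodule_def lsub_def vectorspace_def)

lemma lsub_diff:
  assumes "vectorspace K V" "lsub K V U" "x \<in> U" "y \<in> U" shows "x \<ominus>\<^bsub>V\<^esub> y \<in> U"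
proof -
  interpret V: vectorspace K V by fact
  have "\<ominus>\<^bsub>V\<^esub> y = (\<ominus>\<^bsub>K\<^esub> \<one>\<^bsub>K\<^esub>) \<odot>\<^bsub>V\<^esub> y" using assms by (subst V.module.smult_minus_1) (auto simp: lsub_def)
  then show ?thesis using assms by (simp add: a_minus_def lsub_def)
qed

lemma lsub_image:
  assumes "vectorspace K V" "vectorspace K W" "lin K V W f" "lsub K V U"
  shows "lsub K W (f ` U)"
proof -
  have f0: "f \<zero>\<^bsub>V\<^esub> = \<zero>\<^bsub>W\<^esub>" using assms lin_zero by blast
  have U: "U \<subseteq> carrier V" "\<zero>\<^bsub>V\<^esub> \<in> U" "\<And>x y. x \<in> U \<Longrightarrow> y \<in> U \<Longrightarrow> x \<oplus>\<^bsub>V\<^esub> y \<in> U"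
    "\<And>c x. c \<in> carrier K \<Longrightarrow> x \<in> U \<Longrightarrow> c \<odot>\<^bsub>V\<^esub> x \<in> U"
    using assms(4) by (auto simp: lsub_def)
  show ?thesis unfolding lsub_def
  proof (intro conjI ballI)
    show "f ` U \<subseteq> carrier W" using U(1) assms(3) by (auto simp: lin_def)
    show "\<zero>\<^bsub>W\<^esub> \<in> f ` U" using f0 U(2) by (metis imageI)
  next
    fix x y assume "x \<in> f ` U" "y \<in> f ` U"
    then obtain a b where "a \<in> U" "b \<in> U" "x = f a" "y = f b" by auto
    then show "x \<oplus>\<^bsub>W\<^esub> y \<in> f ` U" using lin_add[OF assms(3), of a b] U by (metis imageI subsetD)
  next
    fix c x assume "c \<in> carrier K" "x \<in> f ` U"
    then obtain a where "a \<in> U" "x = f a" by auto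
    then show "c \<odot>\<^bsub>W\<^esub> x \<in> f ` U" using lin_smult[OF assms(3), of c a] U \<open>c \<in> carrier K\<close>
      by (metis imageI subsetD)
  qed
qed

lemma lsub_carrier:
  assumes "vectorspace K V" shows "lsub K V (carrier V)"
proof -
  interpret V: vectorspace K V by fact
  show ?thesis by (simp add: lsub_def)
qed

text \<open>Zorn's lemma gives a subspace \<open>W\<close> maximal with \<open>W \<inter> U = 0\<close>; it is a complement of \<open>U\<close>.\<close>

lemma subspace_retraction:
  assumes vs: "vectorspace K V" and U: "lsub K V U"
  obtains p where "lin K V V p" "\<And>v. v \<in> carrier V \<Longrightarrow> p v \<in> U" "\<And>u. u \<in> U \<Longrightarrow> p u = u"
proof -
  interpret V: vectorspace K V by (rule vs)
  define A where "A = {W. lsub K V W \<and> W \<inter> U = {\<zero>\<^bsub>V\<^esub>}}"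
  have Uc: "U \<subseteq> carrier V" "\<zero>\<^bsub>V\<^esub> \<in> U" using U by (auto simp: lsub_def)
  have "\<exists>M\<in>A. \<forall>X\<in>A. M \<subseteq> X \<longrightarrow> X = M"
  proof (rule subset_Zorn_nonempty)
    have "{\<zero>\<^bsub>V\<^esub>} \<in> A" using Uc by (auto simp: A_def lsub_def)
    then show "A \<noteq> {}" by blast
    fix C assume C: "C \<noteq> {}" "subset.chain A C"
    then obtain c where c: "c \<in> C" by auto
    have CA: "\<And>W. W \<in> C \<Longrightarrow> lsub K V W \<and> W \<inter> U = {\<zero>\<^bsub>V\<^esub>}"
      using C(2) by (auto simp: subset.chain_def A_def)
    have "lsub K V (\<Union>C)" unfolding lsub_def
    proof (intro conjI ballI)
      show "\<Union>C \<subseteq> carrier V" "\<zero>\<^bsub>V\<^esub> \<in> \<Union>C" using CA c unfolding lsub_def by blast+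
    next
      fix x y assume "x \<in> \<Union>C" "y \<in> \<Union>C"
      then obtain X Y where XY: "x \<in> X" "y \<in> Y" "X \<in> C" "Y \<in> C" by auto
      then have "X \<subseteq> Y \<or> Y \<subseteq> X" using C(2) by (auto simp: subset.chain_def)
      then obtain Z where "Z \<in> C" "x \<in> Z" "y \<in> Z" using XY by blast
      then show "x \<oplus>\<^bsub>V\<^esub> y \<in> \<Union>C" using CA by (meson UnionI lsub_def)
    next
      fix k x assume "k \<in> carrier K" "x \<in> \<Union>C"
      then show "k \<odot>\<^bsub>V\<^esub> x \<in> \<Union>C" using CA by (meson UnionI UnionE lsub_def)
    qed
    moreover have "\<Union>C \<inter> U = {\<zero>\<^bsub>V\<^esub>}" using CA c by blast
    ultimately show "\<Union>C \<in> A" by (simp add: A_def)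
  qed
  then obtain W where WA: "W \<in> A" and Wmax: "\<forall>X\<in>A. W \<subseteq> X \<longrightarrow> X = W" by (rule bexE)
  have W: "lsub K V W" "W \<inter> U = {\<zero>\<^bsub>V\<^esub>}" using WA by (simp_all add: A_def)
  have max: "X = W" if "lsub K V X" "X \<inter> U = {\<zero>\<^bsub>V\<^esub>}" "W \<subseteq> X" for X
    using Wmax that by (simp add: A_def)
  have Wc: "W \<subseteq> carrier V" "\<zero>\<^bsub>V\<^esub> \<in> W" and Wa: "\<And>x y. x \<in> W \<Longrightarrow> y \<in> W \<Longrightarrow> x \<oplus>\<^bsub>V\<^esub> y \<in> W"
    and Ws: "\<And>c x. c \<in> carrier K \<Longrightarrow> x \<in> W \<Longrightarrow> c \<odot>\<^bsub>V\<^esub> x \<in> W" using W by (auto simp: lsub_def)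
  have Ua: "\<And>x y. x \<in> U \<Longrightarrow> y \<in> U \<Longrightarrow> x \<oplus>\<^bsub>V\<^esub> y \<in> U"
    and Us: "\<And>c x. c \<in> carrier K \<Longrightarrow> x \<in> U \<Longrightarrow> c \<odot>\<^bsub>V\<^esub> x \<in> U" using U by (auto simp: lsub_def)
  \<comment> \<open>The decomposition is unique since u - u' = w' - w lies in both \<open>U\<close>
    and \<open>W\<close>.\<close>
  have uniq: "u = u'" if "u \<in> U" "u' \<in> U" "w \<in> W" "w' \<in> W" "u \<oplus>\<^bsub>V\<^esub> w = u' \<oplus>\<^bsub>V\<^esub> w'" for u u' w w'
  proof -
    have c: "u \<in> carrier V" "u' \<in> carrier V" "w \<in> carrier V" "w' \<in> carrier V"
      using that Uc Wc by auto
    have "w' = \<ominus>\<^bsub>V\<^esub> u' \<oplus>\<^bsub>V\<^esub> (u \<oplus>\<^bsub>V\<^esub> w)" using c that(5) by (simp add: V.module.M.r_neg1)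
    then have "w' \<ominus>\<^bsub>V\<^esub> w = \<ominus>\<^bsub>V\<^esub> u' \<oplus>\<^bsub>V\<^esub> (u \<oplus>\<^bsub>V\<^esub> (w \<oplus>\<^bsub>V\<^esub> \<ominus>\<^bsub>V\<^esub> w))"
      using c by (simp only: a_minus_def) (simp add: V.module.M.a_assoc)
    also have "\<dots> = u \<ominus>\<^bsub>V\<^esub> u'"
      using c by (simp add: a_minus_def V.module.M.r_neg V.module.M.a_comm)
    finally have e: "u \<ominus>\<^bsub>V\<^esub> u' = w' \<ominus>\<^bsub>V\<^esub> w" by simp
    have "u \<ominus>\<^bsub>V\<^esub> u' \<in> W \<inter> U"
      using lsub_diff[OF vs W(1) that(4,3)] lsub_diff[OF vs U that(1,2)] e by simp
    then have "u \<ominus>\<^bsub>V\<^esub> u' = \<zero>\<^bsub>V\<^esub>" using W(2) by auto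
    then show ?thesis using c by simp
  qed
  have ex: "\<exists>u\<in>U. \<exists>w\<in>W. v = u \<oplus>\<^bsub>V\<^esub> w" if v: "v \<in> carrier V" for v
  proof -
    \<comment> \<open>\<open>X\<close> is \<open>W\<close> enlarged by the line through
      \<open>v\<close>. If it meets \<open>U\<close> trivially, maximality puts \<open>v\<close>
      into \<open>W\<close>. Otherwise some nonzero c v + w lies in \<open>U\<close>, with c nonzero
      because \<open>W\<close> meets \<open>U\<close> only in 0, and this is solved for
      \<open>v\<close>.\<close>
    define X where "X = {c \<odot>\<^bsub>V\<^esub> v \<oplus>\<^bsub>V\<^esub> w |c w. c \<in> carrier K \<and> w \<in> W}"
    have WX: "W \<subseteq> X"
    proof
      fix w assume w: "w \<in> W"
      then have "w = \<zero>\<^bsub>K\<^esub> \<odot>\<^bsub>V\<^esub> v \<oplus>\<^bsub>V\<^esub> w" using v Wc by auto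
      then show "w \<in> X" unfolding X_def using w by blast
    qed
    have vX: "v \<in> X"
    proof -
      have "v = \<one>\<^bsub>K\<^esub> \<odot>\<^bsub>V\<^esub> v \<oplus>\<^bsub>V\<^esub> \<zero>\<^bsub>V\<^esub>" using v by simp
      then show ?thesis unfolding X_def using Wc by blast
    qed
    have X: "lsub K V X" unfolding lsub_def
    proof (intro conjI ballI)
      show "X \<subseteq> carrier V" using v Wc by (auto simp: X_def)
      show "\<zero>\<^bsub>V\<^esub> \<in> X" using WX Wc by blast
    next
      fix x y assume "x \<in> X" "y \<in> X"
      then obtain c w d w' where h: "c \<in> carrier K" "d \<in> carrier K" "w \<in> W" "w' \<in> W"
        "x = c \<odot>\<^bsub>V\<^esub> v \<oplus>\<^bsub>V\<^esub> w" "y = d \<odot>\<^bsub>V\<^esub> v \<oplus>\<^bsub>V\<^esub> w'" unfolding X_def by blast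
      have wc: "w \<in> carrier V" "w' \<in> carrier V" using h Wc by auto
      have "x \<oplus>\<^bsub>V\<^esub> y = (c \<oplus>\<^bsub>K\<^esub> d) \<odot>\<^bsub>V\<^esub> v \<oplus>\<^bsub>V\<^esub> (w \<oplus>\<^bsub>V\<^esub> w')"
        using h v wc by (simp add: V.module.smult_l_distr V.module.M.a_ac)
      then show "x \<oplus>\<^bsub>V\<^esub> y \<in> X" unfolding X_def using h Wa by blast
    next
      fix k x assume k: "k \<in> carrier K" "x \<in> X"
      then obtain c w where h: "c \<in> carrier K" "w \<in> W" "x = c \<odot>\<^bsub>V\<^esub> v \<oplus>\<^bsub>V\<^esub> w" unfolding X_def by blast
      have wc: "w \<in> carrier V" using h Wc by auto
      have "k \<odot>\<^bsub>V\<^esub> x = (k \<otimes>\<^bsub>K\<^esub> c) \<odot>\<^bsub>V\<^esub> v \<oplus>\<^bsub>V\<^esub> (k \<odot>\<^bsub>V\<^esub> w)"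
        using h v wc k by (simp add: V.module.smult_r_distr V.module.smult_assoc1)
      then show "k \<odot>\<^bsub>V\<^esub> x \<in> X" unfolding X_def using h k Ws by blast
    qed
    show ?thesis
    proof (cases "X \<inter> U = {\<zero>\<^bsub>V\<^esub>}")
      case True
      then have "v \<in> W" using max[OF X _ WX] vX by blast
      then have "v = \<zero>\<^bsub>V\<^esub> \<oplus>\<^bsub>V\<^esub> v" using v by simp
      then show ?thesis using \<open>v \<in> W\<close> Uc by blast
    next
      case False
      moreover have "\<zero>\<^bsub>V\<^esub> \<in> X \<inter> U" using X Uc by (simp add: lsub_def)
      ultimately obtain x where x: "x \<in> X" "x \<in> U" "x \<noteq> \<zero>\<^bsub>V\<^esub>" by blast
      then obtain c w where h: "c \<in> carrier K" "w \<in> W" "x = c \<odot>\<^bsub>V\<^esub> v \<oplus>\<^bsub>V\<^esub> w" unfolding X_def by blast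
      have wc: "w \<in> carrier V" using h Wc by auto
      have c0: "c \<noteq> \<zero>\<^bsub>K\<^esub>"
      proof
        assume "c = \<zero>\<^bsub>K\<^esub>"
        then have "x = w" using h wc v by simp
        then show False using W(2) h x by blast
      qed
      then have ci: "inv\<^bsub>K\<^esub> c \<in> carrier K" "inv\<^bsub>K\<^esub> c \<otimes>\<^bsub>K\<^esub> c = \<one>\<^bsub>K\<^esub>"
        using h V.field.field_Units by auto
      let ?u = "inv\<^bsub>K\<^esub> c \<odot>\<^bsub>V\<^esub> x" and ?w = "inv\<^bsub>K\<^esub> c \<odot>\<^bsub>V\<^esub> w"
      have "?u = v \<oplus>\<^bsub>V\<^esub> ?w"
        using h ci v wc by (simp add: V.module.smult_r_distr V.module.smult_assoc1 [symmetric])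
      moreover have uw: "?u \<in> U" "?w \<in> W" using Us Ws ci x h by auto
      moreover have "\<ominus>\<^bsub>V\<^esub> ?w \<in> W"
        using lsub_diff[OF vs W(1) Wc(2) uw(2)] wc ci by (simp add: a_minus_def)
      moreover have "v = (v \<oplus>\<^bsub>V\<^esub> ?w) \<oplus>\<^bsub>V\<^esub> \<ominus>\<^bsub>V\<^esub> ?w"
        using v wc ci by (simp add: V.module.M.a_assoc V.module.M.r_neg)
      ultimately show ?thesis by metis
    qed
  qed
  \<comment> \<open>By \<open>uniq\<close> the choice is forced, which makes \<open>p\<close> linear
    and the identity on \<open>U\<close>.\<close>
  define p where "p v = (SOME u. u \<in> U \<and> (\<exists>w\<in>W. v = u \<oplus>\<^bsub>V\<^esub> w))" for v
  have p: "p v \<in> U \<and> (\<exists>w\<in>W. v = p v \<oplus>\<^bsub>V\<^esub> w)" if "v \<in> carrier V" for v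
    unfolding p_def by (rule someI_ex) (use ex[OF that] in blast)
  have pI: "p (u \<oplus>\<^bsub>V\<^esub> w) = u" if "u \<in> U" "w \<in> W" for u w
    using p[of "u \<oplus>\<^bsub>V\<^esub> w"] uniq that Uc Wc by (metis V.module.M.a_closed subsetD)
  show ?thesis
  proof
    show "p v \<in> U" if "v \<in> carrier V" for v using p that by blast
    show "p u = u" if "u \<in> U" for u using pI[OF that Wc(2)] that Uc by auto
    show "lin K V V p"
    proof (rule linI)
      show "p v \<in> carrier V" if "v \<in> carrier V" for v using p that Uc by blast
    next
      fix v w assume v: "v \<in> carrier V" and w: "w \<in> carrier V"
      obtain a b where a: "a \<in> W" "p v \<oplus>\<^bsub>V\<^esub> a = v" and b: "b \<in> W" "p w \<oplus>\<^bsub>V\<^esub> b = w"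
        using p v w by metis
      have c: "p v \<in> carrier V" "p w \<in> carrier V" "a \<in> carrier V" "b \<in> carrier V"
        using p v w Uc a(1) b(1) Wc by auto
      have "(p v \<oplus>\<^bsub>V\<^esub> a) \<oplus>\<^bsub>V\<^esub> (p w \<oplus>\<^bsub>V\<^esub> b) = (p v \<oplus>\<^bsub>V\<^esub> p w) \<oplus>\<^bsub>V\<^esub> (a \<oplus>\<^bsub>V\<^esub> b)"
        using c by (simp add: V.module.M.a_ac)
      then show "p (v \<oplus>\<^bsub>V\<^esub> w) = p v \<oplus>\<^bsub>V\<^esub> p w"
        using pI[of "p v \<oplus>\<^bsub>V\<^esub> p w" "a \<oplus>\<^bsub>V\<^esub> b"] Ua Wa p v w a b by simp
    next
      fix c v assume k: "c \<in> carrier K" and v: "v \<in> carrier V"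
      obtain a where a: "a \<in> W" "p v \<oplus>\<^bsub>V\<^esub> a = v" using p v by metis
      have cc: "p v \<in> carrier V" "a \<in> carrier V" using p v Uc a(1) Wc by auto
      have "c \<odot>\<^bsub>V\<^esub> (p v \<oplus>\<^bsub>V\<^esub> a) = c \<odot>\<^bsub>V\<^esub> p v \<oplus>\<^bsub>V\<^esub> c \<odot>\<^bsub>V\<^esub> a"
        using cc k by (simp add: V.module.smult_r_distr)
      then show "p (c \<odot>\<^bsub>V\<^esub> v) = c \<odot>\<^bsub>V\<^esub> p v"
        using pI[of "c \<odot>\<^bsub>V\<^esub> p v" "c \<odot>\<^bsub>V\<^esub> a"] Us Ws p v k a by simp
    qed
  qed
qed

text \<open>Stated with a separate map \<open>g\<close> so that it covers inverses (\<open>g\<close>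
  the identity), left inverses (\<open>g\<close> a projection onto the image of \<open>f\<close>)
  and factorizations through \<open>f\<close>.\<close>

lemma lin_inv_into:
  assumes "vectorspace K V" "lin K V W f" "inj_on f (carrier V)"
    and "\<And>x. x \<in> carrier U \<Longrightarrow> g x \<in> f ` carrier V" "lin K U W g"
  shows "lin K U V (\<lambda>x. inv_into (carrier V) f (g x))"
proof -
  interpret V: vectorspace K V by fact
  have i: "inv_into (carrier V) f (g x) \<in> carrier V" "f (inv_into (carrier V) f (g x)) = g x"
    if "x \<in> carrier U" for x using assms(4)[OF that] by (auto simp: inv_into_into f_inv_into_f)
  have e: "inv_into (carrier V) f y = v" if "v \<in> carrier V" "f v = y" for v y
    using that assms(3) by (auto simp: inv_into_f_f)
  show ?thesis
  proof (rule linI)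
    fix x assume x: "x \<in> carrier U" show "inv_into (carrier V) f (g x) \<in> carrier V" by (rule i[OF x])
  next
    fix x y assume x: "x \<in> carrier U" and y: "y \<in> carrier U"
    show "inv_into (carrier V) f (g (x \<oplus>\<^bsub>U\<^esub> y)) =
      inv_into (carrier V) f (g x) \<oplus>\<^bsub>V\<^esub> inv_into (carrier V) f (g y)"
      by (rule e) (simp_all add: i x y lin_add[OF assms(2)] lin_add[OF assms(5)])
  next
    fix c x assume c: "c \<in> carrier K" and x: "x \<in> carrier U"
    show "inv_into (carrier V) f (g (c \<odot>\<^bsub>U\<^esub> x)) = c \<odot>\<^bsub>V\<^esub> inv_into (carrier V) f (g x)"
      by (rule e) (simp_all add: i c x lin_smult[OF assms(2)] lin_smult[OF assms(5)])
  qed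
qed

text \<open>Project onto the image of \<open>f\<close> and invert \<open>f\<close> there. Such
  splittings are what makes tensor products of injections injective.\<close>

lemma lin_left_inverse:
  assumes "vectorspace K V" "vectorspace K W" "lin K V W f" "inj_on f (carrier V)"
  obtains g where "lin K W V g" "\<And>v. v \<in> carrier V \<Longrightarrow> g (f v) = v"
proof -
  obtain p where p: "lin K W W p" "\<And>v. v \<in> carrier W \<Longrightarrow> p v \<in> f ` carrier V"
    "\<And>u. u \<in> f ` carrier V \<Longrightarrow> p u = u"
    using subspace_retraction[OF assms(2) lsub_image[OF assms(1-3) lsub_carrier[OF assms(1)]]] by blast
  show ?thesis
  proof
    show "lin K W V (\<lambda>x. inv_into (carrier V) f (p x))"
      using lin_inv_into[OF assms(1,3,4)] p by blast
    show "inv_into (carrier V) f (p (f v)) = v" if "v \<in> carrier V" for v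
      using that p(3) assms(4) by simp
  qed
qed

text \<open>Finite generation in the form in which it is inherited by images and tensor products.\<close>

definition fgen :: "('k, 'r) ring_scheme \<Rightarrow> ('k, 'v, 'x) module_scheme \<Rightarrow> bool"
  where "fgen K V \<longleftrightarrow> (\<exists>A. finite A \<and> A \<subseteq> carrier V \<and> (\<forall>U. lsub K V U \<and> A \<subseteq> U \<longrightarrow> carrier V \<subseteq> U))"

lemma fin_dim_iff_fgen:
  assumes "vectorspace K V" shows "vectorspace.fin_dim K V \<longleftrightarrow> fgen K V"
proof -
  interpret V: vectorspace K V by fact
  show ?thesis
  proof
    assume "V.fin_dim"
    then obtain A where "finite A" "A \<subseteq> carrier V" "V.span A = carrier V"
      by (auto simp: V.fin_dim_def)
    then show "fgen K V" unfolding fgen_def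
      using V.span_is_subset lsub_submodule[OF assms] by metis
  next
    assume "fgen K V"
    then obtain A where A: "finite A" "A \<subseteq> carrier V" "\<And>U. lsub K V U \<Longrightarrow> A \<subseteq> U \<Longrightarrow> carrier V \<subseteq> U"
      by (auto simp: fgen_def)
    then have "carrier V \<subseteq> V.span A"
      using V.span_is_submodule[OF A(2)] V.in_own_span[OF A(2)] lsub_submodule[OF assms] by blast
    then show "V.fin_dim" using A V.span_is_subset2[OF A(2)] by (auto simp: V.fin_dim_def)
  qed
qed

text \<open>If a subspace of \<open>W\<close> contains the images of the generators, then its
  preimage contains the generators and hence is all of \<open>V\<close>.\<close>

lemma fgen_image:
  assumes "vectorspace K V" "vectorspace K W" "lin K V W f" "carrier W \<subseteq> f ` carrier V" "fgen K V"
  shows "fgen K W"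
proof -
  interpret V: vectorspace K V by fact
  obtain A where A: "finite A" "A \<subseteq> carrier V" "\<And>U. lsub K V U \<Longrightarrow> A \<subseteq> U \<Longrightarrow> carrier V \<subseteq> U"
    using assms(5) by (auto simp: fgen_def)
  have "carrier W \<subseteq> U" if U: "lsub K W U" "f ` A \<subseteq> U" for U
  proof -
    have "lsub K V {v \<in> carrier V. f v \<in> U}"
      using U(1) lin_zero[OF assms(1-3)] by (auto simp: lsub_def lin_add[OF assms(3)] lin_smult[OF assms(3)])
    then have "carrier V \<subseteq> {v \<in> carrier V. f v \<in> U}" using A(3) A(2) U(2) by blast
    then show ?thesis using assms(4) by blast
  qed
  then show ?thesis unfolding fgen_def using A assms(3)
    by (intro exI[of _ "f ` A"]) (auto simp: lin_def)
qed

text \<open>The dimension bounds the size of independent sets, so there is a largest one inside the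
  union of the chain. It spans the union, and being finite it already lies in one member of the
  chain.\<close>

lemma fgen_chain:
  assumes "vectorspace K V" "fgen K V" "\<And>n. lsub K V (U n)" "\<And>n. U n \<subseteq> U (Suc n)"
  obtains N :: nat where "\<And>n. n \<ge> N \<Longrightarrow> U n = U N"
proof -
  interpret V: vectorspace K V by fact
  have mono: "\<And>m n. m \<le> n \<Longrightarrow> U m \<subseteq> U n" by (rule lift_Suc_mono_le[of U]) (use assms(4) in auto)
  have fd: "V.fin_dim" using fin_dim_iff_fgen assms by blast
  let ?P = "\<lambda>A. V.lin_indpt A \<and> A \<subseteq> (\<Union>n. U n)"
  have Uc: "(\<Union>n. U n) \<subseteq> carrier V" using assms(3) unfolding lsub_def by blast
  have P0: "?P {}" by (auto simp: V.lin_dep_def)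
  have bound: "\<forall>A. ?P A \<longrightarrow> card A < Suc V.dim"
    using V.li_le_dim[OF fd] Uc by (meson le_imp_less_Suc subset_trans)
  have "\<exists>A. ?P A \<and> (\<forall>A'. ?P A' \<longrightarrow> card A' \<le> card A)"
    by (rule ex_has_greatest_nat[of ?P "{}" card "Suc V.dim"]) (rule P0 bound)+
  then obtain A where "?P A \<and> (\<forall>A'. ?P A' \<longrightarrow> card A' \<le> card A)" by (rule exE)
  then have A: "?P A" and Amax: "\<And>A'. ?P A' \<Longrightarrow> card A' \<le> card A" by simp_all
  have Ac: "A \<subseteq> carrier V" using A Uc by (rule_tac subset_trans) simp_all
  have fA: "finite A" by (rule V.li_le_dim(1)[OF fd Ac]) (simp add: A)
  have sp: "(\<Union>n. U n) \<subseteq> V.span A"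
  proof
    fix x assume x: "x \<in> (\<Union>n. U n)"
    show "x \<in> V.span A"
    proof (cases "x \<in> A")
      case True then show ?thesis using V.in_own_span[OF Ac] by (rule_tac subsetD)
    next
      case False
      have "\<not> V.lin_indpt (A \<union> {x})"
        using Amax[of "A \<union> {x}"] A x fA False by auto
      moreover have "x \<in> carrier V" using x Uc by (rule_tac subsetD)
      ultimately show ?thesis using V.lin_dep_iff_in_span[of A x] A Ac False by simp
    qed
  qed
  have "\<exists>N. F \<subseteq> U N" if "finite F" "F \<subseteq> (\<Union>n. U n)" for F
    using that
  proof (induction F rule: finite_induct)
    case empty show ?case by simp
  next
    case (insert a F)
    then obtain M N where "F \<subseteq> U N" "a \<in> U M" by auto
    then have "insert a F \<subseteq> U (max M N)" using mono[of M "max M N"] mono[of N "max M N"] by auto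
    then show ?case by blast
  qed
  then obtain N where N: "A \<subseteq> U N" using fA A by blast
  have "V.span A \<subseteq> U N" using V.span_is_subset[OF N] assms(3) lsub_submodule[OF assms(1)] by simp
  then have "U n = U N" if "n \<ge> N" for n using sp mono[OF that] by blast
  then show ?thesis using that by blast
qed

section \<open>Tensor products\<close>

definition bilin ::
  "('k, 'r) ring_scheme \<Rightarrow> ('k, 'v, 'x) module_scheme \<Rightarrow> ('k, 'w, 'y) module_scheme \<Rightarrow>
     ('k, 'z, 'u) module_scheme \<Rightarrow> ('v \<Rightarrow> 'w \<Rightarrow> 'z) \<Rightarrow> bool"
  where "bilin K V W Z \<beta> \<longleftrightarrow>
    (\<forall>v\<in>carrier V. lin K W Z (\<beta> v)) \<and> (\<forall>w\<in>carrier W. lin K V Z (\<lambda>v. \<beta> v w))"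

lemma bilin_closed: "bilin K V W Z \<beta> \<Longrightarrow> v \<in> carrier V \<Longrightarrow> w \<in> carrier W \<Longrightarrow> \<beta> v w \<in> carrier Z"
  by (simp add: bilin_def lin_def)

lemma bilinI:
  assumes "\<And>v. v \<in> carrier V \<Longrightarrow> lin K W Z (\<beta> v)" "\<And>w. w \<in> carrier W \<Longrightarrow> lin K V Z (\<lambda>v. \<beta> v w)"
  shows "bilin K V W Z \<beta>"
  using assms by (simp add: bilin_def)

lemma bilin_left: "bilin K V W Z \<beta> \<Longrightarrow> w \<in> carrier W \<Longrightarrow> lin K V Z (\<lambda>v. \<beta> v w)"
  and bilin_right: "bilin K V W Z \<beta> \<Longrightarrow> v \<in> carrier V \<Longrightarrow> lin K W Z (\<beta> v)"
  by (simp_all add: bilin_def)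

lemma bilin_comp:
  assumes "bilin K V W Z \<beta>" "lin K V' V f" "lin K W' W g" "lin K Z Z' h"
  shows "bilin K V' W' Z' (\<lambda>v w. h (\<beta> (f v) (g w)))"
proof (rule bilinI)
  fix v assume "v \<in> carrier V'"
  then show "lin K W' Z' (\<lambda>w. h (\<beta> (f v) (g w)))"
    using lin_comp[OF lin_comp[OF assms(3) bilin_right[OF assms(1)]] assms(4)] lin_closed[OF assms(2)]
    by blast
next
  fix w assume "w \<in> carrier W'"
  then show "lin K V' Z' (\<lambda>v. h (\<beta> (f v) (g w)))"
    using lin_comp[OF lin_comp[OF assms(2) bilin_left[OF assms(1)]] assms(4)] lin_closed[OF assms(3)]
    by blast
qed

lemma tens_lift_simps [simp]:
  "tens_lift Z \<beta> [] = \<zero>\<^bsub>Z\<^esub>" "tens_lift Z \<beta> (x # l) = \<beta> (fst x) (snd x) \<oplus>\<^bsub>Z\<^esub> tens_lift Z \<beta> l"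
  by (simp_all add: tens_lift_def split: prod.splits)

lemma tens_lift_cong:
  assumes "\<And>v w. (v, w) \<in> set l \<Longrightarrow> \<beta> v w = \<beta>' v w"
  shows "tens_lift Z \<beta> l = tens_lift Z \<beta>' l"
  using assms by (induction l) auto

lemma tens_lift_closed:
  assumes "vectorspace K Z" "\<And>v w. (v, w) \<in> set l \<Longrightarrow> \<beta> v w \<in> carrier Z"
  shows "tens_lift Z \<beta> l \<in> carrier Z"
proof -
  interpret Z: vectorspace K Z by fact
  show ?thesis using assms(2) by (induction l) auto
qed

lemma tens_lift_append:
  assumes "vectorspace K Z" "\<And>v w. (v, w) \<in> set l \<union> set m \<Longrightarrow> \<beta> v w \<in> carrier Z"
  shows "tens_lift Z \<beta> (l @ m) = tens_lift Z \<beta> l \<oplus>\<^bsub>Z\<^esub> tens_lift Z \<beta> m"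
proof -
  interpret Z: vectorspace K Z by fact
  have m: "tens_lift Z \<beta> m \<in> carrier Z" using assms by (intro tens_lift_closed) auto
  show ?thesis using assms(2)
  proof (induction l)
    case Nil show ?case using m by simp
  next
    case (Cons a l)
    have "\<beta> (fst a) (snd a) \<in> carrier Z" "tens_lift Z \<beta> l \<in> carrier Z"
      using Cons.prems by (auto intro!: tens_lift_closed[OF assms(1)])
    then show ?case using Cons m by (simp add: Z.module.M.a_assoc)
  qed
qed

lemma tens_lift_hom:
  assumes "vectorspace K Z" "vectorspace K Z'" "lin K Z Z' f"
    "\<And>v w. (v, w) \<in> set l \<Longrightarrow> \<beta> v w \<in> carrier Z"
  shows "f (tens_lift Z \<beta> l) = tens_lift Z' (\<lambda>v w. f (\<beta> v w)) l"
  using assms(4)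
proof (induction l)
  case Nil show ?case using lin_zero[OF assms(1-3)] by simp
next
  case (Cons a l)
  have "\<beta> (fst a) (snd a) \<in> carrier Z" "tens_lift Z \<beta> l \<in> carrier Z"
    using Cons.prems by (auto intro!: tens_lift_closed[OF assms(1)])
  then show ?case using Cons by (simp add: lin_add[OF assms(3)])
qed

context
  fixes K :: "('k, 'r) ring_scheme" and V :: "('k, 'v, 'x) module_scheme"
    and W :: "('k, 'w, 'y) module_scheme"
  assumes vsV: "vectorspace K V" and vsW: "vectorspace K W"
begin

lemma tens_eq_sets:
  "tens_eq K V W l m \<Longrightarrow>
     set l \<subseteq> carrier V \<times> carrier W \<and> set m \<subseteq> carrier V \<times> carrier W"
proof (induction rule: tens_eq.induct)
  interpret V: vectorspace K V by (rule vsV)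
  interpret W: vectorspace K W by (rule vsW)
  { case te_add_left then show ?case by simp
  next case te_add_right then show ?case by simp
  next case te_smult then show ?case by simp
  next case te_zero then show ?case by simp }
qed auto

text \<open>Each generating relation of the congruence is one of the identities that a bilinear map
  satisfies. Hence \<open>tens_lift\<close> may be computed on any representative of a
  tensor.\<close>

lemma tens_lift_eq:
  assumes vsZ: "vectorspace K Z" and b: "bilin K V W Z \<beta>"
  shows "tens_eq K V W l m \<Longrightarrow> tens_lift Z \<beta> l = tens_lift Z \<beta> m"
proof (induction rule: tens_eq.induct)
  interpret Z: vectorspace K Z by (rule vsZ)
  note bc = bilin_closed[OF b]
  { case (te_append l l' m m')
    then show ?case using bc tens_eq_sets[OF te_append(1)] tens_eq_sets[OF te_append(2)]
      by (subst (1 2) tens_lift_append[OF vsZ]) auto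
  next
    case (te_commute l m)
    have c: "tens_lift Z \<beta> l \<in> carrier Z" "tens_lift Z \<beta> m \<in> carrier Z"
      using te_commute bc by (auto intro!: tens_lift_closed[OF vsZ])
    have "tens_lift Z \<beta> (l @ m) = tens_lift Z \<beta> l \<oplus>\<^bsub>Z\<^esub> tens_lift Z \<beta> m"
      "tens_lift Z \<beta> (m @ l) = tens_lift Z \<beta> m \<oplus>\<^bsub>Z\<^esub> tens_lift Z \<beta> l"
      using te_commute bc by (auto intro!: tens_lift_append[OF vsZ])
    then show ?case using c by (simp add: Z.module.M.a_comm)
  next
    case (te_add_left v v' w)
    then show ?case using lin_add[OF bilin_left[OF b]] bc by simp
  next
    case (te_add_right v w w')
    then show ?case using lin_add[OF bilin_right[OF b]] bc by simp
  next
    case (te_smult c v w)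
    then show ?case using lin_smult[OF bilin_right[OF b]] lin_smult[OF bilin_left[OF b]] bc by simp
  next
    case (te_zero w)
    then show ?case using lin_zero[OF vsV vsZ bilin_left[OF b]] by simp }
qed auto

text \<open>Congruent lists define the same predicate, so \<open>SOME\<close> selects the same list
  for both.\<close>

lemma tens_nf_cong: "tens_eq K V W l m \<Longrightarrow> tens_nf K V W l = tens_nf K V W m"
proof -
  assume "tens_eq K V W l m"
  then have "tens_eq K V W l = tens_eq K V W m" by (intro ext) (meson te_sym te_trans)
  then show ?thesis by (simp add: tens_nf_def)
qed

lemma tens_eq_nf: "set l \<subseteq> carrier V \<times> carrier W \<Longrightarrow> tens_eq K V W l (tens_nf K V W l)"
  unfolding tens_nf_def by (rule someI) (rule te_refl)

lemma tens_nf_eq_iff: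
  assumes "set l \<subseteq> carrier V \<times> carrier W" "set m \<subseteq> carrier V \<times> carrier W"
  shows "tens_nf K V W l = tens_nf K V W m \<longleftrightarrow> tens_eq K V W l m"
  using tens_eq_nf[OF assms(1)] tens_eq_nf[OF assms(2)] tens_nf_cong by (metis te_sym te_trans)

lemma tens_nf_set: "set l \<subseteq> carrier V \<times> carrier W \<Longrightarrow> set (tens_nf K V W l) \<subseteq> carrier V \<times> carrier W"
  using tens_eq_nf tens_eq_sets by blast

text \<open>A list is congruent to its normal form, so normalizing twice changes nothing and the
  elements of the tensor product are the lists fixed by \<open>tens_nf\<close>.\<close>

lemma tensor_carrier:
  "x \<in> carrier (tensor K V W) \<longleftrightarrow> set x \<subseteq> carrier V \<times> carrier W \<and> tens_nf K V W x = x"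
proof
  assume "x \<in> carrier (tensor K V W)"
  then obtain l where l: "set l \<subseteq> carrier V \<times> carrier W" "x = tens_nf K V W l"
    by (auto simp: tensor_def)
  then show "set x \<subseteq> carrier V \<times> carrier W \<and> tens_nf K V W x = x"
    using tens_nf_set tens_eq_nf[OF l(1)] tens_nf_cong by metis
next
  assume x: "set x \<subseteq> carrier V \<times> carrier W \<and> tens_nf K V W x = x"
  have "tens_nf K V W x \<in> carrier (tensor K V W)" using conjunct1[OF x] by (simp add: tensor_def)
  then show "x \<in> carrier (tensor K V W)" by (simp only: conjunct2[OF x])
qed

lemma tens_nf_in: "set l \<subseteq> carrier V \<times> carrier W \<Longrightarrow> tens_nf K V W l \<in> carrier (tensor K V W)"
  by (simp add: tensor_def)

lemma tensor_zero: "\<zero>\<^bsub>tensor K V W\<^esub> = tens_nf K V W []"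
  by (simp add: tensor_def)

lemma tensor_add_nf:
  assumes "set l \<subseteq> carrier V \<times> carrier W" "set m \<subseteq> carrier V \<times> carrier W"
  shows "tens_nf K V W l \<oplus>\<^bsub>tensor K V W\<^esub> tens_nf K V W m = tens_nf K V W (l @ m)"
  using te_append[OF tens_eq_nf[OF assms(1)] tens_eq_nf[OF assms(2)]]
  by (simp add: tensor_def tens_nf_cong te_sym)

lemma tens_eq_scale:
  assumes c: "c \<in> carrier K"
  shows "tens_eq K V W l m \<Longrightarrow>
    tens_eq K V W (map (\<lambda>(v, w). (c \<odot>\<^bsub>V\<^esub> v, w)) l) (map (\<lambda>(v, w). (c \<odot>\<^bsub>V\<^esub> v, w)) m)"
proof (induction rule: tens_eq.induct)
  interpret V: vectorspace K V by (rule vsV)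
  interpret W: vectorspace K W by (rule vsW)
  { case (te_refl l) then show ?case using c by (intro tens_eq.te_refl) auto
  next case (te_sym l m) then show ?case by (rule_tac tens_eq.te_sym)
  next case (te_trans l m n) then show ?case by (rule_tac tens_eq.te_trans)
  next case (te_append l l' m m') then show ?case by (simp only: map_append tens_eq.te_append)
  next case (te_commute l m)
    have "set (map (\<lambda>(v, w). (c \<odot>\<^bsub>V\<^esub> v, w)) l) \<subseteq> carrier V \<times> carrier W"
      "set (map (\<lambda>(v, w). (c \<odot>\<^bsub>V\<^esub> v, w)) m) \<subseteq> carrier V \<times> carrier W"
      using te_commute c by auto
    then show ?case using tens_eq.te_commute by (simp only: map_append)
  next case (te_add_left v v' w)
    then show ?case using c tens_eq.te_add_left[of "c \<odot>\<^bsub>V\<^esub> v" V "c \<odot>\<^bsub>V\<^esub> v'" w W K]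
      by (simp add: V.module.smult_r_distr)
  next case (te_add_right v w w') then show ?case using c tens_eq.te_add_right[of "c \<odot>\<^bsub>V\<^esub> v" V w W w' K] by simp
  next case (te_smult d v w)
    have "tens_eq K V W [(d \<odot>\<^bsub>V\<^esub> (c \<odot>\<^bsub>V\<^esub> v), w)] [(c \<odot>\<^bsub>V\<^esub> v, d \<odot>\<^bsub>W\<^esub> w)]"
      using te_smult c by (intro tens_eq.te_smult) auto
    moreover have "d \<odot>\<^bsub>V\<^esub> (c \<odot>\<^bsub>V\<^esub> v) = c \<odot>\<^bsub>V\<^esub> (d \<odot>\<^bsub>V\<^esub> v)"
      using te_smult c V.module.R.m_comm by (metis V.module.smult_assoc1)
    ultimately show ?case by simp
  next case (te_zero w) then show ?case using c tens_eq.te_zero by simp }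
qed

lemma tensor_smult_nf:
  assumes "c \<in> carrier K" "set l \<subseteq> carrier V \<times> carrier W"
  shows "c \<odot>\<^bsub>tensor K V W\<^esub> tens_nf K V W l = tens_nf K V W (map (\<lambda>(v, w). (c \<odot>\<^bsub>V\<^esub> v, w)) l)"
  using tens_eq_scale[OF assms(1) tens_eq_nf[OF assms(2)]]
  by (simp add: tensor_def tens_nf_cong te_sym)

lemma scale_set:
  "c \<in> carrier K \<Longrightarrow> set l \<subseteq> carrier V \<times> carrier W \<Longrightarrow>
    set (map (\<lambda>(v, w). (c \<odot>\<^bsub>V\<^esub> v, w)) l) \<subseteq> carrier V \<times> carrier W"
proof -
  interpret V: vectorspace K V by (rule vsV)
  show "c \<in> carrier K \<Longrightarrow> set l \<subseteq> carrier V \<times> carrier W \<Longrightarrow>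
    set (map (\<lambda>(v, w). (c \<odot>\<^bsub>V\<^esub> v, w)) l) \<subseteq> carrier V \<times> carrier W" by auto
qed

lemma tensor_vs: "vectorspace K (tensor K V W)"
proof -
  interpret V: vectorspace K V by (rule vsV)
  interpret W: vectorspace K W by (rule vsW)
  let ?T = "tensor K V W" and ?n = "tens_nf K V W"
  let ?L = "{l. set l \<subseteq> carrier V \<times> carrier W}"
  have rep: "\<exists>l\<in>?L. x = ?n l" if "x \<in> carrier ?T" for x
    using that by (auto simp: tensor_def)
  have sc: "map (\<lambda>(v, w). (c \<odot>\<^bsub>V\<^esub> v, w)) l \<in> ?L" if "c \<in> carrier K" "l \<in> ?L" for c l
    using scale_set that by simp
  have nil: "[] \<in> ?L" by simp
  have app: "l @ m \<in> ?L" if "l \<in> ?L" "m \<in> ?L" for l m using that by simp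
  have add: "?n l \<oplus>\<^bsub>?T\<^esub> ?n m = ?n (l @ m)" if "l \<in> ?L" "m \<in> ?L" for l m
    using tensor_add_nf that by simp
  have smu: "c \<odot>\<^bsub>?T\<^esub> ?n l = ?n (map (\<lambda>(v, w). (c \<odot>\<^bsub>V\<^esub> v, w)) l)" if "c \<in> carrier K" "l \<in> ?L" for c l
    using tensor_smult_nf that by simp
  have mem: "?n l \<in> carrier ?T" if "l \<in> ?L" for l using tens_nf_in that by simp
  \<comment> \<open>Scaling acts term by term, so the two halves of each term arise next to each
    other. Sorting them into the two scaled lists takes commutations and an induction on the
    list.\<close>
  have dist: "?n (map (\<lambda>(v, w). ((a \<oplus>\<^bsub>K\<^esub> b) \<odot>\<^bsub>V\<^esub> v, w)) l) =
      ?n (map (\<lambda>(v, w). (a \<odot>\<^bsub>V\<^esub> v, w)) l @ map (\<lambda>(v, w). (b \<odot>\<^bsub>V\<^esub> v, w)) l)"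
    if a: "a \<in> carrier K" "b \<in> carrier K" and l: "l \<in> ?L" for a b l
    using l
  proof (induction l)
    case Nil show ?case by simp
  next
    case (Cons x l)
    obtain v w where x: "x = (v, w)" by force
    let ?f = "\<lambda>a. map (\<lambda>(v, w). (a \<odot>\<^bsub>V\<^esub> v, w)) l"
    have vw: "v \<in> carrier V" "w \<in> carrier W" "l \<in> ?L" using Cons.prems x by auto
    have IH: "tens_eq K V W (?f (a \<oplus>\<^bsub>K\<^esub> b)) (?f a @ ?f b)"
      using Cons.IH[OF vw(3)] sc[OF _ vw(3)] a by (subst (asm) tens_nf_eq_iff) auto
    have "tens_eq K V W [((a \<oplus>\<^bsub>K\<^esub> b) \<odot>\<^bsub>V\<^esub> v, w)] [(a \<odot>\<^bsub>V\<^esub> v, w), (b \<odot>\<^bsub>V\<^esub> v, w)]"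
      using vw a by (subst V.module.smult_l_distr) (auto intro!: te_add_left)
    then have 1: "tens_eq K V W ([((a \<oplus>\<^bsub>K\<^esub> b) \<odot>\<^bsub>V\<^esub> v, w)] @ ?f (a \<oplus>\<^bsub>K\<^esub> b))
        ([(a \<odot>\<^bsub>V\<^esub> v, w), (b \<odot>\<^bsub>V\<^esub> v, w)] @ (?f a @ ?f b))" using IH by (rule te_append)
    have "tens_eq K V W (([(a \<odot>\<^bsub>V\<^esub> v, w)] @ ([(b \<odot>\<^bsub>V\<^esub> v, w)] @ ?f a)) @ ?f b)
        (([(a \<odot>\<^bsub>V\<^esub> v, w)] @ (?f a @ [(b \<odot>\<^bsub>V\<^esub> v, w)])) @ ?f b)"
      using vw a sc[OF a(1) vw(3)] sc[OF a(2) vw(3)] by (intro te_append te_refl te_commute) auto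
    then show ?case using te_trans[OF 1] x by (intro tens_nf_cong) simp
  qed
  have nil_eq: "?n (map (\<lambda>(v, w). (\<zero>\<^bsub>K\<^esub> \<odot>\<^bsub>V\<^esub> v, w)) l) = ?n []" if "l \<in> ?L" for l
    using that
  proof (induction l)
    case Nil show ?case by simp
  next
    case (Cons x l)
    obtain v w where x: "x = (v, w)" by force
    have vw: "v \<in> carrier V" "w \<in> carrier W" "l \<in> ?L" using Cons.prems x by auto
    have "tens_eq K V W (map (\<lambda>(v, w). (\<zero>\<^bsub>K\<^esub> \<odot>\<^bsub>V\<^esub> v, w)) l) []"
      using Cons.IH[OF vw(3)] sc[OF _ vw(3)] by (subst (asm) tens_nf_eq_iff) auto
    from te_append[OF te_zero[OF vw(2)] this] show ?case using x vw by (intro tens_nf_cong) simp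
  qed
  show ?thesis
  proof (rule vs_criteria)
    show "field K" by (rule V.field.field_axioms)
    show "\<zero>\<^bsub>?T\<^esub> \<in> carrier ?T" using mem[OF nil] by (simp add: tensor_zero)
    show "\<forall>v w. v \<in> carrier ?T \<and> w \<in> carrier ?T \<longrightarrow> v \<oplus>\<^bsub>?T\<^esub> w \<in> carrier ?T"
      using rep add mem app by (metis (no_types, lifting))
    show "\<forall>v\<in>carrier ?T. \<exists>neg_v\<in>carrier ?T. v \<oplus>\<^bsub>?T\<^esub> neg_v = \<zero>\<^bsub>?T\<^esub>"
    proof
      fix x assume "x \<in> carrier ?T"
      then obtain l where l: "l \<in> ?L" "x = ?n l" using rep by blast
      \<comment> \<open>The negative of a formal sum is its multiple by -1: by \<open>dist\<close>
        all coefficients of the total are 1 - 1, and \<open>nil_eq\<close> collapses it.\<close>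
      let ?m = "map (\<lambda>(v, w). ((\<ominus>\<^bsub>K\<^esub> \<one>\<^bsub>K\<^esub>) \<odot>\<^bsub>V\<^esub> v, w)) l"
      have one: "map (\<lambda>(v, w). (\<one>\<^bsub>K\<^esub> \<odot>\<^bsub>V\<^esub> v, w)) l = l" using l(1) by (induction l) auto
      have m: "?m \<in> ?L" using l by (intro sc) auto
      have "x \<oplus>\<^bsub>?T\<^esub> ?n ?m = ?n (map (\<lambda>(v, w). (\<one>\<^bsub>K\<^esub> \<odot>\<^bsub>V\<^esub> v, w)) l @ ?m)"
        using l m add one by simp
      also have "\<dots> = ?n (map (\<lambda>(v, w). ((\<one>\<^bsub>K\<^esub> \<oplus>\<^bsub>K\<^esub> \<ominus>\<^bsub>K\<^esub> \<one>\<^bsub>K\<^esub>) \<odot>\<^bsub>V\<^esub> v, w)) l)"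
        using l by (intro dist[symmetric]) auto
      also have "\<dots> = ?n []" using nil_eq[OF l(1)] by (simp add: V.module.R.r_neg)
      finally show "\<exists>neg_v\<in>carrier ?T. x \<oplus>\<^bsub>?T\<^esub> neg_v = \<zero>\<^bsub>?T\<^esub>"
        using mem[OF m] tensor_zero by auto
    qed
    show "\<forall>c v. c \<in> carrier K \<and> v \<in> carrier ?T \<longrightarrow> c \<odot>\<^bsub>?T\<^esub> v \<in> carrier ?T"
      using rep smu mem sc by (metis (no_types, lifting))
    show "\<forall>v w. v \<in> carrier ?T \<and> w \<in> carrier ?T \<longrightarrow> v \<oplus>\<^bsub>?T\<^esub> w = w \<oplus>\<^bsub>?T\<^esub> v"
    proof (intro allI impI)
      fix x y assume "x \<in> carrier ?T \<and> y \<in> carrier ?T"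
      then obtain l m where lm: "l \<in> ?L" "x = ?n l" "m \<in> ?L" "y = ?n m" using rep by meson
      then have "?n (l @ m) = ?n (m @ l)" by (intro tens_nf_cong te_commute) auto
      then show "x \<oplus>\<^bsub>?T\<^esub> y = y \<oplus>\<^bsub>?T\<^esub> x" using lm add by simp
    qed
    show "\<forall>v w x. v \<in> carrier ?T \<and> w \<in> carrier ?T \<and> x \<in> carrier ?T \<longrightarrow>
        v \<oplus>\<^bsub>?T\<^esub> w \<oplus>\<^bsub>?T\<^esub> x = v \<oplus>\<^bsub>?T\<^esub> (w \<oplus>\<^bsub>?T\<^esub> x)"
    proof (intro allI impI)
      fix x y z assume "x \<in> carrier ?T \<and> y \<in> carrier ?T \<and> z \<in> carrier ?T"
      then obtain l m n where lm: "l \<in> ?L" "x = ?n l" "m \<in> ?L" "y = ?n m" "n \<in> ?L" "z = ?n n"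
        using rep by meson
      show "x \<oplus>\<^bsub>?T\<^esub> y \<oplus>\<^bsub>?T\<^esub> z = x \<oplus>\<^bsub>?T\<^esub> (y \<oplus>\<^bsub>?T\<^esub> z)"
        using lm(1,3,5) by (simp add: lm(2,4,6) add)
    qed
    show "\<forall>v\<in>carrier ?T. v \<oplus>\<^bsub>?T\<^esub> \<zero>\<^bsub>?T\<^esub> = v"
    proof
      fix x assume "x \<in> carrier ?T"
      then obtain l where l: "l \<in> ?L" "x = ?n l" using rep by blast
      show "x \<oplus>\<^bsub>?T\<^esub> \<zero>\<^bsub>?T\<^esub> = x" using l(1) add[OF l(1) nil] by (simp add: l(2) tensor_zero)
    qed
    show "\<forall>a b v. a \<in> carrier K \<and> b \<in> carrier K \<and> v \<in> carrier ?T \<longrightarrow>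
        (a \<otimes>\<^bsub>K\<^esub> b) \<odot>\<^bsub>?T\<^esub> v = a \<odot>\<^bsub>?T\<^esub> (b \<odot>\<^bsub>?T\<^esub> v)"
    proof (intro allI impI)
      fix a b x assume h: "a \<in> carrier K \<and> b \<in> carrier K \<and> x \<in> carrier ?T"
      then obtain l where l: "l \<in> ?L" "x = ?n l" using rep by blast
      have e: "map (\<lambda>(v, w). ((a \<otimes>\<^bsub>K\<^esub> b) \<odot>\<^bsub>V\<^esub> v, w)) l =
        map (\<lambda>(v, w). (a \<odot>\<^bsub>V\<^esub> v, w)) (map (\<lambda>(v, w). (b \<odot>\<^bsub>V\<^esub> v, w)) l)"
        using l(1) h by (induction l) (auto simp: V.module.smult_assoc1)
      have ab: "a \<in> carrier K" "b \<in> carrier K" "a \<otimes>\<^bsub>K\<^esub> b \<in> carrier K" using h by auto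
      show "(a \<otimes>\<^bsub>K\<^esub> b) \<odot>\<^bsub>?T\<^esub> x = a \<odot>\<^bsub>?T\<^esub> (b \<odot>\<^bsub>?T\<^esub> x)"
        by (simp only: l(2) smu[OF ab(3) l(1)] smu[OF ab(2) l(1)] smu[OF ab(1) sc[OF ab(2) l(1)]] e)
    qed
    show "\<forall>v\<in>carrier ?T. \<one>\<^bsub>K\<^esub> \<odot>\<^bsub>?T\<^esub> v = v"
    proof
      fix x assume "x \<in> carrier ?T"
      then obtain l where l: "l \<in> ?L" "x = ?n l" using rep by blast
      have one: "map (\<lambda>(v, w). (\<one>\<^bsub>K\<^esub> \<odot>\<^bsub>V\<^esub> v, w)) l = l" using l(1) by (induction l) auto
      show "\<one>\<^bsub>K\<^esub> \<odot>\<^bsub>?T\<^esub> x = x" using smu[OF _ l(1), of "\<one>\<^bsub>K\<^esub>"] one by (simp add: l(2))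
    qed
    show "\<forall>a b v. a \<in> carrier K \<and> b \<in> carrier K \<and> v \<in> carrier ?T \<longrightarrow>
        (a \<oplus>\<^bsub>K\<^esub> b) \<odot>\<^bsub>?T\<^esub> v = a \<odot>\<^bsub>?T\<^esub> v \<oplus>\<^bsub>?T\<^esub> b \<odot>\<^bsub>?T\<^esub> v"
    proof (intro allI impI)
      fix a b x assume h: "a \<in> carrier K \<and> b \<in> carrier K \<and> x \<in> carrier ?T"
      then obtain l where l: "l \<in> ?L" "x = ?n l" using rep by blast
      show "(a \<oplus>\<^bsub>K\<^esub> b) \<odot>\<^bsub>?T\<^esub> x = a \<odot>\<^bsub>?T\<^esub> x \<oplus>\<^bsub>?T\<^esub> b \<odot>\<^bsub>?T\<^esub> x"
        using h l(1) by (simp only: l(2) smu V.module.R.a_closed dist add sc)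
    qed
    show "\<forall>a v w. a \<in> carrier K \<and> v \<in> carrier ?T \<and> w \<in> carrier ?T \<longrightarrow>
        a \<odot>\<^bsub>?T\<^esub> (v \<oplus>\<^bsub>?T\<^esub> w) = a \<odot>\<^bsub>?T\<^esub> v \<oplus>\<^bsub>?T\<^esub> a \<odot>\<^bsub>?T\<^esub> w"
    proof (intro allI impI)
      fix a x y assume h: "a \<in> carrier K \<and> x \<in> carrier ?T \<and> y \<in> carrier ?T"
      then obtain l m where lm: "l \<in> ?L" "x = ?n l" "m \<in> ?L" "y = ?n m" using rep by meson
      show "a \<odot>\<^bsub>?T\<^esub> (x \<oplus>\<^bsub>?T\<^esub> y) = a \<odot>\<^bsub>?T\<^esub> x \<oplus>\<^bsub>?T\<^esub> a \<odot>\<^bsub>?T\<^esub> y"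
        using h lm(1,3) by (simp only: lm(2,4) smu dist add sc app map_append)
    qed
  qed
qed

lemma pure_tensor_bilin: "bilin K V W (tensor K V W) (pure_tensor K V W)"
proof -
  interpret V: vectorspace K V by (rule vsV)
  interpret W: vectorspace K W by (rule vsW)
  show ?thesis unfolding bilin_def pure_tensor_def
  proof (intro conjI ballI linI)
    fix v w w' assume "v \<in> carrier V" "w \<in> carrier W" "w' \<in> carrier W"
    then show "tens_nf K V W [(v, w \<oplus>\<^bsub>W\<^esub> w')] = tens_nf K V W [(v, w)] \<oplus>\<^bsub>tensor K V W\<^esub> tens_nf K V W [(v, w')]"
      by (subst tensor_add_nf) (auto intro!: tens_nf_cong te_add_right)
  next
    fix v v' w assume "v \<in> carrier V" "w \<in> carrier W" "v' \<in> carrier V"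
    then show "tens_nf K V W [(v \<oplus>\<^bsub>V\<^esub> v', w)] = tens_nf K V W [(v, w)] \<oplus>\<^bsub>tensor K V W\<^esub> tens_nf K V W [(v', w)]"
      by (subst tensor_add_nf) (auto intro!: tens_nf_cong te_add_left)
  next
    fix c v w assume "v \<in> carrier V" "w \<in> carrier W" "c \<in> carrier K"
    then show "tens_nf K V W [(v, c \<odot>\<^bsub>W\<^esub> w)] = c \<odot>\<^bsub>tensor K V W\<^esub> tens_nf K V W [(v, w)]"
      by (subst tensor_smult_nf) (auto intro!: tens_nf_cong te_smult te_sym[OF te_smult])
  next
    fix c v w assume "v \<in> carrier V" "w \<in> carrier W" "c \<in> carrier K"
    then show "tens_nf K V W [(c \<odot>\<^bsub>V\<^esub> v, w)] = c \<odot>\<^bsub>tensor K V W\<^esub> tens_nf K V W [(v, w)]"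
      by (subst tensor_smult_nf) auto
  qed (auto intro!: tens_nf_in)
qed

lemma tensor_pure_sum:
  "set l \<subseteq> carrier V \<times> carrier W \<Longrightarrow> tens_lift (tensor K V W) (pure_tensor K V W) l = tens_nf K V W l"
proof (induction l)
  case Nil show ?case by (simp add: tensor_zero)
next
  case (Cons x l)
  obtain v w where x: "x = (v, w)" by force
  show ?case using Cons by (simp add: x pure_tensor_def) (subst tensor_add_nf, auto)
qed

text \<open>A normal form is the sum of its own pure tensors (\<open>tensor_pure_sum\<close>), so
  this serves as an induction principle for tensors.\<close>

lemma tensor_gen:
  assumes "lsub K (tensor K V W) U"
    "\<And>v w. v \<in> carrier V \<Longrightarrow> w \<in> carrier W \<Longrightarrow> pure_tensor K V W v w \<in> U"
  shows "carrier (tensor K V W) \<subseteq> U"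
proof
  fix x assume "x \<in> carrier (tensor K V W)"
  then have x: "set x \<subseteq> carrier V \<times> carrier W" "tens_nf K V W x = x" by (simp_all add: tensor_carrier)
  have "tens_lift (tensor K V W) (pure_tensor K V W) l \<in> U" if "set l \<subseteq> carrier V \<times> carrier W" for l
    using that
  proof (induction l)
    case Nil show ?case using assms(1) by (simp add: lsub_def)
  next
    case (Cons a l)
    then have "pure_tensor K V W (fst a) (snd a) \<in> U" by (intro assms(2)) auto
    then show ?case using Cons assms(1) by (simp add: lsub_def)
  qed
  then show "x \<in> U" using tensor_pure_sum[OF x(1)] x by metis
qed

lemma tens_lift_lin:
  assumes "vectorspace K Z" "bilin K V W Z \<beta>"
  shows "lin K (tensor K V W) Z (tens_lift Z \<beta>)"
proof -
  interpret V: vectorspace K V by (rule vsV)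
  interpret Z: vectorspace K Z by fact
  have cl: "tens_lift Z \<beta> l \<in> carrier Z" if "set l \<subseteq> carrier V \<times> carrier W" for l
    using that bilin_closed[OF assms(2)] by (intro tens_lift_closed[OF assms(1)]) auto
  have nf: "tens_lift Z \<beta> (tens_nf K V W l) = tens_lift Z \<beta> l" if "set l \<subseteq> carrier V \<times> carrier W" for l
    using tens_lift_eq[OF assms tens_eq_nf[OF that]] by simp
  have scl: "tens_lift Z \<beta> (map (\<lambda>(v, w). (c \<odot>\<^bsub>V\<^esub> v, w)) l) = c \<odot>\<^bsub>Z\<^esub> tens_lift Z \<beta> l"
    if "set l \<subseteq> carrier V \<times> carrier W" "c \<in> carrier K" for c l
    using that
  proof (induction l)
    case Nil show ?case using Nil by simp
  next
    case (Cons a l)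
    obtain v w where a: "a = (v, w)" by force
    have vw: "v \<in> carrier V" "w \<in> carrier W" using Cons.prems a by auto
    then show ?case using Cons a cl[of l] bilin_closed[OF assms(2) vw]
      by (simp add: Z.module.smult_r_distr lin_smult[OF bilin_left[OF assms(2)]])
  qed
  show ?thesis
  proof (rule linI)
    fix x assume "x \<in> carrier (tensor K V W)"
    then show "tens_lift Z \<beta> x \<in> carrier Z" using cl by (simp add: tensor_carrier)
  next
    fix x y assume "x \<in> carrier (tensor K V W)" "y \<in> carrier (tensor K V W)"
    then have xy: "set x \<subseteq> carrier V \<times> carrier W" "tens_nf K V W x = x"
       "set y \<subseteq> carrier V \<times> carrier W" "tens_nf K V W y = y" by (simp_all add: tensor_carrier)
    have "tens_lift Z \<beta> (x \<oplus>\<^bsub>tensor K V W\<^esub> y) = tens_lift Z \<beta> (x @ y)"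
      using tensor_add_nf[OF xy(1,3)] xy nf[of "x @ y"] by simp
    also have "\<dots> = tens_lift Z \<beta> x \<oplus>\<^bsub>Z\<^esub> tens_lift Z \<beta> y"
      using xy bilin_closed[OF assms(2)] by (intro tens_lift_append[OF assms(1)]) auto
    finally show "tens_lift Z \<beta> (x \<oplus>\<^bsub>tensor K V W\<^esub> y) = tens_lift Z \<beta> x \<oplus>\<^bsub>Z\<^esub> tens_lift Z \<beta> y" .
  next
    fix c x assume c: "c \<in> carrier K" and "x \<in> carrier (tensor K V W)"
    then have x: "set x \<subseteq> carrier V \<times> carrier W" "tens_nf K V W x = x" by (simp_all add: tensor_carrier)
    show "tens_lift Z \<beta> (c \<odot>\<^bsub>tensor K V W\<^esub> x) = c \<odot>\<^bsub>Z\<^esub> tens_lift Z \<beta> x"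
      using tensor_smult_nf[OF c x(1)] x(2) nf[OF scale_set[OF c x(1)]] scl[OF x(1) c] by simp
  qed
qed

lemma tens_lift_pure:
  assumes "vectorspace K Z" "bilin K V W Z \<beta>" "v \<in> carrier V" "w \<in> carrier W"
  shows "tens_lift Z \<beta> (pure_tensor K V W v w) = \<beta> v w"
proof -
  interpret Z: vectorspace K Z by fact
  have "tens_lift Z \<beta> [(v, w)] = tens_lift Z \<beta> (pure_tensor K V W v w)"
    unfolding pure_tensor_def by (rule tens_lift_eq[OF assms(1,2) tens_eq_nf]) (use assms in auto)
  then show ?thesis using bilin_closed[OF assms(2-4)] by simp
qed

end

lemma lsub_equalizer:
  assumes "vectorspace K V" "vectorspace K Z" "lin K V Z f" "lin K V Z g"
  shows "lsub K V {x \<in> carrier V. f x = g x}"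
proof -
  interpret V: vectorspace K V by fact
  show ?thesis using lin_zero[OF assms(1-3)] lin_zero[OF assms(1,2,4)]
    by (auto simp: lsub_def lin_add[OF assms(3)] lin_add[OF assms(4)] lin_smult[OF assms(3)] lin_smult[OF assms(4)])
qed

lemma bilin_plus:
  assumes "vectorspace K V" "vectorspace K W" "vectorspace K Z" "bilin K V W Z f" "bilin K V W Z g"
  shows "bilin K V W Z (\<lambda>v w. f v w \<oplus>\<^bsub>Z\<^esub> g v w)"
  using assms unfolding bilin_def by (auto intro!: lin_plus)

lemma bilin_scale:
  assumes "vectorspace K V" "vectorspace K W" "vectorspace K Z" "bilin K V W Z f" "c \<in> carrier K"
  shows "bilin K V W Z (\<lambda>v w. c \<odot>\<^bsub>Z\<^esub> f v w)"
  using assms unfolding bilin_def by (auto intro!: lin_scale)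

lemma bilin_zero:
  assumes "vectorspace K Z"
  shows "bilin K V W Z (\<lambda>v w. \<zero>\<^bsub>Z\<^esub>)"
  using assms unfolding bilin_def by (auto intro!: lin_const_zero)

lemma bilin_cong:
  assumes "vectorspace K V" "vectorspace K W"
    "\<And>v w. v \<in> carrier V \<Longrightarrow> w \<in> carrier W \<Longrightarrow> f v w = g v w"
  shows "bilin K V W Z f \<longleftrightarrow> bilin K V W Z g"
proof -
  have "lin K W Z (f v) \<longleftrightarrow> lin K W Z (g v)" if "v \<in> carrier V" for v
    by (rule lin_cong[OF assms(2)]) (use assms(3) that in simp)
  moreover have "lin K V Z (\<lambda>v. f v w) \<longleftrightarrow> lin K V Z (\<lambda>v. g v w)" if "w \<in> carrier W" for w
    by (rule lin_cong[OF assms(1)]) (use assms(3) that in simp)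
  ultimately show ?thesis by (simp add: bilin_def)
qed

section \<open>Tensor products of spaces inside the universe \<open>elt\<close>\<close>

context
  fixes K :: "('k, 'r) ring_scheme" and V W :: "('k, 'a) space"
  assumes vsV: "vectorspace K V" and vsW: "vectorspace K W"
begin

lemma vt_carrier: "carrier (vect_tensor K V W) = Tens ` carrier (tensor K V W)"
  by (simp add: vect_tensor_def)

lemma lin_Tens: "lin K (tensor K V W) (vect_tensor K V W) Tens"
  and lin_terms: "lin K (vect_tensor K V W) (tensor K V W) terms"
proof -
  interpret T: vectorspace K "tensor K V W" by (rule tensor_vs[OF vsV vsW])
  show "lin K (tensor K V W) (vect_tensor K V W) Tens" "lin K (vect_tensor K V W) (tensor K V W) terms"
    by (auto simp: lin_def vect_tensor_def)
qed

lemma vt_vs: "vectorspace K (vect_tensor K V W)"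
proof -
  interpret T: vectorspace K "tensor K V W" by (rule tensor_vs[OF vsV vsW])
  show ?thesis
    by (rule vectorspace_transport[OF tensor_vs[OF vsV vsW], where g = terms])
       (auto simp: vect_tensor_def inj_on_def)
qed

lemma vt_pure_bilin: "bilin K V W (vect_tensor K V W) (vect_pure K V W)"
  using bilin_comp[OF pure_tensor_bilin[OF vsV vsW] lin_id lin_id lin_Tens]
  by (simp add: vect_pure_def [abs_def])

lemma vt_pure_closed: "v \<in> carrier V \<Longrightarrow> w \<in> carrier W \<Longrightarrow> vect_pure K V W v w \<in> carrier (vect_tensor K V W)"
  by (rule bilin_closed[OF vt_pure_bilin])

lemma vt_gen:
  assumes "lsub K (vect_tensor K V W) U"
    "\<And>v w. v \<in> carrier V \<Longrightarrow> w \<in> carrier W \<Longrightarrow> vect_pure K V W v w \<in> U"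
  shows "carrier (vect_tensor K V W) \<subseteq> U"
proof -
  have "lsub K (tensor K V W) {x \<in> carrier (tensor K V W). Tens x \<in> U}"
  proof -
    interpret T: vectorspace K "tensor K V W" by (rule tensor_vs[OF vsV vsW])
    show ?thesis using assms(1) lin_zero[OF tensor_vs[OF vsV vsW] vt_vs lin_Tens]
      by (auto simp: lsub_def lin_add[OF lin_Tens] lin_smult[OF lin_Tens])
  qed
  then have "carrier (tensor K V W) \<subseteq> {x \<in> carrier (tensor K V W). Tens x \<in> U}"
    using assms(2) bilin_closed[OF pure_tensor_bilin[OF vsV vsW]]
    by (intro tensor_gen[OF vsV vsW]) (auto simp: vect_pure_def)
  then show ?thesis by (auto simp: vt_carrier)
qed

text \<open>The equalizer of two linear maps is a subspace, here one that contains all pure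
  tensors.\<close>

lemma vt_ext:
  assumes "vectorspace K Z" "lin K (vect_tensor K V W) Z f" "lin K (vect_tensor K V W) Z g"
    "\<And>v w. v \<in> carrier V \<Longrightarrow> w \<in> carrier W \<Longrightarrow> f (vect_pure K V W v w) = g (vect_pure K V W v w)"
    "x \<in> carrier (vect_tensor K V W)"
  shows "f x = g x"
  using vt_gen[OF lsub_equalizer[OF vt_vs assms(1-3)]] assms(4,5) vt_pure_closed by auto

lemma vt_lift_lin:
  assumes "vectorspace K Z" "bilin K V W Z \<beta>"
  shows "lin K (vect_tensor K V W) Z (\<lambda>x. tens_lift Z \<beta> (terms x))"
  using lin_comp[OF lin_terms tens_lift_lin[OF vsV vsW assms]] by simp

lemma vt_lift_pure:
  assumes "vectorspace K Z" "bilin K V W Z \<beta>" "v \<in> carrier V" "w \<in> carrier W"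
  shows "tens_lift Z \<beta> (terms (vect_pure K V W v w)) = \<beta> v w"
  using tens_lift_pure[OF vsV vsW assms] by (simp add: vect_pure_def)

text \<open>Products of generators suffice: with a generator of \<open>W\<close> fixed on the right,
  the left factor may range over all of \<open>V\<close>; then, with any left factor fixed, the
  right one may range over all of \<open>W\<close>.\<close>

lemma vt_fgen:
  assumes "fgen K V" "fgen K W"
  shows "fgen K (vect_tensor K V W)"
proof -
  interpret T: vectorspace K "vect_tensor K V W" by (rule vt_vs)
  obtain A where A: "finite A" "A \<subseteq> carrier V" "\<And>U. lsub K V U \<Longrightarrow> A \<subseteq> U \<Longrightarrow> carrier V \<subseteq> U"
    using assms(1) by (auto simp: fgen_def)
  obtain B where B: "finite B" "B \<subseteq> carrier W" "\<And>U. lsub K W U \<Longrightarrow> B \<subseteq> U \<Longrightarrow> carrier W \<subseteq> U"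
    using assms(2) by (auto simp: fgen_def)
  have pre: "lsub K V' {v \<in> carrier V'. f v \<in> U}"
    if "vectorspace K V'" "lin K V' (vect_tensor K V W) f" "lsub K (vect_tensor K V W) U"
    for V' :: "('k, 'a) space" and f U
  proof -
    interpret V': vectorspace K V' by fact
    show ?thesis using that(3) lin_zero[OF that(1) vt_vs that(2)]
      by (auto simp: lsub_def lin_add[OF that(2)] lin_smult[OF that(2)])
  qed
  let ?C = "(\<lambda>(a, b). vect_pure K V W a b) ` (A \<times> B)"
  have "carrier (vect_tensor K V W) \<subseteq> U" if U: "lsub K (vect_tensor K V W) U" "?C \<subseteq> U" for U
  proof (rule vt_gen[OF U(1)])
    have 1: "carrier V \<subseteq> {v \<in> carrier V. vect_pure K V W v b \<in> U}" if b: "b \<in> B" for b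
    proof (rule A(3))
      show "lsub K V {v \<in> carrier V. vect_pure K V W v b \<in> U}"
        using b B(2) by (intro pre[OF vsV bilin_left[OF vt_pure_bilin] U(1)]) auto
      show "A \<subseteq> {v \<in> carrier V. vect_pure K V W v b \<in> U}" using A(2) U(2) b by auto
    qed
    fix v w assume v: "v \<in> carrier V" and w: "w \<in> carrier W"
    have "carrier W \<subseteq> {w \<in> carrier W. vect_pure K V W v w \<in> U}"
    proof (rule B(3))
      show "lsub K W {w \<in> carrier W. vect_pure K V W v w \<in> U}"
        by (rule pre[OF vsW bilin_right[OF vt_pure_bilin v] U(1)])
      show "B \<subseteq> {w \<in> carrier W. vect_pure K V W v w \<in> U}" using B(2) 1 v by auto
    qed
    then show "vect_pure K V W v w \<in> U" using w by auto
  qed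
  moreover have "?C \<subseteq> carrier (vect_tensor K V W)" using A(2) B(2) vt_pure_closed by auto
  ultimately show ?thesis unfolding fgen_def using A(1) B(1) by (intro exI[of _ ?C]) auto
qed

end

section \<open>Tensor products of linear maps\<close>

abbreviation vten where "vten K \<equiv> TenA (vect K)"

lemma vect_simps [simp]:
  "Ob (vect K) = {V. vectorspace K V}" "Hom (vect K) = vect_hom K"
  "Idn (vect K) V = (\<lambda>v\<in>carrier V. v)" "Cmp (vect K) U V W g f = compose (carrier U) g f"
  "TenO (vect K) = vect_tensor K" "Unt (vect K) = vect_unit K"
  by (simp_all add: vect_def)

lemma TenA_vect: "vten K V V' W W' f g = (\<lambda>x\<in>carrier (vect_tensor K V W).
       tens_lift (vect_tensor K V' W') (\<lambda>v w. vect_pure K V' W' (f v) (g w)) (terms x))"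
  by (simp add: vect_def)

lemma TenA_ext: "vten K V V' W W' f g \<in> extensional (carrier (vect_tensor K V W))"
  by (simp add: TenA_vect)

lemma vect_hom_carrier:
  assumes "vectorspace K V" "vectorspace K W"
  shows "f \<in> carrier (vect_hom K V W) \<longleftrightarrow> lin K V W f \<and> f \<in> extensional (carrier V)"
  using assms by (simp add: vect_hom_def linear_map_iff)

lemma TenA_bilin:
  assumes "vectorspace K V" "vectorspace K W" "vectorspace K V'" "vectorspace K W'"
    and "lin K V V' f" "lin K W W' g"
  shows "bilin K V W (vect_tensor K V' W') (\<lambda>v w. vect_pure K V' W' (f v) (g w))"
  by (rule bilin_comp[OF vt_pure_bilin[OF assms(3,4)] assms(5,6) lin_id])

context
  fixes K :: "('k, 'r) ring_scheme" and V W V' W' :: "('k, 'a) space"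
  assumes vs: "vectorspace K V" "vectorspace K W" "vectorspace K V'" "vectorspace K W'"
begin

lemma TenA_lin:
  assumes "lin K V V' f" "lin K W W' g"
  shows "lin K (vect_tensor K V W) (vect_tensor K V' W') (vten K V V' W W' f g)"
proof (subst lin_cong)
  show "vectorspace K (vect_tensor K V W)" by (rule vt_vs[OF vs(1,2)])
  show "lin K (vect_tensor K V W) (vect_tensor K V' W')
     (\<lambda>x. tens_lift (vect_tensor K V' W') (\<lambda>v w. vect_pure K V' W' (f v) (g w)) (terms x))"
    by (rule vt_lift_lin[OF vs(1,2) vt_vs[OF vs(3,4)] TenA_bilin[OF vs assms]])
qed (simp add: TenA_vect)

lemma TenA_pure:
  assumes "lin K V V' f" "lin K W W' g" "v \<in> carrier V" "w \<in> carrier W"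
  shows "vten K V V' W W' f g (vect_pure K V W v w) = vect_pure K V' W' (f v) (g w)"
  using vt_lift_pure[OF vs(1,2) vt_vs[OF vs(3,4)] TenA_bilin[OF vs assms(1,2)] assms(3,4)]
    vt_pure_closed[OF vs(1,2) assms(3,4)] by (simp add: TenA_vect)

text \<open>The terms of a tensor lie in the carriers, so only the values of the maps there enter.
  This allows a restricted function to be exchanged for a plain one under the tensor sign.\<close>

lemma TenA_cong:
  assumes "\<And>v. v \<in> carrier V \<Longrightarrow> f v = f' v" "\<And>w. w \<in> carrier W \<Longrightarrow> g w = g' w"
  shows "vten K V V' W W' f g = vten K V V' W W' f' g'"
proof -
  have "tens_lift (vect_tensor K V' W') (\<lambda>v w. vect_pure K V' W' (f v) (g w)) (terms x) =
        tens_lift (vect_tensor K V' W') (\<lambda>v w. vect_pure K V' W' (f' v) (g' w)) (terms x)"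
    if "x \<in> carrier (vect_tensor K V W)" for x
  proof (rule tens_lift_cong)
    have "set (terms x) \<subseteq> carrier V \<times> carrier W"
      using lin_closed[OF lin_terms[OF vs(1,2)] that] tensor_carrier[OF vs(1,2)] by blast
    then show "vect_pure K V' W' (f v) (g w) = vect_pure K V' W' (f' v) (g' w)"
      if "(v, w) \<in> set (terms x)" for v w using that assms by auto
  qed
  then show ?thesis by (simp add: TenA_vect restrict_def fun_eq_iff)
qed

end

lemma TenA_comp:
  assumes "vectorspace K V" "vectorspace K W" "vectorspace K V'" "vectorspace K W'"
    "vectorspace K V''" "vectorspace K W''" "lin K V V' f" "lin K W W' g"
    "lin K V' V'' f'" "lin K W' W'' g'" "x \<in> carrier (vect_tensor K V W)"
  shows "vten K V' V'' W' W'' f' g' (vten K V V' W W' f g x) =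
    vten K V V'' W W'' (\<lambda>v. f' (f v)) (\<lambda>w. g' (g w)) x"
proof (rule vt_ext[OF assms(1,2) vt_vs[OF assms(5,6)] _ _ _ assms(11)])
  show "lin K (vect_tensor K V W) (vect_tensor K V'' W'')
      (\<lambda>x. vten K V' V'' W' W'' f' g' (vten K V V' W W' f g x))"
    by (rule lin_comp[OF TenA_lin[OF assms(1-4,7,8)] TenA_lin[OF assms(3-6,9,10)]])
  show "lin K (vect_tensor K V W) (vect_tensor K V'' W'')
      (vten K V V'' W W'' (\<lambda>v. f' (f v)) (\<lambda>w. g' (g w)))"
    by (rule TenA_lin[OF assms(1,2,5,6) lin_comp[OF assms(7,9)] lin_comp[OF assms(8,10)]])
  fix v w assume v: "v \<in> carrier V" and w: "w \<in> carrier W"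
  show "vten K V' V'' W' W'' f' g' (vten K V V' W W' f g (vect_pure K V W v w)) =
    vten K V V'' W W'' (\<lambda>v. f' (f v)) (\<lambda>w. g' (g w)) (vect_pure K V W v w)"
    using TenA_pure[OF assms(1-4,7,8) v w]
      TenA_pure[OF assms(3-6,9,10) lin_closed[OF assms(7) v] lin_closed[OF assms(8) w]]
      TenA_pure[OF assms(1,2,5,6) lin_comp[OF assms(7,9)] lin_comp[OF assms(8,10)] v w] by simp
qed

lemma TenA_id:
  assumes "vectorspace K V" "vectorspace K W"
    "\<And>v. v \<in> carrier V \<Longrightarrow> f v = v" "\<And>w. w \<in> carrier W \<Longrightarrow> g w = w"
    "x \<in> carrier (vect_tensor K V W)"
  shows "vten K V V W W f g x = x"
proof -
  have "vten K V V W W f g = vten K V V W W (\<lambda>v. v) (\<lambda>w. w)"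
    using assms(3,4) by (intro TenA_cong[OF assms(1,2,1,2)])
  moreover have "vten K V V W W (\<lambda>v. v) (\<lambda>w. w) x = x"
    by (rule vt_ext[OF assms(1,2) vt_vs[OF assms(1,2)] TenA_lin[OF assms(1,2,1,2) lin_id lin_id] lin_id _ assms(5)])
       (rule TenA_pure[OF assms(1,2,1,2) lin_id lin_id])
  ultimately show ?thesis by simp
qed

lemma TenA_left_inverse:
  assumes "vectorspace K V" "vectorspace K W" "vectorspace K V'" "vectorspace K W'"
    "lin K V V' f" "lin K W W' g" "lin K V' V f'" "lin K W' W g'"
    "\<And>v. v \<in> carrier V \<Longrightarrow> f' (f v) = v" "\<And>w. w \<in> carrier W \<Longrightarrow> g' (g w) = w"
    "x \<in> carrier (vect_tensor K V W)"
  shows "vten K V' V W' W f' g' (vten K V V' W W' f g x) = x"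
  using TenA_comp[OF assms(1-4,1,2,5-8,11)] TenA_id[OF assms(1,2,9,10,11)] by simp

text \<open>Over a field injections split, and the tensor product of left inverses is a left
  inverse. This keeps the embeddings of a tensor product of gliders injective.\<close>

lemma TenA_inj:
  assumes "vectorspace K V" "vectorspace K W" "vectorspace K V'" "vectorspace K W'"
    "lin K V V' f" "lin K W W' g" "inj_on f (carrier V)" "inj_on g (carrier W)"
  shows "inj_on (vten K V V' W W' f g) (carrier (vect_tensor K V W))"
proof -
  obtain f' where f': "lin K V' V f'" "\<And>v. v \<in> carrier V \<Longrightarrow> f' (f v) = v"
    using lin_left_inverse[OF assms(1,3,5,7)] by blast
  obtain g' where g': "lin K W' W g'" "\<And>v. v \<in> carrier W \<Longrightarrow> g' (g v) = v"
    using lin_left_inverse[OF assms(2,4,6,8)] by blast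
  show ?thesis
    by (rule inj_on_inverseI) (rule TenA_left_inverse[OF assms(1-6) f'(1) g'(1) f'(2) g'(2)])
qed

text \<open>The tensors \<open>x\<close> with this property form a subspace, so pure tensors
  suffice. With \<open>a\<close> and \<open>c\<close> the actions on two modules, the result is the
  bilinear map along which \<Delta>(b) is made to act on \<open>x\<close>.\<close>

lemma TenA_act_bilin:
  fixes V W V' W' :: "('k, 'a) space"
  assumes vs: "vectorspace K V" "vectorspace K W" "vectorspace K V'" "vectorspace K W'"
    and vsB: "vectorspace K B" "vectorspace K B'"
    and a: "\<And>b. b \<in> carrier B \<Longrightarrow> lin K V V' (a b)" "\<And>v. v \<in> carrier V \<Longrightarrow> lin K B V' (\<lambda>b. a b v)"
    and c: "\<And>b. b \<in> carrier B' \<Longrightarrow> lin K W W' (c b)" "\<And>w. w \<in> carrier W \<Longrightarrow> lin K B' W' (\<lambda>b. c b w)"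
    and x: "x \<in> carrier (vect_tensor K V W)"
  shows "bilin K B B' (vect_tensor K V' W') (\<lambda>p q. vten K V V' W W' (a p) (c q) x)"
proof -
  let ?Z = "vect_tensor K V' W'"
  let ?b = "\<lambda>x p q. vten K V V' W W' (a p) (c q) x"
  let ?U = "{x \<in> carrier (vect_tensor K V W). bilin K B B' ?Z (?b x)}"
  interpret T: vectorspace K "vect_tensor K V W" by (rule vt_vs[OF vs(1,2)])
  have Z: "vectorspace K ?Z" by (rule vt_vs[OF vs(3,4)])
  have L: "lin K (vect_tensor K V W) ?Z (\<lambda>x. ?b x p q)" if "p \<in> carrier B" "q \<in> carrier B'" for p q
    using TenA_lin[OF vs a(1)[OF that(1)] c(1)[OF that(2)]] .
  have "lsub K (vect_tensor K V W) ?U" unfolding lsub_def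
  proof (intro conjI ballI)
    have "bilin K B B' ?Z (?b \<zero>\<^bsub>vect_tensor K V W\<^esub>) \<longleftrightarrow> bilin K B B' ?Z (\<lambda>p q. \<zero>\<^bsub>?Z\<^esub>)"
      by (rule bilin_cong[OF vsB]) (rule lin_zero[OF vt_vs[OF vs(1,2)] Z L])
    then show "\<zero>\<^bsub>vect_tensor K V W\<^esub> \<in> ?U" using bilin_zero[OF Z] by simp
  next
    fix x y assume xy: "x \<in> ?U" "y \<in> ?U"
    have "bilin K B B' ?Z (?b (x \<oplus>\<^bsub>vect_tensor K V W\<^esub> y)) \<longleftrightarrow>
        bilin K B B' ?Z (\<lambda>p q. ?b x p q \<oplus>\<^bsub>?Z\<^esub> ?b y p q)"
      by (rule bilin_cong[OF vsB]) (use xy lin_add[OF L] in auto)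
    then show "x \<oplus>\<^bsub>vect_tensor K V W\<^esub> y \<in> ?U" using bilin_plus[OF vsB Z] xy by simp
  next
    fix k x assume k: "k \<in> carrier K" "x \<in> ?U"
    have "bilin K B B' ?Z (?b (k \<odot>\<^bsub>vect_tensor K V W\<^esub> x)) \<longleftrightarrow> bilin K B B' ?Z (\<lambda>p q. k \<odot>\<^bsub>?Z\<^esub> ?b x p q)"
      by (rule bilin_cong[OF vsB]) (use k lin_smult[OF L] in auto)
    then show "k \<odot>\<^bsub>vect_tensor K V W\<^esub> x \<in> ?U" using bilin_scale[OF vsB Z] k by simp
  qed auto
  moreover have "vect_pure K V W v w \<in> ?U" if v: "v \<in> carrier V" and w: "w \<in> carrier W" for v w
  proof -
    have "bilin K B B' ?Z (?b (vect_pure K V W v w)) \<longleftrightarrow>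
        bilin K B B' ?Z (\<lambda>p q. vect_pure K V' W' (a p v) (c q w))"
      by (rule bilin_cong[OF vsB]) (rule TenA_pure[OF vs a(1) c(1) v w])
    moreover have "bilin K B B' ?Z (\<lambda>p q. vect_pure K V' W' (a p v) (c q w))"
      by (rule bilin_comp[OF vt_pure_bilin[OF vs(3,4)] a(2)[OF v] c(2)[OF w] lin_id])
    ultimately show ?thesis using vt_pure_closed[OF vs(1,2) v w] by simp
  qed
  ultimately have "carrier (vect_tensor K V W) \<subseteq> ?U" by (rule vt_gen[OF vs(1,2)])
  then show ?thesis using x by blast
qed

section \<open>Spaces of linear maps\<close>

lemma vect_hom_ops [simp]:
  "\<zero>\<^bsub>vect_hom K V W\<^esub> = (\<lambda>v\<in>carrier V. \<zero>\<^bsub>W\<^esub>)"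
  "f \<oplus>\<^bsub>vect_hom K V W\<^esub> g = (\<lambda>v\<in>carrier V. f v \<oplus>\<^bsub>W\<^esub> g v)"
  "c \<odot>\<^bsub>vect_hom K V W\<^esub> f = (\<lambda>v\<in>carrier V. c \<odot>\<^bsub>W\<^esub> f v)"
  by (simp_all add: vect_hom_def)

lemma lin_restrict:
  "vectorspace K V \<Longrightarrow> lin K V W (\<lambda>v\<in>carrier V. f v) \<longleftrightarrow> lin K V W f"
  by (rule lin_cong) simp_all

lemma ext_eqI:
  "f \<in> extensional A \<Longrightarrow> g \<in> extensional A \<Longrightarrow> (\<And>x. x \<in> A \<Longrightarrow> f x = g x) \<Longrightarrow> f = g"
  by (rule extensionalityI)

lemma vect_hom_vs:
  assumes "vectorspace K V" "vectorspace K W"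
  shows "vectorspace K (vect_hom K V W)"
proof -
  let ?H = "vect_hom K V W"
  interpret V: vectorspace K V by fact
  interpret W: vectorspace K W by fact
  note c = vect_hom_carrier[OF assms] lin_restrict[OF assms(1)]
  have cl: "f v \<in> carrier W" if "f \<in> carrier (?H)" "v \<in> carrier V" for f v
    using that lin_closed by (auto simp: c)
  have eq: "f = g" if "f \<in> carrier (?H)" "g \<in> carrier (?H)"
    "\<And>v. v \<in> carrier V \<Longrightarrow> f v = g v" for f g
    using that by (auto simp: c intro: ext_eqI)
  have z: "\<zero>\<^bsub>?H\<^esub> \<in> carrier (?H)"
    using lin_const_zero[OF assms(2)] by (simp add: c)
  have a: "f \<oplus>\<^bsub>?H\<^esub> g \<in> carrier (?H)"
    if "f \<in> carrier (?H)" "g \<in> carrier (?H)" for f g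
    using lin_plus[OF assms] that by (simp add: c)
  have s: "k \<odot>\<^bsub>?H\<^esub> f \<in> carrier (?H)"
    if "k \<in> carrier K" "f \<in> carrier (?H)" for k f
    using lin_scale[OF assms] that by (simp add: c)
  show ?thesis
  proof (rule vs_criteria)
    show "\<forall>f\<in>carrier (?H). \<exists>g\<in>carrier (?H).
        f \<oplus>\<^bsub>?H\<^esub> g = \<zero>\<^bsub>?H\<^esub>"
    proof
      fix f assume f: "f \<in> carrier (?H)"
      have m: "(\<ominus>\<^bsub>K\<^esub> \<one>\<^bsub>K\<^esub>) \<odot>\<^bsub>?H\<^esub> f \<in> carrier (?H)" using f by (intro s) auto
      have "f \<oplus>\<^bsub>?H\<^esub> ((\<ominus>\<^bsub>K\<^esub> \<one>\<^bsub>K\<^esub>) \<odot>\<^bsub>?H\<^esub> f) = \<zero>\<^bsub>?H\<^esub>"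
        by (rule eq[OF a[OF f m] z]) (use cl[OF f] in \<open>simp add: W.module.smult_minus_1 W.module.M.r_neg\<close>)
      then show "\<exists>g\<in>carrier (?H). f \<oplus>\<^bsub>?H\<^esub> g = \<zero>\<^bsub>?H\<^esub>"
        using m by blast
    qed
    show "\<forall>f g. f \<in> carrier (?H) \<and> g \<in> carrier (?H) \<longrightarrow>
        f \<oplus>\<^bsub>?H\<^esub> g \<in> carrier (?H)" using a by blast
    show "\<forall>k f. k \<in> carrier K \<and> f \<in> carrier (?H) \<longrightarrow>
        k \<odot>\<^bsub>?H\<^esub> f \<in> carrier (?H)" using s by blast
    show "\<forall>f g. f \<in> carrier (?H) \<and> g \<in> carrier (?H) \<longrightarrow>
        f \<oplus>\<^bsub>?H\<^esub> g = g \<oplus>\<^bsub>?H\<^esub> f"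
      by (intro allI impI eq a) (auto simp: cl W.module.M.a_comm)
    show "\<forall>f g h. f \<in> carrier (?H) \<and> g \<in> carrier (?H) \<and>
        h \<in> carrier (?H) \<longrightarrow> f \<oplus>\<^bsub>?H\<^esub> g \<oplus>\<^bsub>?H\<^esub> h =
        f \<oplus>\<^bsub>?H\<^esub> (g \<oplus>\<^bsub>?H\<^esub> h)"
      by (intro allI impI eq a) (auto simp: cl W.module.M.a_assoc)
    show "\<forall>f\<in>carrier (?H). f \<oplus>\<^bsub>?H\<^esub> \<zero>\<^bsub>?H\<^esub> = f"
      by (intro ballI eq a z) (auto simp: cl)
    show "\<forall>k l f. k \<in> carrier K \<and> l \<in> carrier K \<and> f \<in> carrier (?H) \<longrightarrow>
        (k \<otimes>\<^bsub>K\<^esub> l) \<odot>\<^bsub>?H\<^esub> f = k \<odot>\<^bsub>?H\<^esub> (l \<odot>\<^bsub>?H\<^esub> f)"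
      by (intro allI impI eq s) (auto simp: cl W.module.smult_assoc1)
    show "\<forall>f\<in>carrier (?H). \<one>\<^bsub>K\<^esub> \<odot>\<^bsub>?H\<^esub> f = f"
      by (intro ballI eq s) (auto simp: cl)
    show "\<forall>k l f. k \<in> carrier K \<and> l \<in> carrier K \<and> f \<in> carrier (?H) \<longrightarrow>
        (k \<oplus>\<^bsub>K\<^esub> l) \<odot>\<^bsub>?H\<^esub> f =
        k \<odot>\<^bsub>?H\<^esub> f \<oplus>\<^bsub>?H\<^esub> l \<odot>\<^bsub>?H\<^esub> f"
      by (intro allI impI eq a s) (auto simp: cl W.module.smult_l_distr)
    show "\<forall>k f g. k \<in> carrier K \<and> f \<in> carrier (?H) \<and> g \<in> carrier (?H) \<longrightarrow>
        k \<odot>\<^bsub>?H\<^esub> (f \<oplus>\<^bsub>?H\<^esub> g) =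
        k \<odot>\<^bsub>?H\<^esub> f \<oplus>\<^bsub>?H\<^esub> k \<odot>\<^bsub>?H\<^esub> g"
      by (intro allI impI eq a s) (auto simp: cl W.module.smult_r_distr)
  qed (rule V.field.field_axioms z)+
qed

text \<open>Evaluation at \<open>v\<close> is linear on the space of linear maps, and linear maps
  commute with \<open>tens_lift\<close>.\<close>

lemma tens_lift_vect_hom:
  assumes "vectorspace K V" "vectorspace K W" "v \<in> carrier V"
    "\<And>p q. (p, q) \<in> set l \<Longrightarrow> \<beta> p q \<in> carrier (vect_hom K V W)"
  shows "tens_lift (vect_hom K V W) \<beta> l v = tens_lift W (\<lambda>p q. \<beta> p q v) l"
  by (rule tens_lift_hom[OF vect_hom_vs[OF assms(1,2)] assms(2), of "\<lambda>f. f v"])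
     (use assms in \<open>auto simp: lin_def vect_hom_carrier[OF assms(1,2)]\<close>)

lemma vect_unit_simps [simp]:
  "carrier (vect_unit K) = Scal ` carrier K" "\<zero>\<^bsub>vect_unit K\<^esub> = Scal \<zero>\<^bsub>K\<^esub>"
  "x \<oplus>\<^bsub>vect_unit K\<^esub> y = Scal (scal x \<oplus>\<^bsub>K\<^esub> scal y)" "c \<odot>\<^bsub>vect_unit K\<^esub> x = Scal (c \<otimes>\<^bsub>K\<^esub> scal x)"
  by (simp_all add: vect_unit_def)

lemma vect_unit_vs:
  assumes "field K" shows "vectorspace K (vect_unit K)"
proof -
  interpret K: field K by fact
  show ?thesis
    by (rule vs_criteria) (auto simp: assms K.l_distr K.r_distr K.a_ac K.m_assoc
        intro!: bexI[of _ "\<ominus>\<^bsub>K\<^esub> _"] K.r_neg)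
qed

lemma lin_from_unit:
  assumes "vectorspace K V" "v \<in> carrier V"
  shows "lin K (vect_unit K) V (\<lambda>s. scal s \<odot>\<^bsub>V\<^esub> v)"
proof -
  interpret V: vectorspace K V by fact
  show ?thesis using assms(2) by (auto simp: lin_def V.module.smult_l_distr V.module.smult_assoc1)
qed

text \<open>The one-dimensional space detects vectors: x corresponds to the map s to s x, so
  cancelling \<open>f\<close> against such maps is injectivity.\<close>

lemma vect_mono_iff:
  fixes V W :: "('k, 'a) space"
  assumes "vectorspace K V" "vectorspace K W"
  shows "cat_mono (vect K) V W f \<longleftrightarrow> f \<in> carrier (vect_hom K V W) \<and> inj_on f (carrier V)"
proof
  interpret V: vectorspace K V by fact
  let ?I = "vect_unit K :: ('k, 'a) space"
  have I: "vectorspace K ?I" by (rule vect_unit_vs[OF V.field.field_axioms])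
  assume m: "cat_mono (vect K) V W f"
  have "x = y" if xy: "x \<in> carrier V" "y \<in> carrier V" "f x = f y" for x y
  proof -
    have f: "lin K V W f" using m by (simp add: cat_mono_def vect_hom_carrier[OF assms])
    let ?p = "\<lambda>v. \<lambda>s\<in>carrier ?I. scal s \<odot>\<^bsub>V\<^esub> v"
    have p: "?p v \<in> carrier (vect_hom K ?I V)" if "v \<in> carrier V" for v
      using lin_from_unit[OF assms(1) that] by (simp add: vect_hom_carrier[OF I assms(1)] lin_restrict[OF I] del: vect_unit_simps)
    have "compose (carrier ?I) f (?p x) = compose (carrier ?I) f (?p y)"
      using xy by (auto simp: compose_def fun_eq_iff lin_smult[OF f])
    then have "?p x = ?p y" using m p xy I by (simp add: cat_mono_def del: vect_unit_simps)
    then have "?p x (Scal \<one>\<^bsub>K\<^esub>) = ?p y (Scal \<one>\<^bsub>K\<^esub>)" by simp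
    then show ?thesis using xy by simp
  qed
  then show "f \<in> carrier (vect_hom K V W) \<and> inj_on f (carrier V)"
    using m by (auto simp: cat_mono_def inj_on_def)
next
  assume f: "f \<in> carrier (vect_hom K V W) \<and> inj_on f (carrier V)"
  show "cat_mono (vect K) V W f" unfolding cat_mono_def
  proof (intro conjI ballI impI)
    fix U g h assume U: "U \<in> Ob (vect K)" "g \<in> carrier (Hom (vect K) U V)" "h \<in> carrier (Hom (vect K) U V)"
      and e: "Cmp (vect K) U V W f g = Cmp (vect K) U V W f h"
    then have U': "vectorspace K U" "g \<in> carrier (vect_hom K U V)" "h \<in> carrier (vect_hom K U V)" by simp_all
    have "f (g x) = f (h x)" if "x \<in> carrier U" for x
      using fun_cong[OF e, of x] that by (simp add: compose_def)
    then show "g = h" using f U'(2,3) unfolding vect_hom_carrier[OF U'(1) assms(1)]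
      by (auto intro!: ext_eqI[of g _ h] dest: inj_onD lin_closed)
  qed (use f in simp)
qed

lemma vect_iso_iff:
  assumes "vectorspace K V" "vectorspace K W"
  shows "cat_iso (vect K) V W f \<longleftrightarrow> f \<in> carrier (vect_hom K V W) \<and> bij_betw f (carrier V) (carrier W)"
proof
  assume "cat_iso (vect K) V W f"
  then obtain g where f: "f \<in> carrier (vect_hom K V W)" and g: "g \<in> carrier (vect_hom K W V)"
    and e: "compose (carrier V) g f = (\<lambda>v\<in>carrier V. v)" "compose (carrier W) f g = (\<lambda>v\<in>carrier W. v)"
    by (auto simp: cat_iso_def)
  have "g (f v) = v" if "v \<in> carrier V" for v using fun_cong[OF e(1), of v] that by (simp add: compose_def)
  moreover have "f (g v) = v" if "v \<in> carrier W" for v using fun_cong[OF e(2), of v] that by (simp add: compose_def)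
  ultimately have "bij_betw f (carrier V) (carrier W)"
    using f g by (intro bij_betwI[of f _ _ g]) (auto simp: vect_hom_carrier assms lin_def)
  then show "f \<in> carrier (vect_hom K V W) \<and> bij_betw f (carrier V) (carrier W)" using f by simp
next
  assume f: "f \<in> carrier (vect_hom K V W) \<and> bij_betw f (carrier V) (carrier W)"
  let ?g = "\<lambda>w\<in>carrier W. inv_into (carrier V) f w"
  have im: "inj_on f (carrier V)" "f ` carrier V = carrier W" using f by (auto simp: bij_betw_def)
  have "lin K W V (\<lambda>w. inv_into (carrier V) f w)"
    by (rule lin_inv_into[OF assms(1) _ im(1) _ lin_id])
       (use f im in \<open>auto simp: vect_hom_carrier assms\<close>)
  then have "?g \<in> carrier (vect_hom K W V)" by (simp add: vect_hom_carrier assms lin_restrict)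
  moreover have "compose (carrier V) ?g f = (\<lambda>v\<in>carrier V. v)"
    using im by (auto simp: compose_def fun_eq_iff)
  moreover have "compose (carrier W) f ?g = (\<lambda>v\<in>carrier W. v)"
    using im by (auto simp: compose_def fun_eq_iff f_inv_into_f)
  ultimately show "cat_iso (vect K) V W f" using f by (auto simp: cat_iso_def)
qed

section \<open>Gliders as modules with two subspaces\<close>

definition idxs :: "idx set" where "idxs = {At (-1), At 0, Infty}"

abbreviation fh where "fh K B \<equiv> filt_hom B (trivial_filtration K B)"
abbreviation FK where "FK K B \<equiv> Fbar B (trivial_filtration K B) {-1, 0}"
abbreviation PG where "PG K B \<equiv> preglid K B (trivial_filtration K B) {-1, 0}"
abbreviation SG where "SG K B \<equiv> glid_Sigma K B (trivial_filtration K B) {-1, 0}"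
abbreviation phom where "phom K B X Y \<equiv> carrier (Hom (PG K B) X Y)"
abbreviation loV where "loV M \<equiv> fob M (At (-1))"
abbreviation hiV where "hiV M \<equiv> fob M (At 0)"
abbreviation inV where "inV M \<equiv> fob M Infty"
abbreviation pgl where "pgl K B \<equiv> preglider K B (trivial_filtration K B) {-1, 0}"

declare filt_hom.simps [simp del]

lemma Fbar_simps [simp]:
  "Ob (FK K B) = idxs" "Idn (FK K B) ix = \<one>\<^bsub>B\<^esub>" "Cmp (FK K B) ix jx kx b c = b \<otimes>\<^bsub>B\<^esub> c"
  "Hom (FK K B) ix jx = mk_space (fh K B ix jx) \<zero>\<^bsub>B\<^esub> (\<oplus>\<^bsub>B\<^esub>) (\<odot>\<^bsub>B\<^esub>)"
  by (auto simp: Fbar_def idxs_def)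

lemma idxs_mem [simp]: "At (-1) \<in> idxs" "At 0 \<in> idxs" "Infty \<in> idxs"
  by (simp_all add: idxs_def)

text \<open>A preglider seen from infinity: \<open>i\<close> embeds the three spaces into one
  module, on which \<open>B\<close> acts by \<open>a\<close>. The last clause says that b M(-1) lies
  in M(0); for b = 1 it contains the inclusion of M(-1) in M(0).\<close>

definition gdata ::
  "('k, 'r) ring_scheme \<Rightarrow> ('k, 'b, 'z) module_scheme \<Rightarrow> (idx \<Rightarrow> ('k, 'a) space) \<Rightarrow>
     (idx \<Rightarrow> ('k, 'a) space_map) \<Rightarrow> ('b \<Rightarrow> ('k, 'a) space_map) \<Rightarrow> bool"
  where "gdata K B V i a \<longleftrightarrow>
    (\<forall>ix\<in>idxs. vectorspace K (V ix)) \<and>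
    (\<forall>ix\<in>idxs. lin K (V ix) (V Infty) (i ix) \<and> inj_on (i ix) (carrier (V ix))) \<and>
    (\<forall>x\<in>carrier (V Infty). i Infty x = x) \<and>
    (\<forall>b\<in>carrier B. lin K (V Infty) (V Infty) (a b)) \<and>
    (\<forall>x\<in>carrier (V Infty). lin K B (V Infty) (\<lambda>b. a b x)) \<and>
    (\<forall>x\<in>carrier (V Infty). a \<one>\<^bsub>B\<^esub> x = x) \<and>
    (\<forall>b\<in>carrier B. \<forall>c\<in>carrier B. \<forall>x\<in>carrier (V Infty). a (b \<otimes>\<^bsub>B\<^esub> c) x = a b (a c x)) \<and>
    (\<forall>b\<in>carrier B. \<forall>x\<in>carrier (V (At (-1))).
       a b (i (At (-1)) x) \<in> i (At 0) ` carrier (V (At 0)))"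

lemma gdataD:
  assumes "gdata K B V i a"
  shows "\<And>ix. ix \<in> idxs \<Longrightarrow> vectorspace K (V ix)"
    "\<And>ix. ix \<in> idxs \<Longrightarrow> lin K (V ix) (V Infty) (i ix)"
    "\<And>ix. ix \<in> idxs \<Longrightarrow> inj_on (i ix) (carrier (V ix))"
    "\<And>x. x \<in> carrier (V Infty) \<Longrightarrow> i Infty x = x"
    "\<And>b. b \<in> carrier B \<Longrightarrow> lin K (V Infty) (V Infty) (a b)"
    "\<And>x. x \<in> carrier (V Infty) \<Longrightarrow> lin K B (V Infty) (\<lambda>b. a b x)"
    "\<And>x. x \<in> carrier (V Infty) \<Longrightarrow> a \<one>\<^bsub>B\<^esub> x = x"
    "\<And>b c x. b \<in> carrier B \<Longrightarrow> c \<in> carrier B \<Longrightarrow> x \<in> carrier (V Infty) \<Longrightarrow> a (b \<otimes>\<^bsub>B\<^esub> c) x = a b (a c x)"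
    "\<And>b x. b \<in> carrier B \<Longrightarrow> x \<in> carrier (V (At (-1))) \<Longrightarrow> a b (i (At (-1)) x) \<in> i (At 0) ` carrier (V (At 0))"
  using assms by (simp_all add: gdata_def)

text \<open>A morphism acts in the module at infinity, and the result is brought back along the
  embedding of its target, whose image contains it by \<open>gdata_img\<close>.\<close>

definition gmk where
  "gmk K B V i a = mk_glider B (trivial_filtration K B) {-1, 0} V
     (\<lambda>ix jx b. \<lambda>x\<in>carrier (V ix). inv_into (carrier (V jx)) (i jx) (a b (i ix x)))"

definition gi :: "('k, 'b, 'z) module_scheme \<Rightarrow> ('k, 'b, 'a) glider \<Rightarrow> idx \<Rightarrow> ('k, 'a) space_map"
  where "gi B M ix = far M ix Infty \<one>\<^bsub>B\<^esub>"

definition ga :: "('k, 'b, 'a) glider \<Rightarrow> 'b \<Rightarrow> ('k, 'a) space_map"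
  where "ga M b = far M Infty Infty b"

section \<open>The Hom-spaces of the trivial filtration\<close>

context bialgebra
begin

lemma vs_B: "vectorspace K B" by unfold_locales
lemma field_K: "field K" by (rule field.field_axioms)
lemma vs_BB: "vectorspace K (tensor K B B)" by (rule tensor_vs[OF vs_B vs_B])

lemma fh_sub: "ix \<in> idxs \<Longrightarrow> jx \<in> idxs \<Longrightarrow> fh K B ix jx \<subseteq> carrier B"
  and fh_lsub: "ix \<in> idxs \<Longrightarrow> jx \<in> idxs \<Longrightarrow> lsub K B (fh K B ix jx)"
proof -
  have 1: "lsub K B {\<zero>\<^bsub>B\<^esub>}" by (simp add: lsub_def)
  have 2: "lsub K B {c \<odot>\<^bsub>B\<^esub> \<one>\<^bsub>B\<^esub> |c. c \<in> carrier K}" unfolding lsub_def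
  proof (intro conjI ballI)
    show "\<zero>\<^bsub>B\<^esub> \<in> {c \<odot>\<^bsub>B\<^esub> \<one>\<^bsub>B\<^esub> |c. c \<in> carrier K}"
      by (intro CollectI exI[of _ "\<zero>\<^bsub>K\<^esub>"]) simp
  next
    fix x y assume "x \<in> {c \<odot>\<^bsub>B\<^esub> \<one>\<^bsub>B\<^esub> |c. c \<in> carrier K}" "y \<in> {c \<odot>\<^bsub>B\<^esub> \<one>\<^bsub>B\<^esub> |c. c \<in> carrier K}"
    then obtain c d where "c \<in> carrier K" "d \<in> carrier K" "x = c \<odot>\<^bsub>B\<^esub> \<one>\<^bsub>B\<^esub>" "y = d \<odot>\<^bsub>B\<^esub> \<one>\<^bsub>B\<^esub>" by blast
    then show "x \<oplus>\<^bsub>B\<^esub> y \<in> {c \<odot>\<^bsub>B\<^esub> \<one>\<^bsub>B\<^esub> |c. c \<in> carrier K}"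
      by (intro CollectI exI[of _ "c \<oplus>\<^bsub>K\<^esub> d"]) (simp add: module.smult_l_distr)
  next
    fix k x assume "k \<in> carrier K" "x \<in> {c \<odot>\<^bsub>B\<^esub> \<one>\<^bsub>B\<^esub> |c. c \<in> carrier K}"
    then obtain c where "c \<in> carrier K" "k \<in> carrier K" "x = c \<odot>\<^bsub>B\<^esub> \<one>\<^bsub>B\<^esub>" by blast
    then show "k \<odot>\<^bsub>B\<^esub> x \<in> {c \<odot>\<^bsub>B\<^esub> \<one>\<^bsub>B\<^esub> |c. c \<in> carrier K}"
      by (intro CollectI exI[of _ "k \<otimes>\<^bsub>K\<^esub> c"]) (simp add: module.smult_assoc1)
  qed auto
  have 3: "lsub K B (carrier B)" by (rule lsub_carrier[OF vs_B])
  show l: "ix \<in> idxs \<Longrightarrow> jx \<in> idxs \<Longrightarrow> lsub K B (fh K B ix jx)"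
    using 1 2 3 by (auto simp: idxs_def trivial_filtration_def filt_hom.simps)
  show "ix \<in> idxs \<Longrightarrow> jx \<in> idxs \<Longrightarrow> fh K B ix jx \<subseteq> carrier B"
    using l by (simp add: lsub_def)
qed

lemma fh_Infty [simp]: "fh K B ix Infty = carrier B" by (cases ix) (auto simp: filt_hom.simps)
lemma fh_m10 [simp]: "fh K B (At (-1)) (At 0) = carrier B" by (auto simp: trivial_filtration_def filt_hom.simps)

lemma fh_diag: "ix \<in> idxs \<Longrightarrow> ix \<noteq> Infty \<Longrightarrow> fh K B ix ix = {c \<odot>\<^bsub>B\<^esub> \<one>\<^bsub>B\<^esub> |c. c \<in> carrier K}"
  by (auto simp: idxs_def trivial_filtration_def filt_hom.simps)

lemma fh_zero: "ix \<in> idxs \<Longrightarrow> jx \<in> idxs \<Longrightarrow> \<not> idx_le ix jx \<Longrightarrow> fh K B ix jx = {\<zero>\<^bsub>B\<^esub>}"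
  by (auto simp: idxs_def trivial_filtration_def filt_hom.simps)

lemma fh_one: "ix \<in> idxs \<Longrightarrow> jx \<in> idxs \<Longrightarrow> idx_le ix jx \<Longrightarrow> \<one>\<^bsub>B\<^esub> \<in> fh K B ix jx"
proof -
  have "\<one>\<^bsub>B\<^esub> = \<one>\<^bsub>K\<^esub> \<odot>\<^bsub>B\<^esub> \<one>\<^bsub>B\<^esub>" by simp
  then have "\<exists>c. \<one>\<^bsub>B\<^esub> = c \<odot>\<^bsub>B\<^esub> \<one>\<^bsub>B\<^esub> \<and> c \<in> carrier K" by (metis module.R.one_closed)
  then show "ix \<in> idxs \<Longrightarrow> jx \<in> idxs \<Longrightarrow> idx_le ix jx \<Longrightarrow> \<one>\<^bsub>B\<^esub> \<in> fh K B ix jx"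
    by (auto simp: idxs_def trivial_filtration_def filt_hom.simps)
qed

lemma idx_le_refl [simp]: "idx_le ix ix" by (cases ix) auto
text \<open>For the trivial filtration these cases exhaust the Hom-spaces: all of \<open>B\<close>
  in the first two, scalar multiples of 1 on the diagonal, and 0 where no arrow goes.\<close>

lemma fh_cases:
  assumes "ix \<in> idxs" "jx \<in> idxs"
  obtains "jx = Infty" | "ix = At (-1)" "jx = At 0" | "ix = jx" "ix \<noteq> Infty" | "\<not> idx_le ix jx"
  using assms by (auto simp: idxs_def)

lemma fh_mult:
  assumes "ix \<in> idxs" "jx \<in> idxs" "kx \<in> idxs" "b \<in> fh K B ix jx" "c \<in> fh K B jx kx"
  shows "c \<otimes>\<^bsub>B\<^esub> b \<in> fh K B ix kx"
proof -
  have bc: "b \<in> carrier B" "c \<in> carrier B" using fh_sub assms by blast+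
  have scl: "c \<otimes>\<^bsub>B\<^esub> b \<in> fh K B ix kx" if "c \<in> {k \<odot>\<^bsub>B\<^esub> \<one>\<^bsub>B\<^esub> |k. k \<in> carrier K}" "jx = kx"
    using that bc assms fh_lsub[OF assms(1,3)] by (auto simp: smult_mult_left lsub_def)
  have scr: "c \<otimes>\<^bsub>B\<^esub> b \<in> fh K B ix kx" if "b \<in> {k \<odot>\<^bsub>B\<^esub> \<one>\<^bsub>B\<^esub> |k. k \<in> carrier K}" "ix = jx"
    using that bc assms fh_lsub[OF assms(1,3)] by (auto simp: smult_mult_right lsub_def)
  have z: "\<zero>\<^bsub>B\<^esub> \<in> fh K B ix kx" using fh_lsub[OF assms(1,3)] by (simp add: lsub_def)
  show ?thesis
  proof (cases rule: fh_cases[OF assms(2,3)])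
    case 1 then show ?thesis using bc by simp
  next
    case 2
    show ?thesis
    proof (cases rule: fh_cases[OF assms(1,2)])
      case 3 then show ?thesis using scr assms fh_diag by simp
    next
      case 4 then show ?thesis using z bc assms fh_zero by simp
    qed (use 2 in auto)
  next
    case 3
    then have "c \<in> {k \<odot>\<^bsub>B\<^esub> \<one>\<^bsub>B\<^esub> |k. k \<in> carrier K}" using assms(5) fh_diag[OF assms(2)] by simp
    then show ?thesis using scl 3 by blast
  next
    case 4 then show ?thesis using z bc assms fh_zero by simp
  qed
qed

lemma fh_vs:
  assumes "ix \<in> idxs" "jx \<in> idxs"
  shows "vectorspace K (mk_space (fh K B ix jx) \<zero>\<^bsub>B\<^esub> (\<oplus>\<^bsub>B\<^esub>) (\<odot>\<^bsub>B\<^esub>))"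
  by (rule vectorspace_transport[OF vs_B, where g = "\<lambda>x. x"])
     (use fh_lsub[OF assms] in \<open>auto simp: lsub_def\<close>)

text \<open>By the cases of \<open>fh_cases\<close>: at infinity every vector is in the image, from
  -1 to 0 the last clause of \<open>gdata\<close> applies, on the diagonal the action is by scalars,
  and elsewhere it is 0.\<close>

lemma gdata_img:
  assumes g: "gdata K B V i a" and "ix \<in> idxs" "jx \<in> idxs" "b \<in> fh K B ix jx" "x \<in> carrier (V ix)"
  shows "a b (i ix x) \<in> i jx ` carrier (V jx)"
proof -
  note D = gdataD[OF g]
  interpret Vb: vectorspace K "V jx" using D(1) assms by simp
  have ix: "i ix x \<in> carrier (V Infty)" using lin_closed[OF D(2)] assms by blast
  have b: "b \<in> carrier B" using fh_sub assms by blast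
  show ?thesis
  proof (cases rule: fh_cases[OF assms(2,3)])
    case 1
    have "a b (i ix x) \<in> carrier (V Infty)" by (rule lin_closed[OF D(5)[OF b] ix])
    then have "i Infty (a b (i ix x)) \<in> i Infty ` carrier (V Infty)" by blast
    then show ?thesis using D(4) \<open>a b (i ix x) \<in> carrier (V Infty)\<close> 1 by simp
  next
    case 2 then show ?thesis using D(9)[OF b] assms by simp
  next
    case 3
    then obtain c where c: "c \<in> carrier K" "b = c \<odot>\<^bsub>B\<^esub> \<one>\<^bsub>B\<^esub>" using assms fh_diag by auto
    have "a b (i ix x) = c \<odot>\<^bsub>V Infty\<^esub> i ix x"
      using lin_smult[OF D(6)[OF ix] c(1), of "\<one>\<^bsub>B\<^esub>"] D(7)[OF ix] c by simp
    also have "\<dots> = i ix (c \<odot>\<^bsub>V ix\<^esub> x)" using lin_smult[OF D(2)] assms c by simp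
    finally show ?thesis using 3 assms c by auto
  next
    case 4
    then have "b = \<zero>\<^bsub>B\<^esub>" using assms fh_zero by simp
    then have "a b (i ix x) = \<zero>\<^bsub>V Infty\<^esub>" using lin_zero[OF vs_B D(1) D(6)[OF ix]] by simp
    also have "\<dots> = i jx \<zero>\<^bsub>V jx\<^esub>" using lin_zero[OF D(1)[OF assms(3)] D(1) D(2)[OF assms(3)]] by simp
    finally show ?thesis by auto
  qed
qed

section \<open>Pregliders built from a module and its subspaces\<close>

lemma gmk_simps:
  "ix \<in> idxs \<Longrightarrow> fob (gmk K B V i a) ix = V ix"
  "ix \<in> idxs \<Longrightarrow> jx \<in> idxs \<Longrightarrow> b \<in> fh K B ix jx \<Longrightarrow> far (gmk K B V i a) ix jx b =
     (\<lambda>x\<in>carrier (V ix). inv_into (carrier (V jx)) (i jx) (a b (i ix x)))"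
  by (simp_all add: gmk_def mk_glider_def)

lemma gmk_far:
  assumes g: "gdata K B V i a" and "ix \<in> idxs" "jx \<in> idxs" "b \<in> fh K B ix jx" "x \<in> carrier (V ix)"
  shows "far (gmk K B V i a) ix jx b x \<in> carrier (V jx)"
    "i jx (far (gmk K B V i a) ix jx b x) = a b (i ix x)"
  using gdata_img[OF assms] assms by (simp_all add: gmk_simps inv_into_into f_inv_into_f)

lemma pgl_def': "pgl K B M \<longleftrightarrow>
    linear_functor K (FK K B) (vect K) M \<and>
    (\<forall>ix\<in>idxs. \<forall>jx\<in>idxs. idx_le ix jx \<longrightarrow> cat_mono (vect K) (fob M ix) (fob M jx) (far M ix jx \<one>\<^bsub>B\<^esub>)) \<and>
    fob M \<in> extensional idxs \<and>
    (\<forall>ix jx. far M ix jx \<in> extensional {b. ix \<in> idxs \<and> jx \<in> idxs \<and> b \<in> fh K B ix jx})"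
  unfolding preglider_def by simp

text \<open>A functor is checked after composing with the monomorphisms into the value at infinity.\<close>

lemma pglI:
  assumes g: "gdata K B V i a"
    and fo: "fob M \<in> extensional idxs" "\<And>ix. ix \<in> idxs \<Longrightarrow> fob M ix = V ix"
    and fe: "\<And>ix jx. far M ix jx \<in> extensional {b. ix \<in> idxs \<and> jx \<in> idxs \<and> b \<in> fh K B ix jx}"
      "\<And>ix jx b. ix \<in> idxs \<Longrightarrow> jx \<in> idxs \<Longrightarrow> b \<in> fh K B ix jx \<Longrightarrow> far M ix jx b \<in> extensional (carrier (V ix))"
    and fc: "\<And>ix jx b x. ix \<in> idxs \<Longrightarrow> jx \<in> idxs \<Longrightarrow> b \<in> fh K B ix jx \<Longrightarrow> x \<in> carrier (V ix) \<Longrightarrow>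
        far M ix jx b x \<in> carrier (V jx) \<and> i jx (far M ix jx b x) = a b (i ix x)"
  shows "pgl K B M"
proof -
  note D = gdataD[OF g]
  have eqI: "x = y" if "ix \<in> idxs" "x \<in> carrier (V ix)" "y \<in> carrier (V ix)" "i ix x = i ix y" for ix x y
    using D(3)[OF that(1)] that by (auto dest: inj_onD)
  have ic: "i ix x \<in> carrier (V Infty)" if "ix \<in> idxs" "x \<in> carrier (V ix)" for ix x
    using lin_closed[OF D(2)] that by blast
  have flin: "lin K (V ix) (V jx) (far M ix jx b)"
    if ix: "ix \<in> idxs" and jx: "jx \<in> idxs" and b: "b \<in> fh K B ix jx" for ix jx b
  proof -
    interpret Va: vectorspace K "V ix" by (rule D(1)[OF ix])
    interpret Vb: vectorspace K "V jx" by (rule D(1)[OF jx])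
    have bB: "b \<in> carrier B" using b fh_sub[OF ix jx] by blast
    show ?thesis
    proof (rule linI)
      fix v assume "v \<in> carrier (V ix)"
      then show "far M ix jx b v \<in> carrier (V jx)" using fc[OF ix jx b] by blast
    next
      fix v w assume v: "v \<in> carrier (V ix)" and w: "w \<in> carrier (V ix)"
      show "far M ix jx b (v \<oplus>\<^bsub>V ix\<^esub> w) = far M ix jx b v \<oplus>\<^bsub>V jx\<^esub> far M ix jx b w"
        by (rule eqI[OF jx])
          (simp_all add: fc[OF ix jx b] v w lin_add[OF D(2)[OF ix]] lin_add[OF D(2)[OF jx]]
            lin_add[OF D(5)[OF bB]] ic[OF ix])
    next
      fix c v assume c: "c \<in> carrier K" and v: "v \<in> carrier (V ix)"
      show "far M ix jx b (c \<odot>\<^bsub>V ix\<^esub> v) = c \<odot>\<^bsub>V jx\<^esub> far M ix jx b v"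
        by (rule eqI[OF jx])
          (simp_all add: fc[OF ix jx b] c v lin_smult[OF D(2)[OF ix]] lin_smult[OF D(2)[OF jx]]
            lin_smult[OF D(5)[OF bB]] ic[OF ix])
    qed
  qed
  have fhom: "far M ix jx b \<in> carrier (vect_hom K (V ix) (V jx))"
    if "ix \<in> idxs" "jx \<in> idxs" "b \<in> fh K B ix jx" for ix jx b
    using flin[OF that] fe(2)[OF that] by (simp add: vect_hom_carrier D(1) that)
  have he: "f = h" if "jx \<in> idxs" "f \<in> extensional (carrier (V ix))" "h \<in> extensional (carrier (V ix))"
      "\<And>v. v \<in> carrier (V ix) \<Longrightarrow> f v \<in> carrier (V jx) \<and> h v \<in> carrier (V jx) \<and> i jx (f v) = i jx (h v)" for ix jx f h
    by (rule ext_eqI[OF that(2,3)], rule eqI[OF that(1)]) (use that(4) in auto)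
  have lf: "linear_functor K (FK K B) (vect K) M"
    unfolding linear_functor_def
  proof (intro conjI ballI)
    fix ix assume "ix \<in> Ob (FK K B)"
    then have ix: "ix \<in> idxs" by simp
    show "fob M ix \<in> Ob (vect K)" using D(1) ix fo by simp
    have 1: "\<one>\<^bsub>B\<^esub> \<in> fh K B ix ix" using fh_one ix by simp
    have "far M ix ix \<one>\<^bsub>B\<^esub> = (\<lambda>v\<in>carrier (V ix). v)"
      by (rule he[OF ix fe(2)[OF ix ix 1]]) (simp_all add: fc[OF ix ix 1] D(7) ic[OF ix])
    then show "far M ix ix (Idn (FK K B) ix) = Idn (vect K) (fob M ix)" using fo ix by simp
  next
    fix ix jx assume "ix \<in> Ob (FK K B)" "jx \<in> Ob (FK K B)"
    then have ix: "ix \<in> idxs" and jx: "jx \<in> idxs" by simp_all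
    interpret Vb: vectorspace K "V jx" by (rule D(1)[OF jx])
    have "lin K (Hom (FK K B) ix jx) (vect_hom K (V ix) (V jx)) (far M ix jx)"
    proof (rule linI)
      fix b c assume "b \<in> carrier (Hom (FK K B) ix jx)" "c \<in> carrier (Hom (FK K B) ix jx)"
      then have b: "b \<in> fh K B ix jx" "b \<in> carrier B" and c: "c \<in> fh K B ix jx" "c \<in> carrier B"
        using fh_sub[OF ix jx] by auto
      have bc: "b \<oplus>\<^bsub>B\<^esub> c \<in> fh K B ix jx" using b c fh_lsub[OF ix jx] by (simp add: lsub_def)
      have "far M ix jx (b \<oplus>\<^bsub>B\<^esub> c) = far M ix jx b \<oplus>\<^bsub>vect_hom K (V ix) (V jx)\<^esub> far M ix jx c"
        by (rule he[OF jx fe(2)[OF ix jx bc]]) (simp_all add: fc[OF ix jx bc] fc[OF ix jx b(1)] fc[OF ix jx c(1)]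
          lin_add[OF D(2)[OF jx]] lin_add[OF D(6)[OF ic[OF ix]] b(2) c(2)])
      then show "far M ix jx (b \<oplus>\<^bsub>Hom (FK K B) ix jx\<^esub> c) =
          far M ix jx b \<oplus>\<^bsub>vect_hom K (V ix) (V jx)\<^esub> far M ix jx c" by simp
    next
      fix k b assume k: "k \<in> carrier K" and "b \<in> carrier (Hom (FK K B) ix jx)"
      then have b: "b \<in> fh K B ix jx" "b \<in> carrier B" using fh_sub[OF ix jx] by auto
      have kb: "k \<odot>\<^bsub>B\<^esub> b \<in> fh K B ix jx" using k b fh_lsub[OF ix jx] by (simp add: lsub_def)
      have "far M ix jx (k \<odot>\<^bsub>B\<^esub> b) = k \<odot>\<^bsub>vect_hom K (V ix) (V jx)\<^esub> far M ix jx b"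
        by (rule he[OF jx fe(2)[OF ix jx kb]]) (simp_all add: k fc[OF ix jx kb] fc[OF ix jx b(1)]
          lin_smult[OF D(2)[OF jx] k] lin_smult[OF D(6)[OF ic[OF ix]] k b(2)])
      then show "far M ix jx (k \<odot>\<^bsub>Hom (FK K B) ix jx\<^esub> b) =
          k \<odot>\<^bsub>vect_hom K (V ix) (V jx)\<^esub> far M ix jx b" by simp
    qed (use fhom[OF ix jx] in simp)
    then show "linear_map K (Hom (FK K B) ix jx) (Hom (vect K) (fob M ix) (fob M jx)) (far M ix jx)"
      using fh_vs[OF ix jx] vect_hom_vs[OF D(1)[OF ix] D(1)[OF jx]] by (simp add: linear_map_iff fo ix jx)
  next
    fix ix jx kx b c assume "ix \<in> Ob (FK K B)" "jx \<in> Ob (FK K B)" "kx \<in> Ob (FK K B)"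
      "b \<in> carrier (Hom (FK K B) ix jx)" "c \<in> carrier (Hom (FK K B) jx kx)"
    then have i: "ix \<in> idxs" "jx \<in> idxs" "kx \<in> idxs" and b: "b \<in> fh K B ix jx" "b \<in> carrier B"
      and c: "c \<in> fh K B jx kx" "c \<in> carrier B" using fh_sub by auto
    note cb = fh_mult[OF i b(1) c(1)]
    have "far M ix kx (c \<otimes>\<^bsub>B\<^esub> b) = compose (carrier (V ix)) (far M jx kx c) (far M ix jx b)"
      by (rule he[OF i(3) fe(2)[OF i(1,3) cb]]) (simp_all add: compose_eq fc[OF i(1,3) cb] fc[OF i(2,3) c(1)]
        fc[OF i(1,2) b(1)] D(8)[OF c(2) b(2)] ic[OF i(1)])
    then show "far M ix kx (Cmp (FK K B) ix jx kx c b) =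
       Cmp (vect K) (fob M ix) (fob M jx) (fob M kx) (far M jx kx c) (far M ix jx b)"
      using fo i by simp
  qed
  have mono: "cat_mono (vect K) (fob M ix) (fob M jx) (far M ix jx \<one>\<^bsub>B\<^esub>)"
    if ix: "ix \<in> idxs" and jx: "jx \<in> idxs" and le: "idx_le ix jx" for ix jx
  proof -
    note 1 = fh_one[OF ix jx le]
    have "inj_on (far M ix jx \<one>\<^bsub>B\<^esub>) (carrier (V ix))"
    proof (rule inj_onI)
      fix x y assume xy: "x \<in> carrier (V ix)" "y \<in> carrier (V ix)" "far M ix jx \<one>\<^bsub>B\<^esub> x = far M ix jx \<one>\<^bsub>B\<^esub> y"
      then have "a \<one>\<^bsub>B\<^esub> (i ix x) = a \<one>\<^bsub>B\<^esub> (i ix y)" using fc[OF ix jx 1] by metis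
      then show "x = y" using eqI[OF ix xy(1,2)] D(7) ic[OF ix] xy by simp
    qed
    then show ?thesis using fhom[OF ix jx 1] by (simp add: vect_mono_iff D(1) ix jx fo)
  qed
  show ?thesis unfolding pgl_def' by (intro conjI allI ballI impI lf mono fo(1) fe(1))
qed

lemma gmk_pgl:
  assumes g: "gdata K B V i a"
  shows "pgl K B (gmk K B V i a)"
proof (rule pglI[OF g])
  fix ix jx b x assume h: "ix \<in> idxs" "jx \<in> idxs" "b \<in> fh K B ix jx" "x \<in> carrier (V ix)"
  show "far (gmk K B V i a) ix jx b x \<in> carrier (V jx) \<and> i jx (far (gmk K B V i a) ix jx b x) = a b (i ix x)"
    using gmk_far[OF g h] by simp
next
  show "fob (gmk K B V i a) \<in> extensional idxs" by (simp add: gmk_def mk_glider_def)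
  show "far (gmk K B V i a) ix jx \<in> extensional {b. ix \<in> idxs \<and> jx \<in> idxs \<and> b \<in> fh K B ix jx}" for ix jx
    by (simp add: gmk_def mk_glider_def)
qed (simp_all add: gmk_simps)

lemma pgl_simps:
  assumes "pgl K B M"
  shows pgl_vs: "\<And>ix. ix \<in> idxs \<Longrightarrow> vectorspace K (fob M ix)"
    and pgl_hom: "\<And>ix jx b. ix \<in> idxs \<Longrightarrow> jx \<in> idxs \<Longrightarrow> b \<in> fh K B ix jx \<Longrightarrow>
      lin K (fob M ix) (fob M jx) (far M ix jx b) \<and> far M ix jx b \<in> extensional (carrier (fob M ix))"
    and pgl_inj: "\<And>ix jx. ix \<in> idxs \<Longrightarrow> jx \<in> idxs \<Longrightarrow> idx_le ix jx \<Longrightarrow> inj_on (far M ix jx \<one>\<^bsub>B\<^esub>) (carrier (fob M ix))"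
    and pgl_id: "\<And>ix x. ix \<in> idxs \<Longrightarrow> x \<in> carrier (fob M ix) \<Longrightarrow> far M ix ix \<one>\<^bsub>B\<^esub> x = x"
    and pgl_comp: "\<And>ix jx kx b c x. ix \<in> idxs \<Longrightarrow> jx \<in> idxs \<Longrightarrow> kx \<in> idxs \<Longrightarrow> b \<in> fh K B ix jx \<Longrightarrow>
      c \<in> fh K B jx kx \<Longrightarrow> x \<in> carrier (fob M ix) \<Longrightarrow> far M ix kx (c \<otimes>\<^bsub>B\<^esub> b) x = far M jx kx c (far M ix jx b x)"
    and pgl_lin: "\<And>ix jx x. ix \<in> idxs \<Longrightarrow> jx \<in> idxs \<Longrightarrow> x \<in> carrier (fob M ix) \<Longrightarrow>
      lin K (mk_space (fh K B ix jx) \<zero>\<^bsub>B\<^esub> (\<oplus>\<^bsub>B\<^esub>) (\<odot>\<^bsub>B\<^esub>)) (fob M jx) (\<lambda>b. far M ix jx b x)"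
proof -
  have lf: "linear_functor K (FK K B) (vect K) M"
    and mono: "\<And>ix jx. ix \<in> idxs \<Longrightarrow> jx \<in> idxs \<Longrightarrow> idx_le ix jx \<Longrightarrow> cat_mono (vect K) (fob M ix) (fob M jx) (far M ix jx \<one>\<^bsub>B\<^esub>)"
    using assms by (auto simp: pgl_def')
  show vs: "vectorspace K (fob M ix)" if "ix \<in> idxs" for ix using lf that by (simp add: linear_functor_def)
  have lm: "lin K (mk_space (fh K B ix jx) \<zero>\<^bsub>B\<^esub> (\<oplus>\<^bsub>B\<^esub>) (\<odot>\<^bsub>B\<^esub>)) (vect_hom K (fob M ix) (fob M jx)) (far M ix jx)"
    if "ix \<in> idxs" "jx \<in> idxs" for ix jx
    using lf that by (simp add: linear_functor_def linear_map_iff)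
  show hom: "lin K (fob M ix) (fob M jx) (far M ix jx b) \<and> far M ix jx b \<in> extensional (carrier (fob M ix))"
    if "ix \<in> idxs" "jx \<in> idxs" "b \<in> fh K B ix jx" for ix jx b
    using lin_closed[OF lm[OF that(1,2)], of b] that vect_hom_carrier[OF vs vs] by simp
  show "inj_on (far M ix jx \<one>\<^bsub>B\<^esub>) (carrier (fob M ix))" if "ix \<in> idxs" "jx \<in> idxs" "idx_le ix jx" for ix jx
    using mono[OF that] vect_mono_iff[OF vs vs] that by blast
  show "far M ix ix \<one>\<^bsub>B\<^esub> x = x" if "ix \<in> idxs" "x \<in> carrier (fob M ix)" for ix x
    using lf that by (simp add: linear_functor_def)
  show "far M ix kx (c \<otimes>\<^bsub>B\<^esub> b) x = far M jx kx c (far M ix jx b x)"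
    if "ix \<in> idxs" "jx \<in> idxs" "kx \<in> idxs" "b \<in> fh K B ix jx" "c \<in> fh K B jx kx" "x \<in> carrier (fob M ix)"
    for ix jx kx b c x
    using lf that by (simp add: linear_functor_def compose_def)
  show "lin K (mk_space (fh K B ix jx) \<zero>\<^bsub>B\<^esub> (\<oplus>\<^bsub>B\<^esub>) (\<odot>\<^bsub>B\<^esub>)) (fob M jx) (\<lambda>b. far M ix jx b x)"
    if i: "ix \<in> idxs" "jx \<in> idxs" and x: "x \<in> carrier (fob M ix)" for ix jx x
    using lm[OF i] lin_closed[OF conjunct1[OF hom[OF i]] x] x by (simp add: lin_def)
qed

lemmas lo_vs = pgl_vs[OF _ idxs_mem(1)] and hi_vs = pgl_vs[OF _ idxs_mem(2)]

text \<open>The last clause of \<open>gdata\<close> compares two factorizations of b from -1 to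
  infinity: \<open>1\<close> followed by b at infinity, and b from -1 to 0 followed by
  \<open>1\<close>.\<close>

lemma pgl_gdata:
  assumes M: "pgl K B M"
  shows "gdata K B (fob M) (gi B M) (ga M)"
  unfolding gdata_def gi_def ga_def
proof (intro conjI ballI)
  fix x assume "x \<in> carrier (inV M)"
  then show "lin K B (inV M) (\<lambda>b. far M Infty Infty b x)"
    using pgl_lin[OF M, of Infty Infty x] by (simp add: lin_def)
next
  fix b x assume b: "b \<in> carrier B" and x: "x \<in> carrier (loV M)"
  have "far M Infty Infty b (far M (At (-1)) Infty \<one>\<^bsub>B\<^esub> x) = far M (At (-1)) Infty (b \<otimes>\<^bsub>B\<^esub> \<one>\<^bsub>B\<^esub>) x"
    using b x by (intro pgl_comp[OF M, symmetric]) auto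
  also have "\<dots> = far M (At (-1)) Infty (\<one>\<^bsub>B\<^esub> \<otimes>\<^bsub>B\<^esub> b) x" using b by simp
  also have "\<dots> = far M (At 0) Infty \<one>\<^bsub>B\<^esub> (far M (At (-1)) (At 0) b x)"
    using b x by (intro pgl_comp[OF M]) auto
  finally show "far M Infty Infty b (far M (At (-1)) Infty \<one>\<^bsub>B\<^esub> x)
    \<in> far M (At 0) Infty \<one>\<^bsub>B\<^esub> ` carrier (hiV M)"
    using lin_closed[OF conjunct1[OF pgl_hom[OF M, of "At (-1)" "At 0" b]]] b x by simp
next
  fix b assume "b \<in> carrier B"
  then show "lin K (inV M) (inV M) (far M Infty Infty b)"
    by (intro conjunct1[OF pgl_hom[OF M]]) simp_all
next
  fix ix assume "ix \<in> idxs"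
  then show "lin K (fob M ix) (inV M) (far M ix Infty \<one>\<^bsub>B\<^esub>)"
    by (intro conjunct1[OF pgl_hom[OF M]]) simp_all
next
  fix b c x assume "b \<in> carrier B" "c \<in> carrier B" "x \<in> carrier (inV M)"
  then show "far M Infty Infty (b \<otimes>\<^bsub>B\<^esub> c) x = far M Infty Infty b (far M Infty Infty c x)"
    by (intro pgl_comp[OF M]) simp_all
qed (simp_all add: pgl_vs[OF M] pgl_inj[OF M] pgl_id[OF M])

lemma pgl_far:
  assumes M: "pgl K B M" and i: "ix \<in> idxs" "jx \<in> idxs" "b \<in> fh K B ix jx" "x \<in> carrier (fob M ix)"
  shows "far M ix jx b x \<in> carrier (fob M jx)" "gi B M jx (far M ix jx b x) = ga M b (gi B M ix x)"
proof -
  have b: "b \<in> carrier B" using fh_sub i by blast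
  show "far M ix jx b x \<in> carrier (fob M jx)"
    by (rule lin_closed[OF conjunct1[OF pgl_hom[OF M i(1-3)]] i(4)])
  have "far M jx Infty \<one>\<^bsub>B\<^esub> (far M ix jx b x) = far M ix Infty (\<one>\<^bsub>B\<^esub> \<otimes>\<^bsub>B\<^esub> b) x"
    using i by (intro pgl_comp[OF M, symmetric]) auto
  also have "\<dots> = far M ix Infty (b \<otimes>\<^bsub>B\<^esub> \<one>\<^bsub>B\<^esub>) x" using b by simp
  also have "\<dots> = far M Infty Infty b (far M ix Infty \<one>\<^bsub>B\<^esub> x)"
    using i b by (intro pgl_comp[OF M]) auto
  finally show "gi B M jx (far M ix jx b x) = ga M b (gi B M ix x)" by (simp add: gi_def ga_def)
qed

lemma pgl_eqI:
  assumes M: "pgl K B M" and N: "pgl K B N"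
    and "\<And>ix. ix \<in> idxs \<Longrightarrow> fob M ix = fob N ix"
    and "\<And>ix jx b x. ix \<in> idxs \<Longrightarrow> jx \<in> idxs \<Longrightarrow> b \<in> fh K B ix jx \<Longrightarrow> x \<in> carrier (fob M ix) \<Longrightarrow>
      far M ix jx b x = far N ix jx b x"
  shows "M = N"
proof -
  have "fob M = fob N" by (rule ext_eqI[of _ idxs]) (use assms in \<open>auto simp: pgl_def'\<close>)
  moreover have "far M ix jx = far N ix jx" for ix jx
  proof (rule ext_eqI[of _ "{b. ix \<in> idxs \<and> jx \<in> idxs \<and> b \<in> fh K B ix jx}"])
    fix b assume "b \<in> {b. ix \<in> idxs \<and> jx \<in> idxs \<and> b \<in> fh K B ix jx}"
    then have b: "ix \<in> idxs" "jx \<in> idxs" "b \<in> fh K B ix jx" by auto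
    show "far M ix jx b = far N ix jx b"
      by (rule ext_eqI[of _ "carrier (fob M ix)"]) (use pgl_hom[OF M b] pgl_hom[OF N b] assms(3,4) b in auto)
  qed (use M N in \<open>auto simp: pgl_def'\<close>)
  ultimately show ?thesis by (cases M; cases N) (simp add: fun_eq_iff)
qed

end

section \<open>Zigzags and their evaluation at index 0\<close>

abbreviation lo where "lo M \<equiv> carrier (loV M)"
abbreviation hi where "hi M \<equiv> carrier (hiV M)"
abbreviation zz where "zz K B \<equiv> zigzag (PG K B) (SG K B)"
abbreviation zeq where "zeq K B \<equiv> zigzag_eq (PG K B) (SG K B)"
abbreviation zcl where "zcl K B \<equiv> zz_class (PG K B) (SG K B)"
abbreviation fm where "fm M \<equiv> far M (At (-1)) (At 0)"

lemma PG_simps [simp]: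
  "Ob (PG K B) = {M. pgl K B M}"
  "Hom (PG K B) = preglid_hom K B (trivial_filtration K B) {-1, 0}"
  "Idn (PG K B) M = (\<lambda>ix\<in>idxs. \<lambda>v\<in>carrier (fob M ix). v)"
  "Cmp (PG K B) L M N g f = (\<lambda>ix\<in>idxs. compose (carrier (fob L ix)) (g ix) (f ix))"
  "TenO (PG K B) M N = mk_glider B (trivial_filtration K B) {-1, 0}
     (\<lambda>ix. vect_tensor K (fob M ix) (fob N ix)) (glider_tensor_act K B (trivial_filtration K B) M N)"
  "TenA (PG K B) M M' N N' f g =
     (\<lambda>ix\<in>idxs. vten K (fob M ix) (fob M' ix) (fob N ix) (fob N' ix) (f ix) (g ix))"
  by (simp_all add: preglid_def)

lemma preglid_hom_ops [simp]:
  "\<zero>\<^bsub>preglid_hom K B (trivial_filtration K B) {-1, 0} M N\<^esub> = (\<lambda>ix\<in>idxs. \<lambda>x\<in>carrier (fob M ix). \<zero>\<^bsub>fob N ix\<^esub>)"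
  "f \<oplus>\<^bsub>preglid_hom K B (trivial_filtration K B) {-1, 0} M N\<^esub> g =
     (\<lambda>ix\<in>idxs. \<lambda>x\<in>carrier (fob M ix). f ix x \<oplus>\<^bsub>fob N ix\<^esub> g ix x)"
  "c \<odot>\<^bsub>preglid_hom K B (trivial_filtration K B) {-1, 0} M N\<^esub> f =
     (\<lambda>ix\<in>idxs. \<lambda>x\<in>carrier (fob M ix). c \<odot>\<^bsub>fob N ix\<^esub> f ix x)"
  by (simp_all add: preglid_hom_def)

text \<open>
  A morphism of the localization is determined by its component at \<open>0\<close>; \<open>hp K B M N\<close> is the set
  of the maps that arise.
\<close>

definition hp ::
  "('k, 'r) ring_scheme \<Rightarrow> ('k, 'b, 'z) module_scheme \<Rightarrow> ('k, 'b, 'a) glider \<Rightarrow> ('k, 'b, 'a) glider \<Rightarrow>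
     ('k, 'a) space_map set"
  where "hp K B M N = {f. lin K (hiV M) (hiV N) f \<and> f \<in> extensional (hi M) \<and>
    (\<forall>x\<in>lo M. \<exists>y\<in>lo N. \<forall>b\<in>carrier B. f (fm M b x) = fm N b y)}"

text \<open>A backward step belongs to \<Sigma> and is bijective at 0, so there it can be traversed
  by inverting its component.\<close>

fun zev :: "(('k, 'b, 'a) glider, ('k, 'a) glider_map) step list \<Rightarrow> ('k, 'a) space_map" where
  "zev [] v = v"
| "zev (Fwd X Y f # p) v = zev p (f (At 0) v)"
| "zev (Bwd X Y s # p) v = zev p (inv_into (hi X) (s (At 0)) v)"

lemma zev_append: "zev (p @ q) v = zev q (zev p v)"
  by (induction p v rule: zev.induct) auto

lemma zigzag_append: "zigzag C S X Y p \<Longrightarrow> zigzag C S Y Z q \<Longrightarrow> zigzag C S X Z (p @ q)"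
  by (induction rule: zigzag.induct) (auto intro: zigzag.intros)

lemma zigzag_Ob: "zigzag C S X Y p \<Longrightarrow> X \<in> Ob C \<and> Y \<in> Ob C"
  by (induction rule: zigzag.induct) auto

declare ze_trans [trans]

lemma ze_append_right: "zigzag_eq C S X Y p p' \<Longrightarrow> zigzag C S Y Z q \<Longrightarrow> zigzag_eq C S X Z (p @ q) (p' @ q)"
  and ze_append_left: "zigzag C S X Y p \<Longrightarrow> zigzag_eq C S Y Z q q' \<Longrightarrow> zigzag_eq C S X Z (p @ q) (p @ q')"
  by (auto intro: ze_append ze_refl)

text \<open>Products must again be spaces of the universe \<open>elt\<close>. A pair is coded as a
  list with one entry under \<open>Tens\<close>; it is a plain list, not a class of formal
  sums.\<close>

definition vpair :: "('k, 'a) space \<Rightarrow> ('k, 'a) space \<Rightarrow> ('k, 'a) space"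
  where "vpair V W = mk_space {Tens [(v, w)] |v w. v \<in> carrier V \<and> w \<in> carrier W}
     (Tens [(\<zero>\<^bsub>V\<^esub>, \<zero>\<^bsub>W\<^esub>)])
     (\<lambda>x y. Tens [(fst (hd (terms x)) \<oplus>\<^bsub>V\<^esub> fst (hd (terms y)), snd (hd (terms x)) \<oplus>\<^bsub>W\<^esub> snd (hd (terms y)))])
     (\<lambda>c x. Tens [(c \<odot>\<^bsub>V\<^esub> fst (hd (terms x)), c \<odot>\<^bsub>W\<^esub> snd (hd (terms x)))])"

abbreviation vp1 :: "('k, 'a) elt \<Rightarrow> ('k, 'a) elt" where "vp1 x \<equiv> fst (hd (terms x))"
abbreviation vp2 :: "('k, 'a) elt \<Rightarrow> ('k, 'a) elt" where "vp2 x \<equiv> snd (hd (terms x))"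

lemma vpair_simps [simp]:
  "carrier (vpair V W) = {Tens [(v, w)] |v w. v \<in> carrier V \<and> w \<in> carrier W}"
  "\<zero>\<^bsub>vpair V W\<^esub> = Tens [(\<zero>\<^bsub>V\<^esub>, \<zero>\<^bsub>W\<^esub>)]"
  "x \<oplus>\<^bsub>vpair V W\<^esub> y = Tens [(vp1 x \<oplus>\<^bsub>V\<^esub> vp1 y, vp2 x \<oplus>\<^bsub>W\<^esub> vp2 y)]"
  "c \<odot>\<^bsub>vpair V W\<^esub> x = Tens [(c \<odot>\<^bsub>V\<^esub> vp1 x, c \<odot>\<^bsub>W\<^esub> vp2 x)]"
  by (simp_all add: vpair_def)

lemma vpair_vs:
  assumes "vectorspace K V" "vectorspace K W" shows "vectorspace K (vpair V W)"
proof -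
  interpret V: vectorspace K V by fact
  interpret W: vectorspace K W by fact
  show ?thesis
    by (rule vectorspace_transport[OF direct_sum_is_vs[OF assms], where g = "\<lambda>x. (vp1 x, vp2 x)"])
       (auto simp: direct_sum_def inj_on_def)
qed

lemma lin_vp1: "lin K (vpair V W) V vp1" and lin_vp2: "lin K (vpair V W) W vp2"
  by (auto simp: lin_def)

lemma lin_vpair: "lin K U V f \<Longrightarrow> lin K U W g \<Longrightarrow> lin K U (vpair V W) (\<lambda>x. Tens [(f x, g x)])"
  by (auto simp: lin_def)

context bialgebra
begin

lemma pgl_gi:
  assumes M: "pgl K B M"
  shows gi_lin: "ix \<in> idxs \<Longrightarrow> lin K (fob M ix) (inV M) (gi B M ix)"
    and gi_inj: "ix \<in> idxs \<Longrightarrow> x \<in> carrier (fob M ix) \<Longrightarrow> y \<in> carrier (fob M ix) \<Longrightarrow>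
      gi B M ix x = gi B M ix y \<Longrightarrow> x = y"
    and gi_Infty: "x \<in> carrier (inV M) \<Longrightarrow> gi B M Infty x = x"
    and gi_closed: "ix \<in> idxs \<Longrightarrow> x \<in> carrier (fob M ix) \<Longrightarrow> gi B M ix x \<in> carrier (inV M)"
    and ga_lin: "b \<in> carrier B \<Longrightarrow> lin K (inV M) (inV M) (ga M b)"
    and ga_lin2: "x \<in> carrier (inV M) \<Longrightarrow> lin K B (inV M) (\<lambda>b. ga M b x)"
    and ga_one: "x \<in> carrier (inV M) \<Longrightarrow> ga M \<one>\<^bsub>B\<^esub> x = x"
    and ga_mult: "b \<in> carrier B \<Longrightarrow> c \<in> carrier B \<Longrightarrow> x \<in> carrier (inV M) \<Longrightarrow>
      ga M (b \<otimes>\<^bsub>B\<^esub> c) x = ga M b (ga M c x)"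
    and ga_closed: "b \<in> carrier B \<Longrightarrow> x \<in> carrier (inV M) \<Longrightarrow> ga M b x \<in> carrier (inV M)"
    and fm_closed: "b \<in> carrier B \<Longrightarrow> x \<in> lo M \<Longrightarrow> fm M b x \<in> hi M"
    and gi_fm: "b \<in> carrier B \<Longrightarrow> x \<in> lo M \<Longrightarrow> gi B M (At 0) (fm M b x) = ga M b (gi B M (At (-1)) x)"
    and gi_fm_one: "x \<in> lo M \<Longrightarrow> gi B M (At 0) (fm M \<one>\<^bsub>B\<^esub> x) = gi B M (At (-1)) x"
    and fm_lin: "b \<in> carrier B \<Longrightarrow> lin K (loV M) (hiV M) (fm M b)"
    and fm_lin2: "x \<in> lo M \<Longrightarrow> lin K B (hiV M) (\<lambda>b. fm M b x)"
    and fm_inj: "x \<in> lo M \<Longrightarrow> y \<in> lo M \<Longrightarrow> fm M \<one>\<^bsub>B\<^esub> x = fm M \<one>\<^bsub>B\<^esub> y \<Longrightarrow> x = y"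
proof -
  note D = gdataD[OF pgl_gdata[OF M]]
  show 1: "lin K (fob M ix) (inV M) (gi B M ix)" if "ix \<in> idxs" for ix using D(2) that .
  show 2: "ix \<in> idxs \<Longrightarrow> x \<in> carrier (fob M ix) \<Longrightarrow> y \<in> carrier (fob M ix) \<Longrightarrow>
      gi B M ix x = gi B M ix y \<Longrightarrow> x = y" for ix x y using D(3)[of ix] by (simp add: inj_on_def)
  show "x \<in> carrier (inV M) \<Longrightarrow> gi B M Infty x = x" using D(4) .
  show 4: "ix \<in> idxs \<Longrightarrow> x \<in> carrier (fob M ix) \<Longrightarrow> gi B M ix x \<in> carrier (inV M)" for ix x
    by (rule lin_closed[OF 1])
  show 5: "b \<in> carrier B \<Longrightarrow> lin K (inV M) (inV M) (ga M b)" for b by (rule D(5))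
  show "x \<in> carrier (inV M) \<Longrightarrow> lin K B (inV M) (\<lambda>b. ga M b x)" by (rule D(6))
  show 7: "x \<in> carrier (inV M) \<Longrightarrow> ga M \<one>\<^bsub>B\<^esub> x = x" for x by (rule D(7))
  show "b \<in> carrier B \<Longrightarrow> c \<in> carrier B \<Longrightarrow> x \<in> carrier (inV M) \<Longrightarrow>
      ga M (b \<otimes>\<^bsub>B\<^esub> c) x = ga M b (ga M c x)" by (rule D(8))
  show "b \<in> carrier B \<Longrightarrow> x \<in> carrier (inV M) \<Longrightarrow> ga M b x \<in> carrier (inV M)"
    by (rule lin_closed[OF 5])
  show "b \<in> carrier B \<Longrightarrow> x \<in> lo M \<Longrightarrow> fm M b x \<in> hi M" by (rule pgl_far(1)[OF M]) simp_all
  show 10: "b \<in> carrier B \<Longrightarrow> x \<in> lo M \<Longrightarrow> gi B M (At 0) (fm M b x) = ga M b (gi B M (At (-1)) x)" for b x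
    by (rule pgl_far(2)[OF M]) simp_all
  show 11: "x \<in> lo M \<Longrightarrow> gi B M (At 0) (fm M \<one>\<^bsub>B\<^esub> x) = gi B M (At (-1)) x" for x
    using 10[of "\<one>\<^bsub>B\<^esub>" x] 7[OF 4, of "At (-1)" x] by simp
  show "b \<in> carrier B \<Longrightarrow> lin K (loV M) (hiV M) (fm M b)"
    by (rule conjunct1[OF pgl_hom[OF M]]) simp_all
  show "x \<in> lo M \<Longrightarrow> lin K B (hiV M) (\<lambda>b. fm M b x)"
    using pgl_lin[OF M, of "At (-1)" "At 0" x] by (simp add: lin_def)
  show "x \<in> lo M \<Longrightarrow> y \<in> lo M \<Longrightarrow> fm M \<one>\<^bsub>B\<^esub> x = fm M \<one>\<^bsub>B\<^esub> y \<Longrightarrow> x = y"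
    by (rule 2[of "At (-1)"]) (simp_all add: 11[symmetric])
qed

text \<open>Naturality is an equation between vectors of some N(\<beta>), and it may be checked
  after the injective embedding into infinity. There it follows from compatibility with the
  embeddings and with the action at infinity.\<close>

lemma hom_iff:
  assumes M: "pgl K B M" and N: "pgl K B N"
  shows "f \<in> phom K B M N \<longleftrightarrow> f \<in> extensional idxs \<and>
    (\<forall>ix\<in>idxs. lin K (fob M ix) (fob N ix) (f ix) \<and> f ix \<in> extensional (carrier (fob M ix))) \<and>
    (\<forall>ix\<in>idxs. \<forall>x\<in>carrier (fob M ix). f Infty (gi B M ix x) = gi B N ix (f ix x)) \<and>
    (\<forall>b\<in>carrier B. \<forall>x\<in>carrier (inV M). f Infty (ga M b x) = ga N b (f Infty x))"
    (is "?L \<longleftrightarrow> ?E \<and> ?H \<and> ?I \<and> ?A")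
proof -
  have L: "?L \<longleftrightarrow> ?E \<and> ?H \<and> (\<forall>ix\<in>idxs. \<forall>jx\<in>idxs. \<forall>b\<in>fh K B ix jx.
      compose (carrier (fob M ix)) (f jx) (far M ix jx b) = compose (carrier (fob M ix)) (far N ix jx b) (f ix))"
    using pgl_vs[OF M] pgl_vs[OF N] by (auto simp: preglid_hom_def PiE_iff vect_hom_carrier)
  have c: "compose A g h = compose A g' h' \<longleftrightarrow> (\<forall>x\<in>A. g (h x) = g' (h' x))"
    for A :: "('k, 'd) elt set" and g h g' h' :: "('k, 'd) space_map"
    by (auto simp: compose_def fun_eq_iff)
  show ?thesis unfolding L c
  proof (intro conj_cong refl iffI conjI ballI)
    fix ix x assume n: "\<forall>ix\<in>idxs. \<forall>jx\<in>idxs. \<forall>b\<in>fh K B ix jx. \<forall>x\<in>carrier (fob M ix).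
       f jx (far M ix jx b x) = far N ix jx b (f ix x)" and ix: "ix \<in> idxs" and x: "x \<in> carrier (fob M ix)"
    show "f Infty (gi B M ix x) = gi B N ix (f ix x)"
      using bspec[OF bspec[OF bspec[OF bspec[OF n ix], of Infty], of "\<one>\<^bsub>B\<^esub>"] x] by (simp add: gi_def)
  next
    fix b x assume n: "\<forall>ix\<in>idxs. \<forall>jx\<in>idxs. \<forall>b\<in>fh K B ix jx. \<forall>x\<in>carrier (fob M ix).
       f jx (far M ix jx b x) = far N ix jx b (f ix x)" and b: "b \<in> carrier B" and x: "x \<in> carrier (inV M)"
    show "f Infty (ga M b x) = ga N b (f Infty x)"
      using bspec[OF bspec[OF bspec[OF bspec[OF n, of Infty], of Infty], of b], of x] b x by (simp add: ga_def)
  next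
    fix ix jx b x assume H: ?H and IA: "?I \<and> ?A" and i: "ix \<in> idxs" "jx \<in> idxs" "b \<in> fh K B ix jx" "x \<in> carrier (fob M ix)"
    have b: "b \<in> carrier B" using fh_sub i by blast
    have fx: "f ix x \<in> carrier (fob N ix)" by (rule lin_closed[OF conjunct1[OF bspec[OF H i(1)]] i(4)])
    note M1 = pgl_far[OF M i] and N1 = pgl_far[OF N i(1-3) fx]
    have fM: "f jx (far M ix jx b x) \<in> carrier (fob N jx)" by (rule lin_closed[OF conjunct1[OF bspec[OF H i(2)]] M1(1)])
    have gx: "gi B M ix x \<in> carrier (inV M)" by (rule gi_closed[OF M i(1,4)])
    have "gi B N jx (f jx (far M ix jx b x)) = f Infty (gi B M jx (far M ix jx b x))"
      using IA i(2) M1(1) by simp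
    also have "\<dots> = f Infty (ga M b (gi B M ix x))" by (simp add: M1(2))
    also have "\<dots> = ga N b (f Infty (gi B M ix x))" using IA b gx by simp
    also have "\<dots> = ga N b (gi B N ix (f ix x))" using IA i by simp
    also have "\<dots> = gi B N jx (far N ix jx b (f ix x))" by (simp add: N1(2))
    finally show "f jx (far M ix jx b x) = far N ix jx b (f ix x)" by (rule gi_inj[OF N i(2) fM N1(1)])
  qed
qed

lemma homI:
  assumes "pgl K B M" "pgl K B N" "f \<in> extensional idxs"
    "\<And>ix. ix \<in> idxs \<Longrightarrow> lin K (fob M ix) (fob N ix) (f ix)"
    "\<And>ix. ix \<in> idxs \<Longrightarrow> f ix \<in> extensional (carrier (fob M ix))"
    "\<And>ix x. ix \<in> idxs \<Longrightarrow> x \<in> carrier (fob M ix) \<Longrightarrow> f Infty (gi B M ix x) = gi B N ix (f ix x)"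
    "\<And>b x. b \<in> carrier B \<Longrightarrow> x \<in> carrier (inV M) \<Longrightarrow> f Infty (ga M b x) = ga N b (f Infty x)"
  shows "f \<in> phom K B M N"
  unfolding hom_iff[OF assms(1,2)] using assms(3-) by simp

lemma homD:
  assumes "pgl K B M" "pgl K B N" "f \<in> phom K B M N"
  shows "f \<in> extensional idxs"
    "\<And>ix. ix \<in> idxs \<Longrightarrow> lin K (fob M ix) (fob N ix) (f ix)"
    "\<And>ix. ix \<in> idxs \<Longrightarrow> f ix \<in> extensional (carrier (fob M ix))"
    "\<And>ix x. ix \<in> idxs \<Longrightarrow> x \<in> carrier (fob M ix) \<Longrightarrow> f Infty (gi B M ix x) = gi B N ix (f ix x)"
    "\<And>b x. b \<in> carrier B \<Longrightarrow> x \<in> carrier (inV M) \<Longrightarrow> f Infty (ga M b x) = ga N b (f Infty x)"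
  using assms(3) unfolding hom_iff[OF assms(1,2)] by simp_all

lemma hom_closed:
  assumes "pgl K B M" "pgl K B N" "f \<in> phom K B M N" "ix \<in> idxs" "x \<in> carrier (fob M ix)"
  shows "f ix x \<in> carrier (fob N ix)"
  by (rule lin_closed[OF homD(2)[OF assms(1-4)] assms(5)])

lemma hom_fm:
  assumes M: "pgl K B M" and N: "pgl K B N" and f: "f \<in> phom K B M N"
    and b: "b \<in> carrier B" and x: "x \<in> lo M"
  shows "f (At 0) (fm M b x) = fm N b (f (At (-1)) x)"
proof (rule gi_inj[OF N, of "At 0"])
  note D = homD[OF M N f]
  have fx: "f (At (-1)) x \<in> lo N" using hom_closed[OF M N f _ x] by simp
  show "f (At 0) (fm M b x) \<in> hi N" using hom_closed[OF M N f] fm_closed[OF M b x] by simp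
  show "fm N b (f (At (-1)) x) \<in> hi N" by (rule fm_closed[OF N b fx])
  show "gi B N (At 0) (f (At 0) (fm M b x)) = gi B N (At 0) (fm N b (f (At (-1)) x))"
    using D(4)[of "At 0" "fm M b x"] D(4)[of "At (-1)" x] fm_closed[OF M b x] gi_fm[OF M b x] gi_fm[OF N b fx]
      D(5)[OF b gi_closed[OF M _ x]] x by simp
qed simp

lemma Cmp_closed:
  assumes L: "pgl K B L" and M: "pgl K B M" and N: "pgl K B N"
    and f: "f \<in> phom K B L M" and g: "g \<in> phom K B M N"
  shows "Cmp (PG K B) L M N g f \<in> phom K B L N"
proof (rule homI[OF L N])
  note F = homD[OF L M f] and G = homD[OF M N g] and fc = hom_closed[OF L M f]
  show "lin K (fob L ix) (fob N ix) (Cmp (PG K B) L M N g f ix)" if "ix \<in> idxs" for ix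
    using lin_comp[OF F(2)[OF that] G(2)[OF that]] that
    by (simp add: compose_def lin_restrict[OF pgl_vs[OF L]])
  show "Cmp (PG K B) L M N g f Infty (gi B L ix x) = gi B N ix (Cmp (PG K B) L M N g f ix x)"
    if "ix \<in> idxs" "x \<in> carrier (fob L ix)" for ix x
    using that F(4) G(4) fc gi_closed[OF L] by (simp add: compose_def)
  show "Cmp (PG K B) L M N g f Infty (ga L b x) = ga N b (Cmp (PG K B) L M N g f Infty x)"
    if "b \<in> carrier B" "x \<in> carrier (inV L)" for b x
    using that F(5) G(5) fc ga_closed[OF L] by (simp add: compose_def)
qed (simp_all add: compose_def)

lemma Idn_closed:
  assumes M: "pgl K B M" shows "Idn (PG K B) M \<in> phom K B M M"
proof (rule homI[OF M M])
  show "lin K (fob M ix) (fob M ix) (Idn (PG K B) M ix)" if "ix \<in> idxs" for ix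
    using lin_id that by (simp add: lin_restrict[OF pgl_vs[OF M]])
qed (simp_all add: gi_closed[OF M] ga_closed[OF M])

lemma SG_iff:
  assumes M: "pgl K B M" and N: "pgl K B N"
  shows "f \<in> SG K B M N \<longleftrightarrow> f \<in> phom K B M N \<and>
    bij_betw (f (At (-1))) (lo M) (lo N) \<and> bij_betw (f (At 0)) (hi M) (hi N)"
proof -
  have "f ix \<in> carrier (vect_hom K (fob M ix) (fob N ix))"
    if "f \<in> phom K B M N" "ix \<in> idxs" for ix
    using homD[OF M N that(1)] that(2) by (simp add: vect_hom_carrier pgl_vs[OF M] pgl_vs[OF N])
  then show ?thesis
    unfolding glid_Sigma_def by (auto simp: vect_iso_iff pgl_vs[OF M] pgl_vs[OF N])
qed

lemma hpI:
  assumes "lin K (hiV M) (hiV N) f" "f \<in> extensional (hi M)"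
    "\<And>x. x \<in> lo M \<Longrightarrow> \<exists>y\<in>lo N. \<forall>b\<in>carrier B. f (fm M b x) = fm N b y"
  shows "f \<in> hp K B M N"
  using assms by (simp add: hp_def)

lemma hpD:
  assumes "f \<in> hp K B M N"
  shows hp_lin: "lin K (hiV M) (hiV N) f" and hp_ext: "f \<in> extensional (hi M)"
    and hp_fm: "x \<in> lo M \<Longrightarrow> \<exists>y\<in>lo N. \<forall>b\<in>carrier B. f (fm M b x) = fm N b y"
  using assms by (simp_all add: hp_def)

lemma hp_closed: "f \<in> hp K B M N \<Longrightarrow> x \<in> hi M \<Longrightarrow> f x \<in> hi N"
  by (rule lin_closed[OF hp_lin])

lemma hp_eqI: "f \<in> hp K B M N \<Longrightarrow> g \<in> hp K B M N \<Longrightarrow> (\<And>x. x \<in> hi M \<Longrightarrow> f x = g x) \<Longrightarrow> f = g"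
  by (rule ext_eqI[OF hp_ext hp_ext])

lemma hom_hp:
  assumes M: "pgl K B M" and N: "pgl K B N" and f: "f \<in> phom K B M N"
  shows "f (At 0) \<in> hp K B M N"
proof (rule hpI)
  fix x assume x: "x \<in> lo M"
  show "\<exists>y\<in>lo N. \<forall>b\<in>carrier B. f (At 0) (fm M b x) = fm N b y"
    using hom_fm[OF M N f _ x] hom_closed[OF M N f _ x] by auto
qed (use homD[OF M N f] in simp_all)

lemma hp_comp:
  assumes L: "pgl K B L" and M: "pgl K B M" and f: "f \<in> hp K B L M" and g: "g \<in> hp K B M N"
  shows "compose (hi L) g f \<in> hp K B L N"
proof (rule hpI)
  show "lin K (hiV L) (hiV N) (compose (hi L) g f)"
    using lin_comp[OF hp_lin[OF f] hp_lin[OF g]] by (simp add: compose_def lin_restrict[OF pgl_vs[OF L]])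
  fix x assume x: "x \<in> lo L"
  obtain y where y: "y \<in> lo M" "\<And>b. b \<in> carrier B \<Longrightarrow> f (fm L b x) = fm M b y" using hp_fm[OF f x] by blast
  obtain z where z: "z \<in> lo N" "\<And>b. b \<in> carrier B \<Longrightarrow> g (fm M b y) = fm N b z" using hp_fm[OF g y(1)] by blast
  show "\<exists>y\<in>lo N. \<forall>b\<in>carrier B. compose (hi L) g f (fm L b x) = fm N b y"
    using y z fm_closed[OF L _ x] by (intro bexI[of _ z]) (auto simp: compose_def)
qed (simp add: compose_def)

lemma hp_id: "pgl K B M \<Longrightarrow> (\<lambda>v\<in>hi M. v) \<in> hp K B M M"
  using hom_hp[OF _ _ Idn_closed, of M] by simp

text \<open>Bijectivity at 0 provides the inverse map, and bijectivity at -1 the vectors y that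
  \<open>hp\<close> asks for. Both halves of the definition of \<Sigma> are needed.\<close>

lemma hp_inv:
  assumes M: "pgl K B M" and N: "pgl K B N" and s: "s \<in> SG K B M N"
  shows "(\<lambda>v\<in>hi N. inv_into (hi M) (s (At 0)) v) \<in> hp K B N M"
proof (rule hpI)
  have sh: "s \<in> phom K B M N" and b1: "bij_betw (s (At (-1))) (lo M) (lo N)"
    and b0: "bij_betw (s (At 0)) (hi M) (hi N)" using s by (simp_all add: SG_iff[OF M N])
  note S = homD[OF M N sh]
  have "lin K (hiV N) (hiV M) (\<lambda>v. inv_into (hi M) (s (At 0)) v)"
    by (rule lin_inv_into[OF pgl_vs[OF M] S(2) _ _ lin_id]) (use b0 in \<open>auto simp: bij_betw_def\<close>)
  then show "lin K (hiV N) (hiV M) (\<lambda>v\<in>hi N. inv_into (hi M) (s (At 0)) v)"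
    by (simp add: lin_restrict[OF pgl_vs[OF N]])
  fix x assume "x \<in> lo N"
  then obtain y where y: "y \<in> lo M" "x = s (At (-1)) y" using b1 by (auto simp: bij_betw_def)
  have "(\<lambda>v\<in>hi N. inv_into (hi M) (s (At 0)) v) (fm N b x) = fm M b y" if b: "b \<in> carrier B" for b
  proof -
    have "fm N b x = s (At 0) (fm M b y)" using hom_fm[OF M N sh b y(1)] y by simp
    then show ?thesis using b0 fm_closed[OF M b y(1)] hom_closed[OF M N sh, of "At 0" "fm M b y"]
      by (simp add: bij_betw_def)
  qed
  then show "\<exists>y\<in>lo M. \<forall>b\<in>carrier B. (\<lambda>v\<in>hi N. inv_into (hi M) (s (At 0)) v) (fm N b x) = fm M b y"
    using y(1) by blast
qed simp

lemma zigzag_hp: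
  "zz K B X Y p \<Longrightarrow> (\<lambda>v\<in>hi X. zev p v) \<in> hp K B X Y"
proof (induction rule: zigzag.induct)
  case (zz_nil X)
  have e: "(\<lambda>v\<in>hi X. zev [] v) = (\<lambda>v\<in>hi X. v)" by (auto simp: fun_eq_iff)
  show ?case unfolding e by (rule hp_id) (use zz_nil in simp)
next
  case (zz_fwd X Y f Z p)
  then have XY: "pgl K B X" "pgl K B Y" and f: "f \<in> phom K B X Y" by simp_all
  have e: "compose (hi X) (\<lambda>v\<in>hi Y. zev p v) (f (At 0)) = (\<lambda>v\<in>hi X. zev (Fwd X Y f # p) v)"
    using hom_closed[OF XY f, of "At 0"] by (auto simp: compose_def fun_eq_iff)
  show ?case unfolding e[symmetric] by (rule hp_comp[OF XY hom_hp[OF XY f] zz_fwd.IH])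
next
  case (zz_bwd X Y s Z p)
  then have XY: "pgl K B X" "pgl K B Y" and s: "s \<in> SG K B X Y" by simp_all
  have e: "compose (hi Y) (\<lambda>v\<in>hi X. zev p v) (\<lambda>v\<in>hi Y. inv_into (hi X) (s (At 0)) v) = (\<lambda>v\<in>hi Y. zev (Bwd X Y s # p) v)"
    using hp_closed[OF hp_inv[OF XY s]] by (auto simp: compose_def fun_eq_iff)
  show ?case unfolding e[symmetric] by (rule hp_comp[OF XY(2,1) hp_inv[OF XY s] zz_bwd.IH])
qed

lemma zev_closed: "zz K B X Y p \<Longrightarrow> v \<in> hi X \<Longrightarrow> zev p v \<in> hi Y"
  using hp_closed[OF zigzag_hp] by fastforce

text \<open>Each generating relation preserves the evaluation at 0. The converse, that the
  evaluation determines the class, is \<open>zz_class_kap\<close>.\<close>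

lemma zigzag_eq_zev:
  "zeq K B X Y p q \<Longrightarrow>
     zz K B X Y p \<and> zz K B X Y q \<and> (\<forall>v\<in>hi X. zev p v = zev q v)"
proof (induction rule: zigzag_eq.induct)
  case (ze_append X Y p p' Z q q')
  then show ?case using zev_closed[of X Y p] by (auto simp: zev_append intro: zigzag_append)
next
  case (ze_id X)
  then have X: "pgl K B X" by simp
  then show ?case using Idn_closed[OF X] by (auto intro!: zigzag.intros simp del: PG_simps(2,3) simp: PG_simps(3)[of K B X])
next
  case (ze_comp X Y Z f g)
  then have P: "pgl K B X" "pgl K B Y" "pgl K B Z" by simp_all
  note c = Cmp_closed[OF P ze_comp(4,5)]
  have 1: "zz K B X Z [Fwd X Y f, Fwd Y Z g]"
    using ze_comp P by (intro zigzag.intros) simp_all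
  have 2: "zz K B X Z [Fwd X Z (Cmp (PG K B) X Y Z g f)]"
    using c P by (intro zigzag.intros) simp_all
  show ?case using 1 2 by (simp add: compose_def)
next
  case (ze_inv_left X Y s)
  then have P: "pgl K B X" "pgl K B Y" by simp_all
  have s: "s \<in> phom K B X Y" "bij_betw (s (At 0)) (hi X) (hi Y)"
    using ze_inv_left(3) unfolding SG_iff[OF P] by blast+
  show ?case using ze_inv_left s P by (auto intro!: zigzag.intros simp: bij_betw_def)
next
  case (ze_inv_right X Y s)
  then have P: "pgl K B X" "pgl K B Y" by simp_all
  have s: "s \<in> phom K B X Y" "bij_betw (s (At 0)) (hi X) (hi Y)"
    using ze_inv_right(3) unfolding SG_iff[OF P] by blast+
  show ?case using ze_inv_right s P by (auto intro!: zigzag.intros simp: bij_betw_def f_inv_into_f)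
qed auto

text \<open>The relations compose forward steps only. For two backward steps, the composite is
  appended forwards and backwards, its forward copy is split, and the inner pairs cancel.\<close>

lemma ze_Bwd_comp:
  assumes P: "pgl K B W" "pgl K B X" "pgl K B Y" and t: "t \<in> SG K B W X" and s: "s \<in> SG K B X Y"
  shows "Cmp (PG K B) W X Y s t \<in> SG K B W Y"
    and "zeq K B Y W [Bwd X Y s, Bwd W X t] [Bwd W Y (Cmp (PG K B) W X Y s t)]"
proof -
  let ?Z = "zz K B" and ?E = "zeq K B"
  let ?st = "Cmp (PG K B) W X Y s t"
  have t': "t \<in> phom K B W X" and s': "s \<in> phom K B X Y"
    using t s by (simp_all add: SG_iff P)
  show st: "?st \<in> SG K B W Y"
    using t s Cmp_closed[OF P t' s'] bij_betw_trans[of "t (At 0)" "hi W" "hi X" "s (At 0)" "hi Y"]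
      bij_betw_trans[of "t (At (-1))" "lo W" "lo X" "s (At (-1))" "lo Y"]
    by (auto simp: SG_iff P compose_def cong: bij_betw_cong)
  have O: "W \<in> Ob (PG K B)" "X \<in> Ob (PG K B)" "Y \<in> Ob (PG K B)" using P by simp_all
  have zb: "?Z Y W [Bwd X Y s, Bwd W X t]" using O s t by (intro zigzag.intros) simp_all
  have zs: "?Z Y X [Bwd X Y s]" using O s by (intro zigzag.intros) simp_all
  have zf: "?Z X Y [Fwd X Y s]" using O s' by (intro zigzag.intros) simp_all
  have zst: "?Z Y W [Bwd W Y ?st]" using O st by (intro zigzag.intros) simp_all
  have "?E Y W ([Bwd X Y s, Bwd W X t] @ []) ([Bwd X Y s, Bwd W X t] @ [Fwd W Y ?st, Bwd W Y ?st])"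
    by (rule ze_append_left[OF zb ze_sym[OF ze_inv_left[where C = "PG K B" and S = "SG K B", OF O(1,3) st]]])
  then have "?E Y W [Bwd X Y s, Bwd W X t] (([Bwd X Y s, Bwd W X t] @ [Fwd W Y ?st]) @ [Bwd W Y ?st])" by simp
  also have "?E Y W (([Bwd X Y s, Bwd W X t] @ [Fwd W Y ?st]) @ [Bwd W Y ?st])
      (([Bwd X Y s, Bwd W X t] @ [Fwd W X t, Fwd X Y s]) @ [Bwd W Y ?st])"
    by (rule ze_append_right[OF ze_append_left[OF zb ze_sym[OF ze_comp[OF O t' s']]] zst])
  also have "([Bwd X Y s, Bwd W X t] @ [Fwd W X t, Fwd X Y s]) @ [Bwd W Y ?st] =
      (([Bwd X Y s] @ [Bwd W X t, Fwd W X t]) @ [Fwd X Y s]) @ [Bwd W Y ?st]" by simp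
  also have "?E Y W ((([Bwd X Y s] @ [Bwd W X t, Fwd W X t]) @ [Fwd X Y s]) @ [Bwd W Y ?st])
      ((([Bwd X Y s] @ []) @ [Fwd X Y s]) @ [Bwd W Y ?st])"
    by (rule ze_append_right[OF ze_append_right[OF ze_append_left[OF zs ze_inv_right[where C = "PG K B" and S = "SG K B", OF O(1,2) t]] zf] zst])
  also have "(([Bwd X Y s] @ []) @ [Fwd X Y s]) @ [Bwd W Y ?st] = [Bwd X Y s, Fwd X Y s] @ [Bwd W Y ?st]" by simp
  also have "?E Y W ([Bwd X Y s, Fwd X Y s] @ [Bwd W Y ?st]) ([] @ [Bwd W Y ?st])"
    by (rule ze_append_right[OF ze_inv_right[where C = "PG K B" and S = "SG K B", OF O(2,3) s] zst])
  finally show "?E Y W [Bwd X Y s, Bwd W X t] [Bwd W Y ?st]" by simp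
qed

lemma pglI_gi:
  assumes g: "gdata K B V i a"
    and fo: "\<And>ix. ix \<in> idxs \<Longrightarrow> fob M ix = V ix"
    and fc: "\<And>ix jx b x. ix \<in> idxs \<Longrightarrow> jx \<in> idxs \<Longrightarrow> b \<in> fh K B ix jx \<Longrightarrow> x \<in> carrier (V ix) \<Longrightarrow>
        far M ix jx b x \<in> carrier (V jx) \<and> i jx (far M ix jx b x) = a b (i ix x)"
  shows "ix \<in> idxs \<Longrightarrow> x \<in> carrier (V ix) \<Longrightarrow> gi B M ix x = i ix x"
    and "b \<in> carrier B \<Longrightarrow> x \<in> carrier (V Infty) \<Longrightarrow> ga M b x = a b x"
proof -
  note D = gdataD[OF g]
  show "gi B M ix x = i ix x" if "ix \<in> idxs" "x \<in> carrier (V ix)"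
  proof -
    have f: "far M ix Infty \<one>\<^bsub>B\<^esub> x \<in> carrier (V Infty) \<and>
        i Infty (far M ix Infty \<one>\<^bsub>B\<^esub> x) = a \<one>\<^bsub>B\<^esub> (i ix x)"
      using that by (intro fc) simp_all
    show ?thesis using conjunct2[OF f] D(4)[OF conjunct1[OF f]] D(7)[OF lin_closed[OF D(2)]] that
      by (simp add: gi_def)
  qed
  show "ga M b x = a b x" if "b \<in> carrier B" "x \<in> carrier (V Infty)"
  proof -
    have f: "far M Infty Infty b x \<in> carrier (V Infty) \<and>
        i Infty (far M Infty Infty b x) = a b (i Infty x)" using that by (intro fc) simp_all
    show ?thesis using conjunct2[OF f] D(4)[OF conjunct1[OF f]] D(4)[OF that(2)] by (simp add: ga_def)
  qed
qed

lemma gmk_gi: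
  assumes g: "gdata K B V i a"
  shows "ix \<in> idxs \<Longrightarrow> x \<in> carrier (V ix) \<Longrightarrow> gi B (gmk K B V i a) ix x = i ix x"
    and "b \<in> carrier B \<Longrightarrow> x \<in> carrier (V Infty) \<Longrightarrow> ga (gmk K B V i a) b x = a b x"
proof -
  have fc: "far (gmk K B V i a) ix jx b x \<in> carrier (V jx) \<and> i jx (far (gmk K B V i a) ix jx b x) = a b (i ix x)"
    if "ix \<in> idxs" "jx \<in> idxs" "b \<in> fh K B ix jx" "x \<in> carrier (V ix)" for ix jx b x
    using gmk_far[OF g that] by simp
  show "ix \<in> idxs \<Longrightarrow> x \<in> carrier (V ix) \<Longrightarrow> gi B (gmk K B V i a) ix x = i ix x"
    "b \<in> carrier B \<Longrightarrow> x \<in> carrier (V Infty) \<Longrightarrow> ga (gmk K B V i a) b x = a b x"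
    using pglI_gi[OF g gmk_simps(1) fc] by simp_all
qed

end

text \<open>
  The graph of an element \<open>h\<close> of \<open>hp K B X Y\<close> is a glider with the components of \<open>X\<close> at \<open>-1\<close> and
  \<open>0\<close>, embedded by \<open>x \<mapsto> (x, h x)\<close> into the product of the modules at infinity. Its projections
  represent \<open>h\<close> as a fraction.
\<close>

definition gph_V :: "('k, 'b, 'a) glider \<Rightarrow> ('k, 'b, 'a) glider \<Rightarrow> idx \<Rightarrow> ('k, 'a) space"
  where "gph_V X Y ix = (if ix = Infty then vpair (inV X) (inV Y) else fob X ix)"

text \<open>As \<open>h\<close> is defined at index 0 only, \<open>x\<close> is first moved there by
  the morphism 1.\<close>

definition gph_i where
  "gph_i B X Y h ix x = (if ix = Infty then x
     else Tens [(gi B X ix x, gi B Y (At 0) (h (far X ix (At 0) \<one>\<^bsub>B\<^esub> x)))])"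

definition gph_a where "gph_a X Y b z = Tens [(ga X b (vp1 z), ga Y b (vp2 z))]"

definition gph where "gph K B X Y h = gmk K B (gph_V X Y) (gph_i B X Y h) (gph_a X Y)"

definition gph1 where
  "gph1 X Y = (\<lambda>ix\<in>idxs. \<lambda>x\<in>carrier (gph_V X Y ix). if ix = Infty then vp1 x else x)"

text \<open>At -1 the projection has to be the vector y with h(b x) = b y for all b. The case b = 1
  determines it, since 1 from -1 to 0 is injective on \<open>Y\<close>.\<close>

definition gph2 where
  "gph2 B X Y h = (\<lambda>ix\<in>idxs. \<lambda>x\<in>carrier (gph_V X Y ix).
     if ix = Infty then vp2 x else if ix = At 0 then h x
     else inv_into (lo Y) (fm Y \<one>\<^bsub>B\<^esub>) (h (fm X \<one>\<^bsub>B\<^esub> x)))"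

text \<open>The canonical fraction of \<open>h\<close>, to which every zigzag that evaluates to
  \<open>h\<close> will be reduced.\<close>

definition can where
  "can K B X Y h = [Bwd (gph K B X Y h) X (gph1 X Y), Fwd (gph K B X Y h) Y (gph2 B X Y h)]"

lemma gph_V_simps [simp]:
  "gph_V X Y Infty = vpair (inV X) (inV Y)" "gph_V X Y (At n) = fob X (At n)"
  by (simp_all add: gph_V_def)

section \<open>The graph of a map and its two projections\<close>

context bialgebra
begin

lemma far_one_lin: "pgl K B M \<Longrightarrow> ix \<in> idxs \<Longrightarrow> ix \<noteq> Infty \<Longrightarrow>
    lin K (fob M ix) (hiV M) (far M ix (At 0) \<one>\<^bsub>B\<^esub>)"
  by (rule conjunct1[OF pgl_hom]) (auto simp: idxs_def intro!: fh_one)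

text \<open>The vector y in the definition of \<open>hp\<close> is determined by the case b = 1.
  Naming it by a formula allows it to be recognized as linear in \<open>x\<close>.\<close>

lemma hp_lo:
  assumes X: "pgl K B X" and Y: "pgl K B Y" and h: "h \<in> hp K B X Y" and x: "x \<in> lo X"
  defines "y \<equiv> inv_into (lo Y) (fm Y \<one>\<^bsub>B\<^esub>) (h (fm X \<one>\<^bsub>B\<^esub> x))"
  shows "y \<in> lo Y" "fm Y \<one>\<^bsub>B\<^esub> y = h (fm X \<one>\<^bsub>B\<^esub> x)" "\<And>b. b \<in> carrier B \<Longrightarrow> h (fm X b x) = fm Y b y"
proof -
  obtain z where z: "z \<in> lo Y" "\<And>b. b \<in> carrier B \<Longrightarrow> h (fm X b x) = fm Y b z"
    using hp_fm[OF h x] by blast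
  have "inj_on (fm Y \<one>\<^bsub>B\<^esub>) (lo Y)" using fm_inj[OF Y] by (auto simp: inj_on_def)
  then have "y = z" using z by (simp add: y_def)
  then show "y \<in> lo Y" "fm Y \<one>\<^bsub>B\<^esub> y = h (fm X \<one>\<^bsub>B\<^esub> x)" "\<And>b. b \<in> carrier B \<Longrightarrow> h (fm X b x) = fm Y b y"
    using z by simp_all
qed

text \<open>The condition in \<open>hp\<close> is exactly what the last clause of
  \<open>gdata\<close> asks of the graph: for x in X(-1) with partner y, the action of b takes (x, h
  x) to (b x, b y) = (b x, h(b x)), again a point of the graph.\<close>

lemma gph_gdata:
  assumes X: "pgl K B X" and Y: "pgl K B Y" and h: "h \<in> hp K B X Y"
  shows "gdata K B (gph_V X Y) (gph_i B X Y h) (gph_a X Y)"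
proof -
  have i: "lin K (fob X ix) (vpair (inV X) (inV Y))
      (\<lambda>x. Tens [(gi B X ix x, gi B Y (At 0) (h (far X ix (At 0) \<one>\<^bsub>B\<^esub> x)))])"
    if "ix \<in> idxs" "ix \<noteq> Infty" for ix
    using lin_vpair[OF gi_lin[OF X that(1)] lin_comp[OF lin_comp[OF far_one_lin[OF X that] hp_lin[OF h]] gi_lin[OF Y]]]
    by simp
  show ?thesis unfolding gdata_def
  proof (intro conjI ballI)
    fix ix assume ix: "ix \<in> idxs"
    show "vectorspace K (gph_V X Y ix)"
      using ix by (simp add: gph_V_def vpair_vs pgl_vs[OF X] pgl_vs[OF Y])
    show "lin K (gph_V X Y ix) (gph_V X Y Infty) (gph_i B X Y h ix)"
      using i[OF ix] lin_id by (cases "ix = Infty") (simp_all add: gph_V_def gph_i_def [abs_def])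
    show "inj_on (gph_i B X Y h ix) (carrier (gph_V X Y ix))"
      using gi_inj[OF X ix] by (cases "ix = Infty") (auto simp: gph_V_def gph_i_def inj_on_def)
  next
    fix b assume b: "b \<in> carrier B"
    show "lin K (gph_V X Y Infty) (gph_V X Y Infty) (gph_a X Y b)"
      using lin_vpair[OF lin_comp[OF lin_vp1 ga_lin[OF X b]] lin_comp[OF lin_vp2 ga_lin[OF Y b]]]
      by (simp add: gph_a_def [abs_def] del: vpair_simps)
  next
    fix x assume x: "x \<in> carrier (gph_V X Y Infty)"
    show "lin K B (gph_V X Y Infty) (\<lambda>b. gph_a X Y b x)"
      using x lin_vpair[OF ga_lin2[OF X, of "vp1 x"] ga_lin2[OF Y, of "vp2 x"]]
      by (auto simp: gph_a_def simp del: vpair_simps(2-))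
    show "gph_a X Y \<one>\<^bsub>B\<^esub> x = x" using x ga_one[OF X] ga_one[OF Y] by (auto simp: gph_a_def)
  next
    fix b c x assume "b \<in> carrier B" "c \<in> carrier B" "x \<in> carrier (gph_V X Y Infty)"
    then show "gph_a X Y (b \<otimes>\<^bsub>B\<^esub> c) x = gph_a X Y b (gph_a X Y c x)"
      using ga_mult[OF X] ga_mult[OF Y] by (auto simp: gph_a_def)
  next
    fix b x assume b: "b \<in> carrier B" and "x \<in> carrier (gph_V X Y (At (-1)))"
    then have x: "x \<in> lo X" by simp
    note y = hp_lo[OF X Y h x]
    let ?y = "inv_into (lo Y) (fm Y \<one>\<^bsub>B\<^esub>) (h (fm X \<one>\<^bsub>B\<^esub> x))"
    have "ga Y b (gi B Y (At 0) (h (fm X \<one>\<^bsub>B\<^esub> x))) = ga Y b (gi B Y (At (-1)) ?y)"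
      using gi_fm_one[OF Y y(1)] y(2) by simp
    also have "\<dots> = gi B Y (At 0) (h (fm X b x))" using gi_fm[OF Y b y(1)] y(3)[OF b] by simp
    finally have "gph_a X Y b (gph_i B X Y h (At (-1)) x) = gph_i B X Y h (At 0) (fm X b x)"
      using gi_fm[OF X b x] pgl_id[OF X, of "At 0"] fm_closed[OF X b x] by (simp add: gph_a_def gph_i_def)
    then show "gph_a X Y b (gph_i B X Y h (At (-1)) x) \<in> gph_i B X Y h (At 0) ` carrier (gph_V X Y (At 0))"
      using fm_closed[OF X b x] by simp
  qed (auto simp: gph_i_def)
qed

lemma gph_pgl: "pgl K B X \<Longrightarrow> pgl K B Y \<Longrightarrow> h \<in> hp K B X Y \<Longrightarrow> pgl K B (gph K B X Y h)"
  unfolding gph_def by (rule gmk_pgl[OF gph_gdata])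

lemma gph_fob: "ix \<in> idxs \<Longrightarrow> fob (gph K B X Y h) ix = gph_V X Y ix"
  by (simp add: gph_def gmk_simps)

lemma gph_gi:
  assumes X: "pgl K B X" and Y: "pgl K B Y" and h: "h \<in> hp K B X Y"
  shows "ix \<in> idxs \<Longrightarrow> x \<in> carrier (gph_V X Y ix) \<Longrightarrow> gi B (gph K B X Y h) ix x = gph_i B X Y h ix x"
    and "b \<in> carrier B \<Longrightarrow> x \<in> carrier (gph_V X Y Infty) \<Longrightarrow> ga (gph K B X Y h) b x = gph_a X Y b x"
  using gmk_gi[OF gph_gdata[OF assms]] by (simp_all add: gph_def)

text \<open>At -1 and 0 the graph has the spaces of \<open>X\<close>, and the projection is the
  identity there.\<close>

lemma gph1_SG:
  assumes X: "pgl K B X" and Y: "pgl K B Y" and h: "h \<in> hp K B X Y"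
  shows "gph1 X Y \<in> SG K B (gph K B X Y h) X"
proof -
  note G = gph_pgl[OF assms] and gi = gph_gi[OF assms]
  have "gph1 X Y \<in> phom K B (gph K B X Y h) X"
  proof (rule homI[OF G X])
    fix ix assume ix: "ix \<in> idxs"
    have "lin K (gph_V X Y ix) (fob X ix) (\<lambda>x. if ix = Infty then vp1 x else x)"
      using lin_id lin_vp1 by (cases "ix = Infty") (simp_all add: gph_V_def)
    then show "lin K (fob (gph K B X Y h) ix) (fob X ix) (gph1 X Y ix)"
      using ix by (simp add: gph1_def gph_fob lin_restrict[OF gdataD(1)[OF gph_gdata[OF assms] ix]])
    show "gph1 X Y ix \<in> extensional (carrier (fob (gph K B X Y h) ix))"
      using ix by (simp add: gph1_def gph_fob)
    fix x assume x: "x \<in> carrier (fob (gph K B X Y h) ix)"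
    then have x': "x \<in> carrier (gph_V X Y ix)" using ix by (simp add: gph_fob)
    have "gph_i B X Y h ix x \<in> carrier (gph_V X Y Infty)"
      by (rule lin_closed[OF gdataD(2)[OF gph_gdata[OF assms] ix] x'])
    then show "gph1 X Y Infty (gi B (gph K B X Y h) ix x) = gi B X ix (gph1 X Y ix x)"
      using ix x' gi_Infty[OF X] by (auto simp: gi gph1_def gph_i_def)
  next
    fix b x assume b: "b \<in> carrier B" and "x \<in> carrier (inV (gph K B X Y h))"
    then have x: "x \<in> carrier (gph_V X Y Infty)" by (simp add: gph_fob)
    have "gph_a X Y b x \<in> carrier (gph_V X Y Infty)"
      by (rule lin_closed[OF gdataD(5)[OF gph_gdata[OF assms] b] x])
    then show "gph1 X Y Infty (ga (gph K B X Y h) b x) = ga X b (gph1 X Y Infty x)"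
      using b x by (simp add: gi gph1_def del: vpair_simps) (simp add: gph_a_def)
  qed (simp add: gph1_def)
  then show ?thesis unfolding SG_iff[OF G X]
    by (simp add: gph_fob) (auto simp: gph1_def bij_betw_def inj_on_def)
qed

lemma gph2_Hom:
  assumes X: "pgl K B X" and Y: "pgl K B Y" and h: "h \<in> hp K B X Y"
  shows "gph2 B X Y h \<in> phom K B (gph K B X Y h) Y"
proof (rule homI[OF gph_pgl[OF assms] Y])
  note gi = gph_gi[OF assms]
  note y = hp_lo[OF X Y h]
  let ?l = "\<lambda>x. inv_into (lo Y) (fm Y \<one>\<^bsub>B\<^esub>) (h (fm X \<one>\<^bsub>B\<^esub> x))"
  have l: "lin K (loV X) (loV Y) ?l"
  proof (rule lin_inv_into[OF pgl_vs[OF Y] fm_lin[OF Y]])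
    show "lin K (loV X) (hiV Y) (\<lambda>x. h (fm X \<one>\<^bsub>B\<^esub> x))"
      by (rule lin_comp[OF fm_lin[OF X] hp_lin[OF h]]) simp
    show "inj_on (fm Y \<one>\<^bsub>B\<^esub>) (lo Y)" using fm_inj[OF Y] by (auto simp: inj_on_def)
    show "h (fm X \<one>\<^bsub>B\<^esub> x) \<in> fm Y \<one>\<^bsub>B\<^esub> ` lo Y" if "x \<in> lo X" for x
      using y(1,2)[OF that] by (metis imageI)
  qed simp_all
  fix ix assume ix: "ix \<in> idxs"
  have "lin K (gph_V X Y ix) (fob Y ix)
      (\<lambda>x. if ix = Infty then vp2 x else if ix = At 0 then h x else ?l x)"
    using ix l hp_lin[OF h] lin_vp2 by (auto simp: idxs_def simp del: vpair_simps)
  then show "lin K (fob (gph K B X Y h) ix) (fob Y ix) (gph2 B X Y h ix)"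
    using ix by (simp add: gph2_def gph_fob lin_restrict[OF gdataD(1)[OF gph_gdata[OF assms] ix]])
  show "gph2 B X Y h ix \<in> extensional (carrier (fob (gph K B X Y h) ix))"
    using ix by (simp add: gph2_def gph_fob)
  fix x assume x: "x \<in> carrier (fob (gph K B X Y h) ix)"
  then have x': "x \<in> carrier (gph_V X Y ix)" using ix by (simp add: gph_fob)
  have c: "gph_i B X Y h ix x \<in> carrier (gph_V X Y Infty)"
    by (rule lin_closed[OF gdataD(2)[OF gph_gdata[OF assms] ix] x'])
  have 1: "gph2 B X Y h Infty (gi B (gph K B X Y h) ix x) = vp2 (gph_i B X Y h ix x)"
    using ix x' c by (simp add: gi gph2_def del: vpair_simps)
  show "gph2 B X Y h Infty (gi B (gph K B X Y h) ix x) = gi B Y ix (gph2 B X Y h ix x)"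
  proof -
    consider "ix = Infty" | "ix = At 0" | "ix = At (-1)" using ix by (auto simp: idxs_def)
    then show ?thesis
    proof cases
      case 1
      have "vp2 x \<in> carrier (inV Y)" using x' 1 by auto
      then show ?thesis unfolding \<open>gph2 B X Y h Infty _ = _\<close>
        using x' 1 gi_Infty[OF Y] by (simp add: gph2_def gph_i_def del: vpair_simps)
    next
      case 2 then show ?thesis unfolding \<open>gph2 B X Y h Infty _ = _\<close>
        using x' pgl_id[OF X, of "At 0"] by (simp add: gph2_def gph_i_def)
    next
      case 3
      then have x0: "x \<in> lo X" using x' by simp
      have "gi B Y (At 0) (h (fm X \<one>\<^bsub>B\<^esub> x)) = gi B Y (At (-1)) (?l x)"
        using gi_fm_one[OF Y y(1)[OF x0]] unfolding y(2)[OF x0] .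
      then show ?thesis unfolding \<open>gph2 B X Y h Infty _ = _\<close>
        using 3 x0 by (simp add: gph2_def gph_i_def)
    qed
  qed
next
  note gi = gph_gi[OF assms]
  fix b x assume b: "b \<in> carrier B" and "x \<in> carrier (inV (gph K B X Y h))"
  then have x: "x \<in> carrier (gph_V X Y Infty)" by (simp add: gph_fob)
  have "gph_a X Y b x \<in> carrier (gph_V X Y Infty)"
    by (rule lin_closed[OF gdataD(5)[OF gph_gdata[OF assms] b] x])
  then show "gph2 B X Y h Infty (ga (gph K B X Y h) b x) = ga Y b (gph2 B X Y h Infty x)"
    using b x by (simp add: gi gph2_def del: vpair_simps) (simp add: gph_a_def)
qed (simp add: gph2_def)

lemma can_zigzag:
  assumes X: "pgl K B X" and Y: "pgl K B Y" and h: "h \<in> hp K B X Y"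
  shows "zz K B X Y (can K B X Y h)"
  unfolding can_def
  by (intro zigzag.intros) (use gph_pgl[OF assms] gph1_SG[OF assms] gph2_Hom[OF assms] X Y in simp_all)

lemma can_zev:
  assumes X: "pgl K B X" and Y: "pgl K B Y" and h: "h \<in> hp K B X Y" and v: "v \<in> hi X"
  shows "zev (can K B X Y h) v = h v"
proof -
  have "inj_on (gph1 X Y (At 0)) (hi X)" by (auto simp: gph1_def inj_on_def)
  then have "inv_into (hi X) (gph1 X Y (At 0)) v = v"
    using inv_into_f_f[of "gph1 X Y (At 0)" "hi X" v] v by (simp add: gph1_def)
  then show ?thesis using v by (simp add: can_def gph_fob) (simp add: gph2_def)
qed

lemma hom_eqI:
  assumes "pgl K B M" "pgl K B N" "f \<in> phom K B M N" "g \<in> phom K B M N"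
    "\<And>x. x \<in> carrier (hiV M) \<Longrightarrow> f (At 0) x = g (At 0) x"
    "\<And>x. x \<in> carrier (inV M) \<Longrightarrow> f Infty x = g Infty x"
  shows "f = g"
proof (rule ext_eqI[OF homD(1)[OF assms(1-3)] homD(1)[OF assms(1,2,4)]])
  fix ix assume ix: "ix \<in> idxs"
  show "f ix = g ix"
  proof (rule ext_eqI[OF homD(3)[OF assms(1-3) ix] homD(3)[OF assms(1,2,4) ix]])
    fix x assume x: "x \<in> carrier (fob M ix)"
    have "gi B N ix (f ix x) = gi B N ix (g ix x)"
      using homD(4)[OF assms(1-3) ix x] homD(4)[OF assms(1,2,4) ix x] assms(6)[OF gi_closed[OF assms(1) ix x]]
      by simp
    then show "f ix x = g ix x"
      by (rule gi_inj[OF assms(2) ix hom_closed[OF assms(1-3) ix x] hom_closed[OF assms(1,2,4) ix x]])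
  qed
qed

text \<open>The pair (s, f) lands in the graph as soon as h s = f holds at 0. At infinity nothing
  has to be checked, because there the graph has the full product of the two modules; this is the
  reason for not taking anything smaller.\<close>

lemma gph_universal:
  assumes W: "pgl K B W" and X: "pgl K B X" and Y: "pgl K B Y"
    and s: "s \<in> phom K B W X" and f: "f \<in> phom K B W Y" and h: "h \<in> hp K B X Y"
    and e: "\<And>w. w \<in> hi W \<Longrightarrow> h (s (At 0) w) = f (At 0) w"
  obtains t where "t \<in> phom K B W (gph K B X Y h)"
    "Cmp (PG K B) W (gph K B X Y h) X (gph1 X Y) t = s" "Cmp (PG K B) W (gph K B X Y h) Y (gph2 B X Y h) t = f"
    "\<And>ix x. ix \<in> idxs \<Longrightarrow> ix \<noteq> Infty \<Longrightarrow> x \<in> carrier (fob W ix) \<Longrightarrow> t ix x = s ix x"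
proof -
  let ?G = "gph K B X Y h" and ?p = "gph1 X Y" and ?q = "gph2 B X Y h"
  note G = gph_pgl[OF X Y h] and gi = gph_gi[OF X Y h]
  note S = homD[OF W X s] and F = homD[OF W Y f] and sc = hom_closed[OF W X s] and fc = hom_closed[OF W Y f]
  define t where "t = (\<lambda>ix\<in>idxs. \<lambda>x\<in>carrier (fob W ix). if ix = Infty then Tens [(s Infty x, f Infty x)] else s ix x)"
  have tc: "t Infty x \<in> carrier (gph_V X Y Infty)" if "x \<in> carrier (inV W)" for x
    using that sc fc by (simp add: t_def)
  have t: "t \<in> phom K B W ?G"
  proof (rule homI[OF W G])
    fix ix assume ix: "ix \<in> idxs"
    have "lin K (fob W ix) (gph_V X Y ix) (\<lambda>x. if ix = Infty then Tens [(s Infty x, f Infty x)] else s ix x)"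
      using lin_vpair[OF S(2) F(2)] S(2) ix by (cases "ix = Infty") (simp_all add: gph_V_def)
    then show "lin K (fob W ix) (fob ?G ix) (t ix)"
      using ix by (simp add: t_def gph_fob lin_restrict[OF pgl_vs[OF W ix]])
    show "t ix \<in> extensional (carrier (fob W ix))" using ix by (simp add: t_def)
    fix x assume x: "x \<in> carrier (fob W ix)"
    note gx = gi_closed[OF W ix x]
    show "t Infty (gi B W ix x) = gi B ?G ix (t ix x)"
    proof (cases "ix = Infty")
      case True
      then show ?thesis using gi(1)[of Infty "t Infty x"] tc x gi_Infty[OF W] by (simp add: gph_i_def)
    next
      case False
      have "gi B Y (At 0) (h (far X ix (At 0) \<one>\<^bsub>B\<^esub> (s ix x))) = f Infty (gi B W ix x)"
      proof (cases "ix = At 0")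
        case True
        then show ?thesis using e[of x] x pgl_id[OF X, of "At 0"] sc[OF ix x] F(4)[OF ix x] by simp
      next
        case nF: False
        then have a: "ix = At (-1)" using False ix by (auto simp: idxs_def)
        have "h (fm X \<one>\<^bsub>B\<^esub> (s (At (-1)) x)) = fm Y \<one>\<^bsub>B\<^esub> (f (At (-1)) x)"
          using hom_fm[OF W X s, of "\<one>\<^bsub>B\<^esub>" x] e[OF fm_closed[OF W, of "\<one>\<^bsub>B\<^esub>" x]] hom_fm[OF W Y f, of "\<one>\<^bsub>B\<^esub>" x] x a
          by simp
        then show ?thesis using gi_fm_one[OF Y, of "f (At (-1)) x"] F(4)[OF ix x] fc[OF ix x] a by simp
      qed
      then show ?thesis using False ix x gx S(4)[OF ix x] sc[OF ix x] gi(1)[OF ix, of "s ix x"]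
        by (simp add: t_def gph_i_def gph_V_def)
    qed
  next
    fix b x assume b: "b \<in> carrier B" and x: "x \<in> carrier (inV W)"
    show "t Infty (ga W b x) = ga ?G b (t Infty x)"
      using gi(2)[OF b tc[OF x]] S(5)[OF b x] F(5)[OF b x] ga_closed[OF W b x] x by (simp add: t_def gph_a_def)
  qed (simp add: t_def)
  have p: "?p \<in> SG K B ?G X" by (rule gph1_SG[OF X Y h])
  then have p': "?p \<in> phom K B ?G X" unfolding SG_iff[OF G X] by simp
  have q: "?q \<in> phom K B ?G Y" by (rule gph2_Hom[OF X Y h])
  have pt: "Cmp (PG K B) W ?G X ?p t = s"
  proof (rule hom_eqI[OF W X Cmp_closed[OF W G X t p'] s])
    show "Cmp (PG K B) W ?G X ?p t Infty x = s Infty x" if "x \<in> carrier (inV W)" for x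
      using that tc[OF that] by (simp add: compose_def gph1_def del: vpair_simps) (simp add: t_def)
    show "Cmp (PG K B) W ?G X ?p t (At 0) x = s (At 0) x" if "x \<in> hi W" for x
      using that sc by (simp add: compose_def gph1_def t_def)
  qed
  have qt: "Cmp (PG K B) W ?G Y ?q t = f"
  proof (rule hom_eqI[OF W Y Cmp_closed[OF W G Y t q] f])
    show "Cmp (PG K B) W ?G Y ?q t Infty x = f Infty x" if "x \<in> carrier (inV W)" for x
      using that tc[OF that] by (simp add: compose_def gph2_def del: vpair_simps) (simp add: t_def)
    show "Cmp (PG K B) W ?G Y ?q t (At 0) x = f (At 0) x" if "x \<in> hi W" for x
      using that sc e by (simp add: compose_def gph2_def t_def)
  qed
  show ?thesis by (rule that[OF t pt qt]) (simp add: t_def)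
qed

text \<open>The map \<open>t\<close> into the graph has the components of \<open>s\<close> at -1 and
  0. Hence it lies in \<Sigma> and can be cancelled from the numerator and the denominator.\<close>

lemma fraction_can:
  assumes W: "pgl K B W" and X: "pgl K B X" and Y: "pgl K B Y"
    and s: "s \<in> SG K B W X" and f: "f \<in> phom K B W Y" and h: "h \<in> hp K B X Y"
    and e: "\<And>w. w \<in> hi W \<Longrightarrow> h (s (At 0) w) = f (At 0) w"
  shows "zeq K B X Y [Bwd W X s, Fwd W Y f] (can K B X Y h)"
proof -
  let ?G = "gph K B X Y h" and ?p = "gph1 X Y" and ?q = "gph2 B X Y h"
  note G = gph_pgl[OF X Y h]
  have s': "s \<in> phom K B W X" and sb: "bij_betw (s (At (-1))) (lo W) (lo X)"
    "bij_betw (s (At 0)) (hi W) (hi X)" using s unfolding SG_iff[OF W X] by simp_all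
  obtain t where t: "t \<in> phom K B W ?G" and pt: "Cmp (PG K B) W ?G X ?p t = s" and qt: "Cmp (PG K B) W ?G Y ?q t = f"
    and ts: "\<And>ix x. ix \<in> idxs \<Longrightarrow> ix \<noteq> Infty \<Longrightarrow> x \<in> carrier (fob W ix) \<Longrightarrow> t ix x = s ix x"
    using gph_universal[OF W X Y s' f h e] by metis
  have tS: "t \<in> SG K B W ?G"
    unfolding SG_iff[OF W G] using t sb by (simp add: gph_fob) (simp add: ts cong: bij_betw_cong)
  have p: "?p \<in> SG K B ?G X" by (rule gph1_SG[OF X Y h])
  then have p': "?p \<in> phom K B ?G X" unfolding SG_iff[OF G X] by simp
  have q: "?q \<in> phom K B ?G Y" by (rule gph2_Hom[OF X Y h])
  let ?E = "zeq K B" and ?Z = "zz K B"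
  have O: "W \<in> Ob (PG K B)" "X \<in> Ob (PG K B)" "Y \<in> Ob (PG K B)" "?G \<in> Ob (PG K B)" using W X Y G by simp_all
  have zf: "?Z W Y [Fwd W Y f]" and zp: "?Z X ?G [Bwd ?G X ?p]" and zq: "?Z ?G Y [Fwd ?G Y ?q]"
    and zpt: "?Z X W [Bwd ?G X ?p, Bwd W ?G t]"
    using O p p' q f tS by (auto intro!: zigzag.intros simp del: PG_simps)
  have "?E X Y ([Bwd W X s] @ [Fwd W Y f]) ([Bwd ?G X ?p, Bwd W ?G t] @ [Fwd W Y f])"
    using ze_sym[OF ze_Bwd_comp(2)[OF W G X tS p]] zf unfolding pt by (rule ze_append_right)
  also have "?E X Y ([Bwd ?G X ?p, Bwd W ?G t] @ [Fwd W Y f]) ([Bwd ?G X ?p, Bwd W ?G t] @ [Fwd W ?G t, Fwd ?G Y ?q])"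
    using ze_sym[OF ze_comp[OF O(1,4,3) t q, of "SG K B"]] unfolding qt by (rule ze_append_left[OF zpt])
  also have "[Bwd ?G X ?p, Bwd W ?G t] @ [Fwd W ?G t, Fwd ?G Y ?q] =
      ([Bwd ?G X ?p] @ [Bwd W ?G t, Fwd W ?G t]) @ [Fwd ?G Y ?q]" by simp
  also have "?E X Y (([Bwd ?G X ?p] @ [Bwd W ?G t, Fwd W ?G t]) @ [Fwd ?G Y ?q]) (([Bwd ?G X ?p] @ []) @ [Fwd ?G Y ?q])"
    by (rule ze_append_right[OF ze_append_left[OF zp ze_inv_right[where C = "PG K B" and S = "SG K B", OF O(1,4) tS]] zq])
  finally show ?thesis by (simp add: can_def)
qed

end

section \<open>The localization\<close>

text \<open>These sets, for \<open>h\<close> in \<open>hp\<close>, turn out to be precisely the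
  morphisms of the localization (\<open>loc_carrier\<close>), so that the rest of the proof computes
  with \<open>h\<close> instead of zigzags.\<close>

definition kap where
  "kap K B X Y h = {p. zz K B X Y p \<and> (\<forall>v\<in>hi X. zev p v = h v)}"

text \<open>All zigzags of a class evaluate alike on X(0), so the choice of one does no harm. By
  \<open>kev_kap\<close> this recovers \<open>h\<close> from its class.\<close>

definition kev where "kev X x = (\<lambda>v\<in>hi X. zev (SOME p. p \<in> x) v)"

lemma kap_cong: "(\<And>v. v \<in> hi X \<Longrightarrow> f v = g v) \<Longrightarrow> kap K B X Y f = kap K B X Y g"
  by (auto simp: kap_def)

context bialgebra
begin

text \<open>An exchange of Ore type: by \<open>gph_universal\<close> the graph of the composite maps
  to the graph of \<open>h\<close>, and this moves the forward step past the denominator.\<close>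

lemma fwd_can:
  assumes X: "pgl K B X" and Y: "pgl K B Y" and Z: "pgl K B Z"
    and f: "f \<in> phom K B X Y" and h: "h \<in> hp K B Y Z"
  shows "zeq K B X Z (Fwd X Y f # can K B Y Z h) (can K B X Z (compose (hi X) h (f (At 0))))"
proof -
  let ?h = "compose (hi X) h (f (At 0))"
  have k: "?h \<in> hp K B X Z" by (rule hp_comp[OF X Y hom_hp[OF X Y f] h])
  let ?P = "gph K B X Z ?h" and ?G = "gph K B Y Z h"
  let ?p1 = "gph1 X Z" and ?p2 = "gph2 B X Z ?h" and ?g1 = "gph1 Y Z" and ?g2 = "gph2 B Y Z h"
  note P = gph_pgl[OF X Z k] and G = gph_pgl[OF Y Z h]
  have p1: "?p1 \<in> SG K B ?P X" by (rule gph1_SG[OF X Z k])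
  then have p1': "?p1 \<in> phom K B ?P X" unfolding SG_iff[OF P X] by simp
  have g1: "?g1 \<in> SG K B ?G Y" by (rule gph1_SG[OF Y Z h])
  then have g1': "?g1 \<in> phom K B ?G Y" unfolding SG_iff[OF G Y] by simp
  have p2: "?p2 \<in> phom K B ?P Z" by (rule gph2_Hom[OF X Z k])
  have g2: "?g2 \<in> phom K B ?G Z" by (rule gph2_Hom[OF Y Z h])
  obtain q where q: "q \<in> phom K B ?P ?G" and e1: "Cmp (PG K B) ?P ?G Y ?g1 q = Cmp (PG K B) ?P X Y f ?p1"
    and e2: "Cmp (PG K B) ?P ?G Z ?g2 q = ?p2"
  proof (rule gph_universal[OF P Y Z Cmp_closed[OF P X Y p1' f] p2 h])
    show "h (Cmp (PG K B) ?P X Y f ?p1 (At 0) w) = ?p2 (At 0) w" if "w \<in> hi ?P" for w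
      using that by (simp add: compose_def gph_fob gph1_def gph2_def)
  qed
  let ?E = "zeq K B" and ?Z = "zz K B"
  have O: "X \<in> Ob (PG K B)" "Y \<in> Ob (PG K B)" "Z \<in> Ob (PG K B)" "?P \<in> Ob (PG K B)" "?G \<in> Ob (PG K B)"
    using X Y Z P G by simp_all
  have z1: "?Z X Z [Fwd X Y f, Bwd ?G Y ?g1, Fwd ?G Z ?g2]" and z2: "?Z X ?P [Bwd ?P X ?p1]"
    and z3: "?Z Y Z [Bwd ?G Y ?g1, Fwd ?G Z ?g2]" and z4: "?Z ?G Z [Fwd ?G Z ?g2]"
    and z5: "?Z X ?G [Bwd ?P X ?p1, Fwd ?P ?G q]"
    using O f g1 g2 p1 q by (auto intro!: zigzag.intros simp del: PG_simps)
  have "?E X Z ([] @ [Fwd X Y f, Bwd ?G Y ?g1, Fwd ?G Z ?g2])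
      ([Bwd ?P X ?p1, Fwd ?P X ?p1] @ [Fwd X Y f, Bwd ?G Y ?g1, Fwd ?G Z ?g2])"
    using ze_sym[OF ze_inv_right[where C = "PG K B" and S = "SG K B", OF O(4,1) p1]] z1 by (rule ze_append_right)
  also have "[Bwd ?P X ?p1, Fwd ?P X ?p1] @ [Fwd X Y f, Bwd ?G Y ?g1, Fwd ?G Z ?g2] =
      [Bwd ?P X ?p1] @ ([Fwd ?P X ?p1, Fwd X Y f] @ [Bwd ?G Y ?g1, Fwd ?G Z ?g2])" by simp
  also have "?E X Z \<dots> ([Bwd ?P X ?p1] @ ([Fwd ?P Y (Cmp (PG K B) ?P X Y f ?p1)] @ [Bwd ?G Y ?g1, Fwd ?G Z ?g2]))"
    by (rule ze_append_left[OF z2 ze_append_right[OF ze_comp[OF O(4,1,2) p1' f] z3]])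
  also have "?E X Z \<dots> ([Bwd ?P X ?p1] @ ([Fwd ?P ?G q, Fwd ?G Y ?g1] @ [Bwd ?G Y ?g1, Fwd ?G Z ?g2]))"
    unfolding e1[symmetric] by (rule ze_append_left[OF z2 ze_append_right[OF ze_sym[OF ze_comp[OF O(4,5,2) q g1']] z3]])
  also have "[Bwd ?P X ?p1] @ ([Fwd ?P ?G q, Fwd ?G Y ?g1] @ [Bwd ?G Y ?g1, Fwd ?G Z ?g2]) =
      [Bwd ?P X ?p1, Fwd ?P ?G q] @ ([Fwd ?G Y ?g1, Bwd ?G Y ?g1] @ [Fwd ?G Z ?g2])" by simp
  also have "?E X Z \<dots> ([Bwd ?P X ?p1, Fwd ?P ?G q] @ ([] @ [Fwd ?G Z ?g2]))"
    by (rule ze_append_left[OF z5 ze_append_right[OF ze_inv_left[where C = "PG K B" and S = "SG K B", OF O(5,2) g1] z4]])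
  also have "[Bwd ?P X ?p1, Fwd ?P ?G q] @ ([] @ [Fwd ?G Z ?g2]) = [Bwd ?P X ?p1] @ [Fwd ?P ?G q, Fwd ?G Z ?g2]" by simp
  also have "?E X Z \<dots> ([Bwd ?P X ?p1] @ [Fwd ?P Z ?p2])"
    unfolding e2[symmetric] by (rule ze_append_left[OF z2 ze_comp[OF O(4,5,3) q g2]])
  finally show ?thesis by (simp add: can_def)
qed

lemma Idn_SG: "pgl K B X \<Longrightarrow> Idn (PG K B) X \<in> SG K B X X"
  using Idn_closed[of X] by (simp add: SG_iff) (auto simp: bij_betw_def inj_on_def)

text \<open>A forward step is absorbed by \<open>fwd_can\<close>. A backward step merges with the
  denominator by \<open>ze_Bwd_comp\<close>, after which \<open>fraction_can\<close> restores the
  canonical form.\<close>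

lemma zigzag_can:
  "zz K B X Y p \<Longrightarrow>
     zeq K B X Y p (can K B X Y (\<lambda>v\<in>hi X. zev p v))"
proof (induction rule: zigzag.induct)
  case (zz_nil X)
  then have X: "pgl K B X" by simp
  \<comment> \<open>The empty zigzag is first written as a fraction whose numerator and denominator
    are the identity.\<close>
  show ?case
    by (rule ze_trans[OF ze_sym[OF ze_inv_right[where C = "PG K B" and S = "SG K B", OF zz_nil zz_nil Idn_SG[OF X]]]
          fraction_can[OF X X X Idn_SG[OF X] Idn_closed[OF X] zigzag_hp[OF zigzag.zz_nil[OF zz_nil]]]]) simp
next
  case (zz_fwd X Y f Z p)
  then have P: "pgl K B X" "pgl K B Y" "pgl K B Z" and f: "f \<in> phom K B X Y"
    using zigzag_Ob[OF zz_fwd(4)] by simp_all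
  have "zz K B X Y [Fwd X Y f]" using zz_fwd(1-3) by (intro zigzag.intros)
  from ze_append_left[OF this zz_fwd.IH]
  have "zeq K B X Z (Fwd X Y f # p) (Fwd X Y f # can K B Y Z (\<lambda>v\<in>hi Y. zev p v))"
    by (simp only: append_Cons append_Nil)
  also note fwd_can[OF P f zigzag_hp[OF zz_fwd(4)]]
  also have "compose (hi X) (\<lambda>v\<in>hi Y. zev p v) (f (At 0)) = (\<lambda>v\<in>hi X. zev (Fwd X Y f # p) v)"
    using hom_closed[OF P(1,2) f, of "At 0"] by (auto simp: compose_def fun_eq_iff)
  finally show ?case .
next
  case (zz_bwd X Y s Z p)
  then have P: "pgl K B X" "pgl K B Y" "pgl K B Z" and s: "s \<in> SG K B X Y"
    using zigzag_Ob[OF zz_bwd(4)] by simp_all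
  have s': "s \<in> phom K B X Y" "bij_betw (s (At 0)) (hi X) (hi Y)" using s unfolding SG_iff[OF P(1,2)] by blast+
  let ?h = "\<lambda>v\<in>hi X. zev p v"
  have h: "?h \<in> hp K B X Z" by (rule zigzag_hp[OF zz_bwd(4)])
  let ?G = "gph K B X Z ?h" and ?g1 = "gph1 X Z" and ?g2 = "gph2 B X Z ?h"
  note G = gph_pgl[OF P(1,3) h] and g1 = gph1_SG[OF P(1,3) h] and g2 = gph2_Hom[OF P(1,3) h]
  have z: "zz K B Y X [Bwd X Y s]" using zz_bwd(1-3) by (intro zigzag.intros)
  have z2: "zz K B ?G Z [Fwd ?G Z ?g2]" using G P(3) g2 by (intro zigzag.intros) simp_all
  have zz: "zz K B Y Z (Bwd X Y s # p)" using zz_bwd(1-4) by (intro zigzag.intros)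
  have "zeq K B Y Z ([Bwd X Y s] @ p) ([Bwd X Y s] @ can K B X Z ?h)"
    by (rule ze_append_left[OF z zz_bwd.IH])
  also have "[Bwd X Y s] @ can K B X Z ?h = [Bwd X Y s, Bwd ?G X ?g1] @ [Fwd ?G Z ?g2]" by (simp add: can_def)
  also have "zeq K B Y Z \<dots> ([Bwd ?G Y (Cmp (PG K B) ?G X Y s ?g1)] @ [Fwd ?G Z ?g2])"
    by (rule ze_append_right[OF ze_Bwd_comp(2)[OF G P(1,2) g1 s] z2])
  also have "[Bwd ?G Y (Cmp (PG K B) ?G X Y s ?g1)] @ [Fwd ?G Z ?g2] = [Bwd ?G Y (Cmp (PG K B) ?G X Y s ?g1), Fwd ?G Z ?g2]" by simp
  also have "zeq K B Y Z \<dots> (can K B Y Z (\<lambda>v\<in>hi Y. zev (Bwd X Y s # p) v))"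
  proof (rule fraction_can[OF G P(2,3) ze_Bwd_comp(1)[OF G P(1,2) g1 s] g2 zigzag_hp[OF zz]])
    fix w assume "w \<in> hi ?G"
    then have w: "w \<in> hi X" by (simp add: gph_fob)
    then have "s (At 0) w \<in> hi Y" "inv_into (hi X) (s (At 0)) (s (At 0) w) = w"
      using s'(2) by (auto simp: bij_betw_def)
    then show "(\<lambda>v\<in>hi Y. zev (Bwd X Y s # p) v) (Cmp (PG K B) ?G X Y s ?g1 (At 0) w) = ?g2 (At 0) w"
      using w by (simp add: compose_def gph_fob gph1_def gph2_def)
  qed
  finally show ?case by (simp only: append_Cons append_Nil)
qed

text \<open>Two zigzags with the same evaluation are congruent to the same canonical fraction, hence
  to each other.\<close>

lemma zz_class_kap:
  assumes p: "zz K B X Y p"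
  shows "zcl K B X Y p = kap K B X Y (zev p)"
proof
  show "zcl K B X Y p \<subseteq> kap K B X Y (zev p)"
    using zigzag_eq_zev unfolding zz_class_def kap_def by fastforce
  show "kap K B X Y (zev p) \<subseteq> zcl K B X Y p"
  proof
    fix q assume "q \<in> kap K B X Y (zev p)"
    then have q: "zz K B X Y q" and e: "\<And>v. v \<in> hi X \<Longrightarrow> zev q v = zev p v"
      by (auto simp: kap_def)
    have r: "(\<lambda>v\<in>hi X. zev q v) = (\<lambda>v\<in>hi X. zev p v)" using e by (intro restrict_ext)
    show "q \<in> zcl K B X Y p"
      using ze_trans[OF zigzag_can[OF p] ze_sym[OF zigzag_can[OF q, unfolded r]]] by (simp add: zz_class_def)
  qed
qed

lemma zz_class_empty:
  "\<not> zz K B X Y p \<Longrightarrow> zcl K B X Y p = {}"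
  unfolding zz_class_def using zigzag_eq_zev by blast

lemma can_kap: "pgl K B X \<Longrightarrow> pgl K B Y \<Longrightarrow> h \<in> hp K B X Y \<Longrightarrow> can K B X Y h \<in> kap K B X Y h"
  by (simp add: kap_def can_zigzag can_zev)

lemma kap_hp_ne: "pgl K B X \<Longrightarrow> pgl K B Y \<Longrightarrow> h \<in> hp K B X Y \<Longrightarrow> kap K B X Y h \<noteq> {}"
  using can_kap by blast

lemma kap_zz: "p \<in> kap K B X Y h \<Longrightarrow> zcl K B X Y p = kap K B X Y h"
  by (subst zz_class_kap) (auto simp: kap_def)

lemma kev_kap:
  assumes "pgl K B X" "pgl K B Y" "h \<in> hp K B X Y"
  shows "kev X (kap K B X Y h) = h"
proof (rule ext_eqI[OF _ hp_ext[OF assms(3)]])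
  have "(SOME p. p \<in> kap K B X Y h) \<in> kap K B X Y h" using can_kap[OF assms] by (rule someI)
  then show "kev X (kap K B X Y h) v = h v" if "v \<in> hi X" for v using that by (simp add: kev_def kap_def)
qed (simp add: kev_def)

lemma kap_inj:
  "pgl K B X \<Longrightarrow> pgl K B Y \<Longrightarrow> h \<in> hp K B X Y \<Longrightarrow> g \<in> hp K B X Y \<Longrightarrow>
     kap K B X Y h = kap K B X Y g \<Longrightarrow> h = g"
  using kev_kap by metis

lemma loc_carrier:
  assumes X: "pgl K B X" and Y: "pgl K B Y"
  shows "carrier (loc_hom (PG K B) (SG K B) X Y) = kap K B X Y ` hp K B X Y"
proof
  show "carrier (loc_hom (PG K B) (SG K B) X Y) \<subseteq> kap K B X Y ` hp K B X Y"
  proof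
    fix x assume "x \<in> carrier (loc_hom (PG K B) (SG K B) X Y)"
    then obtain p where p: "zz K B X Y p" "x = zcl K B X Y p"
      by (auto simp: loc_hom_def)
    have "x = kap K B X Y (\<lambda>v\<in>hi X. zev p v)" unfolding p(2) zz_class_kap[OF p(1)] by (rule kap_cong) simp
    then show "x \<in> kap K B X Y ` hp K B X Y" using zigzag_hp[OF p(1)] by blast
  qed
  show "kap K B X Y ` hp K B X Y \<subseteq> carrier (loc_hom (PG K B) (SG K B) X Y)"
    using kap_zz[OF can_kap[OF X Y]] can_zigzag[OF X Y] by (auto simp: loc_hom_def)
qed

lemma loc_Q_kap:
  assumes X: "pgl K B X" and Y: "pgl K B Y" and f: "f \<in> phom K B X Y"
  shows "loc_Q (PG K B) (SG K B) X Y f = kap K B X Y (f (At 0))"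
proof -
  have z: "zz K B X Y [Fwd X Y f]" using assms by (intro zigzag.intros) simp_all
  show ?thesis unfolding loc_Q_def zz_class_kap[OF z] by (rule kap_cong) simp
qed

lemma loc_comp_kap:
  assumes X: "pgl K B X" and Y: "pgl K B Y" and Z: "pgl K B Z"
    and f: "f \<in> hp K B X Y" and g: "g \<in> hp K B Y Z"
  shows "loc_comp (PG K B) (SG K B) X Y Z (kap K B Y Z g) (kap K B X Y f) = kap K B X Z (compose (hi X) g f)"
proof -
  have "zcl K B X Z (p @ q) = kap K B X Z (compose (hi X) g f)"
    if "p \<in> kap K B X Y f" "q \<in> kap K B Y Z g" for p q
    using that hp_closed[OF f]
    by (subst zz_class_kap) (auto simp: kap_def compose_def zev_append intro!: zigzag_append)
  then show ?thesis unfolding loc_comp_def using kap_hp_ne[OF X Y f] kap_hp_ne[OF Y Z g] by auto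
qed

lemma hom_add_closed:
  assumes X: "pgl K B X" and Y: "pgl K B Y" and f: "f \<in> phom K B X Y" and g: "g \<in> phom K B X Y"
  shows "f \<oplus>\<^bsub>Hom (PG K B) X Y\<^esub> g \<in> phom K B X Y"
proof (rule homI[OF X Y])
  note F = homD[OF X Y f] and G = homD[OF X Y g] and fc = hom_closed[OF X Y f] and gc = hom_closed[OF X Y g]
  show "lin K (fob X ix) (fob Y ix) ((f \<oplus>\<^bsub>Hom (PG K B) X Y\<^esub> g) ix)" if "ix \<in> idxs" for ix
    using lin_plus[OF pgl_vs[OF X that] pgl_vs[OF Y that] F(2)[OF that] G(2)[OF that]] that
    by (simp add: lin_restrict[OF pgl_vs[OF X]])
  show "(f \<oplus>\<^bsub>Hom (PG K B) X Y\<^esub> g) Infty (gi B X ix x) = gi B Y ix ((f \<oplus>\<^bsub>Hom (PG K B) X Y\<^esub> g) ix x)"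
    if "ix \<in> idxs" "x \<in> carrier (fob X ix)" for ix x
    using that F(4) G(4) fc gc gi_closed[OF X] lin_add[OF gi_lin[OF Y that(1)]] by simp
  show "(f \<oplus>\<^bsub>Hom (PG K B) X Y\<^esub> g) Infty (ga X b x) = ga Y b ((f \<oplus>\<^bsub>Hom (PG K B) X Y\<^esub> g) Infty x)"
    if "b \<in> carrier B" "x \<in> carrier (inV X)" for b x
    using that F(5) G(5) fc gc ga_closed[OF X] lin_add[OF ga_lin[OF Y that(1)]] by simp
qed simp_all

lemma hom_zero_closed:
  assumes X: "pgl K B X" and Y: "pgl K B Y"
  shows "\<zero>\<^bsub>Hom (PG K B) X Y\<^esub> \<in> phom K B X Y"
proof (rule homI[OF X Y])
  show "lin K (fob X ix) (fob Y ix) (\<zero>\<^bsub>Hom (PG K B) X Y\<^esub> ix)" if "ix \<in> idxs" for ix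
    using lin_const_zero[OF pgl_vs[OF Y that]] that by (simp add: lin_restrict[OF pgl_vs[OF X]])
  show "\<zero>\<^bsub>Hom (PG K B) X Y\<^esub> Infty (gi B X ix x) = gi B Y ix (\<zero>\<^bsub>Hom (PG K B) X Y\<^esub> ix x)"
    if "ix \<in> idxs" "x \<in> carrier (fob X ix)" for ix x
    using that gi_closed[OF X] lin_zero[OF pgl_vs[OF Y that(1)] pgl_vs[OF Y] gi_lin[OF Y that(1)]] by simp
  show "\<zero>\<^bsub>Hom (PG K B) X Y\<^esub> Infty (ga X b x) = ga Y b (\<zero>\<^bsub>Hom (PG K B) X Y\<^esub> Infty x)"
    if "b \<in> carrier B" "x \<in> carrier (inV X)" for b x
    using that ga_closed[OF X] lin_zero[OF pgl_vs[OF Y] pgl_vs[OF Y] ga_lin[OF Y that(1)]] by simp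
qed simp_all

lemma hom_scale_closed:
  assumes X: "pgl K B X" and Y: "pgl K B Y" and f: "f \<in> phom K B X Y" and c: "c \<in> carrier K"
  shows "c \<odot>\<^bsub>Hom (PG K B) X Y\<^esub> f \<in> phom K B X Y"
proof (rule homI[OF X Y])
  note F = homD[OF X Y f] and fc = hom_closed[OF X Y f]
  show "lin K (fob X ix) (fob Y ix) ((c \<odot>\<^bsub>Hom (PG K B) X Y\<^esub> f) ix)" if "ix \<in> idxs" for ix
    using lin_scale[OF pgl_vs[OF X that] pgl_vs[OF Y that] F(2)[OF that] c] that
    by (simp add: lin_restrict[OF pgl_vs[OF X]])
  show "(c \<odot>\<^bsub>Hom (PG K B) X Y\<^esub> f) Infty (gi B X ix x) = gi B Y ix ((c \<odot>\<^bsub>Hom (PG K B) X Y\<^esub> f) ix x)"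
    if "ix \<in> idxs" "x \<in> carrier (fob X ix)" for ix x
    using that F(4) fc gi_closed[OF X] lin_smult[OF gi_lin[OF Y that(1)] c] by simp
  show "(c \<odot>\<^bsub>Hom (PG K B) X Y\<^esub> f) Infty (ga X b x) = ga Y b ((c \<odot>\<^bsub>Hom (PG K B) X Y\<^esub> f) Infty x)"
    if "b \<in> carrier B" "x \<in> carrier (inV X)" for b x
    using that F(5) fc ga_closed[OF X] lin_smult[OF ga_lin[OF Y that(1)] c] by simp
qed simp_all

lemma hp_add:
  assumes X: "pgl K B X" and Y: "pgl K B Y" and f: "f \<in> hp K B X Y" and g: "g \<in> hp K B X Y"
  shows "(\<lambda>v\<in>hi X. f v \<oplus>\<^bsub>hiV Y\<^esub> g v) \<in> hp K B X Y"
proof (rule hpI)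
  show "lin K (hiV X) (hiV Y) (\<lambda>v\<in>hi X. f v \<oplus>\<^bsub>hiV Y\<^esub> g v)"
    using lin_plus[OF pgl_vs[OF X] pgl_vs[OF Y] hp_lin[OF f] hp_lin[OF g]] by (simp add: lin_restrict[OF pgl_vs[OF X]])
  fix x assume x: "x \<in> lo X"
  interpret Y1: vectorspace K "loV Y" by (rule pgl_vs[OF Y]) simp
  obtain y where y: "y \<in> lo Y" "\<And>b. b \<in> carrier B \<Longrightarrow> f (fm X b x) = fm Y b y" using hp_fm[OF f x] by blast
  obtain z where z: "z \<in> lo Y" "\<And>b. b \<in> carrier B \<Longrightarrow> g (fm X b x) = fm Y b z" using hp_fm[OF g x] by blast
  show "\<exists>y\<in>lo Y. \<forall>b\<in>carrier B. (\<lambda>v\<in>hi X. f v \<oplus>\<^bsub>hiV Y\<^esub> g v) (fm X b x) = fm Y b y"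
    using y z fm_closed[OF X _ x] lin_add[OF fm_lin[OF Y]] by (intro bexI[of _ "y \<oplus>\<^bsub>loV Y\<^esub> z"]) auto
qed simp

lemma hp_scale:
  assumes X: "pgl K B X" and Y: "pgl K B Y" and f: "f \<in> hp K B X Y" and c: "c \<in> carrier K"
  shows "(\<lambda>v\<in>hi X. c \<odot>\<^bsub>hiV Y\<^esub> f v) \<in> hp K B X Y"
proof (rule hpI)
  show "lin K (hiV X) (hiV Y) (\<lambda>v\<in>hi X. c \<odot>\<^bsub>hiV Y\<^esub> f v)"
    using lin_scale[OF pgl_vs[OF X] pgl_vs[OF Y] hp_lin[OF f] c] by (simp add: lin_restrict[OF pgl_vs[OF X]])
  fix x assume x: "x \<in> lo X"
  interpret Y1: vectorspace K "loV Y" by (rule pgl_vs[OF Y]) simp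
  obtain y where y: "y \<in> lo Y" "\<And>b. b \<in> carrier B \<Longrightarrow> f (fm X b x) = fm Y b y" using hp_fm[OF f x] by blast
  show "\<exists>y\<in>lo Y. \<forall>b\<in>carrier B. (\<lambda>v\<in>hi X. c \<odot>\<^bsub>hiV Y\<^esub> f v) (fm X b x) = fm Y b y"
    using y c fm_closed[OF X _ x] lin_smult[OF fm_lin[OF Y]] by (intro bexI[of _ "c \<odot>\<^bsub>loV Y\<^esub> y"]) auto
qed simp

lemma hp_zero:
  assumes X: "pgl K B X" and Y: "pgl K B Y"
  shows "(\<lambda>v\<in>hi X. \<zero>\<^bsub>hiV Y\<^esub>) \<in> hp K B X Y"
  using hom_hp[OF X Y hom_zero_closed[OF X Y]] by simp

lemma fraction_kap:
  assumes W: "pgl K B W" and X: "pgl K B X" and Y: "pgl K B Y"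
    and s: "s \<in> SG K B W X" and f: "f \<in> phom K B W Y"
  shows "zcl K B X Y [Bwd W X s, Fwd W Y f] =
    kap K B X Y (\<lambda>v\<in>hi X. f (At 0) (inv_into (hi W) (s (At 0)) v))"
    and "(\<lambda>v\<in>hi X. f (At 0) (inv_into (hi W) (s (At 0)) v)) \<in> hp K B X Y"
proof -
  have z: "zz K B X Y [Bwd W X s, Fwd W Y f]"
    using assms by (intro zigzag.intros) simp_all
  show "zcl K B X Y [Bwd W X s, Fwd W Y f] =
    kap K B X Y (\<lambda>v\<in>hi X. f (At 0) (inv_into (hi W) (s (At 0)) v))"
    unfolding zz_class_kap[OF z] by (rule kap_cong) simp
  show "(\<lambda>v\<in>hi X. f (At 0) (inv_into (hi W) (s (At 0)) v)) \<in> hp K B X Y"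
    using zigzag_hp[OF z] by simp
qed

text \<open>The description in \<open>loc_add\<close> needs a common denominator and independence of
  it. A denominator is obtained by iterating the construction: the graph of \<open>g\<close>,
  regarded on the graph of \<open>f\<close>. Its space at 0 is still X(0), and all projections to
  \<open>X\<close> are the identity there.\<close>

lemma loc_add_kap:
  assumes X: "pgl K B X" and Y: "pgl K B Y" and f: "f \<in> hp K B X Y" and g: "g \<in> hp K B X Y"
  shows "loc_add (PG K B) (SG K B) X Y (kap K B X Y f) (kap K B X Y g) =
    kap K B X Y (\<lambda>v\<in>hi X. f v \<oplus>\<^bsub>hiV Y\<^esub> g v)"
  unfolding loc_add_def
proof (rule the_equality)
  let ?G = "gph K B X Y f" and ?g1 = "gph1 X Y" and ?g2 = "gph2 B X Y f"
  note G = gph_pgl[OF X Y f] and g1 = gph1_SG[OF X Y f] and g2 = gph2_Hom[OF X Y f]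
  have g1': "?g1 \<in> phom K B ?G X" using g1 unfolding SG_iff[OF G X] by blast
  let ?g = "compose (hi ?G) g (?g1 (At 0))"
  have k: "?g \<in> hp K B ?G Y" by (rule hp_comp[OF G X hom_hp[OF G X g1'] g])
  let ?P = "gph K B ?G Y ?g" and ?p1 = "gph1 ?G Y" and ?p2 = "gph2 B ?G Y ?g"
  note P = gph_pgl[OF G Y k] and p1 = gph1_SG[OF G Y k] and p2 = gph2_Hom[OF G Y k]
  have p1': "?p1 \<in> phom K B ?P ?G" using p1 unfolding SG_iff[OF P G] by blast
  let ?s = "Cmp (PG K B) ?P ?G X ?g1 ?p1" and ?f = "Cmp (PG K B) ?P ?G Y ?g2 ?p1"
  have s: "?s \<in> SG K B ?P X" by (rule ze_Bwd_comp(1)[OF P G X p1 g1])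
  have f': "?f \<in> phom K B ?P Y" by (rule Cmp_closed[OF P G Y p1' g2])
  have hiP: "hi ?P = hi X" by (simp add: gph_fob)
  have s0: "?s (At 0) v = v" if "v \<in> hi X" for v using that by (simp add: compose_def gph_fob gph1_def)
  have inv: "inv_into (hi ?P) (?s (At 0)) v = v" if "v \<in> hi X" for v
  proof -
    have "inj_on (?s (At 0)) (hi X)" by (rule inj_onI) (simp add: s0 del: PG_simps)
    from inv_into_f_f[OF this that] show ?thesis unfolding s0[OF that] hiP .
  qed
  have f0: "?f (At 0) v = f v" if "v \<in> hi X" for v using that by (simp add: compose_def gph_fob gph1_def gph2_def)
  have p20: "?p2 (At 0) v = g v" if "v \<in> hi X" for v using that by (simp add: compose_def gph_fob gph1_def gph2_def)
  have fg0: "(?f \<oplus>\<^bsub>Hom (PG K B) ?P Y\<^esub> ?p2) (At 0) v = f v \<oplus>\<^bsub>hiV Y\<^esub> g v" if "v \<in> hi X" for v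
  proof -
    have "(?f \<oplus>\<^bsub>Hom (PG K B) ?P Y\<^esub> ?p2) (At 0) v = ?f (At 0) v \<oplus>\<^bsub>hiV Y\<^esub> ?p2 (At 0) v"
      using that hiP by (simp del: PG_simps(4) add: PG_simps(2))
    then show ?thesis using f0[OF that] p20[OF that] by simp
  qed
  have c: "kap K B X Y f = zcl K B X Y [Bwd ?P X ?s, Fwd ?P Y ?f]"
    "kap K B X Y g = zcl K B X Y [Bwd ?P X ?s, Fwd ?P Y ?p2]"
    "kap K B X Y (\<lambda>v\<in>hi X. f v \<oplus>\<^bsub>hiV Y\<^esub> g v) =
      zcl K B X Y [Bwd ?P X ?s, Fwd ?P Y (?f \<oplus>\<^bsub>Hom (PG K B) ?P Y\<^esub> ?p2)]"
    unfolding fraction_kap(1)[OF P X Y s f'] fraction_kap(1)[OF P X Y s p2]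
      fraction_kap(1)[OF P X Y s hom_add_closed[OF P Y f' p2]]
    by (rule kap_cong; simp only: restrict_apply' inv f0 p20 fg0)+
  have "?P \<in> Ob (PG K B)" using P by simp
  then show "\<exists>W\<in>Ob (PG K B). \<exists>s\<in>SG K B W X. \<exists>f'\<in>phom K B W Y. \<exists>g'\<in>phom K B W Y.
      kap K B X Y f = zcl K B X Y [Bwd W X s, Fwd W Y f'] \<and>
      kap K B X Y g = zcl K B X Y [Bwd W X s, Fwd W Y g'] \<and>
      kap K B X Y (\<lambda>v\<in>hi X. f v \<oplus>\<^bsub>hiV Y\<^esub> g v) =
        zcl K B X Y [Bwd W X s, Fwd W Y (f' \<oplus>\<^bsub>Hom (PG K B) W Y\<^esub> g')]"
    using s f' p2 c by blast
next
  fix z assume "\<exists>W\<in>Ob (PG K B). \<exists>s\<in>SG K B W X. \<exists>f'\<in>phom K B W Y. \<exists>g'\<in>phom K B W Y.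
      kap K B X Y f = zcl K B X Y [Bwd W X s, Fwd W Y f'] \<and>
      kap K B X Y g = zcl K B X Y [Bwd W X s, Fwd W Y g'] \<and>
      z = zcl K B X Y [Bwd W X s, Fwd W Y (f' \<oplus>\<^bsub>Hom (PG K B) W Y\<^esub> g')]"
  then obtain W s f' g' where W: "pgl K B W" and s: "s \<in> SG K B W X"
    and f': "f' \<in> phom K B W Y" and g': "g' \<in> phom K B W Y"
    and e: "kap K B X Y f = zcl K B X Y [Bwd W X s, Fwd W Y f']"
      "kap K B X Y g = zcl K B X Y [Bwd W X s, Fwd W Y g']"
      "z = zcl K B X Y [Bwd W X s, Fwd W Y (f' \<oplus>\<^bsub>Hom (PG K B) W Y\<^esub> g')]" by auto
  \<comment> \<open>Any other common denominator leads to the same sum, because injectivity of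
    \<open>kap\<close> recovers \<open>f\<close> and \<open>g\<close> from the two
    fractions.\<close>
  note fe = kap_inj[OF X Y f fraction_kap(2)[OF W X Y s f'] e(1)[unfolded fraction_kap(1)[OF W X Y s f']]]
  note ge = kap_inj[OF X Y g fraction_kap(2)[OF W X Y s g'] e(2)[unfolded fraction_kap(1)[OF W X Y s g']]]
  have "inv_into (hi W) (s (At 0)) v \<in> hi W" if "v \<in> hi X" for v
    using that s unfolding SG_iff[OF W X] by (auto simp: bij_betw_def intro: inv_into_into)
  then show "z = kap K B X Y (\<lambda>v\<in>hi X. f v \<oplus>\<^bsub>hiV Y\<^esub> g v)"
    unfolding e(3) fraction_kap(1)[OF W X Y s hom_add_closed[OF W Y f' g']]
    by (intro kap_cong) (simp add: fe ge)
qed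

lemma loc_smult_kap:
  assumes X: "pgl K B X" and Y: "pgl K B Y" and f: "f \<in> hp K B X Y" and c: "c \<in> carrier K"
  shows "c \<odot>\<^bsub>loc_hom (PG K B) (SG K B) X Y\<^esub> kap K B X Y f = kap K B X Y (\<lambda>v\<in>hi X. c \<odot>\<^bsub>hiV Y\<^esub> f v)"
proof -
  let ?c = "c \<odot>\<^bsub>Hom (PG K B) Y Y\<^esub> Idn (PG K B) Y"
  have cc: "?c \<in> phom K B Y Y" by (rule hom_scale_closed[OF Y Y Idn_closed[OF Y] c])
  have "c \<odot>\<^bsub>loc_hom (PG K B) (SG K B) X Y\<^esub> kap K B X Y f =
      loc_comp (PG K B) (SG K B) X Y Y (kap K B Y Y (?c (At 0))) (kap K B X Y f)"
    using loc_Q_kap[OF Y Y cc] by (simp add: loc_hom_def)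
  also have "\<dots> = kap K B X Y (compose (hi X) (?c (At 0)) f)"
    by (rule loc_comp_kap[OF X Y Y f hom_hp[OF Y Y cc]])
  also have "\<dots> = kap K B X Y (\<lambda>v\<in>hi X. c \<odot>\<^bsub>hiV Y\<^esub> f v)"
    by (rule kap_cong) (simp add: compose_def hp_closed[OF f])
  finally show ?thesis .
qed

end

section \<open>The localized category in terms of maps at index 0\<close>

abbreviation GL where "GL K B \<equiv> Glid K B (trivial_filtration K B) {-1, 0}"

abbreviation ghom where "ghom K B X Y \<equiv> carrier (Hom (GL K B) X Y)"

lemma GL_simps [simp]:
  "Ob (GL K B) = {M. pgl K B M}" "Hom (GL K B) = loc_hom (PG K B) (SG K B)"
  "Idn (GL K B) X = loc_Q (PG K B) (SG K B) X X (Idn (PG K B) X)"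
  "Cmp (GL K B) = loc_comp (PG K B) (SG K B)"
  "TenO (GL K B) = TenO (PG K B)" "TenA (GL K B) = loc_tensor (PG K B) (SG K B)"
  "Unt (GL K B) = Unt (PG K B)"
  by (simp_all add: Glid_def localization_def)

context bialgebra
begin

lemma GL_hom:
  assumes X: "pgl K B X" and Y: "pgl K B Y"
  shows GL_carrier: "ghom K B X Y = kap K B X Y ` hp K B X Y"
    and GL_zero: "\<zero>\<^bsub>Hom (GL K B) X Y\<^esub> = kap K B X Y (\<lambda>v\<in>hi X. \<zero>\<^bsub>hiV Y\<^esub>)"
    and GL_add: "f \<in> hp K B X Y \<Longrightarrow> g \<in> hp K B X Y \<Longrightarrow>
      kap K B X Y f \<oplus>\<^bsub>Hom (GL K B) X Y\<^esub> kap K B X Y g = kap K B X Y (\<lambda>v\<in>hi X. f v \<oplus>\<^bsub>hiV Y\<^esub> g v)"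
    and GL_smult: "f \<in> hp K B X Y \<Longrightarrow> c \<in> carrier K \<Longrightarrow>
      c \<odot>\<^bsub>Hom (GL K B) X Y\<^esub> kap K B X Y f = kap K B X Y (\<lambda>v\<in>hi X. c \<odot>\<^bsub>hiV Y\<^esub> f v)"
    and GL_id: "Idn (GL K B) X = kap K B X X (\<lambda>v\<in>hi X. v)"
proof -
  show "ghom K B X Y = kap K B X Y ` hp K B X Y" using loc_carrier[OF X Y] by simp
  show "\<zero>\<^bsub>Hom (GL K B) X Y\<^esub> = kap K B X Y (\<lambda>v\<in>hi X. \<zero>\<^bsub>hiV Y\<^esub>)"
    using loc_Q_kap[OF X Y hom_zero_closed[OF X Y]] by (simp add: loc_hom_def)
  show "f \<in> hp K B X Y \<Longrightarrow> g \<in> hp K B X Y \<Longrightarrow>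
      kap K B X Y f \<oplus>\<^bsub>Hom (GL K B) X Y\<^esub> kap K B X Y g = kap K B X Y (\<lambda>v\<in>hi X. f v \<oplus>\<^bsub>hiV Y\<^esub> g v)"
    using loc_add_kap[OF X Y] by (simp add: loc_hom_def)
  show "f \<in> hp K B X Y \<Longrightarrow> c \<in> carrier K \<Longrightarrow>
      c \<odot>\<^bsub>Hom (GL K B) X Y\<^esub> kap K B X Y f = kap K B X Y (\<lambda>v\<in>hi X. c \<odot>\<^bsub>hiV Y\<^esub> f v)"
    using loc_smult_kap[OF X Y] by simp
  show "Idn (GL K B) X = kap K B X X (\<lambda>v\<in>hi X. v)"
    using loc_Q_kap[OF X X Idn_closed[OF X]] by simp
qed

lemma GL_comp:
  "pgl K B X \<Longrightarrow> pgl K B Y \<Longrightarrow> pgl K B Z \<Longrightarrow> f \<in> hp K B X Y \<Longrightarrow> g \<in> hp K B Y Z \<Longrightarrow>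
    Cmp (GL K B) X Y Z (kap K B Y Z g) (kap K B X Y f) = kap K B X Z (compose (hi X) g f)"
  using loc_comp_kap by simp

text \<open>\<open>kev\<close> embeds the Hom-space into the space of linear maps at 0, from which
  the axioms are inherited.\<close>

lemma GL_vs:
  assumes X: "pgl K B X" and Y: "pgl K B Y"
  shows "vectorspace K (Hom (GL K B) X Y)"
proof (rule vectorspace_transport[OF vect_hom_vs[OF pgl_vs[OF X] pgl_vs[OF Y]], where g = "kev X"])
  note C = GL_carrier[OF X Y] and ke = kev_kap[OF X Y] and z = hp_zero[OF X Y] and Z = GL_zero[OF X Y]
  note a = GL_add[OF X Y] and s = GL_smult[OF X Y] and ha = hp_add[OF X Y] and hs = hp_scale[OF X Y]
  show "inj_on (kev X) (ghom K B X Y)" unfolding C by (rule inj_onI) (auto simp: ke)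
  show "kev X x \<in> carrier (vect_hom K (hiV X) (hiV Y))" if "x \<in> ghom K B X Y" for x
    using that unfolding C by (auto simp: ke vect_hom_carrier pgl_vs[OF X] pgl_vs[OF Y] hp_lin hp_ext)
  show "\<zero>\<^bsub>Hom (GL K B) X Y\<^esub> \<in> ghom K B X Y" unfolding C Z using z by (rule imageI)
  show "kev X \<zero>\<^bsub>Hom (GL K B) X Y\<^esub> = \<zero>\<^bsub>vect_hom K (hiV X) (hiV Y)\<^esub>"
    unfolding Z ke[OF z] by simp
next
  note C = GL_carrier[OF X Y] and ke = kev_kap[OF X Y]
  note a = GL_add[OF X Y] and s = GL_smult[OF X Y] and ha = hp_add[OF X Y] and hs = hp_scale[OF X Y]
  fix x y assume "x \<in> ghom K B X Y" "y \<in> ghom K B X Y"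
  then obtain f g where f: "f \<in> hp K B X Y" "x = kap K B X Y f" and g: "g \<in> hp K B X Y" "y = kap K B X Y g"
    unfolding C by auto
  show "x \<oplus>\<^bsub>Hom (GL K B) X Y\<^esub> y \<in> ghom K B X Y"
    unfolding C f g a[OF f(1) g(1)] using ha[OF f(1) g(1)] by (rule imageI)
  show "kev X (x \<oplus>\<^bsub>Hom (GL K B) X Y\<^esub> y) = kev X x \<oplus>\<^bsub>vect_hom K (hiV X) (hiV Y)\<^esub> kev X y"
    unfolding f g a[OF f(1) g(1)] ke[OF f(1)] ke[OF g(1)] ke[OF ha[OF f(1) g(1)]] by simp
next
  note C = GL_carrier[OF X Y] and ke = kev_kap[OF X Y]
  note s = GL_smult[OF X Y] and hs = hp_scale[OF X Y]
  fix c x assume c: "c \<in> carrier K" and "x \<in> ghom K B X Y"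
  then obtain f where f: "f \<in> hp K B X Y" "x = kap K B X Y f" unfolding C by auto
  show "c \<odot>\<^bsub>Hom (GL K B) X Y\<^esub> x \<in> ghom K B X Y"
    unfolding C f s[OF f(1) c] using hs[OF f(1) c] by (rule imageI)
  show "kev X (c \<odot>\<^bsub>Hom (GL K B) X Y\<^esub> x) = c \<odot>\<^bsub>vect_hom K (hiV X) (hiV Y)\<^esub> kev X x"
    unfolding f s[OF f(1) c] ke[OF f(1)] ke[OF hs[OF f(1) c]] by simp
qed simp_all

end

section \<open>Tensor products of gliders\<close>

lemma tens_lift_lin_arg:
  assumes "vectorspace K V" "vectorspace K Z" "\<And>p q. (p, q) \<in> set l \<Longrightarrow> lin K V Z (jx p q)"
  shows "lin K V Z (\<lambda>x. tens_lift Z (\<lambda>p q. jx p q x) l)"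
  using assms(3)
proof (induction l)
  case Nil show ?case using lin_const_zero[OF assms(2)] by simp
next
  case (Cons a l)
  have "lin K V Z (\<lambda>x. jx (fst a) (snd a) x \<oplus>\<^bsub>Z\<^esub> tens_lift Z (\<lambda>p q. jx p q x) l)"
    by (rule lin_plus[OF assms(1,2)]) (use Cons in auto)
  then show ?case by simp
qed

lemma TenA_bij:
  assumes "vectorspace K V" "vectorspace K W" "vectorspace K V'" "vectorspace K W'"
    "lin K V V' f" "lin K W W' g" "bij_betw f (carrier V) (carrier V')" "bij_betw g (carrier W) (carrier W')"
  shows "bij_betw (vten K V V' W W' f g) (carrier (vect_tensor K V W)) (carrier (vect_tensor K V' W'))"
proof -
  let ?f = "inv_into (carrier V) f" and ?g = "inv_into (carrier W) g"
  have f: "inj_on f (carrier V)" "f ` carrier V = carrier V'" and g: "inj_on g (carrier W)" "g ` carrier W = carrier W'"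
    using assms(7,8) by (auto simp: bij_betw_def)
  have lf: "lin K V' V ?f" by (rule lin_inv_into[OF assms(1,5) f(1) _ lin_id]) (simp add: f(2))
  have lg: "lin K W' W ?g" by (rule lin_inv_into[OF assms(2,6) g(1) _ lin_id]) (simp add: g(2))
  have 1: "vten K V' V W' W ?f ?g (vten K V V' W W' f g x) = x"
    if "x \<in> carrier (vect_tensor K V W)" for x
    by (rule TenA_left_inverse[OF assms(1-6) lf lg _ _ that]) (simp_all add: f(1) g(1))
  have 2: "vten K V V' W W' f g (vten K V' V W' W ?f ?g y) = y"
    if "y \<in> carrier (vect_tensor K V' W')" for y
    by (rule TenA_left_inverse[OF assms(3,4,1,2) lf lg assms(5,6) _ _ that]) (simp_all add: f_inv_into_f f(2) g(2))
  note L = TenA_lin[OF assms(1-6)] and L' = TenA_lin[OF assms(3,4,1,2) lf lg]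
  show "bij_betw (vten K V V' W W' f g) (carrier (vect_tensor K V W)) (carrier (vect_tensor K V' W'))"
    by (rule bij_betwI[where g = "vten K V' V W' W ?f ?g"]) (auto simp: 1 2 lin_closed[OF L] lin_closed[OF L'])
qed

lemma hp_restrictD:
  assumes "(\<lambda>v\<in>hi M. h v) \<in> hp K B M N" "f \<in> extensional (hi M)" "\<And>v. v \<in> hi M \<Longrightarrow> h v = f v"
  shows "f \<in> hp K B M N"
proof -
  have "f = (\<lambda>v\<in>hi M. h v)" using assms(2,3) by (intro ext_eqI[of _ "hi M"]) simp_all
  then show ?thesis using assms(1) by simp
qed

definition ten_V :: "('k, 'r) ring_scheme \<Rightarrow> ('k, 'b, 'a) glider \<Rightarrow> ('k, 'b, 'a) glider \<Rightarrow> idx \<Rightarrow> ('k, 'a) space"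
  where "ten_V K M N ix = vect_tensor K (fob M ix) (fob N ix)"

definition ten_i where
  "ten_i K B M N ix =
     vten K (fob M ix) (inV M) (fob N ix) (inV N) (gi B M ix) (gi B N ix)"

text \<open>At infinity all of \<open>B\<close> acts, so \<Delta>(b) can be used as it stands. The
  representative chosen in \<open>glider_tensor_act\<close> is compared with it in
  \<open>ten_far\<close>.\<close>

definition ten_a where
  "ten_a K B M N b x = tens_lift (ten_V K M N Infty)
     (\<lambda>p q. vten K (inV M) (inV M) (inV N) (inV N) (ga M p) (ga N q) x) (comult B b)"

abbreviation ten where "ten K B \<equiv> TenO (PG K B)"

lemma ten_simps:
  "ix \<in> idxs \<Longrightarrow> fob (ten K B M N) ix = ten_V K M N ix"
  "ix \<in> idxs \<Longrightarrow> jx \<in> idxs \<Longrightarrow> b \<in> fh K B ix jx \<Longrightarrow>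
     far (ten K B M N) ix jx b = glider_tensor_act K B (trivial_filtration K B) M N ix jx b"
  by (simp_all add: mk_glider_def ten_V_def)

context bialgebra
begin

lemma comult_lin: "lin K B (tensor K B B) (comult B)"
  using comult_linear by (simp add: linear_map_iff)

lemma comult_set: "b \<in> carrier B \<Longrightarrow> set (comult B b) \<subseteq> carrier B \<times> carrier B"
  using lin_closed[OF comult_lin] tensor_carrier[OF vs_B vs_B] by blast

text \<open>Guarantees that the choice in \<open>glider_tensor_act\<close> succeeds. Only the small
  Hom-spaces require a different list: \<Delta>(c 1) is the class of the single term c 1 \<otimes>
  1, and \<Delta>(0) that of the empty sum.\<close>

lemma comult_rep:
  assumes i: "ix \<in> idxs" "jx \<in> idxs" and b: "b \<in> fh K B ix jx"
  obtains l where "tens_eq K B B (comult B b) l" "set l \<subseteq> fh K B ix jx \<times> fh K B ix jx"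
proof (cases rule: fh_cases[OF i])
  case 1
  then show ?thesis using that[of "comult B b"] comult_set b by (auto intro: te_refl)
next
  case 2
  then show ?thesis using that[of "comult B b"] comult_set b by (auto intro: te_refl)
next
  case 3
  then obtain c where c: "c \<in> carrier K" "b = c \<odot>\<^bsub>B\<^esub> \<one>\<^bsub>B\<^esub>" using b fh_diag[OF i(1)] by auto
  have "comult B b = c \<odot>\<^bsub>tensor K B B\<^esub> tens_nf K B B [(\<one>\<^bsub>B\<^esub>, \<one>\<^bsub>B\<^esub>)]"
    using lin_smult[OF comult_lin c(1)] by (simp add: c(2) comult_one pure_tensor_def)
  also have "\<dots> = tens_nf K B B [(b, \<one>\<^bsub>B\<^esub>)]" using c by (subst tensor_smult_nf[OF vs_B vs_B]) auto
  finally have "comult B b = tens_nf K B B [(b, \<one>\<^bsub>B\<^esub>)]" .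
  moreover have "set [(b, \<one>\<^bsub>B\<^esub>)] \<subseteq> carrier B \<times> carrier B" using c by simp
  ultimately have "tens_eq K B B (comult B b) [(b, \<one>\<^bsub>B\<^esub>)]" using te_sym[OF tens_eq_nf[OF vs_B vs_B]] by simp
  then show ?thesis using that[of "[(b, \<one>\<^bsub>B\<^esub>)]"] b fh_one[OF i] 3 by simp
next
  case 4
  then have "b = \<zero>\<^bsub>B\<^esub>" using b fh_zero[OF i] by simp
  then have "comult B b = tens_nf K B B []" using lin_zero[OF vs_B vs_BB comult_lin] by (simp add: tensor_zero[OF vs_B vs_B])
  then have "tens_eq K B B (comult B b) []" using te_sym[OF tens_eq_nf[OF vs_B vs_B, of "[]"]] by simp
  then show ?thesis using that[of "[]"] by simp
qed

context
  fixes M N :: "('k, 'b, 'd) glider"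
  assumes M: "pgl K B M" and N: "pgl K B N"
begin

lemma ten_V_vs: "ix \<in> idxs \<Longrightarrow> vectorspace K (ten_V K M N ix)"
  unfolding ten_V_def by (rule vt_vs[OF pgl_vs[OF M] pgl_vs[OF N]])

lemma ten_i_lin: "ix \<in> idxs \<Longrightarrow> lin K (ten_V K M N ix) (ten_V K M N Infty) (ten_i K B M N ix)"
  unfolding ten_V_def ten_i_def
  by (rule TenA_lin) (simp_all add: pgl_vs[OF M] pgl_vs[OF N] gi_lin[OF M] gi_lin[OF N])

lemma ten_far_lin:
  assumes "ix \<in> idxs" "jx \<in> idxs" "p \<in> fh K B ix jx" "q \<in> fh K B ix jx"
  shows "lin K (ten_V K M N ix) (ten_V K M N jx)
    (vten K (fob M ix) (fob M jx) (fob N ix) (fob N jx) (far M ix jx p) (far N ix jx q))"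
  unfolding ten_V_def using pgl_hom[OF M assms(1-3)] pgl_hom[OF N assms(1,2,4)]
  by (intro TenA_lin) (simp_all add: pgl_vs[OF M] pgl_vs[OF N] assms)

lemma ten_ga_lin:
  assumes "p \<in> carrier B" "q \<in> carrier B"
  shows "lin K (ten_V K M N Infty) (ten_V K M N Infty)
    (vten K (inV M) (inV M) (inV N) (inV N) (ga M p) (ga N q))"
  unfolding ten_V_def
  by (intro TenA_lin) (simp_all add: pgl_vs[OF M] pgl_vs[OF N] assms ga_lin[OF M] ga_lin[OF N])

lemma ten_a_bilin:
  assumes "x \<in> carrier (ten_V K M N Infty)"
  shows "bilin K B B (ten_V K M N Infty)
    (\<lambda>p q. vten K (inV M) (inV M) (inV N) (inV N) (ga M p) (ga N q) x)"
  using assms unfolding ten_V_def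
  by (intro TenA_act_bilin)
     (simp_all add: pgl_vs[OF M] pgl_vs[OF N] vs_B ga_lin[OF M] ga_lin[OF N] ga_lin2[OF M] ga_lin2[OF N])

text \<open>On each term p \<otimes> q the embedding into infinity turns the action between two
  indices into the action at infinity, by \<open>pgl_far\<close> for both factors; linearity extends
  this to sums.\<close>

lemma ten_i_far:
  assumes i: "ix \<in> idxs" "jx \<in> idxs" and l: "set l \<subseteq> fh K B ix jx \<times> fh K B ix jx" and x: "x \<in> carrier (ten_V K M N ix)"
  defines "y \<equiv> tens_lift (ten_V K M N jx) (\<lambda>p q. vten K (fob M ix) (fob M jx) (fob N ix) (fob N jx)
      (far M ix jx p) (far N ix jx q) x) l"
  shows "y \<in> carrier (ten_V K M N jx)"
    "ten_i K B M N jx y = tens_lift (ten_V K M N Infty) (\<lambda>p q. vten K (inV M) (inV M)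
      (inV N) (inV N) (ga M p) (ga N q) (ten_i K B M N ix x)) l"
proof -
  note vM = pgl_vs[OF M] and vN = pgl_vs[OF N]
  have c: "vten K (fob M ix) (fob M jx) (fob N ix) (fob N jx) (far M ix jx p) (far N ix jx q) x
      \<in> carrier (ten_V K M N jx)" if "(p, q) \<in> set l" for p q
    using that l by (intro lin_closed[OF ten_far_lin[OF i] x]) auto
  show "y \<in> carrier (ten_V K M N jx)" unfolding y_def by (rule tens_lift_closed[OF ten_V_vs[OF i(2)] c])
  have "ten_i K B M N jx y = tens_lift (ten_V K M N Infty) (\<lambda>p q. ten_i K B M N jx
      (vten K (fob M ix) (fob M jx) (fob N ix) (fob N jx) (far M ix jx p) (far N ix jx q) x)) l"
    unfolding y_def by (rule tens_lift_hom[OF ten_V_vs[OF i(2)] ten_V_vs ten_i_lin[OF i(2)] c]) simp_all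
  also have "\<dots> = tens_lift (ten_V K M N Infty) (\<lambda>p q. vten K (inV M) (inV M)
      (inV N) (inV N) (ga M p) (ga N q) (ten_i K B M N ix x)) l"
  proof (rule tens_lift_cong)
    fix p q assume "(p, q) \<in> set l"
    then have p: "p \<in> fh K B ix jx" "p \<in> carrier B" and q: "q \<in> fh K B ix jx" "q \<in> carrier B"
      using l fh_sub[OF i] by auto
    have x': "x \<in> carrier (vect_tensor K (fob M ix) (fob N ix))" using x by (simp add: ten_V_def)
    have lf: "lin K (fob M ix) (fob M jx) (far M ix jx p)" "lin K (fob N ix) (fob N jx) (far N ix jx q)"
      using pgl_hom[OF M i p(1)] pgl_hom[OF N i q(1)] by simp_all
    have "ten_i K B M N jx (vten K (fob M ix) (fob M jx) (fob N ix) (fob N jx) (far M ix jx p) (far N ix jx q) x) =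
      vten K (fob M ix) (inV M) (fob N ix) (inV N)
        (\<lambda>v. gi B M jx (far M ix jx p v)) (\<lambda>v. gi B N jx (far N ix jx q v)) x"
      unfolding ten_i_def by (rule TenA_comp[OF _ _ _ _ _ _ lf gi_lin[OF M i(2)] gi_lin[OF N i(2)] x']) (simp_all add: vM vN i)
    also have "\<dots> = vten K (fob M ix) (inV M) (fob N ix) (inV N)
        (\<lambda>v. ga M p (gi B M ix v)) (\<lambda>v. ga N q (gi B N ix v)) x"
      by (rule fun_cong[OF TenA_cong]) (simp_all add: vM vN i pgl_far(2)[OF M i p(1)] pgl_far(2)[OF N i q(1)])
    also have "\<dots> = vten K (inV M) (inV M) (inV N) (inV N) (ga M p) (ga N q) (ten_i K B M N ix x)"
      unfolding ten_i_def
      by (rule TenA_comp[symmetric, OF _ _ _ _ _ _ gi_lin[OF M i(1)] gi_lin[OF N i(1)] ga_lin[OF M p(2)] ga_lin[OF N q(2)] x'])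
         (simp_all add: vM vN i)
    finally show "ten_i K B M N jx (vten K (fob M ix) (fob M jx) (fob N ix) (fob N jx) (far M ix jx p) (far N ix jx q) x) =
      vten K (inV M) (inV M) (inV N) (inV N) (ga M p) (ga N q) (ten_i K B M N ix x)" .
  qed
  finally show "ten_i K B M N jx y = tens_lift (ten_V K M N Infty) (\<lambda>p q. vten K (inV M) (inV M)
      (inV N) (inV N) (ga M p) (ga N q) (ten_i K B M N ix x)) l" .
qed

lemma ten_a_lin: "b \<in> carrier B \<Longrightarrow> lin K (ten_V K M N Infty) (ten_V K M N Infty) (ten_a K B M N b)"
  unfolding ten_a_def using comult_set[of b] by (intro tens_lift_lin_arg ten_V_vs ten_ga_lin) auto

text \<open>Here multiplicativity of the comultiplication enters: \<Delta>(ab) is expanded into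
  products of the terms of \<Delta>(a) and \<Delta>(b), which act one after the other.\<close>

lemma ten_a_mult:
  assumes a: "a \<in> carrier B" and b: "b \<in> carrier B" and x: "x \<in> carrier (ten_V K M N Infty)"
  shows "ten_a K B M N (a \<otimes>\<^bsub>B\<^esub> b) x = ten_a K B M N a (ten_a K B M N b x)"
proof -
  let ?Z = "ten_V K M N Infty" and ?T = "tensor K B B"
  let ?t = "\<lambda>p q. vten K (inV M) (inV M) (inV N) (inV N) (ga M p) (ga N q)"
  have Z: "vectorspace K ?Z" by (rule ten_V_vs) simp
  have L: "lin K ?T ?Z (tens_lift ?Z (\<lambda>p q. ?t p q x))" by (rule tens_lift_lin[OF vs_B vs_B Z ten_a_bilin[OF x]])
  have ca: "p \<in> carrier B \<and> q \<in> carrier B" if "(p, q) \<in> set (comult B a)" for p q using that comult_set[OF a] by auto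
  have cb: "p \<in> carrier B \<and> q \<in> carrier B" if "(p, q) \<in> set (comult B b)" for p q using that comult_set[OF b] by auto
  have pc: "pure_tensor K B B p q \<in> carrier ?T" if "p \<in> carrier B" "q \<in> carrier B" for p q
    by (rule bilin_closed[OF pure_tensor_bilin[OF vs_B vs_B] that])
  have "ten_a K B M N (a \<otimes>\<^bsub>B\<^esub> b) x = tens_lift ?Z (\<lambda>p q. ?t p q x) (tens_lift ?T
        (\<lambda>a1 a2. tens_lift ?T (\<lambda>b1 b2. pure_tensor K B B (a1 \<otimes>\<^bsub>B\<^esub> b1) (a2 \<otimes>\<^bsub>B\<^esub> b2)) (comult B b)) (comult B a))"
    unfolding ten_a_def comult_mult[OF a b] ..
  also have "\<dots> = tens_lift ?Z (\<lambda>a1 a2. tens_lift ?Z (\<lambda>p q. ?t p q x)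
      (tens_lift ?T (\<lambda>b1 b2. pure_tensor K B B (a1 \<otimes>\<^bsub>B\<^esub> b1) (a2 \<otimes>\<^bsub>B\<^esub> b2)) (comult B b))) (comult B a)"
    by (rule tens_lift_hom[OF vs_BB Z L]) (use ca cb in \<open>auto intro!: tens_lift_closed[OF vs_BB] pc\<close>)
  also have "\<dots> = tens_lift ?Z (\<lambda>a1 a2. ?t a1 a2 (ten_a K B M N b x)) (comult B a)"
  proof (rule tens_lift_cong)
    fix a1 a2 assume "(a1, a2) \<in> set (comult B a)"
    then have a12: "a1 \<in> carrier B" "a2 \<in> carrier B" using ca by auto
    have "tens_lift ?Z (\<lambda>p q. ?t p q x)
        (tens_lift ?T (\<lambda>b1 b2. pure_tensor K B B (a1 \<otimes>\<^bsub>B\<^esub> b1) (a2 \<otimes>\<^bsub>B\<^esub> b2)) (comult B b)) =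
      tens_lift ?Z (\<lambda>b1 b2. tens_lift ?Z (\<lambda>p q. ?t p q x) (pure_tensor K B B (a1 \<otimes>\<^bsub>B\<^esub> b1) (a2 \<otimes>\<^bsub>B\<^esub> b2))) (comult B b)"
      by (rule tens_lift_hom[OF vs_BB Z L]) (use a12 cb in \<open>auto intro!: pc\<close>)
    also have "\<dots> = tens_lift ?Z (\<lambda>b1 b2. ?t a1 a2 (?t b1 b2 x)) (comult B b)"
    proof (rule tens_lift_cong)
      fix b1 b2 assume "(b1, b2) \<in> set (comult B b)"
      then have b12: "b1 \<in> carrier B" "b2 \<in> carrier B" using cb by auto
      have "tens_lift ?Z (\<lambda>p q. ?t p q x) (pure_tensor K B B (a1 \<otimes>\<^bsub>B\<^esub> b1) (a2 \<otimes>\<^bsub>B\<^esub> b2)) =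
          ?t (a1 \<otimes>\<^bsub>B\<^esub> b1) (a2 \<otimes>\<^bsub>B\<^esub> b2) x"
        using a12 b12 by (intro tens_lift_pure[OF vs_B vs_B Z ten_a_bilin[OF x]]) simp_all
      also have "\<dots> = vten K (inV M) (inV M) (inV N) (inV N)
          (\<lambda>v. ga M a1 (ga M b1 v)) (\<lambda>v. ga N a2 (ga N b2 v)) x"
        by (rule fun_cong[OF TenA_cong])
           (simp_all add: pgl_vs[OF M] pgl_vs[OF N] ga_mult[OF M] ga_mult[OF N] a12 b12)
      also have "\<dots> = ?t a1 a2 (?t b1 b2 x)"
        using x by (intro TenA_comp[symmetric])
          (simp_all add: ten_V_def pgl_vs[OF M] pgl_vs[OF N] ga_lin[OF M] ga_lin[OF N] a12 b12)
      finally show "tens_lift ?Z (\<lambda>p q. ?t p q x) (pure_tensor K B B (a1 \<otimes>\<^bsub>B\<^esub> b1) (a2 \<otimes>\<^bsub>B\<^esub> b2)) =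
          ?t a1 a2 (?t b1 b2 x)" .
    qed
    also have "\<dots> = ?t a1 a2 (ten_a K B M N b x)"
      unfolding ten_a_def
      by (rule tens_lift_hom[symmetric, OF Z Z ten_ga_lin[OF a12]]) (use cb x in \<open>auto intro: lin_closed[OF ten_ga_lin]\<close>)
    finally show "tens_lift ?Z (\<lambda>p q. ?t p q x)
        (tens_lift ?T (\<lambda>b1 b2. pure_tensor K B B (a1 \<otimes>\<^bsub>B\<^esub> b1) (a2 \<otimes>\<^bsub>B\<^esub> b2)) (comult B b)) =
      ?t a1 a2 (ten_a K B M N b x)" .
  qed
  finally show ?thesis by (simp add: ten_a_def)
qed

lemma ten_gdata: "gdata K B (ten_V K M N) (ten_i K B M N) (ten_a K B M N)"
  unfolding gdata_def
proof (intro conjI ballI ten_V_vs ten_i_lin ten_a_lin ten_a_mult)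
  note vM = pgl_vs[OF M] and vN = pgl_vs[OF N]
  show "inj_on (ten_i K B M N ix) (carrier (ten_V K M N ix))" if "ix \<in> idxs" for ix
    unfolding ten_i_def ten_V_def using that gi_inj[OF M that] gi_inj[OF N that]
    by (intro TenA_inj) (auto simp: vM vN gi_lin[OF M] gi_lin[OF N] inj_on_def)
  show "ten_i K B M N Infty x = x" if "x \<in> carrier (ten_V K M N Infty)" for x
    unfolding ten_i_def using that by (intro TenA_id) (simp_all add: vM vN gi_Infty[OF M] gi_Infty[OF N] ten_V_def)
  show "lin K B (ten_V K M N Infty) (\<lambda>b. ten_a K B M N b x)" if "x \<in> carrier (ten_V K M N Infty)" for x
    unfolding ten_a_def
    by (rule lin_comp[OF comult_lin tens_lift_lin[OF vs_B vs_B ten_V_vs ten_a_bilin[OF that]]]) simp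
  show "ten_a K B M N \<one>\<^bsub>B\<^esub> x = x" if x: "x \<in> carrier (ten_V K M N Infty)" for x
  proof -
    have "ten_a K B M N \<one>\<^bsub>B\<^esub> x = vten K (inV M) (inV M) (inV N) (inV N)
        (ga M \<one>\<^bsub>B\<^esub>) (ga N \<one>\<^bsub>B\<^esub>) x"
      unfolding ten_a_def comult_one by (rule tens_lift_pure[OF vs_B vs_B ten_V_vs ten_a_bilin[OF x]]) simp_all
    also have "\<dots> = x" using x by (intro TenA_id) (simp_all add: vM vN ga_one[OF M] ga_one[OF N] ten_V_def)
    finally show ?thesis .
  qed
  fix b x assume b: "b \<in> carrier B" and x: "x \<in> carrier (ten_V K M N (At (-1)))"
  have l: "set (comult B b) \<subseteq> fh K B (At (-1)) (At 0) \<times> fh K B (At (-1)) (At 0)" using comult_set[OF b] by simp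
  show "ten_a K B M N b (ten_i K B M N (At (-1)) x) \<in> ten_i K B M N (At 0) ` carrier (ten_V K M N (At 0))"
    unfolding ten_a_def ten_i_far(2)[OF idxs_mem(1) idxs_mem(2) l x, symmetric]
    by (rule imageI[OF ten_i_far(1)[OF idxs_mem(1) idxs_mem(2) l x]])
qed simp_all

text \<open>The chosen list is congruent to \<Delta>(b), so after the embedding into infinity, where
  the action is bilinear on all of \<open>B\<close>, both give the same value by
  \<open>tens_lift_eq\<close>.\<close>

lemma ten_far:
  assumes i: "ix \<in> idxs" "jx \<in> idxs" and b: "b \<in> fh K B ix jx" and x: "x \<in> carrier (ten_V K M N ix)"
  shows "far (ten K B M N) ix jx b \<in> extensional (carrier (ten_V K M N ix))"
    "far (ten K B M N) ix jx b x \<in> carrier (ten_V K M N jx)"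
    "ten_i K B M N jx (far (ten K B M N) ix jx b x) = ten_a K B M N b (ten_i K B M N ix x)"
proof -
  let ?t = "\<lambda>p q. vten K (fob M ix) (fob M jx) (fob N ix) (fob N jx) (far M ix jx p) (far N ix jx q)"
  let ?P = "\<lambda>l. tens_eq K B B (comult B b) l \<and> set l \<subseteq> fh K B ix jx \<times> fh K B ix jx"
  define l where "l = (SOME l. ?P l)"
  have P: "?P l" unfolding l_def by (rule someI_ex) (rule comult_rep[OF i b], blast)
  have H: "?t p q \<in> carrier (vect_hom K (ten_V K M N ix) (ten_V K M N jx))" if "(p, q) \<in> set l" for p q
    using that P ten_far_lin[OF i, of p q]
    by (auto simp: vect_hom_carrier ten_V_vs i) (simp add: ten_V_def TenA_ext)
  have f: "far (ten K B M N) ix jx b = tens_lift (vect_hom K (ten_V K M N ix) (ten_V K M N jx)) ?t l"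
    by (simp only: ten_simps(2)[OF i b] glider_tensor_act_def l_def ten_V_def)
  have "far (ten K B M N) ix jx b \<in> carrier (vect_hom K (ten_V K M N ix) (ten_V K M N jx))"
    unfolding f by (rule tens_lift_closed[OF vect_hom_vs[OF ten_V_vs[OF i(1)] ten_V_vs[OF i(2)]] H])
  then show "far (ten K B M N) ix jx b \<in> extensional (carrier (ten_V K M N ix))"
    by (simp add: vect_hom_carrier ten_V_vs i)
  have fx: "far (ten K B M N) ix jx b x = tens_lift (ten_V K M N jx) (\<lambda>p q. ?t p q x) l"
    unfolding f by (rule tens_lift_vect_hom[OF ten_V_vs[OF i(1)] ten_V_vs[OF i(2)] x H])
  show "far (ten K B M N) ix jx b x \<in> carrier (ten_V K M N jx)"
    unfolding fx by (rule ten_i_far(1)[OF i conjunct2[OF P] x])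
  have ix: "ten_i K B M N ix x \<in> carrier (ten_V K M N Infty)" by (rule lin_closed[OF ten_i_lin[OF i(1)] x])
  show "ten_i K B M N jx (far (ten K B M N) ix jx b x) = ten_a K B M N b (ten_i K B M N ix x)"
    unfolding fx ten_i_far(2)[OF i conjunct2[OF P] x] ten_a_def
    by (rule tens_lift_eq[OF vs_B vs_B ten_V_vs ten_a_bilin[OF ix] conjunct1[OF P], symmetric]) simp
qed

lemma ten_pgl: "pgl K B (ten K B M N)"
proof (rule pglI[OF ten_gdata])
  show "fob (ten K B M N) \<in> extensional idxs" by (simp add: mk_glider_def)
  show "far (ten K B M N) ix jx \<in> extensional {b. ix \<in> idxs \<and> jx \<in> idxs \<and> b \<in> fh K B ix jx}" for ix jx
    by (simp add: mk_glider_def)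
  fix ix jx b assume i: "ix \<in> idxs" "jx \<in> idxs" "b \<in> fh K B ix jx"
  interpret V: vectorspace K "ten_V K M N ix" by (rule ten_V_vs[OF i(1)])
  show "far (ten K B M N) ix jx b \<in> extensional (carrier (ten_V K M N ix))"
    by (rule ten_far(1)[OF i V.module.M.zero_closed])
next
  fix ix jx b x assume i: "ix \<in> idxs" "jx \<in> idxs" "b \<in> fh K B ix jx" "x \<in> carrier (ten_V K M N ix)"
  show "far (ten K B M N) ix jx b x \<in> carrier (ten_V K M N jx) \<and>
      ten_i K B M N jx (far (ten K B M N) ix jx b x) = ten_a K B M N b (ten_i K B M N ix x)"
    using ten_far(2,3)[OF i] by simp
qed (rule ten_simps(1))

lemma ten_gi: "ix \<in> idxs \<Longrightarrow> x \<in> carrier (ten_V K M N ix) \<Longrightarrow> gi B (ten K B M N) ix x = ten_i K B M N ix x"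
  and ten_ga: "b \<in> carrier B \<Longrightarrow> x \<in> carrier (ten_V K M N Infty) \<Longrightarrow> ga (ten K B M N) b x = ten_a K B M N b x"
proof -
  have fc: "far (ten K B M N) ix jx b x \<in> carrier (ten_V K M N jx) \<and>
      ten_i K B M N jx (far (ten K B M N) ix jx b x) = ten_a K B M N b (ten_i K B M N ix x)"
    if "ix \<in> idxs" "jx \<in> idxs" "b \<in> fh K B ix jx" "x \<in> carrier (ten_V K M N ix)" for ix jx b x
    using ten_far(2,3)[OF that] by simp
  show "ix \<in> idxs \<Longrightarrow> x \<in> carrier (ten_V K M N ix) \<Longrightarrow> gi B (ten K B M N) ix x = ten_i K B M N ix x"
    by (rule pglI_gi(1)[OF ten_gdata ten_simps(1) fc])
  show "b \<in> carrier B \<Longrightarrow> x \<in> carrier (ten_V K M N Infty) \<Longrightarrow> ga (ten K B M N) b x = ten_a K B M N b x"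
    by (rule pglI_gi(2)[OF ten_gdata ten_simps(1) fc])
qed

end

lemma TenA_hom:
  assumes M: "pgl K B M" and M': "pgl K B M'" and N: "pgl K B N" and N': "pgl K B N'"
    and f: "f \<in> phom K B M M'" and g: "g \<in> phom K B N N'"
  shows "TenA (PG K B) M M' N N' f g \<in> phom K B (ten K B M N) (ten K B M' N')"
proof (rule homI[OF ten_pgl[OF M N] ten_pgl[OF M' N']])
  note F = homD[OF M M' f] and G = homD[OF N N' g] and fc = hom_closed[OF M M' f] and gc = hom_closed[OF N N' g]
  note vs = pgl_vs[OF M] pgl_vs[OF M'] pgl_vs[OF N] pgl_vs[OF N']
  note gl = gi_lin[OF M] gi_lin[OF M'] gi_lin[OF N] gi_lin[OF N']
  let ?h = "TenA (PG K B) M M' N N' f g"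
  have h: "?h ix = vten K (fob M ix) (fob M' ix) (fob N ix) (fob N' ix) (f ix) (g ix)" if "ix \<in> idxs" for ix
    using that by simp
  have hl: "lin K (ten_V K M N ix) (ten_V K M' N' ix) (?h ix)" if "ix \<in> idxs" for ix
    unfolding h[OF that] ten_V_def by (intro TenA_lin vs that F(2) G(2))
  show "lin K (fob (ten K B M N) ix) (fob (ten K B M' N') ix) (?h ix)" if "ix \<in> idxs" for ix
    unfolding ten_simps(1)[OF that] by (rule hl[OF that])
  show "?h ix \<in> extensional (carrier (fob (ten K B M N) ix))" if "ix \<in> idxs" for ix
    unfolding ten_simps(1)[OF that] h[OF that] ten_V_def by (rule TenA_ext)
  show "?h Infty (gi B (ten K B M N) ix x) = gi B (ten K B M' N') ix (?h ix x)"
    if ix: "ix \<in> idxs" and "x \<in> carrier (fob (ten K B M N) ix)" for ix x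
  proof -
    have x: "x \<in> carrier (ten_V K M N ix)" using that(2) unfolding ten_simps(1)[OF ix] .
    then have x': "x \<in> carrier (vect_tensor K (fob M ix) (fob N ix))" by (simp add: ten_V_def)
    have "?h Infty (ten_i K B M N ix x) = vten K (fob M ix) (inV M') (fob N ix) (inV N')
        (\<lambda>v. f Infty (gi B M ix v)) (\<lambda>v. g Infty (gi B N ix v)) x"
      unfolding h[OF idxs_mem(3)] ten_i_def by (intro TenA_comp vs gl F(2) G(2) ix x' idxs_mem)
    also have "\<dots> = vten K (fob M ix) (inV M') (fob N ix) (inV N')
        (\<lambda>v. gi B M' ix (f ix v)) (\<lambda>v. gi B N' ix (g ix v)) x"
      by (rule fun_cong[OF TenA_cong]) (simp_all add: vs ix F(4) G(4))
    also have "\<dots> = ten_i K B M' N' ix (?h ix x)"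
      unfolding h[OF ix] ten_i_def by (intro TenA_comp[symmetric] vs gl F(2) G(2) ix x' idxs_mem)
    finally show ?thesis unfolding ten_gi[OF M N ix x] ten_gi[OF M' N' ix lin_closed[OF hl[OF ix] x]] .
  qed
  show "?h Infty (ga (ten K B M N) b x) = ga (ten K B M' N') b (?h Infty x)"
    if b: "b \<in> carrier B" and "x \<in> carrier (inV (ten K B M N))" for b x
  proof -
    have x: "x \<in> carrier (ten_V K M N Infty)" using that(2) unfolding ten_simps(1)[OF idxs_mem(3)] .
    then have x': "x \<in> carrier (vect_tensor K (inV M) (inV N))" by (simp add: ten_V_def)
    have cb: "p \<in> carrier B \<and> q \<in> carrier B" if "(p, q) \<in> set (comult B b)" for p q using that comult_set[OF b] by auto
    have "?h Infty (ten_a K B M N b x) = tens_lift (ten_V K M' N' Infty) (\<lambda>p q. ?h Infty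
       (vten K (inV M) (inV M) (inV N) (inV N) (ga M p) (ga N q) x)) (comult B b)"
      unfolding ten_a_def by (rule tens_lift_hom[OF ten_V_vs[OF M N] ten_V_vs[OF M' N'] hl])
        (use cb lin_closed[OF ten_ga_lin[OF M N] x] in auto)
    also have "\<dots> = tens_lift (ten_V K M' N' Infty) (\<lambda>p q. vten K (inV M') (inV M') (inV N') (inV N')
       (ga M' p) (ga N' q) (?h Infty x)) (comult B b)"
    proof (rule tens_lift_cong)
      fix p q assume "(p, q) \<in> set (comult B b)"
      then have pq: "p \<in> carrier B" "q \<in> carrier B" using cb by auto
      have "?h Infty (vten K (inV M) (inV M) (inV N) (inV N) (ga M p) (ga N q) x) =
        vten K (inV M) (inV M') (inV N) (inV N')
          (\<lambda>v. f Infty (ga M p v)) (\<lambda>v. g Infty (ga N q v)) x"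
        unfolding h[OF idxs_mem(3)] by (intro TenA_comp vs F(2) G(2) x' idxs_mem ga_lin[OF M pq(1)] ga_lin[OF N pq(2)])
      also have "\<dots> = vten K (inV M) (inV M') (inV N) (inV N')
          (\<lambda>v. ga M' p (f Infty v)) (\<lambda>v. ga N' q (g Infty v)) x"
        by (rule fun_cong[OF TenA_cong]) (simp_all add: vs F(5) G(5) pq)
      also have "\<dots> = vten K (inV M') (inV M') (inV N') (inV N') (ga M' p) (ga N' q) (?h Infty x)"
        unfolding h[OF idxs_mem(3)]
        by (intro TenA_comp[symmetric] vs F(2) G(2) x' idxs_mem ga_lin[OF M' pq(1)] ga_lin[OF N' pq(2)])
      finally show "?h Infty (vten K (inV M) (inV M) (inV N) (inV N) (ga M p) (ga N q) x) =
        vten K (inV M') (inV M') (inV N') (inV N') (ga M' p) (ga N' q) (?h Infty x)" .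
    qed
    also have "\<dots> = ten_a K B M' N' b (?h Infty x)" by (simp only: ten_a_def)
    finally show ?thesis unfolding ten_ga[OF M N b x] ten_ga[OF M' N' b lin_closed[OF hl[OF idxs_mem(3)] x]] .
  qed
qed simp

lemma TenA_SG:
  assumes M: "pgl K B M" and M': "pgl K B M'" and N: "pgl K B N" and N': "pgl K B N'"
    and f: "f \<in> SG K B M M'" and g: "g \<in> SG K B N N'"
  shows "TenA (PG K B) M M' N N' f g \<in> SG K B (ten K B M N) (ten K B M' N')"
proof -
  have f': "f \<in> phom K B M M'" "bij_betw (f (At (-1))) (lo M) (lo M')" "bij_betw (f (At 0)) (hi M) (hi M')"
    using f unfolding SG_iff[OF M M'] by blast+
  have g': "g \<in> phom K B N N'" "bij_betw (g (At (-1))) (lo N) (lo N')" "bij_betw (g (At 0)) (hi N) (hi N')"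
    using g unfolding SG_iff[OF N N'] by blast+
  note F = homD(2)[OF M M' f'(1)] and G = homD(2)[OF N N' g'(1)]
  note vs = pgl_vs[OF M] pgl_vs[OF N] pgl_vs[OF M'] pgl_vs[OF N']
  show ?thesis unfolding SG_iff[OF ten_pgl[OF M N] ten_pgl[OF M' N']]
  proof (intro conjI)
    show "TenA (PG K B) M M' N N' f g \<in> phom K B (ten K B M N) (ten K B M' N')"
      by (rule TenA_hom[OF M M' N N' f'(1) g'(1)])
    show "bij_betw (TenA (PG K B) M M' N N' f g (At (-1))) (lo (ten K B M N)) (lo (ten K B M' N'))"
      using TenA_bij[OF vs F G f'(2) g'(2)] unfolding ten_simps(1)[OF idxs_mem(1)] ten_V_def by simp
    show "bij_betw (TenA (PG K B) M M' N N' f g (At 0)) (hi (ten K B M N)) (hi (ten K B M' N'))"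
      using TenA_bij[OF vs F G f'(3) g'(3)] unfolding ten_simps(1)[OF idxs_mem(2)] ten_V_def by simp
  qed
qed

section \<open>Tensor products of morphisms of the localization\<close>

abbreviation ten0 where
  "ten0 X X' Y Y' \<equiv> vten K (hiV X) (hiV X') (hiV Y) (hiV Y')"

lemma hi_ten: "hi (ten K B X Y) = carrier (vect_tensor K (hiV X) (hiV Y))"
  unfolding ten_simps(1)[OF idxs_mem(2)] ten_V_def ..

text \<open>The common induction behind tensoring a zigzag on the right and on the left.
  \<open>O'\<close> and \<open>\<Gamma>\<close> are the effect on objects and morphisms,
  \<open>E\<close> the effect on maps at 0. Functoriality of \<open>E\<close> is required for all
  linear maps, since the inverse of a backward step need not be the component of a morphism of
  pregliders.\<close>

lemma zigzag_map:
  assumes "zz K B X X' p"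
    and O: "\<And>A. pgl K B A \<Longrightarrow> pgl K B (O' A)"
    and S: "\<And>A A' f. \<sigma> (Fwd A A' f) = Fwd (O' A) (O' A') (\<Gamma> A A' f)"
      "\<And>A A' f. \<sigma> (Bwd A A' f) = Bwd (O' A) (O' A') (\<Gamma> A A' f)"
    and G: "\<And>A A' f. pgl K B A \<Longrightarrow> pgl K B A' \<Longrightarrow> f \<in> phom K B A A' \<Longrightarrow>
        \<Gamma> A A' f \<in> phom K B (O' A) (O' A')"
      "\<And>A A' s. pgl K B A \<Longrightarrow> pgl K B A' \<Longrightarrow> s \<in> SG K B A A' \<Longrightarrow> \<Gamma> A A' s \<in> SG K B (O' A) (O' A')"
    and E: "\<And>A A' f v. pgl K B A \<Longrightarrow> pgl K B A' \<Longrightarrow> v \<in> hi (O' A) \<Longrightarrow> \<Gamma> A A' f (At 0) v = E A A' (f (At 0)) v"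
      "\<And>A f v. pgl K B A \<Longrightarrow> (\<And>x. x \<in> hi A \<Longrightarrow> f x = x) \<Longrightarrow> v \<in> hi (O' A) \<Longrightarrow> E A A f v = v"
      "\<And>A A' A'' f g v. pgl K B A \<Longrightarrow> pgl K B A' \<Longrightarrow> pgl K B A'' \<Longrightarrow> lin K (hiV A) (hiV A') f \<Longrightarrow>
        lin K (hiV A') (hiV A'') g \<Longrightarrow> v \<in> hi (O' A) \<Longrightarrow> E A' A'' g (E A A' f v) = E A A'' (\<lambda>x. g (f x)) v"
      "\<And>A A' f v. pgl K B A \<Longrightarrow> pgl K B A' \<Longrightarrow> lin K (hiV A) (hiV A') f \<Longrightarrow> v \<in> hi (O' A) \<Longrightarrow>
        E A A' f v \<in> hi (O' A')"
  shows "zz K B (O' X) (O' X') (map \<sigma> p) \<and> (\<forall>v\<in>hi (O' X). zev (map \<sigma> p) v = E X X' (zev p) v)"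
  using assms(1)
proof (induction rule: zigzag.induct)
  case (zz_nil X)
  then have X: "pgl K B X" by simp
  then have "zz K B (O' X) (O' X) []" using zigzag.zz_nil[of "O' X" "PG K B"] O by simp
  then show ?case by (simp add: E(2)[OF X])
next
  case (zz_fwd X X' f X'' p)
  then have X: "pgl K B X" "pgl K B X'" "pgl K B X''" and f: "f \<in> phom K B X X'"
    using zigzag_Ob[OF zz_fwd(4)] by simp_all
  have lp: "lin K (hiV X') (hiV X'') (zev p)"
    using hp_lin[OF zigzag_hp[OF zz_fwd(4)]] by (simp add: lin_restrict[OF pgl_vs[OF X(2)]])
  have lf: "lin K (hiV X) (hiV X') (f (At 0))" by (rule homD(2)[OF X(1,2) f]) simp
  have "zev (map \<sigma> (Fwd X X' f # p)) v = E X X'' (zev (Fwd X X' f # p)) v" if v: "v \<in> hi (O' X)" for v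
  proof -
    have "zev (map \<sigma> (Fwd X X' f # p)) v = zev (map \<sigma> p) (E X X' (f (At 0)) v)" by (simp add: S E(1)[OF X(1,2) v])
    also have "\<dots> = E X' X'' (zev p) (E X X' (f (At 0)) v)"
      by (rule bspec[OF conjunct2[OF zz_fwd.IH] E(4)[OF X(1,2) lf v]])
    also have "\<dots> = E X X'' (zev (Fwd X X' f # p)) v" unfolding E(3)[OF X lf lp v] by (rule arg_cong[where f = "\<lambda>h. E X X'' h v"]) (rule ext, simp)
    finally show ?thesis .
  qed
  moreover have "zz K B (O' X) (O' X'') (map \<sigma> (Fwd X X' f # p))"
    unfolding list.map S by (rule zigzag.zz_fwd[OF _ _ G(1)[OF X(1,2) f] conjunct1[OF zz_fwd.IH]]) (simp_all add: O X)
  ultimately show ?case by blast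
next
  case (zz_bwd X' X s X'' p)
  then have X: "pgl K B X" "pgl K B X'" "pgl K B X''" and s: "s \<in> SG K B X' X"
    using zigzag_Ob[OF zz_bwd(4)] by simp_all
  have lp: "lin K (hiV X') (hiV X'') (zev p)"
    using hp_lin[OF zigzag_hp[OF zz_bwd(4)]] by (simp add: lin_restrict[OF pgl_vs[OF X(2)]])
  have sh: "s \<in> phom K B X' X" and sb: "bij_betw (s (At 0)) (hi X') (hi X)"
    using s unfolding SG_iff[OF X(2,1)] by blast+
  have ls: "lin K (hiV X') (hiV X) (s (At 0))" by (rule homD(2)[OF X(2,1) sh]) simp
  let ?s = "inv_into (hi X') (s (At 0))"
  have li: "lin K (hiV X) (hiV X') ?s"
    by (rule lin_inv_into[OF pgl_vs[OF X(2)] ls _ _ lin_id]) (use sb in \<open>auto simp: bij_betw_def\<close>)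
  have inj: "inj_on (\<Gamma> X' X s (At 0)) (hi (O' X'))"
    using G(2)[OF X(2,1) s] unfolding SG_iff[OF O[OF X(2)] O[OF X(1)]] bij_betw_def by blast
  have "zev (map \<sigma> (Bwd X' X s # p)) v = E X X'' (zev (Bwd X' X s # p)) v" if v: "v \<in> hi (O' X)" for v
  proof -
    note w = E(4)[OF X(1,2) li v]
    \<comment> \<open>Functoriality of \<open>E\<close> makes the image of the inverse an inverse of
      the image, so evaluating the mapped backward step gives the expected vector.\<close>
    have "\<Gamma> X' X s (At 0) (E X X' ?s v) = v"
      unfolding E(1)[OF X(2,1) w] E(3)[OF X(1,2,1) li ls v]
      by (rule E(2)[OF X(1) _ v]) (use sb in \<open>simp add: f_inv_into_f bij_betw_def\<close>)
    then have "inv_into (hi (O' X')) (\<Gamma> X' X s (At 0)) v = E X X' ?s v" by (rule inv_into_f_eq[OF inj w])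
    then have "zev (map \<sigma> (Bwd X' X s # p)) v = zev (map \<sigma> p) (E X X' ?s v)" by (simp add: S)
    also have "\<dots> = E X' X'' (zev p) (E X X' ?s v)" by (rule bspec[OF conjunct2[OF zz_bwd.IH] w])
    also have "\<dots> = E X X'' (zev (Bwd X' X s # p)) v" unfolding E(3)[OF X li lp v] by (rule arg_cong[where f = "\<lambda>h. E X X'' h v"]) (rule ext, simp)
    finally show ?thesis .
  qed
  moreover have "zz K B (O' X) (O' X'') (map \<sigma> (Bwd X' X s # p))"
    unfolding list.map S by (rule zigzag.zz_bwd[OF _ _ G(2)[OF X(2,1) s] conjunct1[OF zz_bwd.IH]]) (simp_all add: O X)
  ultimately show ?case by blast
qed

lemma zigzag_right:
  assumes p: "zz K B X X' p" and Y: "pgl K B Y"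
  shows "zz K B (ten K B X Y) (ten K B X' Y) (map (step_tensor_right (PG K B) Y) p) \<and>
    (\<forall>v\<in>hi (ten K B X Y). zev (map (step_tensor_right (PG K B) Y) p) v = ten0 X X' Y Y (zev p) (\<lambda>y. y) v)"
proof (rule zigzag_map[OF p, where O' = "\<lambda>A. ten K B A Y" and \<Gamma> = "\<lambda>A A' f. TenA (PG K B) A A' Y Y f (Idn (PG K B) Y)" and E = "\<lambda>A A' h. ten0 A A' Y Y h (\<lambda>y. y)"])
  note vY = hi_vs[OF Y] and v = hi_vs[OF _]
  show "ten0 A' A'' Y Y g (\<lambda>y. y) (ten0 A A' Y Y f (\<lambda>y. y) w) = ten0 A A'' Y Y (\<lambda>x. g (f x)) (\<lambda>y. y) w"
    if "pgl K B A" "pgl K B A'" "pgl K B A''" "lin K (hiV A) (hiV A') f"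
      "lin K (hiV A') (hiV A'') g" "w \<in> hi (ten K B A Y)" for A A' A'' f g w
    by (rule TenA_comp[OF v vY v vY v vY that(4) lin_id that(5) lin_id that(6)[unfolded hi_ten]]) fact+
  show "ten0 A A' Y Y f (\<lambda>y. y) w \<in> hi (ten K B A' Y)"
    if "pgl K B A" "pgl K B A'" "lin K (hiV A) (hiV A') f" "w \<in> hi (ten K B A Y)" for A A' f w
    unfolding hi_ten by (rule lin_closed[OF TenA_lin[OF v vY v vY that(3) lin_id] that(4)[unfolded hi_ten]]) fact+
  show "ten0 A A Y Y f (\<lambda>y. y) w = w" if "pgl K B A" "\<And>x. x \<in> hi A \<Longrightarrow> f x = x" "w \<in> hi (ten K B A Y)" for A f w
    by (rule TenA_id[OF v[OF that(1)] vY that(2) _ that(3)[unfolded hi_ten]]) simp_all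
  show "TenA (PG K B) A A' Y Y f (Idn (PG K B) Y) (At 0) w = ten0 A A' Y Y (f (At 0)) (\<lambda>y. y) w"
    if "pgl K B A" "pgl K B A'" for A A' f w
    using fun_cong[OF TenA_cong[OF v[OF that(1)] vY v[OF that(2)] vY, of "f (At 0)" "f (At 0)" "\<lambda>y\<in>hi Y. y" "\<lambda>y. y"]] by simp
qed (use Y in \<open>simp_all only: step_tensor_right.simps ten_pgl TenA_hom TenA_SG Idn_closed Idn_SG\<close>)

lemma zigzag_left:
  assumes q: "zz K B Y Y' q" and X: "pgl K B X"
  shows "zz K B (ten K B X Y) (ten K B X Y') (map (step_tensor_left (PG K B) X) q) \<and>
    (\<forall>v\<in>hi (ten K B X Y). zev (map (step_tensor_left (PG K B) X) q) v = ten0 X X Y Y' (\<lambda>x. x) (zev q) v)"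
proof (rule zigzag_map[OF q, where O' = "ten K B X" and \<Gamma> = "\<lambda>A A'. TenA (PG K B) X X A A' (Idn (PG K B) X)" and E = "\<lambda>A A'. ten0 X X A A' (\<lambda>y. y)"])
  note vX = hi_vs[OF X] and v = hi_vs[OF _]
  show "ten0 X X A' A'' (\<lambda>y. y) g (ten0 X X A A' (\<lambda>y. y) f w) = ten0 X X A A'' (\<lambda>y. y) (\<lambda>x. g (f x)) w"
    if "pgl K B A" "pgl K B A'" "pgl K B A''" "lin K (hiV A) (hiV A') f"
      "lin K (hiV A') (hiV A'') g" "w \<in> hi (ten K B X A)" for A A' A'' f g w
    by (rule TenA_comp[OF vX v vX v vX v lin_id that(4) lin_id that(5) that(6)[unfolded hi_ten]]) fact+
  show "ten0 X X A A' (\<lambda>y. y) f w \<in> hi (ten K B X A')"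
    if "pgl K B A" "pgl K B A'" "lin K (hiV A) (hiV A') f" "w \<in> hi (ten K B X A)" for A A' f w
    unfolding hi_ten by (rule lin_closed[OF TenA_lin[OF vX v vX v lin_id that(3)] that(4)[unfolded hi_ten]]) fact+
  show "ten0 X X A A (\<lambda>y. y) f w = w" if "pgl K B A" "\<And>x. x \<in> hi A \<Longrightarrow> f x = x" "w \<in> hi (ten K B X A)" for A f w
    by (rule TenA_id[OF vX v[OF that(1)] _ that(2) that(3)[unfolded hi_ten]]) simp_all
  show "TenA (PG K B) X X A A' (Idn (PG K B) X) f (At 0) w = ten0 X X A A' (\<lambda>y. y) (f (At 0)) w"
    if "pgl K B A" "pgl K B A'" for A A' f w
    using fun_cong[OF TenA_cong[OF vX v[OF that(1)] vX v[OF that(2)], of "\<lambda>y\<in>hi X. y" "\<lambda>y. y" "f (At 0)" "f (At 0)"]] by simp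
qed (use X in \<open>simp_all only: step_tensor_left.simps ten_pgl TenA_hom TenA_SG Idn_closed Idn_SG\<close>)

text \<open>Whatever representatives are chosen in \<open>loc_tensor\<close>, the resulting zigzag
  evaluates to (id \<otimes> g)(f \<otimes> id) = f \<otimes> g at 0. So the union is over one class
  only.\<close>

lemma GL_tensor:
  assumes X: "pgl K B X" and X': "pgl K B X'" and Y: "pgl K B Y" and Y': "pgl K B Y'"
    and f: "f \<in> hp K B X X'" and g: "g \<in> hp K B Y Y'"
  shows "TenA (GL K B) X X' Y Y' (kap K B X X' f) (kap K B Y Y' g) =
      kap K B (ten K B X Y) (ten K B X' Y') (ten0 X X' Y Y' f g)"
    and ten_hp: "ten0 X X' Y Y' f g \<in> hp K B (ten K B X Y) (ten K B X' Y')"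
proof -
  note vs = pgl_vs[OF X] pgl_vs[OF X'] pgl_vs[OF Y] pgl_vs[OF Y']
  have main: "zz K B (ten K B X Y) (ten K B X' Y')
        (map (step_tensor_right (PG K B) Y) p @ map (step_tensor_left (PG K B) X') q) \<and>
      (\<forall>v\<in>hi (ten K B X Y). zev (map (step_tensor_right (PG K B) Y) p @ map (step_tensor_left (PG K B) X') q) v =
        ten0 X X' Y Y' f g v)"
    if "p \<in> kap K B X X' f" "q \<in> kap K B Y Y' g" for p q
  proof -
    have p: "zz K B X X' p" "\<And>v. v \<in> hi X \<Longrightarrow> zev p v = f v"
      and q: "zz K B Y Y' q" "\<And>v. v \<in> hi Y \<Longrightarrow> zev q v = g v"
      using that by (auto simp: kap_def)
    note R = zigzag_right[OF p(1) Y] and L = zigzag_left[OF q(1) X']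
    show ?thesis
    proof (intro conjI ballI)
      show "zz K B (ten K B X Y) (ten K B X' Y')
        (map (step_tensor_right (PG K B) Y) p @ map (step_tensor_left (PG K B) X') q)"
        by (rule zigzag_append[OF conjunct1[OF R] conjunct1[OF L]])
      fix v assume v: "v \<in> hi (ten K B X Y)"
      then have v': "v \<in> carrier (vect_tensor K (hiV X) (hiV Y))" unfolding hi_ten .
      have r: "zev (map (step_tensor_right (PG K B) Y) p) v = ten0 X X' Y Y f (\<lambda>y. y) v"
        using R v fun_cong[OF TenA_cong, of K "hiV X" "hiV Y" "hiV X'" "hiV Y" "zev p" f "\<lambda>y. y" "\<lambda>y. y" v] p(2) vs
        by simp
      have rc: "ten0 X X' Y Y f (\<lambda>y. y) v \<in> hi (ten K B X' Y)"
        using zev_closed[OF conjunct1[OF R] v] unfolding r .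
      have "zev (map (step_tensor_left (PG K B) X') q) (ten0 X X' Y Y f (\<lambda>y. y) v) =
          ten0 X' X' Y Y' (\<lambda>x. x) (zev q) (ten0 X X' Y Y f (\<lambda>y. y) v)" by (rule bspec[OF conjunct2[OF L] rc])
      also have "ten0 X' X' Y Y' (\<lambda>x. x) (zev q) = ten0 X' X' Y Y' (\<lambda>x. x) g"
        by (rule TenA_cong) (simp_all add: vs q(2))
      also have "ten0 X' X' Y Y' (\<lambda>x. x) g (ten0 X X' Y Y f (\<lambda>y. y) v) = ten0 X X' Y Y' f g v"
        by (rule TenA_comp[OF _ _ _ _ _ _ hp_lin[OF f] lin_id lin_id hp_lin[OF g] v']) (simp_all add: vs)
      finally show "zev (map (step_tensor_right (PG K B) Y) p @ map (step_tensor_left (PG K B) X') q) v =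
        ten0 X X' Y Y' f g v" unfolding zev_append r .
    qed
  qed
  have "zcl K B (ten K B X Y) (ten K B X' Y')
      (map (step_tensor_right (PG K B) Y) p @ map (step_tensor_left (PG K B) X') q) =
      kap K B (ten K B X Y) (ten K B X' Y') (ten0 X X' Y Y' f g)"
    if "p \<in> kap K B X X' f" "q \<in> kap K B Y Y' g" for p q
    unfolding zz_class_kap[OF conjunct1[OF main[OF that]]]
    by (rule kap_cong) (use conjunct2[OF main[OF that]] in blast)
  then show "TenA (GL K B) X X' Y Y' (kap K B X X' f) (kap K B Y Y' g) =
      kap K B (ten K B X Y) (ten K B X' Y') (ten0 X X' Y Y' f g)"
    unfolding GL_simps loc_tensor_def using kap_hp_ne[OF X X' f] kap_hp_ne[OF Y Y' g] by auto
  note m = main[OF can_kap[OF X X' f] can_kap[OF Y Y' g]]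
  show "ten0 X X' Y Y' f g \<in> hp K B (ten K B X Y) (ten K B X' Y')"
  proof (rule hp_restrictD)
    show "(\<lambda>v\<in>hi (ten K B X Y). zev (map (step_tensor_right (PG K B) Y) (can K B X X' f) @
        map (step_tensor_left (PG K B) X') (can K B Y Y' g)) v) \<in> hp K B (ten K B X Y) (ten K B X' Y')"
      by (rule zigzag_hp[OF conjunct1[OF m]])
    show "ten0 X X' Y Y' f g \<in> extensional (hi (ten K B X Y))" unfolding hi_ten by (rule TenA_ext)
  qed (use conjunct2[OF m] in auto)
qed

section \<open>The unit glider and actions through the counit\<close>

lemma unt_simps:
  "ix \<in> idxs \<Longrightarrow> fob (Unt (PG K B)) ix = vect_unit K"
  "ix \<in> idxs \<Longrightarrow> jx \<in> idxs \<Longrightarrow> b \<in> fh K B ix jx \<Longrightarrow>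
     far (Unt (PG K B)) ix jx b = (\<lambda>s\<in>carrier (vect_unit K). Scal (counit B b \<otimes>\<^bsub>K\<^esub> scal s))"
  by (auto simp: preglid_def mk_glider_def fun_eq_iff)

lemma counit_facts:
  shows counit_closed: "b \<in> carrier B \<Longrightarrow> counit B b \<in> carrier K"
    and counit_one: "counit B \<one>\<^bsub>B\<^esub> = \<one>\<^bsub>K\<^esub>"
    and counit_mult: "b \<in> carrier B \<Longrightarrow> c \<in> carrier B \<Longrightarrow> counit B (b \<otimes>\<^bsub>B\<^esub> c) = counit B b \<otimes>\<^bsub>K\<^esub> counit B c"
    and counit_add: "b \<in> carrier B \<Longrightarrow> c \<in> carrier B \<Longrightarrow> counit B (b \<oplus>\<^bsub>B\<^esub> c) = counit B b \<oplus>\<^bsub>K\<^esub> counit B c"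
  using counit_ring_hom by (auto simp: ring_hom_def)

lemma counit_lin: "lin K B V (\<lambda>b. counit B b \<odot>\<^bsub>V\<^esub> v)" if V: "vectorspace K V" and v: "v \<in> carrier V"
proof -
  interpret V: vectorspace K V by fact
  show ?thesis using v
    by (auto simp: lin_def counit_closed counit_add counit_smult V.module.smult_l_distr V.module.smult_assoc1)
qed

text \<open>If \<open>B\<close> acts through the counit, every subspace is stable, so any pair of
  nested subspaces gives a glider. This covers the unit and the test object T.\<close>

lemma triv_gdata:
  assumes V: "\<And>ix. ix \<in> idxs \<Longrightarrow> vectorspace K (V ix)"
    and i: "\<And>ix. ix \<in> idxs \<Longrightarrow> lin K (V ix) (V Infty) (i ix)" "\<And>ix. ix \<in> idxs \<Longrightarrow> inj_on (i ix) (carrier (V ix))"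
    and i1: "\<And>x. x \<in> carrier (V Infty) \<Longrightarrow> i Infty x = x"
    and le: "i (At (-1)) ` carrier (V (At (-1))) \<subseteq> i (At 0) ` carrier (V (At 0))"
  shows "gdata K B V i (\<lambda>b x. counit B b \<odot>\<^bsub>V Infty\<^esub> x)"
  unfolding gdata_def
proof (intro conjI ballI V i i1)
  interpret V: vectorspace K "V Infty" by (rule V) simp
  show "lin K (V Infty) (V Infty) (\<lambda>x. counit B b \<odot>\<^bsub>V Infty\<^esub> x)" if "b \<in> carrier B" for b
    by (rule lin_scale[OF V V lin_id counit_closed[OF that]]) simp_all
  show "lin K B (V Infty) (\<lambda>b. counit B b \<odot>\<^bsub>V Infty\<^esub> x)" if "x \<in> carrier (V Infty)" for x
    by (rule counit_lin[OF V that]) simp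
  show "counit B \<one>\<^bsub>B\<^esub> \<odot>\<^bsub>V Infty\<^esub> x = x" if "x \<in> carrier (V Infty)" for x using that by (simp add: counit_one)
  show "counit B (b \<otimes>\<^bsub>B\<^esub> c) \<odot>\<^bsub>V Infty\<^esub> x = counit B b \<odot>\<^bsub>V Infty\<^esub> (counit B c \<odot>\<^bsub>V Infty\<^esub> x)"
    if "b \<in> carrier B" "c \<in> carrier B" "x \<in> carrier (V Infty)" for b c x
    using that by (simp add: counit_mult counit_closed V.module.smult_assoc1)
  fix b x assume b: "b \<in> carrier B" and x: "x \<in> carrier (V (At (-1)))"
  obtain y where y: "y \<in> carrier (V (At 0))" "i (At (-1)) x = i (At 0) y" using le x by blast
  interpret V0: vectorspace K "V (At 0)" by (rule V) simp
  have "counit B b \<odot>\<^bsub>V Infty\<^esub> i (At (-1)) x = i (At 0) (counit B b \<odot>\<^bsub>V (At 0)\<^esub> y)"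
    using lin_smult[OF i(1) counit_closed[OF b] y(1)] y by simp
  then show "counit B b \<odot>\<^bsub>V Infty\<^esub> i (At (-1)) x \<in> i (At 0) ` carrier (V (At 0))"
    using y(1) counit_closed[OF b] by simp
qed simp_all

lemma unt_gdata: "gdata K B (\<lambda>ix. vect_unit K) (\<lambda>ix x. x) (\<lambda>b x. counit B b \<odot>\<^bsub>vect_unit K\<^esub> x)"
  by (rule triv_gdata) (use vect_unit_vs[OF field_K] in \<open>auto intro: lin_id\<close>)

lemma unt_far:
  assumes "ix \<in> idxs" "jx \<in> idxs" "b \<in> fh K B ix jx" "x \<in> carrier (vect_unit K)"
  shows "far (Unt (PG K B)) ix jx b x \<in> carrier (vect_unit K) \<and>
    far (Unt (PG K B)) ix jx b x = counit B b \<odot>\<^bsub>vect_unit K\<^esub> x"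
proof -
  have "b \<in> carrier B" using fh_sub assms by blast
  then show ?thesis using assms counit_closed by (auto simp: unt_simps)
qed

lemma unt_pgl: "pgl K B (Unt (PG K B))"
proof (rule pglI[OF unt_gdata])
  show "fob (Unt (PG K B)) \<in> extensional idxs" by (simp add: preglid_def mk_glider_def)
  show "far (Unt (PG K B)) ix jx \<in> extensional {b. ix \<in> idxs \<and> jx \<in> idxs \<and> b \<in> fh K B ix jx}" for ix jx
    by (simp add: preglid_def mk_glider_def)
next
  fix ix jx b x assume "ix \<in> idxs" "jx \<in> idxs" "b \<in> fh K B ix jx" "x \<in> carrier (vect_unit K)"
  then show "far (Unt (PG K B)) ix jx b x \<in> carrier (vect_unit K) \<and>
      far (Unt (PG K B)) ix jx b x = counit B b \<odot>\<^bsub>vect_unit K\<^esub> x" by (rule unt_far)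
qed (simp_all add: unt_simps)

end

section \<open>Transport along an isomorphism of bialgebras\<close>

lemma linear_functorD:
  assumes "linear_functor K C D F"
  shows "X \<in> Ob C \<Longrightarrow> fob F X \<in> Ob D"
    and "X \<in> Ob C \<Longrightarrow> Y \<in> Ob C \<Longrightarrow> linear_map K (Hom C X Y) (Hom D (fob F X) (fob F Y)) (far F X Y)"
    and "X \<in> Ob C \<Longrightarrow> far F X X (Idn C X) = Idn D (fob F X)"
    and "X \<in> Ob C \<Longrightarrow> Y \<in> Ob C \<Longrightarrow> Z \<in> Ob C \<Longrightarrow> f \<in> carrier (Hom C X Y) \<Longrightarrow> g \<in> carrier (Hom C Y Z) \<Longrightarrow>
       far F X Z (Cmp C X Y Z g f) = Cmp D (fob F X) (fob F Y) (fob F Z) (far F Y Z g) (far F X Y f)"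
    and "X \<in> Ob C \<Longrightarrow> Y \<in> Ob C \<Longrightarrow> f \<in> carrier (Hom C X Y) \<Longrightarrow>
       far F X Y f \<in> carrier (Hom D (fob F X) (fob F Y))"
proof -
  show l: "X \<in> Ob C \<Longrightarrow> Y \<in> Ob C \<Longrightarrow> linear_map K (Hom C X Y) (Hom D (fob F X) (fob F Y)) (far F X Y)"
    using assms by (simp add: linear_functor_def)
  show "far F X Y f \<in> carrier (Hom D (fob F X) (fob F Y))"
    if "X \<in> Ob C" "Y \<in> Ob C" "f \<in> carrier (Hom C X Y)"
    using l[OF that(1,2)] that(3) by (simp add: linear_map_iff lin_def)
qed (use assms in \<open>simp_all add: linear_functor_def\<close>)

text \<open>The Noetherian condition is internal to the category, so it is moved by functors. As the
  two functors are strictly inverse to each other, monomorphisms, factorizations and chains of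
  subobjects carry over literally.\<close>

lemma noetherian_transport:
  assumes F: "linear_functor K C D F" and G: "linear_functor K D C G"
    and FG: "\<And>Y. Y \<in> Ob D \<Longrightarrow> fob F (fob G Y) = Y"
      "\<And>X Y f. X \<in> Ob D \<Longrightarrow> Y \<in> Ob D \<Longrightarrow> f \<in> carrier (Hom D X Y) \<Longrightarrow>
        far F (fob G X) (fob G Y) (far G X Y f) = f"
    and GF: "\<And>X. X \<in> Ob C \<Longrightarrow> fob G (fob F X) = X"
      "\<And>X Y f. X \<in> Ob C \<Longrightarrow> Y \<in> Ob C \<Longrightarrow> f \<in> carrier (Hom C X Y) \<Longrightarrow>
        far G (fob F X) (fob F Y) (far F X Y f) = f"
    and X: "X \<in> Ob C" "noetherian_object C X"
  shows "noetherian_object D (fob F X)"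
  unfolding noetherian_object_def
proof (intro allI impI, elim conjE)
  fix S m
  assume sub: "\<forall>n. S n \<in> Ob D \<and> cat_mono D (S n) (fob F X) (m n)"
    and chain: "\<forall>n. subobject_le D (fob F X) (S n) (m n) (S (Suc n)) (m (Suc n))"
  note FD = linear_functorD[OF F] and GD = linear_functorD[OF G]
  have S: "S n \<in> Ob D" and m: "m n \<in> carrier (Hom D (S n) (fob F X))" for n using sub by (auto simp: cat_mono_def)
  have FX: "fob F X \<in> Ob D" by (rule FD(1)[OF X(1)])
  define T where "T n = fob G (S n)" for n
  define k where "k n = far G (S n) (fob F X) (m n)" for n
  have T: "T n \<in> Ob C" for n unfolding T_def by (rule GD(1)[OF S])
  have FT: "fob F (T n) = S n" for n unfolding T_def by (rule FG(1)[OF S])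
  have k: "k n \<in> carrier (Hom C (T n) X)" for n using GD(5)[OF S FX m] by (simp add: k_def T_def GF(1)[OF X(1)])
  have Fk: "far F (T n) X (k n) = m n" for n
    using FG(2)[OF S FX m, of n] by (simp add: k_def T_def GF(1)[OF X(1)])
  have mono: "cat_mono C (T n) X (k n)" for n
    unfolding cat_mono_def
  proof (intro conjI ballI impI k)
    fix W g h assume W: "W \<in> Ob C" and g: "g \<in> carrier (Hom C W (T n))" and h: "h \<in> carrier (Hom C W (T n))"
      and e: "Cmp C W (T n) X (k n) g = Cmp C W (T n) X (k n) h"
    have "Cmp D (fob F W) (S n) (fob F X) (m n) (far F W (T n) g) = Cmp D (fob F W) (S n) (fob F X) (m n) (far F W (T n) h)"
      using FD(4)[OF W T X(1) g k] FD(4)[OF W T X(1) h k] e by (simp add: Fk FT)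
    then have "far F W (T n) g = far F W (T n) h"
      using sub FD(1)[OF W] FD(5)[OF W T g] FD(5)[OF W T h] by (simp add: cat_mono_def FT)
    from arg_cong[OF this, of "far G (fob F W) (fob F (T n))"]
    show "g = h" unfolding GF(2)[OF W T g] GF(2)[OF W T h] .
  qed
  have le: "subobject_le C X (T i) (k i) (T j) (k j) \<longleftrightarrow> subobject_le D (fob F X) (S i) (m i) (S j) (m j)" for i j
  proof
    assume "subobject_le C X (T i) (k i) (T j) (k j)"
    then obtain h where h: "h \<in> carrier (Hom C (T i) (T j))" "Cmp C (T i) (T j) X (k j) h = k i"
      by (auto simp: subobject_le_def)
    show "subobject_le D (fob F X) (S i) (m i) (S j) (m j)" unfolding subobject_le_def
      using FD(5)[OF T T h(1)] FD(4)[OF T T X(1) h(1) k] by (intro bexI[of _ "far F (T i) (T j) h"]) (simp_all add: h(2) Fk FT)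
  next
    assume "subobject_le D (fob F X) (S i) (m i) (S j) (m j)"
    then obtain h where h: "h \<in> carrier (Hom D (S i) (S j))" "Cmp D (S i) (S j) (fob F X) (m j) h = m i"
      by (auto simp: subobject_le_def)
    show "subobject_le C X (T i) (k i) (T j) (k j)" unfolding subobject_le_def
      using GD(5)[OF S S h(1)] GD(4)[OF S S FX h(1) m]
      by (intro bexI[of _ "far G (S i) (S j) h"]) (simp_all add: h(2) k_def T_def GF(1)[OF X(1)])
  qed
  have "\<exists>N. \<forall>n\<ge>N. subobject_le C X (T n) (k n) (T N) (k N)"
    using X(2)[unfolded noetherian_object_def, rule_format, of T k] T mono chain le by blast
  then show "\<exists>N. \<forall>n\<ge>N. subobject_le D (fob F X) (S n) (m n) (S N) (m N)" unfolding le .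
qed

text \<open>The inverse map is a parameter, which makes the situation symmetric: statements about
  the inverse functor come from the same locale by \<open>symmetric\<close>.\<close>

locale bialg_iso = B: bialgebra K B + B': bialgebra K B'
  for K :: "'k ring" and B :: "('k, 'b) bialg" and B' :: "('k, 'c) bialg" +
  fixes \<phi> :: "'b \<Rightarrow> 'c" and \<psi> :: "'c \<Rightarrow> 'b"
  assumes lin_phi: "lin K B B' \<phi>" and lin_psi: "lin K B' B \<psi>"
    and psi_phi: "b \<in> carrier B \<Longrightarrow> \<psi> (\<phi> b) = b" and phi_psi: "c \<in> carrier B' \<Longrightarrow> \<phi> (\<psi> c) = c"
    and phi_one: "\<phi> \<one>\<^bsub>B\<^esub> = \<one>\<^bsub>B'\<^esub>"
    and phi_mult: "a \<in> carrier B \<Longrightarrow> b \<in> carrier B \<Longrightarrow> \<phi> (a \<otimes>\<^bsub>B\<^esub> b) = \<phi> a \<otimes>\<^bsub>B'\<^esub> \<phi> b"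
    and phi_counit: "b \<in> carrier B \<Longrightarrow> counit B' (\<phi> b) = counit B b"
    and phi_comult: "b \<in> carrier B \<Longrightarrow> comult B' (\<phi> b) =
      tens_lift (tensor K B' B') (\<lambda>x y. pure_tensor K B' B' (\<phi> x) (\<phi> y)) (comult B b)"
begin

lemma phi_closed: "b \<in> carrier B \<Longrightarrow> \<phi> b \<in> carrier B'" by (rule lin_closed[OF lin_phi])
lemma psi_closed: "c \<in> carrier B' \<Longrightarrow> \<psi> c \<in> carrier B" by (rule lin_closed[OF lin_psi])

text \<open>The formula for \<phi> is taken at \<psi> c and \<psi> \<otimes> \<psi> is applied to
  it. What remains is \<Delta>(\<psi> c) written as the sum of its own terms.\<close>

lemma psi_comult:
  assumes c: "c \<in> carrier B'"
  shows "comult B (\<psi> c) = tens_lift (tensor K B B) (\<lambda>x y. pure_tensor K B B (\<psi> x) (\<psi> y)) (comult B' c)"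
proof -
  note P = pure_tensor_bilin[OF B.vs_B B.vs_B] and P' = pure_tensor_bilin[OF B'.vs_B B'.vs_B]
  let ?T = "tensor K B B" and ?T' = "tensor K B' B'"
  have bl: "bilin K B' B' ?T (\<lambda>x y. pure_tensor K B B (\<psi> x) (\<psi> y))" by (rule bilin_comp[OF P lin_psi lin_psi lin_id])
  note L = tens_lift_lin[OF B'.vs_B B'.vs_B B.vs_BB bl]
  have m: "x \<in> carrier B \<and> y \<in> carrier B" if "(x, y) \<in> set (comult B (\<psi> c))" for x y
    using that B.comult_set[OF psi_closed[OF c]] by auto
  have "tens_lift ?T (\<lambda>x y. pure_tensor K B B (\<psi> x) (\<psi> y)) (comult B' c) =
      tens_lift ?T (\<lambda>x y. pure_tensor K B B (\<psi> x) (\<psi> y))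
        (tens_lift ?T' (\<lambda>x y. pure_tensor K B' B' (\<phi> x) (\<phi> y)) (comult B (\<psi> c)))"
    using phi_comult[OF psi_closed[OF c]] phi_psi[OF c] by simp
  also have "\<dots> = tens_lift ?T (\<lambda>x y. tens_lift ?T (\<lambda>x y. pure_tensor K B B (\<psi> x) (\<psi> y))
      (pure_tensor K B' B' (\<phi> x) (\<phi> y))) (comult B (\<psi> c))"
    by (rule tens_lift_hom[OF B'.vs_BB B.vs_BB L]) (use m phi_closed bilin_closed[OF P'] in auto)
  also have "\<dots> = tens_lift ?T (pure_tensor K B B) (comult B (\<psi> c))"
    by (rule tens_lift_cong)
       (use m in \<open>simp add: tens_lift_pure[OF B'.vs_B B'.vs_B B.vs_BB bl] phi_closed psi_phi\<close>)
  also have "\<dots> = comult B (\<psi> c)"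
    using tensor_pure_sum[OF B.vs_B B.vs_B B.comult_set[OF psi_closed[OF c]]]
      lin_closed[OF B.comult_lin psi_closed[OF c]] tensor_carrier[OF B.vs_B B.vs_B] by simp
  finally show ?thesis by simp
qed

lemma psi_mult: "a \<in> carrier B' \<Longrightarrow> b \<in> carrier B' \<Longrightarrow> \<psi> (a \<otimes>\<^bsub>B'\<^esub> b) = \<psi> a \<otimes>\<^bsub>B\<^esub> \<psi> b"
  using phi_mult[of "\<psi> a" "\<psi> b"] psi_phi[of "\<psi> a \<otimes>\<^bsub>B\<^esub> \<psi> b"] psi_closed phi_psi by simp

lemma psi_one: "\<psi> \<one>\<^bsub>B'\<^esub> = \<one>\<^bsub>B\<^esub>"
  using psi_phi[of "\<one>\<^bsub>B\<^esub>"] phi_one by simp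

lemma psi_counit: "c \<in> carrier B' \<Longrightarrow> counit B (\<psi> c) = counit B' c"
  using phi_counit[OF psi_closed] phi_psi by simp

lemma symmetric: "bialg_iso K B' B \<psi> \<phi>"
  by unfold_locales (simp_all add: lin_phi lin_psi psi_phi phi_psi psi_one psi_mult psi_comult psi_counit)

lemma psi_fh:
  assumes i: "ix \<in> idxs" "jx \<in> idxs" and b: "b \<in> fh K B' ix jx"
  shows "\<psi> b \<in> fh K B ix jx"
proof (cases rule: B.fh_cases[OF i])
  case 1 then show ?thesis using b psi_closed by simp
next
  case 2 then show ?thesis using b psi_closed by simp
next
  case 3
  then obtain c where c: "c \<in> carrier K" "b = c \<odot>\<^bsub>B'\<^esub> \<one>\<^bsub>B'\<^esub>" using b B'.fh_diag[OF i(1)] by auto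
  then have "\<psi> b = c \<odot>\<^bsub>B\<^esub> \<one>\<^bsub>B\<^esub>" using lin_smult[OF lin_psi c(1), of "\<one>\<^bsub>B'\<^esub>"] psi_one by simp
  then show ?thesis using 3 c B.fh_diag[OF i(1)] by auto
next
  case 4
  then have "b = \<zero>\<^bsub>B'\<^esub>" using b B'.fh_zero[OF i] by simp
  then show ?thesis using lin_zero[OF B'.vs_B B.vs_B lin_psi] 4 B.fh_zero[OF i] by simp
qed

text \<open>Restriction of the action along \<psi>. The spaces stay the same, so the sets
  \<open>hp\<close> and the morphisms of pregliders do not change at all.\<close>

definition tr :: "('k, 'b, 'a) glider \<Rightarrow> ('k, 'c, 'a) glider"
  where "tr M = \<lparr>fob = fob M, far = (\<lambda>ix jx. \<lambda>b\<in>{b. ix \<in> idxs \<and> jx \<in> idxs \<and> b \<in> fh K B' ix jx}. far M ix jx (\<psi> b))\<rparr>"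

lemma tr_fob [simp]: "fob (tr M) = fob M" by (simp add: tr_def)

lemma tr_far: "ix \<in> idxs \<Longrightarrow> jx \<in> idxs \<Longrightarrow> b \<in> fh K B' ix jx \<Longrightarrow> far (tr M) ix jx b = far M ix jx (\<psi> b)"
  by (simp add: tr_def)

lemma tr_gi: "ix \<in> idxs \<Longrightarrow> gi B' (tr M) ix = gi B M ix"
  by (simp add: gi_def tr_far psi_one)

lemma tr_ga: "b \<in> carrier B' \<Longrightarrow> ga (tr M) b = ga M (\<psi> b)"
  by (simp add: ga_def tr_far)

lemma tr_fm: "b \<in> carrier B' \<Longrightarrow> fm (tr M) b = fm M (\<psi> b)"
  by (simp add: tr_far)

lemma tr_pgl:
  assumes M: "pgl K B M" shows "pgl K B' (tr M)"
proof (rule B'.pglI[of "fob M" "gi B M" "\<lambda>b. ga M (\<psi> b)"])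
  note D = gdataD[OF B.pgl_gdata[OF M]]
  show "gdata K B' (fob M) (gi B M) (\<lambda>b. ga M (\<psi> b))"
    unfolding gdata_def
  proof (intro conjI ballI D)
    show "lin K B' (inV M) (\<lambda>b. ga M (\<psi> b) x)" if "x \<in> carrier (inV M)" for x
      by (rule lin_comp[OF lin_psi D(6)[OF that]])
    show "ga M (\<psi> (b \<otimes>\<^bsub>B'\<^esub> c)) x = ga M (\<psi> b) (ga M (\<psi> c) x)"
      if "b \<in> carrier B'" "c \<in> carrier B'" "x \<in> carrier (inV M)" for b c x
      using that by (simp add: psi_mult psi_closed D(8))
  qed (simp_all add: psi_one psi_closed D)
  show "fob (tr M) \<in> extensional idxs" using M by (simp add: B.pgl_def')
  show "far (tr M) ix jx \<in> extensional {b. ix \<in> idxs \<and> jx \<in> idxs \<and> b \<in> fh K B' ix jx}" for ix jx by (simp add: tr_def)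
  fix ix jx b assume i: "ix \<in> idxs" "jx \<in> idxs" "b \<in> fh K B' ix jx"
  note i' = i(1,2) psi_fh[OF i]
  show "far (tr M) ix jx b \<in> extensional (carrier (fob M ix))" unfolding tr_far[OF i] using B.pgl_hom[OF M i'] by simp
  show "far (tr M) ix jx b x \<in> carrier (fob M jx) \<and> gi B M jx (far (tr M) ix jx b x) = ga M (\<psi> b) (gi B M ix x)"
    if "x \<in> carrier (fob M ix)" for x unfolding tr_far[OF i] using B.pgl_far[OF M i' that] by simp
qed simp

lemma tr_hp:
  "hp K B' (tr X) (tr Y) = hp K B X Y"
proof -
  have "(\<forall>b\<in>carrier B'. f (fm (tr X) b x) = fm (tr Y) b y) \<longleftrightarrow> (\<forall>b\<in>carrier B. f (fm X b x) = fm Y b y)" for f x y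
  proof
    assume l: "\<forall>b\<in>carrier B'. f (fm (tr X) b x) = fm (tr Y) b y"
    show "\<forall>b\<in>carrier B. f (fm X b x) = fm Y b y"
    proof
      fix b assume b: "b \<in> carrier B"
      show "f (fm X b x) = fm Y b y"
        using bspec[OF l phi_closed[OF b]] unfolding tr_fm[OF phi_closed[OF b]] psi_phi[OF b] .
    qed
  next
    assume "\<forall>b\<in>carrier B. f (fm X b x) = fm Y b y"
    then show "\<forall>b\<in>carrier B'. f (fm (tr X) b x) = fm (tr Y) b y" by (simp add: tr_fm psi_closed)
  qed
  then show ?thesis by (simp add: hp_def)
qed

lemma tr_hom:
  assumes X: "pgl K B X" and Y: "pgl K B Y"
  shows "phom K B' (tr X) (tr Y) = phom K B X Y"
proof -
  have "(\<forall>b\<in>carrier B'. \<forall>x\<in>carrier (inV X). f Infty (ga (tr X) b x) = ga (tr Y) b (f Infty x)) \<longleftrightarrow>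
        (\<forall>b\<in>carrier B. \<forall>x\<in>carrier (inV X). f Infty (ga X b x) = ga Y b (f Infty x))" for f
  proof
    assume l: "\<forall>b\<in>carrier B'. \<forall>x\<in>carrier (inV X). f Infty (ga (tr X) b x) = ga (tr Y) b (f Infty x)"
    show "\<forall>b\<in>carrier B. \<forall>x\<in>carrier (inV X). f Infty (ga X b x) = ga Y b (f Infty x)"
    proof
      fix b assume b: "b \<in> carrier B"
      show "\<forall>x\<in>carrier (inV X). f Infty (ga X b x) = ga Y b (f Infty x)"
        using bspec[OF l phi_closed[OF b]] unfolding tr_ga[OF phi_closed[OF b]] psi_phi[OF b] .
    qed
  next
    assume "\<forall>b\<in>carrier B. \<forall>x\<in>carrier (inV X). f Infty (ga X b x) = ga Y b (f Infty x)"
    then show "\<forall>b\<in>carrier B'. \<forall>x\<in>carrier (inV X). f Infty (ga (tr X) b x) = ga (tr Y) b (f Infty x)"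
      by (simp add: tr_ga psi_closed)
  qed
  then show ?thesis
    unfolding set_eq_iff B'.hom_iff[OF tr_pgl[OF X] tr_pgl[OF Y]] B.hom_iff[OF X Y] by (simp add: tr_gi)
qed

text \<open>Both sides involve chosen representatives of comultiplications, but after the embedding
  into infinity these choices disappear. An equality, not merely an isomorphism, is what allows
  identities as structure maps.\<close>

lemma tr_ten:
  assumes X: "pgl K B X" and Y: "pgl K B Y"
  shows "tr (ten K B X Y) = ten K B' (tr X) (tr Y)"
proof (rule B'.pgl_eqI[OF tr_pgl[OF B.ten_pgl[OF X Y]] B'.ten_pgl[OF tr_pgl[OF X] tr_pgl[OF Y]]])
  note X' = tr_pgl[OF X] and Y' = tr_pgl[OF Y]
  have V: "ten_V K (tr X) (tr Y) = ten_V K X Y" by (simp add: ten_V_def fun_eq_iff)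
  have I: "ten_i K B' (tr X) (tr Y) ix = ten_i K B X Y ix" if "ix \<in> idxs" for ix using that by (simp add: ten_i_def tr_gi)
  show "fob (tr (ten K B X Y)) ix = fob (ten K B' (tr X) (tr Y)) ix" if "ix \<in> idxs" for ix
    unfolding tr_fob ten_simps(1)[OF that] V ..
  have A: "ten_a K B' (tr X) (tr Y) b x = ten_a K B X Y (\<psi> b) x"
    if b: "b \<in> carrier B'" and x: "x \<in> carrier (ten_V K X Y Infty)" for b x
  proof -
    let ?Z = "ten_V K X Y Infty"
    let ?t = "\<lambda>p q. vten K (inV X) (inV X) (inV Y) (inV Y) (ga X p) (ga Y q) x"
    have Z: "vectorspace K ?Z" by (rule B.ten_V_vs[OF X Y]) simp
    note bl = B.ten_a_bilin[OF X Y x]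
    have m: "p \<in> carrier B' \<and> q \<in> carrier B'" if "(p, q) \<in> set (comult B' b)" for p q
      using that B'.comult_set[OF b] by auto
    have "ten_a K B X Y (\<psi> b) x = tens_lift ?Z (\<lambda>p q. tens_lift ?Z ?t (pure_tensor K B B (\<psi> p) (\<psi> q))) (comult B' b)"
      unfolding ten_a_def psi_comult[OF b]
      by (rule tens_lift_hom[OF B.vs_BB Z tens_lift_lin[OF B.vs_B B.vs_B Z bl]])
         (use m psi_closed bilin_closed[OF pure_tensor_bilin[OF B.vs_B B.vs_B]] in auto)
    also have "\<dots> = tens_lift ?Z (\<lambda>p q. ?t (\<psi> p) (\<psi> q)) (comult B' b)"
      by (rule tens_lift_cong) (use m in \<open>simp add: tens_lift_pure[OF B.vs_B B.vs_B Z bl] psi_closed\<close>)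
    also have "\<dots> = tens_lift ?Z (\<lambda>p q. vten K (inV X) (inV X) (inV Y) (inV Y)
        (ga (tr X) p) (ga (tr Y) q) x) (comult B' b)"
      by (rule tens_lift_cong) (use m in \<open>simp add: tr_ga\<close>)
    finally show ?thesis by (simp add: ten_a_def V)
  qed
  fix ix jx b x assume i: "ix \<in> idxs" "jx \<in> idxs" "b \<in> fh K B' ix jx"
    and x0: "x \<in> carrier (fob (tr (ten K B X Y)) ix)"
  have x: "x \<in> carrier (ten_V K X Y ix)" using x0 unfolding tr_fob ten_simps(1)[OF i(1)] .
  have b: "b \<in> carrier B'" using B'.fh_sub i by blast
  note f = B.ten_far[OF X Y i(1,2) psi_fh[OF i] x]
  note f' = B'.ten_far[OF X' Y' i, unfolded V, OF x]
  have "ten_i K B X Y jx (far (ten K B X Y) ix jx (\<psi> b) x) = ten_i K B X Y jx (far (ten K B' (tr X) (tr Y)) ix jx b x)"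
    using f(3) f'(3) A[OF b lin_closed[OF B.ten_i_lin[OF X Y i(1)] x]] by (simp add: I i del: PG_simps)
  then have "far (ten K B X Y) ix jx (\<psi> b) x = far (ten K B' (tr X) (tr Y)) ix jx b x"
    by (rule inj_onD[OF gdataD(3)[OF B.ten_gdata[OF X Y] i(2)] _ f(2) f'(2)])
  then show "far (tr (ten K B X Y)) ix jx b x = far (ten K B' (tr X) (tr Y)) ix jx b x"
    unfolding tr_far[OF i] .
qed

lemma tr_unt: "tr (Unt (PG K B)) = Unt (PG K B')"
proof (rule B'.pgl_eqI[OF tr_pgl[OF B.unt_pgl] B'.unt_pgl])
  show "fob (tr (Unt (PG K B))) ix = fob (Unt (PG K B')) ix" if "ix \<in> idxs" for ix
    using that by (simp add: B.unt_simps B'.unt_simps)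
  fix ix jx b x assume i: "ix \<in> idxs" "jx \<in> idxs" "b \<in> fh K B' ix jx"
  have b: "b \<in> carrier B'" using B'.fh_sub i by blast
  have "counit B (\<psi> b) = counit B' b" using phi_counit[OF psi_closed[OF b]] phi_psi[OF b] by simp
  then show "far (tr (Unt (PG K B))) ix jx b x = far (Unt (PG K B')) ix jx b x"
    using i psi_fh[OF i] by (simp add: tr_far B.unt_simps B'.unt_simps)
qed

text \<open>Defined on arbitrary sets of zigzags, through the evaluations of their members. The
  empty set goes to the empty set, which \<open>trF_Q\<close> relies on.\<close>

definition trF ::
  "(('k, 'b, 'a) glider, (('k, 'b, 'a) glider, ('k, 'a) glider_map) step list set,
    ('k, 'c, 'a) glider, (('k, 'c, 'a) glider, ('k, 'a) glider_map) step list set) ftor"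
  where "trF = \<lparr>fob = tr, far = (\<lambda>X Y x. {p'. zz K B' (tr X) (tr Y) p' \<and>
     (\<exists>p\<in>x. \<forall>v\<in>hi X. zev p' v = zev p v)})\<rparr>"

lemma trF_simps [simp]: "fob trF = tr" "far trF X Y {} = {}"
  by (simp_all add: trF_def)

lemma trF_kap:
  assumes X: "pgl K B X" and Y: "pgl K B Y" and h: "h \<in> hp K B X Y"
  shows "far trF X Y (kap K B X Y h) = kap K B' (tr X) (tr Y) h"
proof
  show "far trF X Y (kap K B X Y h) \<subseteq> kap K B' (tr X) (tr Y) h"
    by (auto simp: trF_def kap_def)
  show "kap K B' (tr X) (tr Y) h \<subseteq> far trF X Y (kap K B X Y h)"
    using B.can_kap[OF X Y h] by (auto simp: trF_def kap_def intro!: bexI[of _ "can K B X Y h"])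
qed

text \<open>Both sides are empty if \<open>f\<close> is not a morphism.\<close>

lemma trF_Q:
  assumes X: "pgl K B X" and Y: "pgl K B Y"
  shows "far trF X Y (loc_Q (PG K B) (SG K B) X Y f) = loc_Q (PG K B') (SG K B') (tr X) (tr Y) f"
proof (cases "f \<in> phom K B X Y")
  case True
  then have f': "f \<in> phom K B' (tr X) (tr Y)" unfolding tr_hom[OF X Y] .
  show ?thesis unfolding B.loc_Q_kap[OF X Y True] B'.loc_Q_kap[OF tr_pgl[OF X] tr_pgl[OF Y] f']
    by (rule trF_kap[OF X Y B.hom_hp[OF X Y True]])
next
  case False
  have "\<not> zz K B X Y [Fwd X Y f]" using False by (auto elim: zigzag.cases)
  moreover have "\<not> zz K B' (tr X) (tr Y) [Fwd (tr X) (tr Y) f]"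
    using False unfolding tr_hom[OF X Y, symmetric] by (auto elim: zigzag.cases)
  ultimately show ?thesis by (simp add: loc_Q_def B.zz_class_empty B'.zz_class_empty)
qed

lemma trF_linear: "linear_functor K (GL K B) (GL K B' :: ('k, 'c, 'a) glid_category) trF"
  unfolding linear_functor_def
proof (intro conjI ballI)
  fix X :: "('k, 'b, 'a) glider" assume "X \<in> Ob (GL K B)"
  then have X: "pgl K B X" by simp
  show "fob trF X \<in> Ob (GL K B')" using tr_pgl[OF X] by simp
  show "far trF X X (Idn (GL K B) X) = Idn (GL K B') (fob trF X)"
    using trF_kap[OF X X B.hp_id[OF X]] B.GL_id[OF X X] B'.GL_id[OF tr_pgl[OF X] tr_pgl[OF X]] by (simp del: GL_simps)
next
  fix X Y :: "('k, 'b, 'a) glider" assume "X \<in> Ob (GL K B)" "Y \<in> Ob (GL K B)"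
  then have X: "pgl K B X" and Y: "pgl K B Y" by simp_all
  note X' = tr_pgl[OF X] and Y' = tr_pgl[OF Y]
  show "linear_map K (Hom (GL K B) X Y) (Hom (GL K B') (fob trF X) (fob trF Y)) (far trF X Y)"
    unfolding linear_map_iff
  proof (intro conjI)
    show "vectorspace K (Hom (GL K B) X Y)" by (rule B.GL_vs[OF X Y])
    show "vectorspace K (Hom (GL K B') (fob trF X) (fob trF Y))" unfolding trF_simps by (rule B'.GL_vs[OF X' Y'])
    show "lin K (Hom (GL K B) X Y) (Hom (GL K B') (fob trF X) (fob trF Y)) (far trF X Y)"
    proof (rule linI, unfold trF_simps)
      fix x assume "x \<in> ghom K B X Y"
      then obtain f where f: "f \<in> hp K B X Y" "x = kap K B X Y f" unfolding B.GL_carrier[OF X Y] by auto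
      have "f \<in> hp K B' (tr X) (tr Y)" unfolding tr_hp by (rule f)
      then show "far trF X Y x \<in> ghom K B' (tr X) (tr Y)"
        unfolding f(2) trF_kap[OF X Y f(1)] B'.GL_carrier[OF X' Y'] by (rule imageI)
    next
      fix x y assume "x \<in> ghom K B X Y" "y \<in> ghom K B X Y"
      then obtain f g where f: "f \<in> hp K B X Y" "x = kap K B X Y f" and g: "g \<in> hp K B X Y" "y = kap K B X Y g"
        unfolding B.GL_carrier[OF X Y] by auto
      have f': "f \<in> hp K B' (tr X) (tr Y)" and g': "g \<in> hp K B' (tr X) (tr Y)" unfolding tr_hp by (rule f g)+
      show "far trF X Y (x \<oplus>\<^bsub>Hom (GL K B) X Y\<^esub> y) = far trF X Y x \<oplus>\<^bsub>Hom (GL K B') (tr X) (tr Y)\<^esub> far trF X Y y"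
        unfolding f(2) g(2) B.GL_add[OF X Y f(1) g(1)] trF_kap[OF X Y f(1)] trF_kap[OF X Y g(1)]
          trF_kap[OF X Y B.hp_add[OF X Y f(1) g(1)]] B'.GL_add[OF X' Y' f' g'] by simp
    next
      fix c x assume c: "c \<in> carrier K" and "x \<in> ghom K B X Y"
      then obtain f where f: "f \<in> hp K B X Y" "x = kap K B X Y f" unfolding B.GL_carrier[OF X Y] by auto
      have f': "f \<in> hp K B' (tr X) (tr Y)" unfolding tr_hp by (rule f)
      show "far trF X Y (c \<odot>\<^bsub>Hom (GL K B) X Y\<^esub> x) = c \<odot>\<^bsub>Hom (GL K B') (tr X) (tr Y)\<^esub> far trF X Y x"
        unfolding f(2) B.GL_smult[OF X Y f(1) c] trF_kap[OF X Y f(1)]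
          trF_kap[OF X Y B.hp_scale[OF X Y f(1) c]] B'.GL_smult[OF X' Y' f' c] by simp
    qed
  qed
next
  fix X Y Z :: "('k, 'b, 'a) glider" and f g assume "X \<in> Ob (GL K B)" "Y \<in> Ob (GL K B)" "Z \<in> Ob (GL K B)"
    and fg: "f \<in> ghom K B X Y" "g \<in> ghom K B Y Z"
  then have X: "pgl K B X" and Y: "pgl K B Y" and Z: "pgl K B Z" by simp_all
  obtain h k where h: "h \<in> hp K B X Y" "f = kap K B X Y h" and k: "k \<in> hp K B Y Z" "g = kap K B Y Z k"
    using fg unfolding B.GL_carrier[OF X Y] B.GL_carrier[OF Y Z] by auto
  have h': "h \<in> hp K B' (tr X) (tr Y)" and k': "k \<in> hp K B' (tr Y) (tr Z)" unfolding tr_hp by (rule h k)+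
  show "far trF X Z (Cmp (GL K B) X Y Z g f) =
      Cmp (GL K B') (fob trF X) (fob trF Y) (fob trF Z) (far trF Y Z g) (far trF X Y f)"
    unfolding h(2) k(2) B.GL_comp[OF X Y Z h(1) k(1)] trF_kap[OF X Y h(1)] trF_kap[OF Y Z k(1)]
      trF_kap[OF X Z B.hp_comp[OF X Y h(1) k(1)]] trF_simps B'.GL_comp[OF tr_pgl[OF X] tr_pgl[OF Y] tr_pgl[OF Z] h' k'] by simp
qed

end

section \<open>Noetherian gliders and strict monoidality of the transport\<close>

abbreviation gld where "gld K B \<equiv> glid K B (trivial_filtration K B) {-1, 0}"

lemma gld_simps [simp]:
  "Ob (gld K B) = {M. pgl K B M \<and> noetherian_object (GL K B) M}"
  "Hom (gld K B) = Hom (GL K B)" "Idn (gld K B) = Idn (GL K B)" "Cmp (gld K B) = Cmp (GL K B)"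
  "TenO (gld K B) = ten K B" "TenA (gld K B) = TenA (GL K B)" "Unt (gld K B) = Unt (PG K B)"
  "Asc (gld K B) X Y Z = loc_Q (PG K B) (SG K B) (ten K B (ten K B X Y) Z) (ten K B X (ten K B Y Z)) (Asc (PG K B) X Y Z)"
  "LUn (gld K B) X = loc_Q (PG K B) (SG K B) (ten K B (Unt (PG K B)) X) X (LUn (PG K B) X)"
  "RUn (gld K B) X = loc_Q (PG K B) (SG K B) (ten K B X (Unt (PG K B))) X (RUn (PG K B) X)"
  by (auto simp: glid_def Glid_def localization_def)

lemma cat_iso_gld: "cat_iso (gld K B) = cat_iso (GL K B)"
  by (simp add: cat_iso_def fun_eq_iff)

context bialgebra
begin

lemma GL_idL:
  assumes X: "pgl K B X" and Y: "pgl K B Y" and x: "x \<in> ghom K B X Y \<or> x = {}"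
  shows "Cmp (GL K B) X Y Y (Idn (GL K B) Y) x = x"
  using x
proof
  assume "x \<in> ghom K B X Y"
  then obtain h where h: "h \<in> hp K B X Y" "x = kap K B X Y h" unfolding GL_carrier[OF X Y] by auto
  show ?thesis unfolding GL_id[OF Y Y] h(2) GL_comp[OF X Y Y h(1) hp_id[OF Y]]
    by (rule kap_cong) (simp add: compose_def hp_closed[OF h(1)])
next
  assume "x = {}" then show ?thesis by (simp add: loc_comp_def)
qed

lemma GL_idR:
  assumes X: "pgl K B X" and Y: "pgl K B Y" and x: "x \<in> ghom K B X Y \<or> x = {}"
  shows "Cmp (GL K B) X X Y x (Idn (GL K B) X) = x"
  using x
proof
  assume "x \<in> ghom K B X Y"
  then obtain h where h: "h \<in> hp K B X Y" "x = kap K B X Y h" unfolding GL_carrier[OF X Y] by auto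
  show ?thesis unfolding GL_id[OF X X] h(2) GL_comp[OF X X Y hp_id[OF X] h(1)]
    by (rule kap_cong) (simp add: compose_def)
next
  assume "x = {}" then show ?thesis by (simp add: loc_comp_def)
qed

lemma GL_Idn_closed: "pgl K B X \<Longrightarrow> Idn (GL K B) X \<in> ghom K B X X"
  unfolding GL_carrier GL_id by (rule imageI) (rule hp_id)

lemma GL_Idn_iso: "pgl K B X \<Longrightarrow> cat_iso (GL K B) X X (Idn (GL K B) X)"
  unfolding cat_iso_def using GL_Idn_closed GL_idL by blast

lemma GL_Idn_ten:
  assumes X: "pgl K B X" and Y: "pgl K B Y"
  shows "TenA (GL K B) X X Y Y (Idn (GL K B) X) (Idn (GL K B) Y) = Idn (GL K B) (ten K B X Y)"
  unfolding GL_id[OF X X] GL_id[OF Y Y] GL_id[OF ten_pgl[OF X Y] ten_pgl[OF X Y]]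
    GL_tensor(1)[OF X X Y Y hp_id[OF X] hp_id[OF Y]]
  by (rule kap_cong) (use pgl_vs[OF X] pgl_vs[OF Y] in \<open>auto simp: hi_ten TenA_id simp del: PG_simps\<close>)

text \<open>Coherence maps enter the localization through \<open>loc_Q\<close>. The class of
  anything that is not a morphism is empty, and the empty class obeys the identity laws
  \<open>GL_idL\<close> and \<open>GL_idR\<close> too, so both alternatives are treated alike in the
  coherence equations.\<close>

lemma loc_Q_cases:
  assumes X: "pgl K B X" and Y: "pgl K B Y"
  shows "loc_Q (PG K B) (SG K B) X Y f \<in> ghom K B X Y \<or> loc_Q (PG K B) (SG K B) X Y f = {}"
proof (cases "f \<in> phom K B X Y")
  case True
  then show ?thesis unfolding loc_Q_kap[OF X Y True] GL_carrier[OF X Y] using hom_hp[OF X Y True] by blast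
next
  case False
  have "\<not> zz K B X Y [Fwd X Y f]" using False by (auto elim: zigzag.cases)
  then show ?thesis by (simp add: loc_Q_def zz_class_empty)
qed

lemma GL_ten_closed:
  assumes "pgl K B X" "pgl K B X'" "pgl K B Y" "pgl K B Y'"
    "x \<in> ghom K B X X'" "y \<in> ghom K B Y Y'"
  shows "TenA (GL K B) X X' Y Y' x y \<in> ghom K B (ten K B X Y) (ten K B X' Y')"
proof -
  obtain f g where f: "f \<in> hp K B X X'" "x = kap K B X X' f" and g: "g \<in> hp K B Y Y'" "y = kap K B Y Y' g"
    using assms(5,6) unfolding GL_carrier[OF assms(1,2)] GL_carrier[OF assms(3,4)] by auto
  show ?thesis
    unfolding f(2) g(2) GL_tensor(1)[OF assms(1-4) f(1) g(1)]
      GL_carrier[OF ten_pgl[OF assms(1,3)] ten_pgl[OF assms(2,4)]]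
    by (rule imageI[OF ten_hp[OF assms(1-4) f(1) g(1)]])
qed

end

context bialg_iso
begin

lemma trF_ten:
  assumes "pgl K B X" "pgl K B X'" "pgl K B Y" "pgl K B Y'"
    "x \<in> ghom K B X X'" "y \<in> ghom K B Y Y'"
  shows "far trF (ten K B X Y) (ten K B X' Y') (TenA (GL K B) X X' Y Y' x y) =
    TenA (GL K B') (tr X) (tr X') (tr Y) (tr Y') (far trF X X' x) (far trF Y Y' y)"
proof -
  obtain f g where f: "f \<in> hp K B X X'" "x = kap K B X X' f" and g: "g \<in> hp K B Y Y'" "y = kap K B Y Y' g"
    using assms(5,6) unfolding B.GL_carrier[OF assms(1,2)] B.GL_carrier[OF assms(3,4)] by auto
  have f': "f \<in> hp K B' (tr X) (tr X')" and g': "g \<in> hp K B' (tr Y) (tr Y')" unfolding tr_hp by (rule f g)+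
  show ?thesis
    unfolding f(2) g(2) B.GL_tensor(1)[OF assms(1-4) f(1) g(1)]
      trF_kap[OF B.ten_pgl[OF assms(1,3)] B.ten_pgl[OF assms(2,4)] B.ten_hp[OF assms(1-4) f(1) g(1)]]
      trF_kap[OF assms(1,2) f(1)] trF_kap[OF assms(3,4) g(1)]
      B'.GL_tensor(1)[OF tr_pgl[OF assms(1)] tr_pgl[OF assms(2)] tr_pgl[OF assms(3)] tr_pgl[OF assms(4)] f' g']
      tr_ten[OF assms(1,3)] tr_ten[OF assms(2,4)] tr_fob ..
qed

lemma tr_tr: "pgl K B M \<Longrightarrow> bialg_iso.tr K B \<phi> (tr M) = M"
proof -
  interpret S: bialg_iso K B' B \<psi> \<phi> by (rule symmetric)
  assume M: "pgl K B M"
  show ?thesis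
  proof (rule B.pgl_eqI[OF S.tr_pgl[OF tr_pgl[OF M]] M])
    fix ix jx b x assume i: "ix \<in> idxs" "jx \<in> idxs" "b \<in> fh K B ix jx"
    have b: "b \<in> carrier B" using B.fh_sub i by blast
    show "far (S.tr (tr M)) ix jx b x = far M ix jx b x"
      unfolding S.tr_far[OF i] tr_far[OF i(1,2) S.psi_fh[OF i]] psi_phi[OF b] ..
  qed simp
qed

lemma trF_trF:
  assumes X: "pgl K B X" and Y: "pgl K B Y" and x: "x \<in> ghom K B X Y"
  shows "far (bialg_iso.trF K B \<phi>) (tr X) (tr Y) (far trF X Y x) = x"
proof -
  interpret S: bialg_iso K B' B \<psi> \<phi> by (rule symmetric)
  obtain f where f: "f \<in> hp K B X Y" "x = kap K B X Y f" using x unfolding B.GL_carrier[OF X Y] by auto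
  have f': "f \<in> hp K B' (tr X) (tr Y)" unfolding tr_hp by (rule f)
  show ?thesis unfolding f(2) trF_kap[OF X Y f(1)] S.trF_kap[OF tr_pgl[OF X] tr_pgl[OF Y] f'] tr_tr[OF X] tr_tr[OF Y] ..
qed

lemma tr_noetherian:
  assumes X: "pgl K B X" "noetherian_object (GL K B) X"
  shows "noetherian_object (GL K B') (tr X)"
proof -
  interpret S: bialg_iso K B' B \<psi> \<phi> by (rule symmetric)
  have "noetherian_object (GL K B') (fob trF X)"
    by (rule noetherian_transport[OF trF_linear S.trF_linear])
       (use X in \<open>simp_all add: tr_tr S.tr_tr trF_trF S.trF_trF del: GL_simps(2-)\<close>)
  then show ?thesis by simp
qed

lemma trF_gld: "linear_functor K (gld K B) (gld K B' :: ('k, 'c, 'a) glid_category) trF"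
  unfolding linear_functor_def
proof (intro conjI ballI)
  have O: "X \<in> Ob (GL K B)" if "X \<in> Ob (gld K B)" for X :: "('k, 'b, 'a) glider" using that by simp
  note D = linear_functorD[OF trF_linear]
  fix X :: "('k, 'b, 'a) glider" assume X: "X \<in> Ob (gld K B)"
  show "fob trF X \<in> Ob (gld K B')" using X by (simp add: tr_pgl tr_noetherian)
  show "far trF X X (Idn (gld K B) X) = Idn (gld K B') (fob trF X)" unfolding gld_simps by (rule D(3)[OF O[OF X]])
  fix Y :: "('k, 'b, 'a) glider" assume Y: "Y \<in> Ob (gld K B)"
  show "linear_map K (Hom (gld K B) X Y) (Hom (gld K B') (fob trF X) (fob trF Y)) (far trF X Y)"
    unfolding gld_simps by (rule D(2)[OF O[OF X] O[OF Y]])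
  fix Z :: "('k, 'b, 'a) glider" and f g assume Z: "Z \<in> Ob (gld K B)"
    and f: "f \<in> carrier (Hom (gld K B) X Y)" and g: "g \<in> carrier (Hom (gld K B) Y Z)"
  show "far trF X Z (Cmp (gld K B) X Y Z g f) =
      Cmp (gld K B') (fob trF X) (fob trF Y) (fob trF Z) (far trF Y Z g) (far trF X Y f)"
    using f g unfolding gld_simps by (rule D(4)[OF O[OF X] O[OF Y] O[OF Z]])
qed

text \<open>Transport along \<phi> and along \<psi> are strictly inverse, so identities serve as the
  two natural isomorphisms.\<close>

lemma trF_equivalence: "linear_equivalence K (gld K B) (gld K B' :: ('k, 'c, 'a) glid_category) trF"
  unfolding linear_equivalence_def
proof (intro conjI exI)
  interpret S: bialg_iso K B' B \<psi> \<phi> by (rule symmetric)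
  show "linear_functor K (gld K B) (gld K B') trF" by (rule trF_gld)
  show "linear_functor K (gld K B' :: ('k, 'c, 'a) glid_category) (gld K B) S.trF" by (rule S.trF_gld)
  show "natural_iso (gld K B :: ('k, 'b, 'a) glid_category) (gld K B) id_functor (comp_functor S.trF trF) (Idn (GL K B))"
    unfolding natural_iso_def
    by (auto simp: id_functor_def comp_functor_def tr_tr trF_trF B.GL_Idn_iso B.GL_idL B.GL_idR cat_iso_gld simp del: GL_simps(2-))
  show "natural_iso (gld K B' :: ('k, 'c, 'a) glid_category) (gld K B') (comp_functor trF S.trF) id_functor (Idn (GL K B'))"
    unfolding natural_iso_def
    by (auto simp: id_functor_def comp_functor_def S.tr_tr S.trF_trF B'.GL_Idn_iso B'.GL_idL B'.GL_idR cat_iso_gld simp del: GL_simps(2-))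
qed

lemma tr_Asc: "Asc (PG K B') (tr X) (tr Y) (tr Z) = Asc (PG K B) X Y Z"
  and tr_LUn: "LUn (PG K B') (tr X) = LUn (PG K B) X"
  and tr_RUn: "RUn (PG K B') (tr X) = RUn (PG K B) X"
  by (simp_all add: preglid_def)

text \<open>Since \<open>tr\<close> commutes strictly with tensor products, the unit and the
  coherence maps, every structure map is an identity and the axioms reduce to identity laws.\<close>

lemma trF_monoidal:
  "monoidal_functor K (gld K B) (gld K B' :: ('k, 'c, 'a) glid_category) trF
     (\<lambda>X Y. Idn (GL K B') (ten K B' (tr X) (tr Y))) (Idn (GL K B') (Unt (PG K B')))"
  unfolding monoidal_functor_def Let_def
proof (intro conjI ballI, goal_cases)
  note p' = tr_pgl and t' = B'.ten_pgl and t = B.ten_pgl and u' = B'.unt_pgl and u = B.unt_pgl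
  have ob: "X \<in> Ob (gld K B) \<Longrightarrow> pgl K B X" for X :: "('k, 'b, 'a) glider" by simp
  {
    case 1 show ?case by (rule trF_gld)
  next
    case (2 X Y)
    note X = ob[OF 2(1)] and Y = ob[OF 2(2)]
    show ?case unfolding cat_iso_gld gld_simps trF_simps tr_ten[OF X Y] by (rule B'.GL_Idn_iso[OF t'[OF p'[OF X] p'[OF Y]]])
  next
    case (3 X X' Y Y' f g)
    note X = ob[OF 3(1)] and X' = ob[OF 3(2)] and Y = ob[OF 3(3)] and Y' = ob[OF 3(4)] and fg = 3(5,6)[unfolded gld_simps]
    note P = p'[OF X] p'[OF X'] p'[OF Y] p'[OF Y']
    have F: "far trF X X' f \<in> ghom K B' (tr X) (tr X')" "far trF Y Y' g \<in> ghom K B' (tr Y) (tr Y')"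
      using linear_functorD(5)[OF trF_linear, of X X' f] linear_functorD(5)[OF trF_linear, of Y Y' g] X X' Y Y' fg
      by (simp_all del: GL_simps(2-))
    note T = disjI1[OF B'.GL_ten_closed[OF P F]]
    show ?case
      unfolding gld_simps trF_simps trF_ten[OF X X' Y Y' fg] tr_ten[OF X Y] tr_ten[OF X' Y']
        B'.GL_idL[OF t'[OF P(1,3)] t'[OF P(2,4)] T] B'.GL_idR[OF t'[OF P(1,3)] t'[OF P(2,4)] T] ..
  next
    case 4 show ?case unfolding cat_iso_gld gld_simps trF_simps tr_unt by (rule B'.GL_Idn_iso[OF u'])
  next
    case (5 X Y Z)
    note X = ob[OF 5(1)] and Y = ob[OF 5(2)] and Z = ob[OF 5(3)]
    note P = p'[OF X] p'[OF Y] p'[OF Z]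
    note A = t'[OF t'[OF P(1,2)] P(3)] and E = t'[OF P(1) t'[OF P(2,3)]]
    show ?case
      unfolding gld_simps trF_simps trF_Q[OF t[OF t[OF X Y] Z] t[OF X t[OF Y Z]]] tr_Asc
        tr_ten[OF t[OF X Y] Z] tr_ten[OF X t[OF Y Z]] tr_ten[OF X Y] tr_ten[OF Y Z]
        B'.GL_Idn_ten[OF t'[OF P(1,2)] P(3)] B'.GL_Idn_ten[OF P(1) t'[OF P(2,3)]]
        B'.GL_idL[OF A A disjI1[OF B'.GL_Idn_closed[OF A]]]
        B'.GL_idL[OF A E B'.loc_Q_cases[OF A E]] B'.GL_idR[OF A E B'.loc_Q_cases[OF A E]] ..
  next
    case (6 X)
    note X = ob[OF 6] and P = p'[OF ob[OF 6]] and T = t'[OF u' p'[OF ob[OF 6]]]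
    show ?case
      unfolding gld_simps trF_simps trF_Q[OF t[OF u X] X] tr_LUn tr_ten[OF u X] tr_unt
        B'.GL_Idn_ten[OF u' P] B'.GL_idL[OF T T disjI1[OF B'.GL_Idn_closed[OF T]]]
        B'.GL_idR[OF T P B'.loc_Q_cases[OF T P]] ..
  next
    case (7 X)
    note X = ob[OF 7] and P = p'[OF ob[OF 7]] and T = t'[OF p'[OF ob[OF 7]] u']
    show ?case
      unfolding gld_simps trF_simps trF_Q[OF t[OF X u] X] tr_RUn tr_ten[OF X u] tr_unt
        B'.GL_Idn_ten[OF P u'] B'.GL_idL[OF T T disjI1[OF B'.GL_Idn_closed[OF T]]]
        B'.GL_idR[OF T P B'.loc_Q_cases[OF T P]] ..
  }
qed

lemma isomorphic: "bialg_isomorphic K B B'"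
  unfolding bialg_isomorphic_def
proof (intro exI conjI ballI)
  show "bij_betw \<phi> (carrier B) (carrier B')"
    by (rule bij_betwI[where g = \<psi>]) (auto simp: phi_closed psi_closed psi_phi phi_psi)
  show "linear_map K B B' \<phi>" using lin_phi B.vs_B B'.vs_B by (simp add: linear_map_iff)
  show "\<phi> \<in> ring_hom B B'" using lin_add[OF lin_phi] by (auto simp: ring_hom_def phi_closed phi_mult phi_one)
qed (simp_all add: phi_counit phi_comult)

end

lemma bialg_isoI:
  fixes K :: "'k ring" and B :: "('k, 'b) bialg" and B' :: "('k, 'c) bialg"
  assumes "bialgebra K B" "bialgebra K B'"
    and bij: "bij_betw \<phi> (carrier B) (carrier B')" and lin: "lin K B B' \<phi>" and one: "\<phi> \<one>\<^bsub>B\<^esub> = \<one>\<^bsub>B'\<^esub>"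
    and mult: "\<And>a b. a \<in> carrier B \<Longrightarrow> b \<in> carrier B \<Longrightarrow> \<phi> (a \<otimes>\<^bsub>B\<^esub> b) = \<phi> a \<otimes>\<^bsub>B'\<^esub> \<phi> b"
    and cou: "\<And>b. b \<in> carrier B \<Longrightarrow> counit B' (\<phi> b) = counit B b"
    and com: "\<And>b. b \<in> carrier B \<Longrightarrow> comult B' (\<phi> b) =
      tens_lift (tensor K B' B') (\<lambda>x y. pure_tensor K B' B' (\<phi> x) (\<phi> y)) (comult B b)"
  shows "bialg_iso K B B' \<phi> (inv_into (carrier B) \<phi>)"
proof -
  interpret B: bialgebra K B by fact
  interpret B': bialgebra K B' by fact
  have i: "inj_on \<phi> (carrier B)" "\<phi> ` carrier B = carrier B'" using bij by (auto simp: bij_betw_def)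
  show ?thesis
  proof
    show "lin K B' B (inv_into (carrier B) \<phi>)"
      by (rule lin_inv_into[OF B.vs_B lin i(1) _ lin_id]) (simp add: i(2))
  qed (simp_all add: lin one mult cou com i f_inv_into_f)
qed

lemma equivalent_if_isomorphic:
  fixes K :: "'k ring" and B :: "('k, 'b) bialg" and B' :: "('k, 'c) bialg"
  assumes "bialgebra K B" "bialgebra K B'" "bialg_isomorphic K B B'"
  shows "linearly_monoidally_equivalent K (gld K B :: ('k, 'b, 'a) glid_category) (gld K B' :: ('k, 'c, 'a) glid_category)"
proof -
  obtain \<phi> where p: "bij_betw \<phi> (carrier B) (carrier B')" "linear_map K B B' \<phi>" "\<phi> \<in> ring_hom B B'"
    "\<And>b. b \<in> carrier B \<Longrightarrow> counit B' (\<phi> b) = counit B b"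
    "\<And>b. b \<in> carrier B \<Longrightarrow> comult B' (\<phi> b) = tens_lift (tensor K B' B') (\<lambda>x y. pure_tensor K B' B' (\<phi> x) (\<phi> y)) (comult B b)"
    using assms(3) by (auto simp: bialg_isomorphic_def)
  interpret bialg_iso K B B' \<phi> "inv_into (carrier B) \<phi>"
    by (rule bialg_isoI[OF assms(1,2)]) (use p in \<open>auto simp: linear_map_iff ring_hom_def\<close>)
  show ?thesis unfolding linearly_monoidally_equivalent_def using trF_monoidal trF_equivalence by blast
qed

section \<open>Noetherian objects and saturated gliders\<close>

text \<open>Nothing is known about the type \<open>'a\<close>, but scalars and lists are available
  in \<open>elt\<close>. So a vector is coded by its list of coefficients with respect to a finite
  spanning set.\<close>

lemma fgen_realization:
  assumes V: "vectorspace K V" and "fgen K V"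
  obtains \<iota> :: "'v \<Rightarrow> ('k, 'a) elt" where "inj_on \<iota> (carrier (V :: ('k, 'v, 'x) module_scheme))"
proof -
  interpret V: vectorspace K V by (rule V)
  have "V.fin_dim" using assms by (simp add: fin_dim_iff_fgen)
  then obtain A where A: "finite A" "A \<subseteq> carrier V" "V.span A = carrier V" by (auto simp: V.fin_dim_def)
  then have "\<forall>v\<in>carrier V. \<exists>a. a \<in> A \<rightarrow> carrier K \<and> v = V.lincomb a A" unfolding A(3)[symmetric] V.finite_span[OF A(1,2)] by blast
  then obtain a where a: "\<And>v. v \<in> carrier V \<Longrightarrow> a v \<in> A \<rightarrow> carrier K \<and> v = V.lincomb (a v) A" by metis
  obtain xs where xs: "set xs = A" using finite_list[OF A(1)] by auto
  \<comment> \<open>Each coefficient appears twice only because \<open>Tens\<close> takes a list of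
    pairs.\<close>
  define \<iota> :: "'v \<Rightarrow> ('k, 'a) elt" where "\<iota> v = Tens (map (\<lambda>x. (Scal (a v x), Scal (a v x))) xs)" for v
  have "inj_on \<iota> (carrier V)"
  proof (rule inj_onI)
    fix v w assume vw: "v \<in> carrier V" "w \<in> carrier V" and "\<iota> v = \<iota> w"
    then have "\<And>x. x \<in> A \<Longrightarrow> a v x = a w x" using xs by (auto simp: \<iota>_def)
    then have "V.lincomb (a v) A = V.lincomb (a w) A" using a[OF vw(2)] A(2) by (intro V.lincomb_cong) auto
    then show "v = w" using a vw by metis
  qed
  then show ?thesis by (rule that)
qed

definition hiso where
  "hiso K B X Y f g \<longleftrightarrow> f \<in> hp K B X Y \<and> g \<in> hp K B Y X \<and>
     (\<forall>x\<in>hi X. g (f x) = x) \<and> (\<forall>y\<in>hi Y. f (g y) = y)"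

definition sat where "sat B N \<longleftrightarrow> hi N \<subseteq> fm N \<one>\<^bsub>B\<^esub> ` lo N"

text \<open>The action of \<open>B\<close> on a saturated glider, that is, one with \<open>M(1\<^bsub>-1,0\<^esub>)\<close> onto.\<close>

definition act where "act B N b z = fm N b (inv_into (lo N) (fm N \<one>\<^bsub>B\<^esub>) z)"

text \<open>Describes R = (B, B, B) by what the argument uses: saturation, and a linear bijection
  from \<open>B\<close> to R(0) that turns left multiplication into the action.\<close>

definition regular where
  "regular K B R \<iota> \<longleftrightarrow> pgl K B R \<and> fgen K (hiV R) \<and> sat B R \<and> lin K B (hiV R) \<iota> \<and>
     bij_betw \<iota> (carrier B) (hi R) \<and> (\<forall>b\<in>carrier B. \<forall>c\<in>carrier B. act B R b (\<iota> c) = \<iota> (b \<otimes>\<^bsub>B\<^esub> c))"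

definition zsp :: "('k, 'r) ring_scheme \<Rightarrow> ('k, 'a) space" where
  "zsp K = mk_space {Scal \<zero>\<^bsub>K\<^esub>} (Scal \<zero>\<^bsub>K\<^esub>) (\<lambda>x y. Scal (scal x \<oplus>\<^bsub>K\<^esub> scal y)) (\<lambda>c x. Scal (c \<otimes>\<^bsub>K\<^esub> scal x))"

text \<open>T = (0, k, k). Since T(-1) = 0, the action chosen at infinity does not influence the
  morphisms from T in the localization; the counit provides one.\<close>

definition gT :: "('k, 'r) ring_scheme \<Rightarrow> ('k, 'b, 'z) bialg_scheme \<Rightarrow> ('k, 'b, 'a) glider" where
  "gT K B = gmk K B (\<lambda>ix. if ix = At (-1) then zsp K else vect_unit K) (\<lambda>ix x. x)
     (\<lambda>b x. counit B b \<odot>\<^bsub>vect_unit K\<^esub> x)"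

definition tau :: "('k, 'r) ring_scheme \<Rightarrow> ('k, 'b, 'a) glider \<Rightarrow> ('k, 'a) elt \<Rightarrow> ('k, 'a) space_map" where
  "tau K N v = (\<lambda>s\<in>Scal ` carrier K. scal s \<odot>\<^bsub>hiV N\<^esub> v)"

section \<open>Morphisms from \<open>gT\<close> and Noetherian objects\<close>

context bialgebra
begin

text \<open>Two vectors of Y(-1) that agree after applying 1 are equal, so agreement for b = 1
  forces agreement for all b.\<close>

lemma hp_one:
  assumes X: "pgl K B X" and Y: "pgl K B Y" and h: "h \<in> hp K B X Y" and x: "x \<in> lo X" and y: "y \<in> lo Y"
    and e: "h (fm X \<one>\<^bsub>B\<^esub> x) = fm Y \<one>\<^bsub>B\<^esub> y" and b: "b \<in> carrier B"
  shows "h (fm X b x) = fm Y b y"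
proof -
  obtain y' where y': "y' \<in> lo Y" "\<And>b. b \<in> carrier B \<Longrightarrow> h (fm X b x) = fm Y b y'"
    using hp_fm[OF h x] by blast
  have "y' = y" using y'(2)[OF B.one_closed] e by (intro fm_inj[OF Y y'(1) y]) simp
  then show ?thesis using y' b by simp
qed

text \<open>By \<open>hp_one\<close> the condition of \<open>hp\<close> for a map through an
  injective \<open>g\<close> has to be tested for b = 1 only. This makes both the Noetherian
  property and the inversion of maps from saturated gliders a matter of comparing subspaces.\<close>

lemma hp_factor:
  assumes X: "pgl K B X" and Y: "pgl K B Y" and M: "pgl K B M" and f: "f \<in> hp K B X M" and g: "g \<in> hp K B Y M"
    and inj: "inj_on g (hi Y)" and s: "\<And>x. x \<in> hi X \<Longrightarrow> f x \<in> g ` hi Y"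
    and l: "\<And>x. x \<in> lo X \<Longrightarrow> \<exists>y\<in>lo Y. f (fm X \<one>\<^bsub>B\<^esub> x) = g (fm Y \<one>\<^bsub>B\<^esub> y)"
  shows "(\<lambda>v\<in>hi X. inv_into (hi Y) g (f v)) \<in> hp K B X Y"
proof (rule hpI)
  show "lin K (hiV X) (hiV Y) (\<lambda>v\<in>hi X. inv_into (hi Y) g (f v))"
    unfolding lin_restrict[OF hi_vs[OF X]]
    by (rule lin_inv_into[OF hi_vs[OF Y] hp_lin[OF g] inj s hp_lin[OF f]])
  fix x assume x: "x \<in> lo X"
  obtain y where y: "y \<in> lo Y" "f (fm X \<one>\<^bsub>B\<^esub> x) = g (fm Y \<one>\<^bsub>B\<^esub> y)" using l[OF x] by auto
  obtain z where z: "z \<in> lo M" "\<And>b. b \<in> carrier B \<Longrightarrow> f (fm X b x) = fm M b z" using hp_fm[OF f x] by blast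
  have "inv_into (hi Y) g (f (fm X b x)) = fm Y b y" if b: "b \<in> carrier B" for b
  proof -
    have "g (fm Y b y) = fm M b z"
      using y(2) z(2)[OF B.one_closed] by (intro hp_one[OF Y M g y(1) z(1) _ b]) simp
    then have "f (fm X b x) = g (fm Y b y)" using z(2)[OF b] by simp
    then show ?thesis using inv_into_f_f[OF inj fm_closed[OF Y b y(1)]] by simp
  qed
  then show "\<exists>y\<in>lo Y. \<forall>b\<in>carrier B. (\<lambda>v\<in>hi X. inv_into (hi Y) g (f v)) (fm X b x) = fm Y b y"
    using y(1) fm_closed[OF X _ x] by auto
qed simp

text \<open>With M(-1) = 0 the condition of \<open>hp\<close> concerns x = 0 only, where y = 0
  serves. For M = T it follows that Hom(T, N) is N(0).\<close>

lemma hp_simple: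
  assumes M: "pgl K B M" and N: "pgl K B N" and l: "lo M = {\<zero>\<^bsub>loV M\<^esub>}"
    and f: "lin K (hiV M) (hiV N) f" "f \<in> extensional (hi M)"
  shows "f \<in> hp K B M N"
proof (rule hpI[OF f])
  fix x assume "x \<in> lo M" then have x: "x = \<zero>\<^bsub>loV M\<^esub>" using l by simp
  have z: "\<zero>\<^bsub>loV N\<^esub> \<in> lo N"
    using lo_vs[OF N] lsub_carrier[of K "loV N"] by (simp add: lsub_def)
  have "f (fm M b x) = fm N b \<zero>\<^bsub>loV N\<^esub>" if b: "b \<in> carrier B" for b
    using lin_zero[OF lo_vs[OF M] hi_vs[OF M] fm_lin[OF M b]]
      lin_zero[OF lo_vs[OF N] hi_vs[OF N] fm_lin[OF N b]]
      lin_zero[OF hi_vs[OF M] hi_vs[OF N] f(1)] by (simp add: x)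
  then show "\<exists>y\<in>lo N. \<forall>b\<in>carrier B. f (fm M b x) = fm N b y" using z by blast
qed

lemma gT_fob: "hiV (gT K B) = vect_unit K" "lo (gT K B) = {Scal \<zero>\<^bsub>K\<^esub>}"
  by (simp_all add: gT_def gmk_simps zsp_def)

lemma zsp_vs: "vectorspace K (zsp K :: ('k, 'd) space)"
  by (rule vectorspace_transport[OF vect_unit_vs[OF field_K], where g = "\<lambda>x. x"])
    (simp_all add: zsp_def)

lemma gT_pgl: "pgl K B (gT K B :: ('k, 'b, 'd) glider)"
proof -
  have "gdata K B (\<lambda>ix. if ix = At (-1) then zsp K else vect_unit K :: ('k, 'd) space) (\<lambda>ix x. x)
     (\<lambda>b x. counit B b \<odot>\<^bsub>(if Infty = At (-1) then zsp K else vect_unit K :: ('k, 'd) space)\<^esub> x)"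
    by (rule triv_gdata) (auto simp: zsp_vs vect_unit_vs[OF field_K] lin_id, auto simp: zsp_def lin_def)
  then show ?thesis unfolding gT_def by (intro gmk_pgl) (simp only: idx.distinct if_False)
qed

lemma tau_hp:
  assumes N: "pgl K B N" and v: "v \<in> hi N" shows "tau K N v \<in> hp K B (gT K B) N"
proof (rule hp_simple[OF gT_pgl N])
  show "lo (gT K B) = {\<zero>\<^bsub>loV (gT K B)\<^esub>}" by (simp add: gT_def gmk_simps zsp_def)
  show "lin K (hiV (gT K B)) (hiV N) (tau K N v)"
    unfolding gT_fob tau_def vect_unit_simps(1)[symmetric] lin_restrict[OF vect_unit_vs[OF field_K]]
    by (rule lin_from_unit[OF hi_vs[OF N] v])
qed (simp add: tau_def gT_fob)

lemma tau_one: "pgl K B N \<Longrightarrow> v \<in> hi N \<Longrightarrow> tau K N v (Scal \<one>\<^bsub>K\<^esub>) = v"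
proof -
  assume "pgl K B N" "v \<in> hi N"
  interpret N: vectorspace K "hiV N" by (rule hi_vs[OF _]) fact
  show ?thesis using \<open>v \<in> hi N\<close> by (simp add: tau_def)
qed

lemma hp_gT_eqI:
  fixes N :: "('k, 'b, 'd) glider"
  assumes N: "pgl K B N" and f: "f \<in> hp K B (gT K B) N" and g: "g \<in> hp K B (gT K B) N"
    and e: "f (Scal \<one>\<^bsub>K\<^esub>) = g (Scal \<one>\<^bsub>K\<^esub>)"
  shows "f = g"
proof (rule hp_eqI[OF f g])
  fix x assume "x \<in> hi (gT K B :: ('k, 'b, 'd) glider)"
  then obtain c where c: "x = Scal c" "c \<in> carrier K" by (auto simp: gT_fob)
  have x: "x = c \<odot>\<^bsub>vect_unit K\<^esub> Scal \<one>\<^bsub>K\<^esub>" using c by simp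
  have o: "Scal \<one>\<^bsub>K\<^esub> \<in> carrier (vect_unit K)" by simp
  show "f x = g x" unfolding x lin_smult[OF hp_lin[OF f, unfolded gT_fob] c(2) o]
    lin_smult[OF hp_lin[OF g, unfolded gT_fob] c(2) o] e ..
qed

text \<open>By \<open>hp_factor\<close>, containment of subobjects of \<open>M\<close> can be read
  off from two subspaces of the finite-dimensional M(0): the images of their values at 0 and at
  -1.\<close>

lemma noetherianI:
  assumes M: "pgl K B M" and fg: "fgen K (hiV M)"
  shows "noetherian_object (GL K B) (M :: ('k, 'b, 'd) glider)"
  unfolding noetherian_object_def
proof (intro allI impI, elim conjE)
  fix S :: "nat \<Rightarrow> ('k, 'b, 'd) glider" and m
  assume mono: "\<forall>n. S n \<in> Ob (GL K B) \<and> cat_mono (GL K B) (S n) M (m n)"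
    and le: "\<forall>n. subobject_le (GL K B) M (S n) (m n) (S (Suc n)) (m (Suc n))"
  have S: "pgl K B (S n)" for n using mono by simp
  have "m n \<in> ghom K B (S n) M" for n
    using mono[rule_format, of n, THEN conjunct2] unfolding cat_mono_def by (rule conjunct1)
  then have "\<exists>h. h \<in> hp K B (S n) M \<and> m n = kap K B (S n) M h" for n
    unfolding GL_carrier[OF S M] image_iff by blast
  then obtain h where h: "\<And>n. h n \<in> hp K B (S n) M" and m: "\<And>n. m n = kap K B (S n) M (h n)" by metis
  \<comment> \<open>Monomorphisms are injective at 0, since different vectors give different
    morphisms from T.\<close>
  have inj: "inj_on (h n) (hi (S n))" for n
  proof (rule inj_onI)
    fix v w assume vw: "v \<in> hi (S n)" "w \<in> hi (S n)" and e: "h n v = h n w"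
    have t: "tau K (S n) v \<in> hp K B (gT K B) (S n)" "tau K (S n) w \<in> hp K B (gT K B) (S n)"
      using tau_hp[OF S] vw by auto
    have o: "Scal \<one>\<^bsub>K\<^esub> \<in> hi (gT K B)" by (simp add: gT_fob)
    have "compose (hi (gT K B)) (h n) (tau K (S n) v) = compose (hi (gT K B)) (h n) (tau K (S n) w)"
      by (rule hp_gT_eqI[OF M hp_comp[OF gT_pgl S t(1) h] hp_comp[OF gT_pgl S t(2) h]])
        (simp add: compose_eq[OF o] tau_one[OF S] vw e)
    then have "Cmp (GL K B) (gT K B) (S n) M (m n) (kap K B (gT K B) (S n) (tau K (S n) v)) =
        Cmp (GL K B) (gT K B) (S n) M (m n) (kap K B (gT K B) (S n) (tau K (S n) w))"
      unfolding m GL_comp[OF gT_pgl S M t(1) h] GL_comp[OF gT_pgl S M t(2) h] by simp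
    moreover have "gT K B \<in> Ob (GL K B)"
      "kap K B (gT K B) (S n) (tau K (S n) v) \<in> ghom K B (gT K B) (S n)"
      "kap K B (gT K B) (S n) (tau K (S n) w) \<in> ghom K B (gT K B) (S n)"
      using gT_pgl t unfolding GL_carrier[OF gT_pgl S] by auto
    ultimately have "kap K B (gT K B) (S n) (tau K (S n) v) = kap K B (gT K B) (S n) (tau K (S n) w)"
      using mono[rule_format, of n, THEN conjunct2, unfolded cat_mono_def, THEN conjunct2, rule_format] by simp
    then have "tau K (S n) v = tau K (S n) w" by (rule kap_inj[OF gT_pgl S t])
    then show "v = w" by (metis tau_one[OF S vw(1)] tau_one[OF S vw(2)])
  qed
  have "\<exists>k. k \<in> hp K B (S n) (S (Suc n)) \<and> (\<forall>x\<in>hi (S n). h (Suc n) (k x) = h n x)" for n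
  proof -
    obtain x where x: "x \<in> ghom K B (S n) (S (Suc n))" "Cmp (GL K B) (S n) (S (Suc n)) M (m (Suc n)) x = m n"
      using le[rule_format, of n, unfolded subobject_le_def] by (rule bexE) (rule that)
    obtain k where k: "k \<in> hp K B (S n) (S (Suc n))" "x = kap K B (S n) (S (Suc n)) k"
      using x(1) unfolding GL_carrier[OF S S] by (rule imageE) (rule that)
    have "kap K B (S n) M (compose (hi (S n)) (h (Suc n)) k) = kap K B (S n) M (h n)"
      using x(2) unfolding k(2) m GL_comp[OF S S M k(1) h] .
    then have "compose (hi (S n)) (h (Suc n)) k = h n"
      by (rule kap_inj[OF S M hp_comp[OF S S k(1) h] h])
    then show ?thesis using k(1) by (metis compose_eq)
  qed
  then obtain k where k: "\<And>n. k n \<in> hp K B (S n) (S (Suc n))" "\<And>n x. x \<in> hi (S n) \<Longrightarrow> h (Suc n) (k n x) = h n x"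
    by metis
  \<comment> \<open>Both chains of images become stationary; from the larger of the two indices on,
    \<open>hp_factor\<close> yields the factorizations.\<close>
  define U where "U n = h n ` hi (S n)" for n
  define W where "W n = (\<lambda>x. h n (fm (S n) \<one>\<^bsub>B\<^esub> x)) ` lo (S n)" for n
  have vM: "vectorspace K (hiV M)" by (rule pgl_vs[OF M]) simp
  have "lsub K (hiV M) (U n)" for n unfolding U_def
    by (rule lsub_image[OF hi_vs[OF S] vM hp_lin[OF h] lsub_carrier[OF hi_vs[OF S]]])
  moreover have "U n \<subseteq> U (Suc n)" for n unfolding U_def
    by (intro image_subsetI, rule image_eqI[where f = "h (Suc n)", OF k(2)[symmetric]]) (simp_all add: hp_closed[OF k(1)])
  ultimately obtain N1 where N1: "\<And>n. n \<ge> N1 \<Longrightarrow> U n = U N1" using fgen_chain[OF vM fg] by blast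
  have "lsub K (hiV M) (W n)" for n unfolding W_def
    by (rule lsub_image[OF lo_vs[OF S] vM lin_comp[OF fm_lin[OF S B.one_closed] hp_lin[OF h]]
        lsub_carrier[OF lo_vs[OF S]]])
  moreover have "W n \<subseteq> W (Suc n)" for n
  proof
    fix y assume "y \<in> W n"
    then obtain x where x: "x \<in> lo (S n)" "y = h n (fm (S n) \<one>\<^bsub>B\<^esub> x)" by (auto simp: W_def)
    obtain z where z: "z \<in> lo (S (Suc n))" "k n (fm (S n) \<one>\<^bsub>B\<^esub> x) = fm (S (Suc n)) \<one>\<^bsub>B\<^esub> z"
      using hp_fm[OF k(1) x(1)] by blast
    have "y = h (Suc n) (fm (S (Suc n)) \<one>\<^bsub>B\<^esub> z)"
      unfolding x(2) z(2)[symmetric] by (rule k(2)[OF fm_closed[OF S B.one_closed x(1)], symmetric])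
    then show "y \<in> W (Suc n)" using z(1) by (simp add: W_def)
  qed
  ultimately obtain N2 where N2: "\<And>n. n \<ge> N2 \<Longrightarrow> W n = W N2" using fgen_chain[OF vM fg] by blast
  show "\<exists>N. \<forall>n\<ge>N. subobject_le (GL K B) M (S n) (m n) (S N) (m N)"
  proof (intro exI allI impI)
    define N where "N = max N1 N2"
    fix n assume n: "n \<ge> max N1 N2"
    have UW: "U n = U N" "W n = W N" using N1[of n] N1[of N] N2[of n] N2[of N] n by (auto simp: N_def)
    let ?k = "\<lambda>v\<in>hi (S n). inv_into (hi (S N)) (h N) (h n v)"
    have s: "h n x \<in> h N ` hi (S N)" if "x \<in> hi (S n)" for x using UW(1) that by (auto simp: U_def)
    have kk: "?k \<in> hp K B (S n) (S N)"
      using UW(2) s by (intro hp_factor[OF S S M h h inj]) (auto simp: W_def image_iff set_eq_iff)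
    have "compose (hi (S n)) (h N) ?k = h n"
      by (rule hp_eqI[OF hp_comp[OF S S kk h] h]) (simp add: compose_eq f_inv_into_f[OF s])
    then have "Cmp (GL K B) (S n) (S N) M (m N) (kap K B (S n) (S N) ?k) = m n"
      unfolding m GL_comp[OF S S M kk h] by simp
    then show "subobject_le (GL K B) M (S n) (m n) (S (max N1 N2)) (m (max N1 N2))"
      unfolding subobject_le_def N_def[symmetric] GL_carrier[OF S S] using kk by blast
  qed
qed

section \<open>Saturated gliders and the action of \<open>B\<close> on them\<close>

lemma act_fm: "pgl K B N \<Longrightarrow> x \<in> lo N \<Longrightarrow> act B N b (fm N \<one>\<^bsub>B\<^esub> x) = fm N b x"
  unfolding act_def by (simp add: inv_into_f_f inj_on_def fm_inj)

lemma satD: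
  assumes "sat B N" "z \<in> hi N" obtains x where "x \<in> lo N" "z = fm N \<one>\<^bsub>B\<^esub> x"
  using assms by (auto simp: sat_def)

text \<open>Saturation is used twice for the last claim: z is lifted to -1 so that c can act, and c
  z is lifted again so that b can act on it. At infinity the two actions multiply.\<close>

lemma sat_act:
  assumes N: "pgl K B N" and s: "sat B N" and z: "z \<in> hi N"
  shows act_closed: "b \<in> carrier B \<Longrightarrow> act B N b z \<in> hi N"
    and act_lin: "lin K B (hiV N) (\<lambda>b. act B N b z)"
    and act_one: "act B N \<one>\<^bsub>B\<^esub> z = z"
    and act_mult: "b \<in> carrier B \<Longrightarrow> c \<in> carrier B \<Longrightarrow> act B N (b \<otimes>\<^bsub>B\<^esub> c) z = act B N b (act B N c z)"
proof -
  obtain x where x: "x \<in> lo N" "z = fm N \<one>\<^bsub>B\<^esub> x" by (rule satD[OF s z])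
  show cl: "b \<in> carrier B \<Longrightarrow> act B N b z \<in> hi N" for b using x by (simp add: act_fm[OF N] fm_closed[OF N])
  show "lin K B (hiV N) (\<lambda>b. act B N b z)" using x by (simp add: act_fm[OF N] fm_lin2[OF N])
  show "act B N \<one>\<^bsub>B\<^esub> z = z" using x by (simp add: act_fm[OF N])
  assume b: "b \<in> carrier B" and c: "c \<in> carrier B"
  obtain y where y: "y \<in> lo N" "act B N c z = fm N \<one>\<^bsub>B\<^esub> y" by (rule satD[OF s cl[OF c]])
  have "gi B N (At 0) (fm N (b \<otimes>\<^bsub>B\<^esub> c) x) = ga N b (gi B N (At 0) (fm N c x))"
    using b c x by (simp add: gi_fm[OF N] ga_mult[OF N] gi_closed[OF N])
  also have "fm N c x = fm N \<one>\<^bsub>B\<^esub> y" using x y(2) by (simp add: act_fm[OF N])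
  finally have "gi B N (At 0) (fm N (b \<otimes>\<^bsub>B\<^esub> c) x) = gi B N (At 0) (fm N b y)"
    using b y(1) by (simp add: gi_fm[OF N] ga_one[OF N] gi_closed[OF N])
  then have "fm N (b \<otimes>\<^bsub>B\<^esub> c) x = fm N b y"
    by (rule gi_inj[OF N idxs_mem(2) fm_closed[OF N B.m_closed[OF b c] x(1)] fm_closed[OF N b y(1)]])
  then show "act B N (b \<otimes>\<^bsub>B\<^esub> c) z = act B N b (act B N c z)"
    unfolding y(2) act_fm[OF N y(1)] unfolding x(2) act_fm[OF N x(1)] .
qed

lemma hp_act:
  assumes X: "pgl K B X" and Y: "pgl K B Y" and h: "h \<in> hp K B X Y" and s: "sat B X"
    and z: "z \<in> hi X" and b: "b \<in> carrier B"
  shows "h (act B X b z) = act B Y b (h z)"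
proof -
  obtain x where x: "x \<in> lo X" "z = fm X \<one>\<^bsub>B\<^esub> x" by (rule satD[OF s z])
  obtain y where y: "y \<in> lo Y" "\<And>b. b \<in> carrier B \<Longrightarrow> h (fm X b x) = fm Y b y" using hp_fm[OF h x(1)] by blast
  show ?thesis unfolding x(2) act_fm[OF X x(1)] y(2)[OF b] y(2)[OF B.one_closed] act_fm[OF Y y(1)] ..
qed

lemma sat_hp:
  assumes X: "pgl K B X" and Y: "pgl K B Y" and h: "h \<in> hp K B X Y" and s: "sat B X" and on: "hi Y \<subseteq> h ` hi X"
  shows "sat B Y" unfolding sat_def
proof
  fix y assume "y \<in> hi Y"
  then obtain z where z: "z \<in> hi X" "y = h z" using on by auto
  obtain x where x: "x \<in> lo X" "z = fm X \<one>\<^bsub>B\<^esub> x" by (rule satD[OF s z(1)])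
  obtain y' where "y' \<in> lo Y" "h (fm X \<one>\<^bsub>B\<^esub> x) = fm Y \<one>\<^bsub>B\<^esub> y'" using hp_fm[OF h x(1)] by blast
  then show "y \<in> fm Y \<one>\<^bsub>B\<^esub> ` lo Y" using x z by auto
qed

text \<open>For y in Y(-1) the preimage of 1 y in X(0) comes from X(-1) by saturation. This is the
  condition under which \<open>hp_factor\<close> accepts the inverse map.\<close>

lemma sat_hiso:
  assumes X: "pgl K B X" and Y: "pgl K B Y" and h: "h \<in> hp K B X Y" and s: "sat B X"
    and bij: "bij_betw h (hi X) (hi Y)"
  obtains g where "hiso K B X Y h g"
proof -
  have im: "h ` hi X = hi Y" and inj: "inj_on h (hi X)" using bij by (auto simp: bij_betw_def)
  have "(\<lambda>v\<in>hi Y. inv_into (hi X) h ((\<lambda>v\<in>hi Y. v) v)) \<in> hp K B Y X"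
  proof (rule hp_factor[OF Y X Y hp_id[OF Y] h inj])
    fix y assume "y \<in> lo Y"
    then have f: "fm Y \<one>\<^bsub>B\<^esub> y \<in> hi Y" by (simp add: fm_closed[OF Y])
    then obtain z where z: "z \<in> hi X" "fm Y \<one>\<^bsub>B\<^esub> y = h z" using im by auto
    obtain x where "x \<in> lo X" "z = fm X \<one>\<^bsub>B\<^esub> x" by (rule satD[OF s z(1)])
    then show "\<exists>x\<in>lo X. (\<lambda>v\<in>hi Y. v) (fm Y \<one>\<^bsub>B\<^esub> y) = h (fm X \<one>\<^bsub>B\<^esub> x)" using z f by auto
  qed (simp add: im)
  then have "hiso K B X Y h (\<lambda>v\<in>hi Y. inv_into (hi X) h ((\<lambda>v\<in>hi Y. v) v))"
    unfolding hiso_def using h inj im hp_closed[OF h] by (auto simp: f_inv_into_f)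
  then show ?thesis by (rule that)
qed

lemma GL_isoD:
  assumes X: "pgl K B X" and Y: "pgl K B Y" and x: "cat_iso (GL K B) X Y x"
  obtains f g where "x = kap K B X Y f" "hiso K B X Y f g"
proof -
  obtain f g where f: "f \<in> hp K B X Y" "x = kap K B X Y f" and g: "g \<in> hp K B Y X"
    and e: "Cmp (GL K B) X Y X (kap K B Y X g) (kap K B X Y f) = Idn (GL K B) X"
      "Cmp (GL K B) Y X Y (kap K B X Y f) (kap K B Y X g) = Idn (GL K B) Y"
    using x unfolding cat_iso_def GL_carrier[OF X Y] GL_carrier[OF Y X] by blast
  have 1: "compose (hi X) g f = (\<lambda>v\<in>hi X. v)"
    using e(1) unfolding GL_comp[OF X Y X f(1) g] GL_id[OF X X]
    by (rule kap_inj[OF X X hp_comp[OF X Y f(1) g] hp_id[OF X]])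
  have 2: "compose (hi Y) f g = (\<lambda>v\<in>hi Y. v)"
    using e(2) unfolding GL_comp[OF Y X Y g f(1)] GL_id[OF Y Y]
    by (rule kap_inj[OF Y Y hp_comp[OF Y X g f(1)] hp_id[OF Y]])
  have "g (f x) = x" if "x \<in> hi X" for x using fun_cong[OF 1, of x] that by (simp add: compose_eq)
  moreover have "f (g y) = y" if "y \<in> hi Y" for y using fun_cong[OF 2, of y] that by (simp add: compose_eq)
  ultimately show ?thesis using f g by (intro that[of f g]) (auto simp: hiso_def)
qed

text \<open>Both sides are compared after the embedding into infinity, where \<Delta>(b) acts
  without restriction and pure tensors can be followed through each term.\<close>

lemma ten_act_sat:
  assumes X: "pgl K B X" and Y: "pgl K B Y" and x: "x \<in> lo X" and y: "y \<in> lo Y" and b: "b \<in> carrier B"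
  shows "vect_pure K (loV X) (loV Y) x y \<in> lo (ten K B X Y)"
    and "fm (ten K B X Y) b (vect_pure K (loV X) (loV Y) x y) =
      tens_lift (hiV (ten K B X Y))
        (\<lambda>p q. vect_pure K (hiV X) (hiV Y) (fm X p x) (fm Y q y)) (comult B b)"
proof -
  let ?z = "vect_pure K (loV X) (loV Y) x y"
  let ?t = "tens_lift (ten_V K X Y (At 0))
    (\<lambda>p q. vect_pure K (hiV X) (hiV Y) (fm X p x) (fm Y q y)) (comult B b)"
  have vX: "ix \<in> idxs \<Longrightarrow> vectorspace K (fob X ix)" and vY: "ix \<in> idxs \<Longrightarrow> vectorspace K (fob Y ix)" for ix
    using pgl_vs[OF X] pgl_vs[OF Y] by auto
  have z: "?z \<in> carrier (ten_V K X Y (At (-1)))"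
    unfolding ten_V_def by (rule vt_pure_closed[OF vX vY]) (simp_all add: x y)
  then show "?z \<in> lo (ten K B X Y)" unfolding ten_simps(1)[OF idxs_mem(1)] .
  have l: "(p, q) \<in> set (comult B b) \<Longrightarrow> p \<in> carrier B \<and> q \<in> carrier B" for p q using comult_set[OF b] by auto
  have pc: "vect_pure K (hiV X) (hiV Y) (fm X p x) (fm Y q y) \<in> carrier (ten_V K X Y (At 0))"
    if "(p, q) \<in> set (comult B b)" for p q
    unfolding ten_V_def by (rule vt_pure_closed[OF vX vY]) (simp_all add: fm_closed[OF X _ x] fm_closed[OF Y _ y] l[OF that])
  have ipure: "ten_i K B X Y ix (vect_pure K (fob X ix) (fob Y ix) u v) =
      vect_pure K (inV X) (inV Y) (gi B X ix u) (gi B Y ix v)"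
    if "ix \<in> idxs" "u \<in> carrier (fob X ix)" "v \<in> carrier (fob Y ix)" for ix u v
    unfolding ten_i_def using that
    by (intro TenA_pure vX vY gi_lin[OF X] gi_lin[OF Y]) simp_all
  have "ten_i K B X Y (At 0) (fm (ten K B X Y) b ?z) = ten_a K B X Y b (ten_i K B X Y (At (-1)) ?z)"
    by (rule ten_far(3)[OF X Y]) (simp_all add: b z)
  also have "\<dots> = tens_lift (ten_V K X Y Infty) (\<lambda>p q. vect_pure K (inV X) (inV Y)
      (ga X p (gi B X (At (-1)) x)) (ga Y q (gi B Y (At (-1)) y))) (comult B b)"
    unfolding ipure[OF idxs_mem(1) x y] ten_a_def
    by (intro tens_lift_cong TenA_pure vX vY ga_lin[OF X] ga_lin[OF Y])
      (auto dest: l simp: gi_closed[OF X] gi_closed[OF Y] x y)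
  also have "\<dots> = tens_lift (ten_V K X Y Infty) (\<lambda>p q. ten_i K B X Y (At 0)
      (vect_pure K (hiV X) (hiV Y) (fm X p x) (fm Y q y))) (comult B b)"
  proof (rule tens_lift_cong)
    fix p q assume "(p, q) \<in> set (comult B b)"
    then have "p \<in> carrier B" "q \<in> carrier B" using l by auto
    then show "vect_pure K (inV X) (inV Y) (ga X p (gi B X (At (-1)) x)) (ga Y q (gi B Y (At (-1)) y)) =
        ten_i K B X Y (At 0) (vect_pure K (hiV X) (hiV Y) (fm X p x) (fm Y q y))"
      using x y by (simp add: ipure fm_closed[OF X] fm_closed[OF Y] gi_fm[OF X] gi_fm[OF Y])
  qed
  also have "\<dots> = ten_i K B X Y (At 0) ?t"
    by (rule tens_lift_hom[OF ten_V_vs[OF X Y] ten_V_vs[OF X Y] ten_i_lin[OF X Y], symmetric]) (simp_all add: pc)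
  finally have e: "ten_i K B X Y (At 0) (fm (ten K B X Y) b ?z) = ten_i K B X Y (At 0) ?t" .
  have t: "?t \<in> carrier (ten_V K X Y (At 0))" by (rule tens_lift_closed[OF ten_V_vs[OF X Y] pc]) simp_all
  have f: "fm (ten K B X Y) b ?z \<in> carrier (ten_V K X Y (At 0))"
    by (rule ten_far(2)[OF X Y]) (simp_all add: b z)
  have "fm (ten K B X Y) b ?z = ?t"
    by (rule inj_onD[OF gdataD(3)[OF ten_gdata[OF X Y] idxs_mem(2)] e f t])
  then show "fm (ten K B X Y) b ?z = tens_lift (hiV (ten K B X Y))
        (\<lambda>p q. vect_pure K (hiV X) (hiV Y) (fm X p x) (fm Y q y)) (comult B b)"
    unfolding ten_simps(1)[OF idxs_mem(2)] .
qed

text \<open>The image of the component at -1 is a subspace of the component at 0 that contains every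
  pure tensor of lifted vectors, and by saturation of both factors these are all pure
  tensors.\<close>

lemma sat_ten:
  assumes X: "pgl K B X" and Y: "pgl K B Y" and sX: "sat B X" and sY: "sat B Y"
  shows "sat B (ten K B X Y)"
    and "x \<in> hi X \<Longrightarrow> y \<in> hi Y \<Longrightarrow> b \<in> carrier B \<Longrightarrow>
      act B (ten K B X Y) b (vect_pure K (hiV X) (hiV Y) x y) =
      tens_lift (vect_tensor K (hiV X) (hiV Y))
        (\<lambda>p q. vect_pure K (hiV X) (hiV Y) (act B X p x) (act B Y q y)) (comult B b)"
proof -
  have vX: "vectorspace K (hiV X)" and vY: "vectorspace K (hiV Y)"
    using pgl_vs[OF X] pgl_vs[OF Y] by auto
  have P: "pgl K B (ten K B X Y)" by (rule ten_pgl[OF X Y])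
  have f: "hiV (ten K B X Y) = vect_tensor K (hiV X) (hiV Y)"
    unfolding ten_simps(1)[OF idxs_mem(2)] ten_V_def ..
  have one: "fm (ten K B X Y) \<one>\<^bsub>B\<^esub> (vect_pure K (loV X) (loV Y) x y) =
      vect_pure K (hiV X) (hiV Y) (fm X \<one>\<^bsub>B\<^esub> x) (fm Y \<one>\<^bsub>B\<^esub> y)" if "x \<in> lo X" "y \<in> lo Y" for x y
    unfolding ten_act_sat(2)[OF X Y that B.one_closed] comult_one f
    by (rule tens_lift_pure[OF vs_B vs_B vt_vs[OF vX vY]
          bilin_comp[OF vt_pure_bilin[OF vX vY] fm_lin2[OF X that(1)] fm_lin2[OF Y that(2)] lin_id]]) simp_all
  have "carrier (vect_tensor K (hiV X) (hiV Y)) \<subseteq> fm (ten K B X Y) \<one>\<^bsub>B\<^esub> ` lo (ten K B X Y)"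
  proof (rule vt_gen[OF vX vY])
    show "lsub K (vect_tensor K (hiV X) (hiV Y)) (fm (ten K B X Y) \<one>\<^bsub>B\<^esub> ` lo (ten K B X Y))"
      unfolding f[symmetric] by (rule lsub_image[OF lo_vs[OF P] hi_vs[OF P]
        fm_lin[OF P B.one_closed] lsub_carrier[OF lo_vs[OF P]]])
    fix v w assume vw: "v \<in> hi X" "w \<in> hi Y"
    obtain x where x: "x \<in> lo X" "v = fm X \<one>\<^bsub>B\<^esub> x" by (rule satD[OF sX vw(1)])
    obtain y where y: "y \<in> lo Y" "w = fm Y \<one>\<^bsub>B\<^esub> y" by (rule satD[OF sY vw(2)])
    show "vect_pure K (hiV X) (hiV Y) v w \<in> fm (ten K B X Y) \<one>\<^bsub>B\<^esub> ` lo (ten K B X Y)"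
      unfolding x(2) y(2) one[OF x(1) y(1), symmetric] by (rule imageI[OF ten_act_sat(1)[OF X Y x(1) y(1) B.one_closed]])
  qed
  then show "sat B (ten K B X Y)" unfolding sat_def f .
  assume h: "x \<in> hi X" "y \<in> hi Y" and b: "b \<in> carrier B"
  obtain u where u: "u \<in> lo X" "x = fm X \<one>\<^bsub>B\<^esub> u" by (rule satD[OF sX h(1)])
  obtain v where v: "v \<in> lo Y" "y = fm Y \<one>\<^bsub>B\<^esub> v" by (rule satD[OF sY h(2)])
  show "act B (ten K B X Y) b (vect_pure K (hiV X) (hiV Y) x y) =
      tens_lift (vect_tensor K (hiV X) (hiV Y))
        (\<lambda>p q. vect_pure K (hiV X) (hiV Y) (act B X p x) (act B Y q y)) (comult B b)"
    unfolding u(2) v(2) act_fm[OF X u(1)] act_fm[OF Y v(1)] one[OF u(1) v(1), symmetric]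
      act_fm[OF P ten_act_sat(1)[OF X Y u(1) v(1) B.one_closed]] ten_act_sat(2)[OF X Y u(1) v(1) b] f ..
qed

lemma unt_sat: "sat B (Unt (PG K B) :: ('k, 'b, 'd) glider)"
  and unt_act: "b \<in> carrier B \<Longrightarrow> s \<in> carrier K \<Longrightarrow> act B (Unt (PG K B) :: ('k, 'b, 'd) glider) b (Scal s) = Scal (counit B b \<otimes>\<^bsub>K\<^esub> s)"
proof -
  let ?I = "Unt (PG K B) :: ('k, 'b, 'd) glider"
  have K: "cring K" using field_K by (simp add: field.axioms domain.axioms(1))
  interpret K: cring K by (rule K)
  have fm: "b \<in> carrier B \<Longrightarrow> s \<in> carrier K \<Longrightarrow> fm ?I b (Scal s) = Scal (counit B b \<otimes>\<^bsub>K\<^esub> s)" for b s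
    by (simp add: unt_simps)
  have o: "s \<in> carrier K \<Longrightarrow> fm ?I \<one>\<^bsub>B\<^esub> (Scal s) = Scal s" for s by (simp add: fm counit_one)
  have lo: "s \<in> carrier K \<Longrightarrow> Scal s \<in> lo ?I" for s by (simp add: unt_simps)
  show "sat B ?I" unfolding sat_def
  proof
    fix x assume "x \<in> hi ?I"
    then obtain s where "x = Scal s" "s \<in> carrier K" by (auto simp: unt_simps)
    then show "x \<in> fm ?I \<one>\<^bsub>B\<^esub> ` lo ?I"
      using o lo by (intro image_eqI[of _ _ "Scal s"]) simp_all
  qed
  assume b: "b \<in> carrier B" and s: "s \<in> carrier K"
  show "act B ?I b (Scal s) = Scal (counit B b \<otimes>\<^bsub>K\<^esub> s)"
    using act_fm[OF unt_pgl lo[OF s], of b] unfolding o[OF s] fm[OF b s] .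
qed

lemma regularD:
  assumes "regular K B R \<iota>"
  shows "pgl K B R" "fgen K (hiV R)" "sat B R" "lin K B (hiV R) \<iota>"
    "bij_betw \<iota> (carrier B) (hi R)" "\<And>b c. b \<in> carrier B \<Longrightarrow> c \<in> carrier B \<Longrightarrow> act B R b (\<iota> c) = \<iota> (b \<otimes>\<^bsub>B\<^esub> c)"
  using assms by (auto simp: regular_def)

text \<open>The regular glider is free on \<iota> 1 among saturated gliders: a vector z prescribes
  the morphism c to c z.\<close>

lemma regular_map:
  assumes R: "regular K B R \<iota>" and N: "pgl K B N" and s: "sat B N" and z: "z \<in> hi N"
  obtains m where "m \<in> hp K B R N" "\<And>c. c \<in> carrier B \<Longrightarrow> m (\<iota> c) = act B N c z"
proof -
  note r = regularD[OF R]
  have im: "\<iota> ` carrier B = hi R" and inj: "inj_on \<iota> (carrier B)" using r(5) by (auto simp: bij_betw_def)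
  define m where "m = (\<lambda>x\<in>hi R. act B N (inv_into (carrier B) \<iota> x) z)"
  have m: "m (\<iota> c) = act B N c z" if "c \<in> carrier B" for c
    using that im inj by (auto simp: m_def inv_into_f_f)
  have "m \<in> hp K B R N"
  proof (rule hpI)
    have "lin K (hiV R) B (\<lambda>x. inv_into (carrier B) \<iota> x)"
      by (rule lin_inv_into[OF vs_B r(4) inj _ lin_id]) (simp add: im)
    then show "lin K (hiV R) (hiV N) m"
      unfolding m_def lin_restrict[OF hi_vs[OF r(1)]] by (rule lin_comp[OF _ act_lin[OF N s z]])
    show "m \<in> extensional (hi R)" by (simp add: m_def)
    fix x assume x: "x \<in> lo R"
    obtain c where c: "c \<in> carrier B" "fm R \<one>\<^bsub>B\<^esub> x = \<iota> c"
      using fm_closed[OF r(1) B.one_closed x] im by auto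
    obtain y where y: "y \<in> lo N" "act B N c z = fm N \<one>\<^bsub>B\<^esub> y" by (rule satD[OF s act_closed[OF N s z c(1)]])
    have "m (fm R b x) = fm N b y" if b: "b \<in> carrier B" for b
      unfolding act_fm[OF r(1) x, of b, symmetric] c(2) r(6)[OF b c(1)] m[OF B.m_closed[OF b c(1)]]
        act_mult[OF N s z b c(1)] y(2) by (rule act_fm[OF N y(1)])
    then show "\<exists>y\<in>lo N. \<forall>b\<in>carrier B. m (fm R b x) = fm N b y" using y(1) by blast
  qed
  then show ?thesis using m by (rule that)
qed

lemma regular_glider:
  assumes fg: "fgen K B"
  obtains R :: "('k, 'b, 'd) glider" and \<iota> where "regular K B R \<iota>"
proof -
  obtain \<iota> :: "'b \<Rightarrow> ('k, 'd) elt" where inj: "inj_on \<iota> (carrier B)" by (rule fgen_realization[OF vs_B fg])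
  define \<kappa> where "\<kappa> = inv_into (carrier B) \<iota>"
  have ki [simp]: "b \<in> carrier B \<Longrightarrow> \<kappa> (\<iota> b) = b" for b by (simp add: \<kappa>_def inv_into_f_f[OF inj])
  \<comment> \<open>The vector space \<open>B\<close>, moved into the universe along the embedding
    \<iota>.\<close>
  define V :: "('k, 'd) space" where "V = mk_space (\<iota> ` carrier B) (\<iota> \<zero>\<^bsub>B\<^esub>)
     (\<lambda>x y. \<iota> (\<kappa> x \<oplus>\<^bsub>B\<^esub> \<kappa> y)) (\<lambda>c x. \<iota> (c \<odot>\<^bsub>B\<^esub> \<kappa> x))"
  interpret vB: vectorspace K B by (rule vs_B)
  have V: "vectorspace K V"
    by (rule vectorspace_transport[OF vs_B, where g = \<kappa>]) (auto simp: V_def inj_on_def)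
  have li: "lin K B V \<iota>" and lk: "lin K V B \<kappa>" by (auto simp: lin_def V_def)
  have cV: "carrier V = \<iota> ` carrier B" by (simp add: V_def)
  have mr: "c \<in> carrier B \<Longrightarrow> lin K B B (\<lambda>b. b \<otimes>\<^bsub>B\<^esub> c)" for c
    by (rule linI) (simp_all add: B.l_distr smult_mult_left)
  have ml: "b \<in> carrier B \<Longrightarrow> lin K B B (\<lambda>c. b \<otimes>\<^bsub>B\<^esub> c)" for b
    by (rule linI) (simp_all add: B.r_distr smult_mult_right)
  have g: "gdata K B (\<lambda>ix. V) (\<lambda>ix x. x) (\<lambda>b x. \<iota> (b \<otimes>\<^bsub>B\<^esub> \<kappa> x))"
    unfolding gdata_def
  proof (intro conjI ballI)
    show "lin K V V (\<lambda>x. \<iota> (b \<otimes>\<^bsub>B\<^esub> \<kappa> x))" if "b \<in> carrier B" for b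
      using lin_comp[OF lin_comp[OF lk ml[OF that]] li] by simp
    show "lin K B V (\<lambda>b. \<iota> (b \<otimes>\<^bsub>B\<^esub> \<kappa> x))" if "x \<in> carrier V" for x
      by (rule lin_comp[OF mr li]) (use that cV in auto)
  qed (auto simp: V lin_id cV B.m_assoc)
  define R :: "('k, 'b, 'd) glider" where "R = gmk K B (\<lambda>ix. V) (\<lambda>ix x. x) (\<lambda>b x. \<iota> (b \<otimes>\<^bsub>B\<^esub> \<kappa> x))"
  have P: "pgl K B R" unfolding R_def by (rule gmk_pgl[OF g])
  have fo: "ix \<in> idxs \<Longrightarrow> fob R ix = V" for ix by (simp add: R_def gmk_simps)
  have fm: "fm R b (\<iota> c) = \<iota> (b \<otimes>\<^bsub>B\<^esub> c)" if "b \<in> carrier B" "c \<in> carrier B" for b c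
    using gmk_far(2)[OF g idxs_mem(1,2), of b "\<iota> c"] that by (simp add: R_def cV)
  have one: "fm R \<one>\<^bsub>B\<^esub> (\<iota> c) = \<iota> c" if "c \<in> carrier B" for c using fm[OF B.one_closed that] that by simp
  have "act B R b (\<iota> c) = \<iota> (b \<otimes>\<^bsub>B\<^esub> c)" if "b \<in> carrier B" "c \<in> carrier B" for b c
    using act_fm[OF P, of "\<iota> c" b] that by (simp add: one fo cV fm)
  moreover have "sat B R" unfolding sat_def
  proof
    fix x assume "x \<in> hi R"
    then obtain c where c: "c \<in> carrier B" "x = \<iota> c" by (auto simp: fo cV)
    show "x \<in> fm R \<one>\<^bsub>B\<^esub> ` lo R" unfolding c(2) by (rule image_eqI[where f = "fm R \<one>\<^bsub>B\<^esub>", OF one[OF c(1), symmetric]]) (simp add: c fo cV)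
  qed
  moreover have "fgen K V" by (rule fgen_image[OF vs_B V li _ fg]) (simp add: cV)
  ultimately have "regular K B R \<iota>"
    using P li inj by (simp add: regular_def fo cV bij_betw_def)
  then show ?thesis by (rule that)
qed

text \<open>On the largest \<open>B\<close>-submodule U contained in N(0) the given action is kept,
  and on a linear complement \<open>B\<close> acts through the counit. This makes N(0) a module. The
  image of N(-1) lies in U, so the identity on N(0) is a morphism to the resulting saturated
  glider.\<close>

lemma sat_hull:
  assumes N: "pgl K B N"
  obtains P where "pgl K B P" "hiV P = hiV N" "sat B P" "(\<lambda>v\<in>hi N. v) \<in> hp K B N P"
proof -
  define V where "V = hiV N"
  define i where "i = gi B N (At 0)"
  have vV: "vectorspace K V" and vI: "vectorspace K (inV N)" using pgl_vs[OF N] by (auto simp: V_def)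
  interpret V: vectorspace K V by (rule vV)
  have li: "lin K V (inV N) i" unfolding V_def i_def by (rule gi_lin[OF N idxs_mem(2)])
  have inj: "inj_on i (carrier V)" unfolding V_def i_def by (rule gdataD(3)[OF pgl_gdata[OF N] idxs_mem(2)])
  obtain j where lj: "lin K (inV N) V j" and ji: "\<And>v. v \<in> carrier V \<Longrightarrow> j (i v) = v"
    using lin_left_inverse[OF vV vI li inj] by metis
  have ic: "v \<in> carrier V \<Longrightarrow> i v \<in> carrier (inV N)" for v by (rule lin_closed[OF li])
  define I where "I = i ` carrier V"
  have "lsub K (inV N) I" unfolding I_def by (rule lsub_image[OF vV vI li lsub_carrier[OF vV]])
  then have I: "\<zero>\<^bsub>inV N\<^esub> \<in> I" "\<And>x y. x \<in> I \<Longrightarrow> y \<in> I \<Longrightarrow> x \<oplus>\<^bsub>inV N\<^esub> y \<in> I"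
    "\<And>c x. c \<in> carrier K \<Longrightarrow> x \<in> I \<Longrightarrow> c \<odot>\<^bsub>inV N\<^esub> x \<in> I" by (simp_all add: lsub_def)
  \<comment> \<open>The vectors of N(0) that \<open>B\<close> does not move out of N(0) inside
    N(\<infinity>). By associativity this subspace is stable under \<open>B\<close>.\<close>
  define U where "U = {w \<in> carrier V. \<forall>b\<in>carrier B. ga N b (i w) \<in> I}"
  have lgi: "b \<in> carrier B \<Longrightarrow> lin K V (inV N) (\<lambda>w. ga N b (i w))" for b
    by (rule lin_comp[OF li ga_lin[OF N]])
  have "lsub K V U" unfolding lsub_def
    by (auto simp: U_def I lin_zero[OF vV vI lgi] lin_add[OF lgi] lin_smult[OF lgi])
  then obtain p where lp: "lin K V V p" and pU: "\<And>v. v \<in> carrier V \<Longrightarrow> p v \<in> U" and pu: "\<And>u. u \<in> U \<Longrightarrow> p u = u"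
    using subspace_retraction[OF vV] by metis
  have Uc: "u \<in> U \<Longrightarrow> u \<in> carrier V" for u by (simp add: U_def)
  have pc: "v \<in> carrier V \<Longrightarrow> p v \<in> carrier V" for v using Uc pU by blast
  \<comment> \<open>q = 1 - p is the projection onto the complement of \<open>U\<close>.\<close>
  define q where "q v = v \<oplus>\<^bsub>V\<^esub> (\<ominus>\<^bsub>K\<^esub> \<one>\<^bsub>K\<^esub>) \<odot>\<^bsub>V\<^esub> p v" for v
  have lq: "lin K V V q" unfolding q_def
    by (rule lin_plus[OF vV vV lin_id lin_scale[OF vV vV lp]]) simp
  have qc: "v \<in> carrier V \<Longrightarrow> q v \<in> carrier V" for v by (rule lin_closed[OF lq])
  have cancel: "v \<in> carrier V \<Longrightarrow> v \<oplus>\<^bsub>V\<^esub> (\<ominus>\<^bsub>K\<^esub> \<one>\<^bsub>K\<^esub>) \<odot>\<^bsub>V\<^esub> v = \<zero>\<^bsub>V\<^esub>" for v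
    by (simp add: V.smult_l_minus V.r_neg)
  have qu: "u \<in> U \<Longrightarrow> q u = \<zero>\<^bsub>V\<^esub>" for u unfolding q_def by (simp add: pu cancel Uc)
  have pq: "p v \<oplus>\<^bsub>V\<^esub> q v = v" if "v \<in> carrier V" for v
    using that pc[OF that] unfolding q_def by (simp add: V.smult_l_minus V.a_lcomm[of "p v" v] V.r_neg)
  have pq0: "p (q v) = \<zero>\<^bsub>V\<^esub>" if v: "v \<in> carrier V" for v
    unfolding q_def using v pc[OF v] pu[OF pU[OF v]]
    by (simp add: lin_add[OF lp] lin_smult[OF lp] cancel)
  have qq: "q (q v) = q v" if v: "v \<in> carrier V" for v using pq[OF qc[OF v]] by (simp add: pq0[OF v] qc v)
  \<comment> \<open>\<open>j\<close> is a linear left inverse of the embedding \<open>i\<close>,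
    defined on the whole module at infinity. It keeps the formula linear, and on \<open>U\<close> it
    recovers the original action.\<close>
  define a where "a b w = j (ga N b (i (p w))) \<oplus>\<^bsub>V\<^esub> counit B b \<odot>\<^bsub>V\<^esub> q w" for b w
  have U_act: "j (ga N b (i u)) \<in> U" "i (j (ga N b (i u))) = ga N b (i u)" if "u \<in> U" "b \<in> carrier B" for b u
  proof -
    have "ga N b (i u) \<in> I" using that by (simp add: U_def)
    then obtain v where v: "v \<in> carrier V" "ga N b (i u) = i v" unfolding I_def by (rule imageE) (rule that)
    then have jv: "j (ga N b (i u)) = v" by (simp add: ji)
    show "i (j (ga N b (i u))) = ga N b (i u)" by (simp add: ji v)
    have "ga N c (i v) \<in> I" if c: "c \<in> carrier B" for c
      unfolding v(2)[symmetric] ga_mult[OF N c \<open>b \<in> carrier B\<close> ic[OF Uc[OF \<open>u \<in> U\<close>]], symmetric]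
      using \<open>u \<in> U\<close> c \<open>b \<in> carrier B\<close> by (simp add: U_def)
    then show "j (ga N b (i u)) \<in> U" by (simp add: jv U_def v(1))
  qed
  have g: "gdata K B (\<lambda>ix. V) (\<lambda>ix x. x) a"
    unfolding gdata_def
  proof (intro conjI ballI)
    show l1: "lin K V V (a b)" if b: "b \<in> carrier B" for b
      unfolding a_def[abs_def] by (rule lin_plus[OF vV vV lin_comp[OF lin_comp[OF lp lgi[OF b]] lj]
        lin_scale[OF vV vV lq counit_closed[OF b]]])
    show "lin K B V (\<lambda>b. a b x)" if x: "x \<in> carrier V" for x
      unfolding a_def by (rule lin_plus[OF vs_B vV lin_comp[OF ga_lin2[OF N ic[OF pc[OF x]]] lj] counit_lin[OF vV qc[OF x]]])
    show "a \<one>\<^bsub>B\<^esub> x = x" if x: "x \<in> carrier V" for x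
      by (simp add: a_def counit_one ga_one[OF N] ic pc x ji qc pq)
    show "a (b \<otimes>\<^bsub>B\<^esub> c) x = a b (a c x)" if b: "b \<in> carrier B" and c: "c \<in> carrier B" and x: "x \<in> carrier V" for b c x
    proof -
      let ?w = "j (ga N c (i (p x)))"
      have w: "?w \<in> U" "i ?w = ga N c (i (p x))" using U_act[OF pU[OF x] c] by auto
      have k: "counit B b \<in> carrier K" "counit B c \<in> carrier K" using b c by (auto simp: counit_closed)
      have "p (a c x) = ?w" "q (a c x) = counit B c \<odot>\<^bsub>V\<^esub> q x"
        unfolding a_def using w k x
        by (simp_all add: lin_add[OF lp] lin_smult[OF lp] lin_add[OF lq] lin_smult[OF lq] Uc qc pq0 qq pu qu)
      then have "a b (a c x) = j (ga N b (i ?w)) \<oplus>\<^bsub>V\<^esub> counit B b \<odot>\<^bsub>V\<^esub> (counit B c \<odot>\<^bsub>V\<^esub> q x)" by (simp add: a_def)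
      also have "\<dots> = a (b \<otimes>\<^bsub>B\<^esub> c) x"
        unfolding w(2) a_def ga_mult[OF N b c ic[OF pc[OF x]]] counit_mult[OF b c]
        using k by (simp add: V.smult_assoc1 qc x)
      finally show ?thesis by simp
    qed
    show "a b x \<in> (\<lambda>x. x) ` carrier V" if "b \<in> carrier B" "x \<in> carrier V" for b x
      using lin_closed[OF l1[OF that(1)] that(2)] by simp
  qed (simp_all add: vV lin_id)
  define P where "P = gmk K B (\<lambda>ix. V) (\<lambda>ix x. x) a"
  have P: "pgl K B P" unfolding P_def by (rule gmk_pgl[OF g])
  have fo: "ix \<in> idxs \<Longrightarrow> fob P ix = V" for ix by (simp add: P_def gmk_simps)
  have fm: "fm P b x = a b x" if "b \<in> carrier B" "x \<in> carrier V" for b x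
    using gmk_far(2)[OF g idxs_mem(1,2), of b x] that by (simp add: P_def)
  have "sat B P" unfolding sat_def
  proof
    fix x assume "x \<in> hi P" then have x: "x \<in> carrier V" by (simp add: fo)
    have "fm P \<one>\<^bsub>B\<^esub> x = x" using x gdataD(7)[OF g] by (simp add: fm)
    then show "x \<in> fm P \<one>\<^bsub>B\<^esub> ` lo P" using x by (intro image_eqI[of _ _ x]) (simp_all add: fo)
  qed
  moreover have "(\<lambda>v\<in>hi N. v) \<in> hp K B N P"
  proof (rule hpI)
    show "lin K (hiV N) (hiV P) (\<lambda>v\<in>hi N. v)"
      unfolding lin_restrict[OF hi_vs[OF N]] by (simp add: fo V_def lin_id)
    fix x assume x: "x \<in> lo N"
    let ?y = "fm N \<one>\<^bsub>B\<^esub> x"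
    have y: "?y \<in> carrier V" unfolding V_def by (rule fm_closed[OF N B.one_closed x])
    have gb: "ga N b (i ?y) = i (fm N b x)" if "b \<in> carrier B" for b
      unfolding i_def gi_fm_one[OF N x] gi_fm[OF N that x] ..
    \<comment> \<open>All of b x lies in N(0) for x in N(-1), so \<open>N\<close> itself already
      acts on this vector as the hull does, and the counit part vanishes.\<close>
    have yU: "?y \<in> U" using y gb fm_closed[OF N _ x] by (auto simp: U_def V_def I_def)
    have e: "fm N b x = fm P b ?y" if b: "b \<in> carrier B" for b
      using fm_closed[OF N b x] counit_closed[OF b]
      by (simp add: fm[OF b y] a_def pu[OF yU] qu[OF yU] gb[OF b] ji flip: V_def)
    show "\<exists>y\<in>lo P. \<forall>b\<in>carrier B. (\<lambda>v\<in>hi N. v) (fm N b x) = fm P b y"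
    proof (intro bexI[of _ ?y] ballI)
      show "(\<lambda>v\<in>hi N. v) (fm N b x) = fm P b ?y" if b: "b \<in> carrier B" for b
        unfolding restrict_apply'[OF fm_closed[OF N b x]] by (rule e[OF b])
    qed (simp add: y fo)
  qed simp
  ultimately show ?thesis using P fo by (intro that[of P]) (simp_all add: V_def)
qed

end

section \<open>Equivalences\<close>

text \<open>A \<open>lincat\<close> is raw data. The standard facts about equivalences below use the
  category axioms, which \<open>gld_cat\<close> provides for gliders.\<close>

definition is_cat :: "('k, 'o, 'm, 'z) lincat_scheme \<Rightarrow> bool" where
  "is_cat C \<longleftrightarrow> (\<forall>X\<in>Ob C. Idn C X \<in> carrier (Hom C X X)) \<and>
    (\<forall>X\<in>Ob C. \<forall>Y\<in>Ob C. \<forall>f\<in>carrier (Hom C X Y). Cmp C X X Y f (Idn C X) = f \<and> Cmp C X Y Y (Idn C Y) f = f) \<and>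
    (\<forall>X\<in>Ob C. \<forall>Y\<in>Ob C. \<forall>Z\<in>Ob C. \<forall>f\<in>carrier (Hom C X Y). \<forall>g\<in>carrier (Hom C Y Z).
       Cmp C X Y Z g f \<in> carrier (Hom C X Z)) \<and>
    (\<forall>W\<in>Ob C. \<forall>X\<in>Ob C. \<forall>Y\<in>Ob C. \<forall>Z\<in>Ob C.
       \<forall>f\<in>carrier (Hom C W X). \<forall>g\<in>carrier (Hom C X Y). \<forall>h\<in>carrier (Hom C Y Z).
         Cmp C W X Z (Cmp C X Y Z h g) f = Cmp C W Y Z h (Cmp C W X Y g f))"

lemma is_catD:
  assumes "is_cat C"
  shows "X \<in> Ob C \<Longrightarrow> Idn C X \<in> carrier (Hom C X X)"
    "X \<in> Ob C \<Longrightarrow> Y \<in> Ob C \<Longrightarrow> f \<in> carrier (Hom C X Y) \<Longrightarrow> Cmp C X X Y f (Idn C X) = f"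
    "X \<in> Ob C \<Longrightarrow> Y \<in> Ob C \<Longrightarrow> f \<in> carrier (Hom C X Y) \<Longrightarrow> Cmp C X Y Y (Idn C Y) f = f"
    "X \<in> Ob C \<Longrightarrow> Y \<in> Ob C \<Longrightarrow> Z \<in> Ob C \<Longrightarrow> f \<in> carrier (Hom C X Y) \<Longrightarrow> g \<in> carrier (Hom C Y Z) \<Longrightarrow>
      Cmp C X Y Z g f \<in> carrier (Hom C X Z)"
    "W \<in> Ob C \<Longrightarrow> X \<in> Ob C \<Longrightarrow> Y \<in> Ob C \<Longrightarrow> Z \<in> Ob C \<Longrightarrow> f \<in> carrier (Hom C W X) \<Longrightarrow>
      g \<in> carrier (Hom C X Y) \<Longrightarrow> h \<in> carrier (Hom C Y Z) \<Longrightarrow>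
      Cmp C W X Z (Cmp C X Y Z h g) f = Cmp C W Y Z h (Cmp C W X Y g f)"
  using assms by (simp_all add: is_cat_def)

lemma iso_cancel_left:
  assumes C: "is_cat C" and o: "X \<in> Ob C" "Y \<in> Ob C" "Z \<in> Ob C" and e: "cat_iso C Y Z e"
    and f: "f \<in> carrier (Hom C X Y)" and g: "g \<in> carrier (Hom C X Y)"
    and eq: "Cmp C X Y Z e f = Cmp C X Y Z e g"
  shows "f = g"
proof -
  note c = is_catD[OF C]
  obtain e' where e': "e' \<in> carrier (Hom C Z Y)" "Cmp C Y Z Y e' e = Idn C Y" and eh: "e \<in> carrier (Hom C Y Z)"
    using e by (auto simp: cat_iso_def)
  have "Cmp C X Z Y e' (Cmp C X Y Z e h) = h" if h: "h \<in> carrier (Hom C X Y)" for h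
    unfolding c(5)[OF o(1,2,3,2) h eh e'(1), symmetric] e'(2) by (rule c(3)[OF o(1,2) h])
  then show ?thesis using f g eq by metis
qed

lemma iso_cancel_right:
  assumes C: "is_cat C" and o: "X \<in> Ob C" "Y \<in> Ob C" "Z \<in> Ob C" and e: "cat_iso C X Y e"
    and f: "f \<in> carrier (Hom C Y Z)" and g: "g \<in> carrier (Hom C Y Z)"
    and eq: "Cmp C X Y Z f e = Cmp C X Y Z g e"
  shows "f = g"
proof -
  note c = is_catD[OF C]
  obtain e' where e': "e' \<in> carrier (Hom C Y X)" "Cmp C Y X Y e e' = Idn C Y" and eh: "e \<in> carrier (Hom C X Y)"
    using e by (auto simp: cat_iso_def)
  have "Cmp C Y X Z (Cmp C X Y Z h e) e' = h" if h: "h \<in> carrier (Hom C Y Z)" for h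
    unfolding c(5)[OF o(2,1,2,3) e'(1) eh h] e'(2) by (rule c(2)[OF o(2,3) h])
  then show ?thesis using f g eq by metis
qed

text \<open>Naturality of \<eta> together with its invertibility gives faithfulness of
  \<open>F\<close>, and \<epsilon> does the same for the quasi-inverse \<open>G\<close>. Fullness of
  \<open>F\<close> then uses faithfulness of \<open>G\<close>.\<close>

lemma equivalence_properties:
  assumes C: "is_cat C" and D: "is_cat D" and E: "linear_equivalence K C D F"
  shows equivalence_faithful: "X \<in> Ob C \<Longrightarrow> Y \<in> Ob C \<Longrightarrow> f \<in> carrier (Hom C X Y) \<Longrightarrow> g \<in> carrier (Hom C X Y) \<Longrightarrow>
      far F X Y f = far F X Y g \<Longrightarrow> f = g"
    and equivalence_full: "X \<in> Ob C \<Longrightarrow> Y \<in> Ob C \<Longrightarrow> h \<in> carrier (Hom D (fob F X) (fob F Y)) \<Longrightarrow>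
      \<exists>f\<in>carrier (Hom C X Y). far F X Y f = h"
    and equivalence_ess_surj: "Z \<in> Ob D \<Longrightarrow> \<exists>X\<in>Ob C. \<exists>e. cat_iso D (fob F X) Z e"
proof -
  obtain G \<eta> \<epsilon> where F: "linear_functor K C D F" and G: "linear_functor K D C G"
    and n: "natural_iso C C id_functor (comp_functor G F) \<eta>" "natural_iso D D (comp_functor F G) id_functor \<epsilon>"
    using E by (auto simp: linear_equivalence_def)
  note Fo = linear_functorD(1)[OF F] and Go = linear_functorD(1)[OF G]
    and Fa = linear_functorD(5)[OF F] and Ga = linear_functorD(5)[OF G]
  have ei: "X \<in> Ob C \<Longrightarrow> cat_iso C X (fob G (fob F X)) (\<eta> X)" for X
    using n(1) by (simp add: natural_iso_def id_functor_def comp_functor_def)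
  have en: "X \<in> Ob C \<Longrightarrow> Y \<in> Ob C \<Longrightarrow> f \<in> carrier (Hom C X Y) \<Longrightarrow>
      Cmp C X Y (fob G (fob F Y)) (\<eta> Y) f =
      Cmp C X (fob G (fob F X)) (fob G (fob F Y)) (far G (fob F X) (fob F Y) (far F X Y f)) (\<eta> X)" for X Y f
    using n(1) by (simp add: natural_iso_def id_functor_def comp_functor_def)
  have di: "X \<in> Ob D \<Longrightarrow> cat_iso D (fob F (fob G X)) X (\<epsilon> X)" for X
    using n(2) by (simp add: natural_iso_def id_functor_def comp_functor_def)
  have dn: "X \<in> Ob D \<Longrightarrow> Y \<in> Ob D \<Longrightarrow> f \<in> carrier (Hom D X Y) \<Longrightarrow>
      Cmp D (fob F (fob G X)) (fob F (fob G Y)) Y (\<epsilon> Y) (far F (fob G X) (fob G Y) (far G X Y f)) =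
      Cmp D (fob F (fob G X)) X Y f (\<epsilon> X)" for X Y f
    using n(2) by (simp add: natural_iso_def id_functor_def comp_functor_def)
  show fa: "f = g" if o: "X \<in> Ob C" "Y \<in> Ob C" and f: "f \<in> carrier (Hom C X Y)" and g: "g \<in> carrier (Hom C X Y)"
    and e: "far F X Y f = far F X Y g" for X Y f g
    by (rule iso_cancel_left[OF C o(1,2) Go[OF Fo[OF o(2)]] ei[OF o(2)] f g])
      (simp add: en[OF o f] en[OF o g] e)
  have ga: "f = g" if o: "X \<in> Ob D" "Y \<in> Ob D" and f: "f \<in> carrier (Hom D X Y)" and g: "g \<in> carrier (Hom D X Y)"
    and e: "far G X Y f = far G X Y g" for X Y f g
    by (rule iso_cancel_right[OF D Fo[OF Go[OF o(1)]] o(1,2) di[OF o(1)] f g])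
      (simp add: dn[OF o f, symmetric] dn[OF o g, symmetric] e)
  show "\<exists>f\<in>carrier (Hom C X Y). far F X Y f = h" if o: "X \<in> Ob C" "Y \<in> Ob C"
    and h: "h \<in> carrier (Hom D (fob F X) (fob F Y))" for X Y h
  proof -
    let ?GX = "fob G (fob F X)" and ?GY = "fob G (fob F Y)" and ?k = "far G (fob F X) (fob F Y) h"
    note go = Go[OF Fo[OF o(1)]] Go[OF Fo[OF o(2)]]
    have k: "?k \<in> carrier (Hom C ?GX ?GY)" by (rule Ga[OF Fo[OF o(1)] Fo[OF o(2)] h])
    have eX: "\<eta> X \<in> carrier (Hom C X ?GX)" and eY: "\<eta> Y \<in> carrier (Hom C Y ?GY)"
      using ei o by (auto simp: cat_iso_def)
    obtain e' where e': "e' \<in> carrier (Hom C ?GY Y)" "Cmp C ?GY Y ?GY (\<eta> Y) e' = Idn C ?GY"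
      using ei[OF o(2)] by (auto simp: cat_iso_def)
    have ke: "Cmp C X ?GX ?GY ?k (\<eta> X) \<in> carrier (Hom C X ?GY)" by (rule is_catD(4)[OF C o(1) go eX k])
    \<comment> \<open>The preimage of h is \<eta> inverse after G h after \<eta>. Then G(F f) = G h
      by naturality, and faithfulness of \<open>G\<close> gives F f = h.\<close>
    define f where "f = Cmp C X ?GY Y e' (Cmp C X ?GX ?GY ?k (\<eta> X))"
    have f: "f \<in> carrier (Hom C X Y)" unfolding f_def by (rule is_catD(4)[OF C o(1) go(2) o(2) ke e'(1)])
    have "Cmp C X Y ?GY (\<eta> Y) f = Cmp C X ?GX ?GY ?k (\<eta> X)"
      unfolding f_def is_catD(5)[OF C o(1) go(2) o(2) go(2) ke e'(1) eY, symmetric] e'(2)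
      by (rule is_catD(3)[OF C o(1) go(2) ke])
    then have "far G (fob F X) (fob F Y) (far F X Y f) = ?k"
      unfolding en[OF o f] by (rule iso_cancel_right[OF C o(1) go ei[OF o(1)] Ga[OF Fo[OF o(1)] Fo[OF o(2)] Fa[OF o f]] k])
    then have "far F X Y f = h" by (rule ga[OF Fo[OF o(1)] Fo[OF o(2)] Fa[OF o f] h])
    then show ?thesis using f by blast
  qed
  show "Z \<in> Ob D \<Longrightarrow> \<exists>X\<in>Ob C. \<exists>e. cat_iso D (fob F X) Z e" for Z using di Go by blast
qed

context bialgebra
begin

lemma gld_cat: "is_cat (gld K B :: ('k, 'b, 'd) glid_category)"
proof -
  have kc: "Cmp (GL K B) X Y Z g f \<in> ghom K B X Z"
    if P: "pgl K B X" "pgl K B Y" "pgl K B Z" and f0: "f \<in> ghom K B X Y" and g0: "g \<in> ghom K B Y Z"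
    for X Y Z :: "('k, 'b, 'd) glider" and f g
  proof -
    obtain f' where f: "f' \<in> hp K B X Y" "f = kap K B X Y f'"
      using f0 unfolding GL_carrier[OF P(1,2)] by (rule imageE) (rule that)
    obtain g' where g: "g' \<in> hp K B Y Z" "g = kap K B Y Z g'"
      using g0 unfolding GL_carrier[OF P(2,3)] by (rule imageE) (rule that)
    show ?thesis unfolding f g GL_comp[OF P f(1) g(1)] GL_carrier[OF P(1,3)] by (rule imageI[OF hp_comp[OF P(1,2) f(1) g(1)]])
  qed
  have ka: "Cmp (GL K B) W X Z (Cmp (GL K B) X Y Z h g) f = Cmp (GL K B) W Y Z h (Cmp (GL K B) W X Y g f)"
    if P: "pgl K B W" "pgl K B X" "pgl K B Y" "pgl K B Z" and f0: "f \<in> ghom K B W X"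
      and g0: "g \<in> ghom K B X Y" and h0: "h \<in> ghom K B Y Z"
    for W X Y Z :: "('k, 'b, 'd) glider" and f g h
  proof -
    obtain f' where f: "f' \<in> hp K B W X" "f = kap K B W X f'"
      using f0 unfolding GL_carrier[OF P(1,2)] by (rule imageE) (rule that)
    obtain g' where g: "g' \<in> hp K B X Y" "g = kap K B X Y g'"
      using g0 unfolding GL_carrier[OF P(2,3)] by (rule imageE) (rule that)
    obtain h' where h: "h' \<in> hp K B Y Z" "h = kap K B Y Z h'"
      using h0 unfolding GL_carrier[OF P(3,4)] by (rule imageE) (rule that)
    show ?thesis
      unfolding f h g GL_comp[OF P(2,3,4) g(1) h(1)] GL_comp[OF P(1,2,3) f(1) g(1)]
        GL_comp[OF P(1,2,4) f(1) hp_comp[OF P(2,3) g(1) h(1)]] GL_comp[OF P(1,3,4) hp_comp[OF P(1,2) f(1) g(1)] h(1)]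
      by (rule kap_cong) (simp add: compose_eq hp_closed[OF f(1)])
  qed
  show ?thesis unfolding is_cat_def gld_simps
    by (intro conjI ballI) (simp_all only: mem_Collect_eq GL_Idn_closed GL_idL GL_idR kc ka simp_thms)
qed

lemma tau_comp:
  assumes X: "pgl K B X" and Y: "pgl K B Y" and h: "h \<in> hp K B X Y" and x: "x \<in> hi X"
  shows "compose (hi (gT K B)) h (tau K X x) = tau K Y (h x)"
  by (rule hp_gT_eqI[OF Y hp_comp[OF gT_pgl X tau_hp[OF X x] h] tau_hp[OF Y hp_closed[OF h x]]])
    (simp add: compose_def gT_fob tau_one[OF X x] tau_one[OF Y hp_closed[OF h x]])

lemma tau_inj:
  assumes N: "pgl K B N" and v: "v \<in> hi N" "v \<noteq> \<zero>\<^bsub>hiV N\<^esub>"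
  shows "inj_on (tau K N v) (carrier (vect_unit K))"
proof -
  interpret N: vectorspace K "hiV N" by (rule hi_vs[OF N])
  show ?thesis
  proof (rule lin_inj_onI[OF vect_unit_vs[OF field_K] N.vectorspace_axioms])
    show "lin K (vect_unit K) (hiV N) (tau K N v)" using hp_lin[OF tau_hp[OF N v(1)]] by (simp add: gT_fob)
    fix x assume "x \<in> carrier (vect_unit K)" "tau K N v x = \<zero>\<^bsub>hiV N\<^esub>"
    then obtain c where c: "c \<in> carrier K" "x = Scal c" "c \<odot>\<^bsub>hiV N\<^esub> v = \<zero>\<^bsub>hiV N\<^esub>"
      by (auto simp: tau_def)
    have "c = \<zero>\<^bsub>K\<^esub>"
    proof (rule ccontr)
      assume n: "c \<noteq> \<zero>\<^bsub>K\<^esub>"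
      then have i: "inv\<^bsub>K\<^esub> c \<in> carrier K" "inv\<^bsub>K\<^esub> c \<otimes>\<^bsub>K\<^esub> c = \<one>\<^bsub>K\<^esub>"
        using c(1) field_Units monoid.Units_inv_closed[of K c] monoid.Units_l_inv[of K c] field_K
        by (auto simp: field_def domain_def cring_def ring_def)
      have "v = inv\<^bsub>K\<^esub> c \<odot>\<^bsub>hiV N\<^esub> (c \<odot>\<^bsub>hiV N\<^esub> v)"
        using v(1) N.smult_assoc1[OF i(1) c(1) v(1)] i(2) by simp
      then show False using v(2) i(1) by (simp add: c(3))
    qed
    then show "x = \<zero>\<^bsub>vect_unit K\<^esub>" by (simp add: c(2))
  qed
qed

end

lemma vect_unit_fgen:
  assumes "field K" shows "fgen K (vect_unit K :: ('k, 'a) space)"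
proof -
  interpret K: field K by fact
  show ?thesis unfolding fgen_def
  proof (intro exI[of _ "{Scal \<one>\<^bsub>K\<^esub>}"] conjI allI impI)
    fix U :: "('k, 'a) elt set" assume U: "lsub K (vect_unit K) U \<and> {Scal \<one>\<^bsub>K\<^esub>} \<subseteq> U"
    have "c \<odot>\<^bsub>vect_unit K\<^esub> (Scal \<one>\<^bsub>K\<^esub> :: ('k, 'a) elt) \<in> U" if "c \<in> carrier K" for c
      using U that unfolding lsub_def by blast
    then show "carrier (vect_unit K) \<subseteq> U" by auto
  qed simp_all
qed

section \<open>An equivalence as an operation on maps at index 0\<close>

locale glid_equivalence = B: bialgebra K B + B': bialgebra K B'
  for K :: "'k ring" and B :: "('k, 'b) bialg" and B' :: "('k, 'c) bialg" +
  fixes F :: "(('k, 'b, 'a) glider, (('k, 'b, 'a) glider, ('k, 'a) glider_map) step list set,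
    ('k, 'c, 'a) glider, (('k, 'c, 'a) glider, ('k, 'a) glider_map) step list set) ftor"
  assumes equiv: "linear_equivalence K (gld K B) (gld K B') F"
begin

definition ob where "ob X \<longleftrightarrow> X \<in> Ob (gld K B :: ('k, 'b, 'a) glid_category)"

text \<open>The objects are arguments because the same linear map can represent morphisms between
  different gliders, with different images under \<open>F\<close>.\<close>

definition Fh where "Fh X Y f = kev (fob F X) (far F X Y (kap K B X Y f))"

abbreviation "T \<equiv> gT K B :: ('k, 'b, 'a) glider"
abbreviation "T' \<equiv> gT K B' :: ('k, 'c, 'a) glider"

lemma F_lin: "linear_functor K (gld K B) (gld K B') F"
  using equiv by (simp add: linear_equivalence_def)

lemma obP: "ob X \<Longrightarrow> pgl K B X" by (simp add: ob_def)

lemma obI: "pgl K B X \<Longrightarrow> fgen K (hiV X) \<Longrightarrow> ob X" by (simp add: ob_def B.noetherianI)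

lemma obV: "ob X \<Longrightarrow> vectorspace K (hiV X)" by (rule B.pgl_vs[OF obP]) simp_all

lemma FP: "ob X \<Longrightarrow> pgl K B' (fob F X)"
  using linear_functorD(1)[OF F_lin, of X] by (simp add: ob_def)

lemma FV: "ob X \<Longrightarrow> vectorspace K (hiV (fob F X))" by (rule B'.pgl_vs[OF FP]) simp_all

lemma gld_hom: "ob X \<Longrightarrow> ob Y \<Longrightarrow> f \<in> hp K B X Y \<Longrightarrow> kap K B X Y f \<in> carrier (Hom (gld K B) X Y)"
  unfolding gld_simps B.GL_carrier[OF obP obP] by (rule imageI)

lemma Fh_props:
  assumes X: "ob X" and Y: "ob Y" and f: "f \<in> hp K B X Y"
  shows Fh_hp: "Fh X Y f \<in> hp K B' (fob F X) (fob F Y)"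
    and Fh_kap: "far F X Y (kap K B X Y f) = kap K B' (fob F X) (fob F Y) (Fh X Y f)"
proof -
  have "far F X Y (kap K B X Y f) \<in> carrier (Hom (gld K B') (fob F X) (fob F Y))"
    by (rule linear_functorD(5)[OF F_lin X[unfolded ob_def] Y[unfolded ob_def] gld_hom[OF X Y f]])
  then obtain h where h: "h \<in> hp K B' (fob F X) (fob F Y)" "far F X Y (kap K B X Y f) = kap K B' (fob F X) (fob F Y) h"
    unfolding gld_simps B'.GL_carrier[OF FP[OF X] FP[OF Y]] by (rule imageE) (rule that)
  have "Fh X Y f = h" unfolding Fh_def h(2) by (rule B'.kev_kap[OF FP[OF X] FP[OF Y] h(1)])
  then show "Fh X Y f \<in> hp K B' (fob F X) (fob F Y)"
    and "far F X Y (kap K B X Y f) = kap K B' (fob F X) (fob F Y) (Fh X Y f)" using h by simp_all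
qed

lemma Fh_closed: "ob X \<Longrightarrow> ob Y \<Longrightarrow> f \<in> hp K B X Y \<Longrightarrow> v \<in> hi (fob F X) \<Longrightarrow> Fh X Y f v \<in> hi (fob F Y)"
  by (rule B'.hp_closed[OF Fh_hp])

lemma Fh_comp:
  assumes X: "ob X" and Y: "ob Y" and Z: "ob Z" and f: "f \<in> hp K B X Y" and g: "g \<in> hp K B Y Z"
    and v: "v \<in> hi (fob F X)"
  shows "Fh X Z (compose (hi X) g f) v = Fh Y Z g (Fh X Y f v)"
proof -
  note gf = B.hp_comp[OF obP[OF X] obP[OF Y] f g]
  have "kap K B' (fob F X) (fob F Z) (Fh X Z (compose (hi X) g f)) =
      kap K B' (fob F X) (fob F Z) (compose (hi (fob F X)) (Fh Y Z g) (Fh X Y f))"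
    unfolding Fh_kap[OF X Z gf, symmetric] B.GL_comp[OF obP[OF X] obP[OF Y] obP[OF Z] f g, symmetric]
      B'.GL_comp[OF FP[OF X] FP[OF Y] FP[OF Z] Fh_hp[OF X Y f] Fh_hp[OF Y Z g], symmetric]
      Fh_kap[OF X Y f, symmetric] Fh_kap[OF Y Z g, symmetric]
    using linear_functorD(4)[OF F_lin X[unfolded ob_def] Y[unfolded ob_def] Z[unfolded ob_def]
      gld_hom[OF X Y f] gld_hom[OF Y Z g]] unfolding gld_simps .
  then have "Fh X Z (compose (hi X) g f) = compose (hi (fob F X)) (Fh Y Z g) (Fh X Y f)"
    by (rule B'.kap_inj[OF FP[OF X] FP[OF Z] Fh_hp[OF X Z gf] B'.hp_comp[OF FP[OF X] FP[OF Y] Fh_hp[OF X Y f] Fh_hp[OF Y Z g]]])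
  then show ?thesis by (simp add: compose_eq[OF v])
qed

lemma Fh_id:
  assumes X: "ob X" shows "Fh X X (\<lambda>v\<in>hi X. v) = (\<lambda>v\<in>hi (fob F X). v)"
proof -
  note i = B.hp_id[OF obP[OF X]]
  have "kap K B' (fob F X) (fob F X) (Fh X X (\<lambda>v\<in>hi X. v)) = kap K B' (fob F X) (fob F X) (\<lambda>v\<in>hi (fob F X). v)"
    unfolding Fh_kap[OF X X i, symmetric] B.GL_id[OF obP[OF X] obP[OF X], symmetric]
      B'.GL_id[OF FP[OF X] FP[OF X], symmetric]
    using linear_functorD(3)[OF F_lin X[unfolded ob_def]] unfolding gld_simps .
  then show ?thesis by (rule B'.kap_inj[OF FP[OF X] FP[OF X] Fh_hp[OF X X i] B'.hp_id[OF FP[OF X]]])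
qed

lemma F_hom_lin:
  assumes X: "ob X" and Y: "ob Y"
  shows "lin K (Hom (GL K B) X Y) (Hom (GL K B') (fob F X) (fob F Y)) (far F X Y)"
  using linear_functorD(2)[OF F_lin X[unfolded ob_def] Y[unfolded ob_def]] by (simp add: linear_map_iff)

lemma Fh_add:
  assumes X: "ob X" and Y: "ob Y" and f: "f \<in> hp K B X Y" and g: "g \<in> hp K B X Y" and v: "v \<in> hi (fob F X)"
  shows "Fh X Y (\<lambda>v\<in>hi X. f v \<oplus>\<^bsub>hiV Y\<^esub> g v) v = Fh X Y f v \<oplus>\<^bsub>hiV (fob F Y)\<^esub> Fh X Y g v"
proof -
  note fg = B.hp_add[OF obP[OF X] obP[OF Y] f g]
  note FX = FP[OF X] and FY = FP[OF Y] and Ff = Fh_hp[OF X Y f] and Fg = Fh_hp[OF X Y g]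
  have "kap K B' (fob F X) (fob F Y) (Fh X Y (\<lambda>v\<in>hi X. f v \<oplus>\<^bsub>hiV Y\<^esub> g v)) =
      kap K B' (fob F X) (fob F Y) (\<lambda>v\<in>hi (fob F X). Fh X Y f v \<oplus>\<^bsub>hiV (fob F Y)\<^esub> Fh X Y g v)"
    unfolding Fh_kap[OF X Y fg, symmetric] B.GL_add[OF obP[OF X] obP[OF Y] f g, symmetric]
      B'.GL_add[OF FX FY Ff Fg, symmetric] Fh_kap[OF X Y f, symmetric] Fh_kap[OF X Y g, symmetric]
    by (rule lin_add[OF F_hom_lin[OF X Y] gld_hom[OF X Y f, unfolded gld_simps] gld_hom[OF X Y g, unfolded gld_simps]])
  then have "Fh X Y (\<lambda>v\<in>hi X. f v \<oplus>\<^bsub>hiV Y\<^esub> g v) =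
      (\<lambda>v\<in>hi (fob F X). Fh X Y f v \<oplus>\<^bsub>hiV (fob F Y)\<^esub> Fh X Y g v)"
    by (rule B'.kap_inj[OF FX FY Fh_hp[OF X Y fg] B'.hp_add[OF FX FY Ff Fg]])
  then show ?thesis using v by simp
qed

lemma Fh_smult:
  assumes X: "ob X" and Y: "ob Y" and f: "f \<in> hp K B X Y" and c: "c \<in> carrier K" and v: "v \<in> hi (fob F X)"
  shows "Fh X Y (\<lambda>v\<in>hi X. c \<odot>\<^bsub>hiV Y\<^esub> f v) v = c \<odot>\<^bsub>hiV (fob F Y)\<^esub> Fh X Y f v"
proof -
  note cf = B.hp_scale[OF obP[OF X] obP[OF Y] f c]
  note FX = FP[OF X] and FY = FP[OF Y] and Ff = Fh_hp[OF X Y f]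
  have "kap K B' (fob F X) (fob F Y) (Fh X Y (\<lambda>v\<in>hi X. c \<odot>\<^bsub>hiV Y\<^esub> f v)) =
      kap K B' (fob F X) (fob F Y) (\<lambda>v\<in>hi (fob F X). c \<odot>\<^bsub>hiV (fob F Y)\<^esub> Fh X Y f v)"
    unfolding Fh_kap[OF X Y cf, symmetric] B.GL_smult[OF obP[OF X] obP[OF Y] f c, symmetric]
      B'.GL_smult[OF FX FY Ff c, symmetric] Fh_kap[OF X Y f, symmetric]
    by (rule lin_smult[OF F_hom_lin[OF X Y] c gld_hom[OF X Y f, unfolded gld_simps]])
  then have "Fh X Y (\<lambda>v\<in>hi X. c \<odot>\<^bsub>hiV Y\<^esub> f v) =
      (\<lambda>v\<in>hi (fob F X). c \<odot>\<^bsub>hiV (fob F Y)\<^esub> Fh X Y f v)"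
    by (rule B'.kap_inj[OF FX FY Fh_hp[OF X Y cf] B'.hp_scale[OF FX FY Ff c]])
  then show ?thesis using v by simp
qed

lemma Fh_zero:
  assumes X: "ob X" and Y: "ob Y" and v: "v \<in> hi (fob F X)"
  shows "Fh X Y (\<lambda>v\<in>hi X. \<zero>\<^bsub>hiV Y\<^esub>) v = \<zero>\<^bsub>hiV (fob F Y)\<^esub>"
proof -
  note z = B.hp_zero[OF obP[OF X] obP[OF Y]] and FX = FP[OF X] and FY = FP[OF Y]
  have "kap K B' (fob F X) (fob F Y) (Fh X Y (\<lambda>v\<in>hi X. \<zero>\<^bsub>hiV Y\<^esub>)) =
      kap K B' (fob F X) (fob F Y) (\<lambda>v\<in>hi (fob F X). \<zero>\<^bsub>hiV (fob F Y)\<^esub>)"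
    unfolding Fh_kap[OF X Y z, symmetric] B.GL_zero[OF obP[OF X] obP[OF Y], symmetric] B'.GL_zero[OF FX FY, symmetric]
    by (rule lin_zero[OF B.GL_vs[OF obP[OF X] obP[OF Y]] B'.GL_vs[OF FX FY] F_hom_lin[OF X Y]])
  then have "Fh X Y (\<lambda>v\<in>hi X. \<zero>\<^bsub>hiV Y\<^esub>) = (\<lambda>v\<in>hi (fob F X). \<zero>\<^bsub>hiV (fob F Y)\<^esub>)"
    by (rule B'.kap_inj[OF FX FY Fh_hp[OF X Y z] B'.hp_zero[OF FX FY]])
  then show ?thesis using v by simp
qed

lemma Fh_inj:
  assumes X: "ob X" and Y: "ob Y" and f: "f \<in> hp K B X Y" and g: "g \<in> hp K B X Y"
    and e: "\<And>v. v \<in> hi (fob F X) \<Longrightarrow> Fh X Y f v = Fh X Y g v"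
  shows "f = g"
proof -
  have "Fh X Y f = Fh X Y g" by (rule B'.hp_eqI[OF Fh_hp[OF X Y f] Fh_hp[OF X Y g] e])
  then have "far F X Y (kap K B X Y f) = far F X Y (kap K B X Y g)" unfolding Fh_kap[OF X Y f] Fh_kap[OF X Y g] by simp
  then have "kap K B X Y f = kap K B X Y g"
    by (rule equivalence_faithful[OF B.gld_cat B'.gld_cat equiv X[unfolded ob_def] Y[unfolded ob_def]
        gld_hom[OF X Y f] gld_hom[OF X Y g]])
  then show ?thesis by (rule B.kap_inj[OF obP[OF X] obP[OF Y] f g])
qed

lemma Fh_surj:
  assumes X: "ob X" and Y: "ob Y" and h: "h \<in> hp K B' (fob F X) (fob F Y)"
  obtains f where "f \<in> hp K B X Y" "Fh X Y f = h"
proof -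
  have "kap K B' (fob F X) (fob F Y) h \<in> carrier (Hom (gld K B') (fob F X) (fob F Y))"
    unfolding gld_simps B'.GL_carrier[OF FP[OF X] FP[OF Y]] using h by (rule imageI)
  from equivalence_full[OF B.gld_cat B'.gld_cat equiv X[unfolded ob_def] Y[unfolded ob_def] this]
  obtain x where x: "x \<in> carrier (Hom (gld K B) X Y)" "far F X Y x = kap K B' (fob F X) (fob F Y) h" by (rule bexE) (rule that)
  obtain f where f: "f \<in> hp K B X Y" "x = kap K B X Y f"
    using x(1) unfolding gld_simps B.GL_carrier[OF obP[OF X] obP[OF Y]] by (rule imageE) (rule that)
  have "Fh X Y f = h" unfolding Fh_def f(2)[symmetric] x(2) by (rule B'.kev_kap[OF FP[OF X] FP[OF Y] h])
  then show ?thesis using f(1) that by simp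
qed

lemma ess_surj:
  assumes P: "pgl K B' P" and fg: "fgen K (hiV P)"
  obtains X i i' where "ob X" "hiso K B' (fob F X) P i i'"
proof -
  have "P \<in> Ob (gld K B')" using P B'.noetherianI[OF P fg] by simp
  from equivalence_ess_surj[OF B.gld_cat B'.gld_cat equiv this]
  obtain X e where X: "X \<in> Ob (gld K B)" and e: "cat_iso (gld K B') (fob F X) P e" by (elim bexE exE) (rule that)
  have X': "ob X" using X by (simp only: ob_def)
  obtain i i' where "hiso K B' (fob F X) P i i'"
    using e unfolding cat_iso_gld by (rule B'.GL_isoD[OF FP[OF X'] P]) (rule that)
  then show ?thesis by (rule that[OF X'])
qed

section \<open>The image of T and the bijections \<open>th\<close>\<close>

lemma obT: "ob T"
  by (rule obI[OF B.gT_pgl]) (simp only: B.gT_fob vect_unit_fgen[OF B.field_K])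

text \<open>Every vector of S(0) is the value of a morphism from T to S, so a nonzero morphism h: S
  \<rightarrow> T, whose target has dimension one at 0, has a section. Applying \<open>F\<close> to
  it inverts \<open>t\<close> on one side, and \<open>t\<close> is injective.\<close>

lemma T_image:
  obtains v m where "v \<in> hi (fob F T)" "m \<in> hp K B' (fob F T) T'" "m v = Scal \<one>\<^bsub>K\<^esub>"
    "\<And>w. w \<in> hi (fob F T) \<Longrightarrow> \<exists>c\<in>carrier K. w = c \<odot>\<^bsub>hiV (fob F T)\<^esub> v"
proof -
  let ?FT = "fob F T"
  have K1: "\<one>\<^bsub>K\<^esub> \<noteq> \<zero>\<^bsub>K\<^esub>" using B.field_K by (simp add: field_def domain_def domain_axioms_def)
  have o: "Scal \<one>\<^bsub>K\<^esub> \<in> hi T" by (simp add: B.gT_fob)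
  have o': "Scal \<one>\<^bsub>K\<^esub> \<in> hi T'" by (simp add: B'.gT_fob)
  \<comment> \<open>If (F T)(0) were 0, then \<open>F\<close> would identify the identity of T with
    0, against faithfulness.\<close>
  have "\<exists>v\<in>hi ?FT. v \<noteq> \<zero>\<^bsub>hiV ?FT\<^esub>"
  proof (rule ccontr)
    assume n: "\<not> ?thesis"
    have "(\<lambda>v\<in>hi T. v) = (\<lambda>v\<in>hi T. \<zero>\<^bsub>hiV T\<^esub>)"
    proof (rule Fh_inj[OF obT obT B.hp_id[OF B.gT_pgl] B.hp_zero[OF B.gT_pgl B.gT_pgl]])
      fix v assume "v \<in> hi ?FT"
      then show "Fh T T (\<lambda>v\<in>hi T. v) v = Fh T T (\<lambda>v\<in>hi T. \<zero>\<^bsub>hiV T\<^esub>) v"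
        using n by (simp add: Fh_id[OF obT] Fh_zero[OF obT obT])
    qed
    from fun_cong[OF this, of "Scal \<one>\<^bsub>K\<^esub>"] show False using o K1 by (simp add: B.gT_fob)
  qed
  then obtain v where v: "v \<in> hi ?FT" "v \<noteq> \<zero>\<^bsub>hiV ?FT\<^esub>" by blast
  define t where "t = tau K ?FT v"
  have t: "t \<in> hp K B' T' ?FT" unfolding t_def by (rule B'.tau_hp[OF FP[OF obT] v(1)])
  have t1: "t (Scal \<one>\<^bsub>K\<^esub>) = v" unfolding t_def by (rule B'.tau_one[OF FP[OF obT] v(1)])
  have t_inj: "inj_on t (hi T')" unfolding t_def B'.gT_fob by (rule B'.tau_inj[OF FP[OF obT] v])
  have "fgen K (hiV T')" unfolding B'.gT_fob by (rule vect_unit_fgen[OF B.field_K])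
  then obtain S i i' where S: "ob S" and i: "hiso K B' (fob F S) T' i i'" by (rule ess_surj[OF B'.gT_pgl])
  have ih: "i \<in> hp K B' (fob F S) T'" "i' \<in> hp K B' T' (fob F S)" and ii: "i (i' (Scal \<one>\<^bsub>K\<^esub>)) = Scal \<one>\<^bsub>K\<^esub>"
    using i o' by (auto simp: hiso_def)
  obtain h where h: "h \<in> hp K B S T" "Fh S T h = compose (hi (fob F S)) t i"
    by (rule Fh_surj[OF S obT B'.hp_comp[OF FP[OF S] B'.gT_pgl ih(1) t]])
  have "\<exists>x\<in>hi S. h x \<noteq> \<zero>\<^bsub>vect_unit K\<^esub>"
  proof (rule ccontr)
    assume n: "\<not> ?thesis"
    have "h = (\<lambda>v\<in>hi S. \<zero>\<^bsub>hiV T\<^esub>)"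
      by (rule B.hp_eqI[OF h(1) B.hp_zero[OF obP[OF S] B.gT_pgl]]) (use n in \<open>simp add: B.gT_fob\<close>)
    then have "t (i (i' (Scal \<one>\<^bsub>K\<^esub>))) = \<zero>\<^bsub>hiV ?FT\<^esub>"
      using Fh_zero[OF S obT B'.hp_closed[OF ih(2) o']] compose_eq[OF B'.hp_closed[OF ih(2) o'], of t i] h(2) by simp
    then show False using ii t1 v(2) by simp
  qed
  then obtain x where x0: "x \<in> hi S" "h x \<noteq> \<zero>\<^bsub>vect_unit K\<^esub>" by (rule bexE) (rule that)
  obtain c where "h x = Scal c" "c \<in> carrier K" using B.hp_closed[OF h(1) x0(1)] by (auto simp: B.gT_fob)
  then have x: "x \<in> hi S" "h x = Scal c" "c \<in> carrier K" "c \<noteq> \<zero>\<^bsub>K\<^esub>" using x0 by auto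
  have ic: "inv\<^bsub>K\<^esub> c \<in> carrier K" "inv\<^bsub>K\<^esub> c \<otimes>\<^bsub>K\<^esub> c = \<one>\<^bsub>K\<^esub>"
    using x(3,4) B.field_Units monoid.Units_inv_closed[of K c] monoid.Units_l_inv[of K c] B.field_K
    by (auto simp: field_def domain_def cring_def ring_def)
  interpret S: vectorspace K "hiV S" by (rule obV[OF S])
  \<comment> \<open>Normalized such that h y = 1; the morphism T \<rightarrow> S belonging to y is
    the section of \<open>h\<close>.\<close>
  define y where "y = inv\<^bsub>K\<^esub> c \<odot>\<^bsub>hiV S\<^esub> x"
  have y: "y \<in> hi S" "h y = Scal \<one>\<^bsub>K\<^esub>"
    unfolding y_def using x(1) ic lin_smult[OF B.hp_lin[OF h(1)] ic(1) x(1)] by (simp_all add: x(2) B.gT_fob)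
  define m where "m = compose (hi ?FT) i (Fh T S (tau K S y))"
  note ty = B.tau_hp[OF obP[OF S] y(1)]
  have m: "m \<in> hp K B' ?FT T'"
    unfolding m_def by (rule B'.hp_comp[OF FP[OF obT] FP[OF S] Fh_hp[OF obT S ty] ih(1)])
  have id: "compose (hi T) h (tau K S y) = (\<lambda>v\<in>hi T. v)"
    by (rule B.hp_gT_eqI[OF B.gT_pgl B.hp_comp[OF B.gT_pgl obP[OF S] ty h(1)] B.hp_id[OF B.gT_pgl]])
      (simp add: compose_eq[OF o] B.tau_one[OF obP[OF S] y(1)] y(2) o)
  \<comment> \<open>The composite t m is F(h) after F of the section, hence the identity.
    Injectivity of \<open>t\<close> then yields m v = 1, and surjectivity shows that v generates (F
    T)(0).\<close>
  have tm: "t (m w) = w" if w: "w \<in> hi ?FT" for w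
  proof -
    have "t (m w) = Fh S T h (Fh T S (tau K S y) w)"
      unfolding h(2) m_def using w Fh_closed[OF obT S ty w] by (simp add: compose_eq)
    also have "\<dots> = w" unfolding Fh_comp[OF obT S obT ty h(1) w, symmetric] id using w by (simp add: Fh_id[OF obT])
    finally show ?thesis .
  qed
  have "m v = Scal \<one>\<^bsub>K\<^esub>"
    by (rule inj_onD[OF t_inj]) (simp_all add: tm[OF v(1)] t1 B'.hp_closed[OF m v(1)] o')
  moreover have "\<exists>c\<in>carrier K. w = c \<odot>\<^bsub>hiV ?FT\<^esub> v" if w: "w \<in> hi ?FT" for w
  proof -
    obtain c where c: "c \<in> carrier K" "m w = Scal c" using B'.hp_closed[OF m w] by (auto simp: B'.gT_fob)
    have "w = t (Scal c)" using tm[OF w] c(2) by simp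
    then show ?thesis using c(1) by (auto simp: t_def tau_def)
  qed
  ultimately show ?thesis by (rule that[OF v(1) m])
qed

text \<open>A generator of (F T)(0), sent to 1 by some morphism to T'. Fixing it once normalizes all
  the maps \<open>th\<close> simultaneously, which makes them natural.\<close>

definition t0 where "t0 = (SOME v. v \<in> hi (fob F T) \<and> (\<exists>m\<in>hp K B' (fob F T) T'. m v = Scal \<one>\<^bsub>K\<^esub>) \<and>
  (\<forall>w\<in>hi (fob F T). \<exists>c\<in>carrier K. w = c \<odot>\<^bsub>hiV (fob F T)\<^esub> v))"

text \<open>The natural linear bijection from \<open>N(0)\<close> to \<open>(F N)(0)\<close>, induced by \<open>N(0) = Hom(T, N)\<close>.\<close>

definition th where "th N n = Fh T N (tau K N n) t0"

lemma t0: shows t0_hi: "t0 \<in> hi (fob F T)" and t0_map: "\<exists>m\<in>hp K B' (fob F T) T'. m t0 = Scal \<one>\<^bsub>K\<^esub>"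
    and t0_gen: "w \<in> hi (fob F T) \<Longrightarrow> \<exists>c\<in>carrier K. w = c \<odot>\<^bsub>hiV (fob F T)\<^esub> t0"
proof -
  have "\<exists>v. v \<in> hi (fob F T) \<and> (\<exists>m\<in>hp K B' (fob F T) T'. m v = Scal \<one>\<^bsub>K\<^esub>) \<and>
      (\<forall>w\<in>hi (fob F T). \<exists>c\<in>carrier K. w = c \<odot>\<^bsub>hiV (fob F T)\<^esub> v)"
    by (rule T_image) blast
  from someI_ex[OF this, folded t0_def]
  show "t0 \<in> hi (fob F T)" "\<exists>m\<in>hp K B' (fob F T) T'. m t0 = Scal \<one>\<^bsub>K\<^esub>"
    "w \<in> hi (fob F T) \<Longrightarrow> \<exists>c\<in>carrier K. w = c \<odot>\<^bsub>hiV (fob F T)\<^esub> t0" by simp_all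
qed

lemma tauN: "ob N \<Longrightarrow> n \<in> hi N \<Longrightarrow> tau K N n \<in> hp K B T N" by (rule B.tau_hp[OF obP])

lemma th_closed: "ob N \<Longrightarrow> n \<in> hi N \<Longrightarrow> th N n \<in> hi (fob F N)"
  unfolding th_def by (rule Fh_closed[OF obT _ tauN t0_hi])

text \<open>The naturality of Hom(T, -): both sides arise from composing T \<rightarrow> X with
  \<open>f\<close> and applying \<open>F\<close>.\<close>

lemma th_nat:
  assumes X: "ob X" and Y: "ob Y" and f: "f \<in> hp K B X Y" and x: "x \<in> hi X"
  shows "Fh X Y f (th X x) = th Y (f x)"
  unfolding th_def Fh_comp[OF obT X Y tauN[OF X x] f t0_hi, symmetric] B.tau_comp[OF obP[OF X] obP[OF Y] f x] ..

lemma th_lin: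
  assumes N: "ob N" shows "lin K (hiV N) (hiV (fob F N)) (th N)"
proof (rule linI)
  interpret N: vectorspace K "hiV N" by (rule obV[OF N])
  have o: "Scal \<one>\<^bsub>K\<^esub> \<in> hi T" by (simp add: B.gT_fob)
  note P = obP[OF N] and gP = B.gT_pgl
  fix v assume v: "v \<in> hi N"
  show "th N v \<in> hi (fob F N)" by (rule th_closed[OF N v])
  note tv = tauN[OF N v] and ov = B.tau_one[OF P v]
  fix w assume w: "w \<in> hi N"
  note tw = tauN[OF N w] and ow = B.tau_one[OF P w]
  have "tau K N (v \<oplus>\<^bsub>hiV N\<^esub> w) = (\<lambda>s\<in>hi T. tau K N v s \<oplus>\<^bsub>hiV N\<^esub> tau K N w s)"
    by (rule B.hp_gT_eqI[OF P tauN[OF N N.a_closed[OF v w]] B.hp_add[OF gP P tv tw]])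
      (simp add: o ov ow B.tau_one[OF P N.a_closed[OF v w]])
  then show "th N (v \<oplus>\<^bsub>hiV N\<^esub> w) = th N v \<oplus>\<^bsub>hiV (fob F N)\<^esub> th N w"
    unfolding th_def by (simp add: Fh_add[OF obT N tv tw t0_hi])
next
  interpret N: vectorspace K "hiV N" by (rule obV[OF N])
  have o: "Scal \<one>\<^bsub>K\<^esub> \<in> hi T" by (simp add: B.gT_fob)
  note P = obP[OF N] and gP = B.gT_pgl
  fix c v assume c: "c \<in> carrier K" and v: "v \<in> hi N"
  note tv = tauN[OF N v] and ov = B.tau_one[OF P v]
  have "tau K N (c \<odot>\<^bsub>hiV N\<^esub> v) = (\<lambda>s\<in>hi T. c \<odot>\<^bsub>hiV N\<^esub> tau K N v s)"
    by (rule B.hp_gT_eqI[OF P tauN[OF N N.smult_closed[OF c v]] B.hp_scale[OF gP P tv c]])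
      (simp add: o ov B.tau_one[OF P N.smult_closed[OF c v]])
  then show "th N (c \<odot>\<^bsub>hiV N\<^esub> v) = c \<odot>\<^bsub>hiV (fob F N)\<^esub> th N v"
    unfolding th_def by (simp add: Fh_smult[OF obT N tv c t0_hi])
qed

text \<open>A morphism out of F T is determined by its value at the generator \<open>t0\<close>, and
  \<open>F\<close> is faithful.\<close>

lemma th_inj:
  assumes N: "ob N" shows "inj_on (th N) (hi N)"
proof (rule inj_onI)
  fix v w assume v: "v \<in> hi N" and w: "w \<in> hi N" and e: "th N v = th N w"
  have "tau K N v = tau K N w"
  proof (rule Fh_inj[OF obT N tauN[OF N v] tauN[OF N w]])
    fix x assume "x \<in> hi (fob F T)"
    then obtain c where c: "c \<in> carrier K" "x = c \<odot>\<^bsub>hiV (fob F T)\<^esub> t0" using t0_gen by blast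
    show "Fh T N (tau K N v) x = Fh T N (tau K N w) x"
      unfolding c(2) lin_smult[OF B'.hp_lin[OF Fh_hp[OF obT N tauN[OF N v]]] c(1) t0_hi]
        lin_smult[OF B'.hp_lin[OF Fh_hp[OF obT N tauN[OF N w]]] c(1) t0_hi]
      using e by (simp add: th_def)
  qed
  then show "v = w" by (metis B.tau_one[OF obP[OF N] v] B.tau_one[OF obP[OF N] w])
qed

text \<open>A vector w gives a morphism T' \<rightarrow> F N. Precomposed with the map F T
  \<rightarrow> T' that sends \<open>t0\<close> to 1, it comes from a morphism T \<rightarrow> N
  because \<open>F\<close> is full.\<close>

lemma th_surj:
  assumes N: "ob N" and w: "w \<in> hi (fob F N)" obtains n where "n \<in> hi N" "th N n = w"
proof -
  have o: "Scal \<one>\<^bsub>K\<^esub> \<in> hi T" by (simp add: B.gT_fob)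
  obtain m where m: "m \<in> hp K B' (fob F T) T'" "m t0 = Scal \<one>\<^bsub>K\<^esub>" using t0_map by (rule bexE) (rule that)
  obtain f where f: "f \<in> hp K B T N" "Fh T N f = compose (hi (fob F T)) (tau K (fob F N) w) m"
    by (rule Fh_surj[OF obT N B'.hp_comp[OF FP[OF obT] B'.gT_pgl m(1) B'.tau_hp[OF FP[OF N] w]]])
  have fo: "f (Scal \<one>\<^bsub>K\<^esub>) \<in> hi N" by (rule B.hp_closed[OF f(1) o])
  have "tau K N (f (Scal \<one>\<^bsub>K\<^esub>)) = f"
    by (rule B.hp_gT_eqI[OF obP[OF N] tauN[OF N fo] f(1)]) (rule B.tau_one[OF obP[OF N] fo])
  then have "th N (f (Scal \<one>\<^bsub>K\<^esub>)) = w"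
    unfolding th_def by (simp add: f(2) compose_eq[OF t0_hi] m(2) B'.tau_one[OF FP[OF N] w])
  with fo show ?thesis by (rule that)
qed

lemma th_fgen:
  assumes N: "ob N" shows "fgen K (hiV (fob F N)) \<longleftrightarrow> fgen K (hiV N)"
proof
  have im: "hi (fob F N) \<subseteq> th N ` hi N"
  proof
    fix w assume "w \<in> hi (fob F N)"
    then obtain n where "n \<in> hi N" "th N n = w" by (rule th_surj[OF N])
    then show "w \<in> th N ` hi N" by blast
  qed
  show "fgen K (hiV N) \<Longrightarrow> fgen K (hiV (fob F N))"
    by (rule fgen_image[OF obV[OF N] FV[OF N] th_lin[OF N] im])
  have l: "lin K (hiV (fob F N)) (hiV N) (\<lambda>x. inv_into (hi N) (th N) x)"
    by (rule lin_inv_into[OF obV[OF N] th_lin[OF N] th_inj[OF N] _ lin_id]) (use im in auto)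
  have "hi N \<subseteq> (\<lambda>x. inv_into (hi N) (th N) x) ` hi (fob F N)"
  proof
    fix n assume n: "n \<in> hi N"
    show "n \<in> (\<lambda>x. inv_into (hi N) (th N) x) ` hi (fob F N)"
      by (rule image_eqI[of _ _ "th N n"]) (simp_all add: inv_into_f_f[OF th_inj[OF N] n] th_closed[OF N n])
  qed
  then show "fgen K (hiV (fob F N)) \<Longrightarrow> fgen K (hiV N)"
    by (rule fgen_image[OF FV[OF N] obV[OF N] l])
qed

text \<open>The saturated hull P of F N is finite-dimensional, hence Noetherian and isomorphic to
  some F Y. The map F N \<rightarrow> P \<rightarrow> F Y comes from some f: N \<rightarrow> Y,
  bijective at 0 by \<open>th\<close>. As \<open>N\<close> is saturated, f is invertible, so P maps
  onto F N and saturation passes along.\<close>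

lemma sat_F:
  assumes N: "ob N" and s: "sat B N" and fg: "fgen K (hiV N)"
  shows "sat B' (fob F N)"
proof -
  let ?FN = "fob F N"
  obtain P where P: "pgl K B' P" "hiV P = hiV ?FN" "sat B' P" "(\<lambda>v\<in>hi ?FN. v) \<in> hp K B' ?FN P"
    by (rule B'.sat_hull[OF FP[OF N]])
  have "fgen K (hiV P)" using fg by (simp add: P(2) th_fgen[OF N])
  then obtain Y i i' where Y: "ob Y" and i: "hiso K B' (fob F Y) P i i'" by (rule ess_surj[OF P(1)])
  have ih: "i \<in> hp K B' (fob F Y) P" "i' \<in> hp K B' P (fob F Y)" "\<And>x. x \<in> hi (fob F Y) \<Longrightarrow> i' (i x) = x"
      "\<And>x. x \<in> hi P \<Longrightarrow> i (i' x) = x" using i by (auto simp: hiso_def)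
  obtain f where f: "f \<in> hp K B N Y" "Fh N Y f = compose (hi ?FN) i' (\<lambda>v\<in>hi ?FN. v)"
    by (rule Fh_surj[OF N Y B'.hp_comp[OF FP[OF N] P(1,4) ih(2)]])
  have fi: "Fh N Y f w = i' w" if "w \<in> hi ?FN" for w using that by (simp add: f(2) compose_eq)
  have tf: "th Y (f n) = i' (th N n)" if n: "n \<in> hi N" for n
    using th_nat[OF N Y f(1) n] fi[OF th_closed[OF N n]] by simp
  have "bij_betw f (hi N) (hi Y)" unfolding bij_betw_def
  proof
    show "inj_on f (hi N)"
    proof (rule inj_onI)
      fix a b assume ab: "a \<in> hi N" "b \<in> hi N" "f a = f b"
      then have "i (i' (th N a)) = i (i' (th N b))" using tf by metis
      then have "th N a = th N b" using th_closed[OF N] ab by (simp add: ih(4) P(2))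
      then show "a = b" using th_inj[OF N] ab by (auto dest: inj_onD)
    qed
    have "y \<in> f ` hi N" if y: "y \<in> hi Y" for y
    proof -
      have "i (th Y y) \<in> hi ?FN" using B'.hp_closed[OF ih(1) th_closed[OF Y y]] by (simp add: P(2))
      then obtain n where n: "n \<in> hi N" "th N n = i (th Y y)" by (rule th_surj[OF N])
      have "th Y (f n) = th Y y" by (simp add: tf[OF n(1)] n(2) ih(3) th_closed[OF Y y])
      then have "f n = y" by (rule inj_onD[OF th_inj[OF Y] _ B.hp_closed[OF f(1) n(1)] y])
      then show ?thesis using n(1) by blast
    qed
    then show "f ` hi N = hi Y" using B.hp_closed[OF f(1)] by auto
  qed
  then obtain g where g: "hiso K B N Y f g" by (rule B.sat_hiso[OF obP[OF N] obP[OF Y] f(1) s])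
  have gh: "g \<in> hp K B Y N" and gf: "\<And>x. x \<in> hi N \<Longrightarrow> g (f x) = x" using g by (auto simp: hiso_def)
  have id: "compose (hi N) g f = (\<lambda>v\<in>hi N. v)"
    by (rule B.hp_eqI[OF B.hp_comp[OF obP[OF N] obP[OF Y] f(1) gh] B.hp_id[OF obP[OF N]]])
      (simp add: compose_eq gf)
  have k: "compose (hi P) (Fh Y N g) i' \<in> hp K B' P ?FN"
    by (rule B'.hp_comp[OF P(1) FP[OF Y] ih(2) Fh_hp[OF Y N gh]])
  show ?thesis
  proof (rule B'.sat_hp[OF P(1) FP[OF N] k P(3)], rule subsetI)
    fix w assume w: "w \<in> hi ?FN"
    have "Fh Y N g (Fh N Y f w) = w" unfolding Fh_comp[OF N Y N f(1) gh w, symmetric] id by (simp add: Fh_id[OF N] w)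
    then have "w = compose (hi P) (Fh Y N g) i' w" using w by (simp add: compose_eq P(2) fi)
    then show "w \<in> compose (hi P) (Fh Y N g) i' ` hi P" by (rule image_eqI) (simp add: P(2) w)
  qed
qed

text \<open>The hull is now taken on the side of \<open>B\<close>. The map N \<rightarrow> P becomes
  bijective at 0 after \<open>F\<close>, hence invertible because F N is saturated. Its inverse
  comes from a map P \<rightarrow> N that is onto at 0.\<close>

lemma sat_reflect:
  assumes N: "ob N" and s: "sat B' (fob F N)" and fg: "fgen K (hiV N)"
  shows "sat B N"
proof -
  obtain P where P: "pgl K B P" "hiV P = hiV N" "sat B P" "(\<lambda>v\<in>hi N. v) \<in> hp K B N P"
    by (rule B.sat_hull[OF obP[OF N]])
  let ?e = "\<lambda>v\<in>hi N. v"
  have oP: "ob P" using fg by (intro obI P(1)) (simp add: P(2))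
  have te: "Fh N P ?e (th N n) = th P n" if n: "n \<in> hi N" for n using th_nat[OF N oP P(4) n] n by simp
  have "bij_betw (Fh N P ?e) (hi (fob F N)) (hi (fob F P))" unfolding bij_betw_def
  proof
    show "inj_on (Fh N P ?e) (hi (fob F N))"
    proof (rule inj_onI)
      fix v w assume vw: "v \<in> hi (fob F N)" "w \<in> hi (fob F N)" and e: "Fh N P ?e v = Fh N P ?e w"
      obtain a where a: "a \<in> hi N" "th N a = v" by (rule th_surj[OF N vw(1)])
      obtain b where b: "b \<in> hi N" "th N b = w" by (rule th_surj[OF N vw(2)])
      have "th P a = th P b" using e te a b by metis
      then have "a = b" by (rule inj_onD[OF th_inj[OF oP]]) (simp_all add: P(2) a b)
      then show "v = w" using a b by simp
    qed
    have "w \<in> Fh N P ?e ` hi (fob F N)" if w: "w \<in> hi (fob F P)" for w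
    proof -
      obtain a where a: "a \<in> hi P" "th P a = w" by (rule th_surj[OF oP w])
      have a': "a \<in> hi N" using a(1) by (simp add: P(2))
      show ?thesis by (rule image_eqI[of _ _ "th N a"]) (simp_all only: te[OF a'] a(2) th_closed[OF N a'])
    qed
    then show "Fh N P ?e ` hi (fob F N) = hi (fob F P)" using Fh_closed[OF N oP P(4)] by auto
  qed
  then obtain g' where g': "hiso K B' (fob F N) (fob F P) (Fh N P ?e) g'"
    by (rule B'.sat_hiso[OF FP[OF N] FP[OF oP] Fh_hp[OF N oP P(4)] s])
  then have gh: "g' \<in> hp K B' (fob F P) (fob F N)" and ge: "\<And>x. x \<in> hi (fob F N) \<Longrightarrow> g' (Fh N P ?e x) = x"
    by (auto simp: hiso_def)
  obtain g where g: "g \<in> hp K B P N" "Fh P N g = g'" by (rule Fh_surj[OF oP N gh])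
  have ge1: "compose (hi N) g ?e = ?e"
  proof (rule Fh_inj[OF N N B.hp_comp[OF obP[OF N] P(1,4) g(1)] B.hp_id[OF obP[OF N]]])
    fix v assume v: "v \<in> hi (fob F N)"
    show "Fh N N (compose (hi N) g ?e) v = Fh N N (\<lambda>v\<in>hi N. v) v"
      unfolding Fh_comp[OF N oP N P(4) g(1) v] g(2) ge[OF v] Fh_id[OF N] by (simp add: v)
  qed
  have gx: "g x = x" if "x \<in> hi N" for x using fun_cong[OF ge1, of x] that by (simp add: compose_eq)
  show ?thesis
  proof (rule B.sat_hp[OF P(1) obP[OF N] g(1) P(3)], rule subsetI)
    fix x assume x: "x \<in> hi N"
    show "x \<in> g ` hi P" by (rule image_eqI[of _ _ x]) (simp_all add: gx[OF x] P(2) x)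
  qed
qed

end

section \<open>The isomorphism of bialgebras induced by a monoidal equivalence\<close>

lemma vectorspace_smult_cancel:
  assumes V: "vectorspace K V" and c: "c \<in> carrier K" "c \<noteq> \<zero>\<^bsub>K\<^esub>" and vw: "v \<in> carrier V" "w \<in> carrier V"
    and e: "c \<odot>\<^bsub>V\<^esub> v = c \<odot>\<^bsub>V\<^esub> w"
  shows "v = w"
proof -
  interpret V: vectorspace K V by (rule V)
  have i: "inv\<^bsub>K\<^esub> c \<in> carrier K" "inv\<^bsub>K\<^esub> c \<otimes>\<^bsub>K\<^esub> c = \<one>\<^bsub>K\<^esub>" using c V.field_Units by auto
  have "inv\<^bsub>K\<^esub> c \<odot>\<^bsub>V\<^esub> (c \<odot>\<^bsub>V\<^esub> x) = x" if "x \<in> carrier V" for x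
    using that V.smult_assoc1[OF i(1) c(1) that] i(2) by simp
  then show ?thesis using e vw by metis
qed

lemma unit_tensor_gen:
  fixes x :: "('k, 'a) elt"
  assumes K: "field K" and x: "x \<in> carrier (vect_tensor K (vect_unit K) (vect_unit K))"
  obtains c where "c \<in> carrier K"
    "x = c \<odot>\<^bsub>vect_tensor K (vect_unit K) (vect_unit K)\<^esub> vect_pure K (vect_unit K) (vect_unit K) (Scal \<one>\<^bsub>K\<^esub>) (Scal \<one>\<^bsub>K\<^esub>)"
proof -
  interpret K: field K by (rule K)
  let ?U = "vect_unit K :: ('k, 'a) space" and ?o = "Scal \<one>\<^bsub>K\<^esub> :: ('k, 'a) elt"
  let ?W = "vect_tensor K ?U ?U" and ?p = "vect_pure K ?U ?U ?o ?o"
  note vU = vect_unit_vs[OF K]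
  note vW = vt_vs[OF vU vU]
  interpret W: vectorspace K ?W by (rule vW)
  have o: "?o \<in> carrier ?U" by simp
  have p: "?p \<in> carrier ?W" by (rule vt_pure_closed[OF vU vU o o])
  have "carrier ?W \<subseteq> (\<lambda>s. scal s \<odot>\<^bsub>?W\<^esub> ?p) ` carrier ?U"
  proof (rule vt_gen[OF vU vU])
    show "lsub K ?W ((\<lambda>s. scal s \<odot>\<^bsub>?W\<^esub> ?p) ` carrier ?U)"
      by (rule lsub_image[OF vU vW lin_from_unit[OF vW p] lsub_carrier[OF vU]])
    fix v w assume "v \<in> carrier ?U" "w \<in> carrier ?U"
    then obtain a b where ab: "a \<in> carrier K" "b \<in> carrier K" "v = Scal a" "w = Scal b" by auto
    note bl = vt_pure_bilin[OF vU vU]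
    have v: "v = a \<odot>\<^bsub>?U\<^esub> ?o" and w: "w = b \<odot>\<^bsub>?U\<^esub> ?o" using ab by simp_all
    have b: "b \<odot>\<^bsub>?U\<^esub> ?o \<in> carrier ?U" using ab by simp
    have "vect_pure K ?U ?U v w = a \<odot>\<^bsub>?W\<^esub> (b \<odot>\<^bsub>?W\<^esub> ?p)"
      unfolding v w lin_smult[OF bilin_left[OF bl b] ab(1) o] lin_smult[OF bilin_right[OF bl o] ab(2) o] ..
    also have "\<dots> = scal (Scal (a \<otimes>\<^bsub>K\<^esub> b) :: ('k, 'a) elt) \<odot>\<^bsub>?W\<^esub> ?p" using W.smult_assoc1[OF ab(1,2) p] by simp
    finally show "vect_pure K ?U ?U v w \<in> (\<lambda>s. scal s \<odot>\<^bsub>?W\<^esub> ?p) ` carrier ?U"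
      by (rule image_eqI) (simp add: ab)
  qed
  then obtain s where "s \<in> carrier ?U" "x = scal s \<odot>\<^bsub>?W\<^esub> ?p" using x by blast
  then show ?thesis by (intro that[of "scal s"]) auto
qed

text \<open>The bilinear form f(x) g(y) has the value 1 at (v, w), so its linear lift does not
  vanish on the pure tensor.\<close>

lemma vect_pure_nonzero:
  fixes V W :: "('k, 'a) space"
  assumes K: "field K" and V: "vectorspace K V" and W: "vectorspace K W"
    and f: "lin K V (vect_unit K) f" and g: "lin K W (vect_unit K) g"
    and v: "v \<in> carrier V" "f v = Scal \<one>\<^bsub>K\<^esub>" and w: "w \<in> carrier W" "g w = (Scal \<one>\<^bsub>K\<^esub> :: ('k, 'a) elt)"
  shows "vect_pure K V W v w \<noteq> \<zero>\<^bsub>vect_tensor K V W\<^esub>"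
proof
  interpret K: field K by (rule K)
  let ?U = "vect_unit K :: ('k, 'a) space" and ?b = "\<lambda>x y. Scal (scal (f x) \<otimes>\<^bsub>K\<^esub> scal (g y)) :: ('k, 'a) elt"
  note vU = vect_unit_vs[OF K]
  have fc: "x \<in> carrier V \<Longrightarrow> scal (f x) \<in> carrier K" for x using lin_closed[OF f, of x] by auto
  have gc: "x \<in> carrier W \<Longrightarrow> scal (g x) \<in> carrier K" for x using lin_closed[OF g, of x] by auto
  have b: "bilin K V W ?U ?b"
    by (intro bilinI linI) (simp_all add: fc gc lin_add[OF f] lin_add[OF g] lin_smult[OF f] lin_smult[OF g]
        K.l_distr K.r_distr K.m_assoc K.m_lcomm)
  assume "vect_pure K V W v w = \<zero>\<^bsub>vect_tensor K V W\<^esub>"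
  then have "?b v w = \<zero>\<^bsub>?U\<^esub>"
    using vt_lift_pure[OF V W vU b v(1) w(1)] lin_zero[OF vt_vs[OF V W] vU vt_lift_lin[OF V W vU b]] by simp
  then show False using v(2) w(2) K.one_not_zero by simp
qed

lemma (in bialgebra) act_smult:
  assumes N: "pgl K B N" and s: "sat B N" and z: "z \<in> hi N" and c: "c \<in> carrier K" and b: "b \<in> carrier B"
  shows "act B N b (c \<odot>\<^bsub>hiV N\<^esub> z) = c \<odot>\<^bsub>hiV N\<^esub> act B N b z"
proof -
  interpret L: vectorspace K "loV N" by (rule lo_vs[OF N])
  obtain x where x: "x \<in> lo N" "z = fm N \<one>\<^bsub>B\<^esub> x" by (rule satD[OF s z])
  show ?thesis
    unfolding x(2) lin_smult[OF fm_lin[OF N B.one_closed] c x(1), symmetric] act_fm[OF N x(1)]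
      act_fm[OF N L.smult_closed[OF c x(1)]] by (rule lin_smult[OF fm_lin[OF N b] c x(1)])
qed

section \<open>The comparison map from \<open>B'\<close> to \<open>B\<close>\<close>

locale glid_monoidal_equivalence = glid_equivalence K B B' F
  for K :: "'k ring" and B :: "('k, 'b) bialg" and B' :: "('k, 'c) bialg"
    and F :: "(('k, 'b, 'a) glider, (('k, 'b, 'a) glider, ('k, 'a) glider_map) step list set,
      ('k, 'c, 'a) glider, (('k, 'c, 'a) glider, ('k, 'a) glider_map) step list set) ftor" +
  fixes J u and R :: "('k, 'b, 'a) glider" and \<iota> and R' :: "('k, 'c, 'a) glider" and \<iota>'
  assumes monoidal: "monoidal_functor K (gld K B) (gld K B') F J u"
    and R: "regular K B R \<iota>" and R': "regular K B' R' \<iota>'"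
begin

lemmas RD = B.regularD[OF R] and RD' = B'.regularD[OF R']

lemma obR: "ob R" by (rule obI[OF RD(1,2)])

lemma iota: "b \<in> carrier B \<Longrightarrow> \<iota> b \<in> hi R" by (rule lin_closed[OF RD(4)])

lemma FR_sat: "sat B' (fob F R)" by (rule sat_F[OF obR RD(3,2)])

lemma th_iota: "bij_betw (\<lambda>b. th R (\<iota> b)) (carrier B) (hi (fob F R))"
  unfolding bij_betw_def
proof
  have im: "\<iota> ` carrier B = hi R" and inj: "inj_on \<iota> (carrier B)" using RD(5) by (auto simp: bij_betw_def)
  show "inj_on (\<lambda>b. th R (\<iota> b)) (carrier B)"
    using inj inj_onD[OF th_inj[OF obR] _ iota iota] by (auto simp: inj_on_def)
  have "w \<in> (\<lambda>b. th R (\<iota> b)) ` carrier B" if w: "w \<in> hi (fob F R)" for w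
  proof -
    obtain n where n: "n \<in> hi R" "th R n = w" by (rule th_surj[OF obR w])
    then obtain b where "b \<in> carrier B" "n = \<iota> b" using im by auto
    then show ?thesis using n(2) by auto
  qed
  then show "(\<lambda>b. th R (\<iota> b)) ` carrier B = hi (fob F R)" using th_closed[OF obR iota] by auto
qed

lemma th_iota_inj: "a \<in> carrier B \<Longrightarrow> b \<in> carrier B \<Longrightarrow> th R (\<iota> a) = th R (\<iota> b) \<Longrightarrow> a = b"
  using th_iota by (auto simp: bij_betw_def inj_on_def)

definition rho where
  "rho c = inv_into (carrier B) (\<lambda>b. th R (\<iota> b)) (act B' (fob F R) c (th R (\<iota> \<one>\<^bsub>B\<^esub>)))"

lemma r_hi: "th R (\<iota> \<one>\<^bsub>B\<^esub>) \<in> hi (fob F R)" by (rule th_closed[OF obR iota[OF B.B.one_closed]])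

lemma rho_closed: "c \<in> carrier B' \<Longrightarrow> rho c \<in> carrier B"
  and th_rho: "c \<in> carrier B' \<Longrightarrow> th R (\<iota> (rho c)) = act B' (fob F R) c (th R (\<iota> \<one>\<^bsub>B\<^esub>))"
proof -
  assume c: "c \<in> carrier B'"
  have "act B' (fob F R) c (th R (\<iota> \<one>\<^bsub>B\<^esub>)) \<in> (\<lambda>b. th R (\<iota> b)) ` carrier B"
    using B'.act_closed[OF FP[OF obR] FR_sat r_hi c] th_iota by (simp add: bij_betw_def)
  then show "rho c \<in> carrier B" "th R (\<iota> (rho c)) = act B' (fob F R) c (th R (\<iota> \<one>\<^bsub>B\<^esub>))"
    unfolding rho_def by (rule inv_into_into, rule f_inv_into_f)
qed

text \<open>By freeness of R there is a morphism R \<rightarrow> N with 1 going to z. Its image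
  under \<open>F\<close> commutes with the action of c, and evaluated at \<open>th\<close> of 1 this
  is the claim.\<close>

lemma th_act:
  assumes N: "ob N" and s: "sat B N" and z: "z \<in> hi N" and c: "c \<in> carrier B'"
  shows "act B' (fob F N) c (th N z) = th N (act B N (rho c) z)"
proof -
  obtain m where m: "m \<in> hp K B R N" "\<And>b. b \<in> carrier B \<Longrightarrow> m (\<iota> b) = act B N b z"
    using B.regular_map[OF R obP[OF N] s z] by metis
  have n: "Fh R N m (th R (\<iota> b)) = th N (act B N b z)" if "b \<in> carrier B" for b
    using th_nat[OF obR N m(1) iota[OF that]] by (simp only: m(2)[OF that])
  have "act B' (fob F N) c (Fh R N m (th R (\<iota> \<one>\<^bsub>B\<^esub>))) = Fh R N m (act B' (fob F R) c (th R (\<iota> \<one>\<^bsub>B\<^esub>)))"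
    by (rule B'.hp_act[OF FP[OF obR] FP[OF N] Fh_hp[OF obR N m(1)] FR_sat r_hi c, symmetric])
  then show ?thesis
    unfolding th_rho[OF c, symmetric] n[OF B.B.one_closed] n[OF rho_closed[OF c]] B.act_one[OF obP[OF N] s z] .
qed

lemma act_R_one: "b \<in> carrier B \<Longrightarrow> act B R b (\<iota> \<one>\<^bsub>B\<^esub>) = \<iota> b"
  by (simp add: RD(6) B.B.one_closed)

lemma rho_lin: "lin K B' B rho"
  unfolding rho_def[abs_def]
  by (rule lin_inv_into[OF B.vs_B lin_comp[OF RD(4) th_lin[OF obR]] bij_betw_imp_inj_on[OF th_iota] _
        B'.act_lin[OF FP[OF obR] FR_sat r_hi]])
    (use th_iota B'.act_closed[OF FP[OF obR] FR_sat r_hi] in \<open>simp add: bij_betw_def\<close>)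

lemma rho_one: "rho \<one>\<^bsub>B'\<^esub> = \<one>\<^bsub>B\<^esub>"
  by (rule th_iota_inj) (simp_all add: rho_closed B.B.one_closed B'.B.one_closed th_rho
      B'.act_one[OF FP[OF obR] FR_sat r_hi])

lemma rho_mult:
  assumes c: "c \<in> carrier B'" and d: "d \<in> carrier B'" shows "rho (c \<otimes>\<^bsub>B'\<^esub> d) = rho c \<otimes>\<^bsub>B\<^esub> rho d"
proof (rule th_iota_inj[OF rho_closed[OF B'.B.m_closed[OF c d]] B.B.m_closed[OF rho_closed[OF c] rho_closed[OF d]]])
  show "th R (\<iota> (rho (c \<otimes>\<^bsub>B'\<^esub> d))) = th R (\<iota> (rho c \<otimes>\<^bsub>B\<^esub> rho d))"
    unfolding th_rho[OF B'.B.m_closed[OF c d]] B'.act_mult[OF FP[OF obR] FR_sat r_hi c d] th_rho[OF d, symmetric]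
      th_act[OF obR RD(3) iota[OF rho_closed[OF d]] c] RD(6)[OF rho_closed[OF c] rho_closed[OF d]] ..
qed

text \<open>On a nonzero vector of (F I)(0), I the unit, c acts by its own counit when seen through
  \<open>u\<close>, and by the counit of \<open>rho c\<close> when seen through
  \<open>th\<close>.\<close>

lemma rho_counit:
  assumes c: "c \<in> carrier B'" shows "counit B (rho c) = counit B' c"
proof -
  let ?I = "Unt (PG K B) :: ('k, 'b, 'a) glider" and ?I' = "Unt (PG K B') :: ('k, 'c, 'a) glider"
  let ?W = "hiV (fob F ?I)"
  have fI: "hiV ?I = vect_unit K" "hiV ?I' = vect_unit K" by (simp_all add: B.unt_simps B'.unt_simps)
  have I: "ob ?I" by (rule obI[OF B.unt_pgl]) (simp only: fI vect_unit_fgen[OF B.field_K])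
  have "cat_iso (GL K B') ?I' (fob F ?I) u"
    using monoidal by (simp add: monoidal_functor_def cat_iso_gld)
  then obtain j j' where "hiso K B' ?I' (fob F ?I) j j'" by (rule B'.GL_isoD[OF B'.unt_pgl FP[OF I]])
  then have j: "j \<in> hp K B' ?I' (fob F ?I)" and jj: "\<And>x. x \<in> hi ?I' \<Longrightarrow> j' (j x) = x" by (auto simp: hiso_def)
  have o: "Scal \<one>\<^bsub>K\<^esub> \<in> hi ?I'" "Scal \<zero>\<^bsub>K\<^esub> \<in> hi ?I'" by (simp_all add: fI)
  define w where "w = j (Scal \<one>\<^bsub>K\<^esub>)"
  have w: "w \<in> hi (fob F ?I)" unfolding w_def by (rule B'.hp_closed[OF j o(1)])
  have jl: "lin K (vect_unit K) ?W j" using B'.hp_lin[OF j] by (simp only: fI)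
  have w0: "w \<noteq> \<zero>\<^bsub>?W\<^esub>"
  proof
    assume "w = \<zero>\<^bsub>?W\<^esub>"
    then have "j (Scal \<one>\<^bsub>K\<^esub>) = j (Scal \<zero>\<^bsub>K\<^esub>)"
      using lin_zero[OF vect_unit_vs[OF B.field_K] FV[OF I] jl] by (simp add: w_def)
    then show False using jj[OF o(1)] jj[OF o(2)] B.one_not_zero by simp
  qed
  obtain n where n: "n \<in> hi ?I" "th ?I n = w" by (rule th_surj[OF I w])
  then obtain s where s: "s \<in> carrier K" "n = Scal s" by (auto simp: fI)
  have k: "counit B' c \<in> carrier K" "counit B (rho c) \<in> carrier K"
    using c by (simp_all add: B.counit_closed B'.counit_closed rho_closed)
  have "act B' (fob F ?I) c w = j (act B' ?I' c (Scal \<one>\<^bsub>K\<^esub>))"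
    unfolding w_def by (rule B'.hp_act[OF B'.unt_pgl FP[OF I] j B'.unt_sat o(1) c, symmetric])
  also have "\<dots> = j (counit B' c \<odot>\<^bsub>vect_unit K\<^esub> Scal \<one>\<^bsub>K\<^esub>)" using c by (simp add: B'.unt_act)
  also have "\<dots> = counit B' c \<odot>\<^bsub>?W\<^esub> w" unfolding w_def by (rule lin_smult[OF jl k(1)]) simp
  finally have 1: "act B' (fob F ?I) c w = counit B' c \<odot>\<^bsub>?W\<^esub> w" .
  have "act B' (fob F ?I) c w = th ?I (act B ?I (rho c) n)"
    unfolding n(2)[symmetric] by (rule th_act[OF I B.unt_sat n(1) c])
  also have "\<dots> = th ?I (counit B (rho c) \<odot>\<^bsub>hiV ?I\<^esub> n)" using s by (simp add: B.unt_act rho_closed[OF c] fI)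
  also have "\<dots> = counit B (rho c) \<odot>\<^bsub>?W\<^esub> w" unfolding lin_smult[OF th_lin[OF I] k(2) n(1)] n(2) ..
  \<comment> \<open>Cancelling the nonzero vector \<open>w\<close> from an equality of multiples is
    injectivity of \<open>tau\<close>.\<close>
  finally have "tau K (fob F ?I) w (Scal (counit B (rho c))) = tau K (fob F ?I) w (Scal (counit B' c))"
    using 1 k by (simp add: tau_def)
  then show ?thesis using inj_onD[OF B'.tau_inj[OF FP[OF I] w w0]] k by fastforce
qed

text \<open>Finite dimension takes the place of the Noetherian condition, which it implies by
  \<open>noetherianI\<close>, because \<open>vt_fgen\<close> passes it on to tensor
  products.\<close>

definition og where "og X \<longleftrightarrow> pgl K B X \<and> fgen K (hiV X)"

lemma ogob: "og X \<Longrightarrow> ob (X :: ('k, 'b, 'a) glider)" by (simp add: og_def obI)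

lemma ten_hi: "hiV (ten K B X Y) = vect_tensor K (hiV X) (hiV Y)"
    "hiV (ten K B' X' Y') = vect_tensor K (hiV X') (hiV Y')"
  unfolding ten_simps(1)[OF idxs_mem(2)] ten_V_def by (rule refl)+

lemma og_ten:
  assumes "og X" "og Y" shows "og (ten K B X Y)"
  using assms B.hi_vs[OF _] unfolding og_def ten_hi
  by (intro conjI B.ten_pgl vt_fgen) auto

definition jj where "jj X Y = kev (ten K B' (fob F X) (fob F Y)) (J X Y)"

lemma jj:
  assumes X: "og X" and Y: "og Y"
  shows jj_J: "J X Y = kap K B' (ten K B' (fob F X) (fob F Y)) (fob F (ten K B X Y)) (jj X Y)"
    and jj_iso: "\<exists>j'. hiso K B' (ten K B' (fob F X) (fob F Y)) (fob F (ten K B X Y)) (jj X Y) j'"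
proof -
  note P = B'.ten_pgl[OF FP[OF ogob[OF X]] FP[OF ogob[OF Y]]] and Q = FP[OF ogob[OF og_ten[OF X Y]]]
  have "cat_iso (GL K B') (ten K B' (fob F X) (fob F Y)) (fob F (ten K B X Y)) (J X Y)"
    using monoidal ogob[OF X] ogob[OF Y] unfolding monoidal_functor_def ob_def
    by (simp add: cat_iso_gld del: PG_simps)
  then obtain j j' where j: "J X Y = kap K B' (ten K B' (fob F X) (fob F Y)) (fob F (ten K B X Y)) j"
      "hiso K B' (ten K B' (fob F X) (fob F Y)) (fob F (ten K B X Y)) j j'" by (rule B'.GL_isoD[OF P Q])
  have "jj X Y = j" unfolding jj_def j(1) using j(2) by (intro B'.kev_kap[OF P Q]) (simp add: hiso_def)
  then show "J X Y = kap K B' (ten K B' (fob F X) (fob F Y)) (fob F (ten K B X Y)) (jj X Y)"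
    "\<exists>j'. hiso K B' (ten K B' (fob F X) (fob F Y)) (fob F (ten K B X Y)) (jj X Y) j'" using j by auto
qed

lemma jj_hp: "og X \<Longrightarrow> og Y \<Longrightarrow> jj X Y \<in> hp K B' (ten K B' (fob F X) (fob F Y)) (fob F (ten K B X Y))"
  using jj_iso unfolding hiso_def by blast

lemma jj_nat:
  assumes X: "og X" and X': "og X'" and Y: "og Y" and Y': "og Y'" and f: "f \<in> hp K B X X'" and g: "g \<in> hp K B Y Y'"
    and v: "v \<in> hi (ten K B' (fob F X) (fob F Y))"
  shows "Fh (ten K B X Y) (ten K B X' Y') (B.ten0 X X' Y Y' f g) (jj X Y v) =
    jj X' Y' (B'.ten0 (fob F X) (fob F X') (fob F Y) (fob F Y') (Fh X X' f) (Fh Y Y' g) v)"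
proof -
  note o = ogob[OF X] ogob[OF X'] ogob[OF Y] ogob[OF Y']
  note p = obP[OF o(1)] obP[OF o(2)] obP[OF o(3)] obP[OF o(4)] and q = FP[OF o(1)] FP[OF o(2)] FP[OF o(3)] FP[OF o(4)]
  note t = ogob[OF og_ten[OF X Y]] ogob[OF og_ten[OF X' Y']]
  note s = B'.ten_pgl[OF q(1,3)] B'.ten_pgl[OF q(2,4)]
  note fg = B.ten_hp[OF p f g] and Ff = Fh_hp[OF o(1,2) f] and Fg = Fh_hp[OF o(3,4) g]
  note FfFg = B'.ten_hp[OF q Ff Fg]
  have "Cmp (GL K B') (ten K B' (fob F X) (fob F Y)) (fob F (ten K B X Y)) (fob F (ten K B X' Y'))
         (far F (ten K B X Y) (ten K B X' Y') (TenA (GL K B) X X' Y Y' (kap K B X X' f) (kap K B Y Y' g))) (J X Y) =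
       Cmp (GL K B') (ten K B' (fob F X) (fob F Y)) (ten K B' (fob F X') (fob F Y')) (fob F (ten K B X' Y'))
         (J X' Y') (TenA (GL K B') (fob F X) (fob F X') (fob F Y) (fob F Y')
           (far F X X' (kap K B X X' f)) (far F Y Y' (kap K B Y Y' g)))"
    using monoidal[unfolded monoidal_functor_def, THEN conjunct2, THEN conjunct2, THEN conjunct1, rule_format,
        OF o(1)[unfolded ob_def] o(2)[unfolded ob_def] o(3)[unfolded ob_def] o(4)[unfolded ob_def]
          gld_hom[OF o(1,2) f] gld_hom[OF o(3,4) g]] unfolding gld_simps .
  then have "kap K B' (ten K B' (fob F X) (fob F Y)) (fob F (ten K B X' Y'))
      (compose (hi (ten K B' (fob F X) (fob F Y))) (Fh (ten K B X Y) (ten K B X' Y') (B.ten0 X X' Y Y' f g)) (jj X Y)) =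
    kap K B' (ten K B' (fob F X) (fob F Y)) (fob F (ten K B X' Y')) (compose (hi (ten K B' (fob F X) (fob F Y)))
      (jj X' Y') (B'.ten0 (fob F X) (fob F X') (fob F Y) (fob F Y') (Fh X X' f) (Fh Y Y' g)))"
    unfolding B.GL_tensor[OF p f g] Fh_kap[OF t fg] Fh_kap[OF o(1,2) f] Fh_kap[OF o(3,4) g] B'.GL_tensor[OF q Ff Fg]
      jj_J[OF X Y] jj_J[OF X' Y'] B'.GL_comp[OF s(1) FP[OF t(1)] FP[OF t(2)] jj_hp[OF X Y] Fh_hp[OF t fg]]
      B'.GL_comp[OF s FP[OF t(2)] FfFg jj_hp[OF X' Y']] .
  then have "compose (hi (ten K B' (fob F X) (fob F Y))) (Fh (ten K B X Y) (ten K B X' Y') (B.ten0 X X' Y Y' f g)) (jj X Y) =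
    compose (hi (ten K B' (fob F X) (fob F Y))) (jj X' Y') (B'.ten0 (fob F X) (fob F X') (fob F Y) (fob F Y') (Fh X X' f) (Fh Y Y' g))"
    by (rule B'.kap_inj[OF s(1) FP[OF t(2)] B'.hp_comp[OF s(1) FP[OF t(1)] jj_hp[OF X Y] Fh_hp[OF t fg]]
          B'.hp_comp[OF s FfFg jj_hp[OF X' Y']]])
  from fun_cong[OF this, of v] show ?thesis unfolding compose_eq[OF v] .
qed

lemma ogT: "og T"
  unfolding og_def B.gT_fob by (intro conjI B.gT_pgl vect_unit_fgen B.field_K)

text \<open>A linear form takes the value 1 at \<open>t0\<close>. The statement will exclude the
  scalar 0 in \<open>jj_theta\<close>.\<close>

lemma t0_tensor_nonzero:
  "vect_pure K (hiV (fob F T)) (hiV (fob F T)) t0 t0 \<noteq> \<zero>\<^bsub>hiV (ten K B' (fob F T) (fob F T))\<^esub>"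
proof -
  obtain m where m: "m \<in> hp K B' (fob F T) T'" "m t0 = Scal \<one>\<^bsub>K\<^esub>" using t0_map by (rule bexE) (rule that)
  have l: "lin K (hiV (fob F T)) (vect_unit K) m" using B'.hp_lin[OF m(1)] unfolding B'.gT_fob .
  show ?thesis unfolding ten_hi
    by (rule vect_pure_nonzero[OF B.field_K FV[OF obT] FV[OF obT] l l t0_hi m(2) t0_hi m(2)])
qed

text \<open>Since (T \<otimes> T)(0) is one-dimensional, J sends t0 \<otimes> t0 to c times
  \<open>th\<close> of 1 \<otimes> 1. Vectors x and y are morphisms from T, and naturality of J
  along x \<otimes> y carries this relation with the same c to all X and Y. Injectivity of J and t0
  \<otimes> t0 \<noteq> 0 exclude c = 0.\<close>

lemma jj_theta:
  obtains c where "c \<in> carrier K" "c \<noteq> \<zero>\<^bsub>K\<^esub>"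
    "\<And>X Y x y. og X \<Longrightarrow> og Y \<Longrightarrow> x \<in> hi X \<Longrightarrow> y \<in> hi Y \<Longrightarrow>
      jj X Y (vect_pure K (hiV (fob F X)) (hiV (fob F Y)) (th X x) (th Y y)) =
      c \<odot>\<^bsub>hiV (fob F (ten K B X Y))\<^esub> th (ten K B X Y) (vect_pure K (hiV X) (hiV Y) x y)"
proof -
  let ?TT = "ten K B T T" and ?FT = "fob F T"
  let ?p = "vect_pure K (hiV ?FT) (hiV ?FT) t0 t0"
  let ?o = "Scal \<one>\<^bsub>K\<^esub> :: ('k, 'a) elt"
  note oTT = ogob[OF og_ten[OF ogT ogT]] and vU = vect_unit_vs[OF B.field_K]
  have o: "?o \<in> carrier (vect_unit K)" by simp
  have p: "?p \<in> hi (ten K B' ?FT ?FT)" unfolding ten_hi by (rule vt_pure_closed[OF FV[OF obT] FV[OF obT] t0_hi t0_hi])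
  obtain t where t: "t \<in> hi ?TT" "th ?TT t = jj T T ?p"
    by (rule th_surj[OF oTT B'.hp_closed[OF jj_hp[OF ogT ogT] p]])
  obtain c where c: "c \<in> carrier K"
    "t = c \<odot>\<^bsub>vect_tensor K (vect_unit K) (vect_unit K)\<^esub> vect_pure K (vect_unit K) (vect_unit K) ?o ?o"
    by (rule unit_tensor_gen[OF B.field_K t(1)[unfolded ten_hi B.gT_fob]])
  have "c \<noteq> \<zero>\<^bsub>K\<^esub>"
  proof
    assume c0: "c = \<zero>\<^bsub>K\<^esub>"
    note P = B'.ten_pgl[OF FP[OF obT] FP[OF obT]]
    note vP = B'.hi_vs[OF P]
    interpret TT: vectorspace K "hiV ?TT" by (rule obV[OF oTT])
    interpret P: vectorspace K "hiV (ten K B' ?FT ?FT)" by (rule vP)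
    have "t = \<zero>\<^bsub>hiV ?TT\<^esub>"
      unfolding c(2) c0 ten_hi B.gT_fob
      by (rule TT.lmult_0[unfolded ten_hi B.gT_fob]) (rule vt_pure_closed[OF vU vU o o])
    then have "jj T T ?p = \<zero>\<^bsub>hiV (fob F ?TT)\<^esub>"
      using t(2) lin_zero[OF obV[OF oTT] FV[OF oTT] th_lin[OF oTT]] by simp
    also have "\<dots> = jj T T \<zero>\<^bsub>hiV (ten K B' ?FT ?FT)\<^esub>"
      by (rule lin_zero[OF vP FV[OF oTT] B'.hp_lin[OF jj_hp[OF ogT ogT]], symmetric])
    finally have e: "jj T T ?p = jj T T \<zero>\<^bsub>hiV (ten K B' ?FT ?FT)\<^esub>" .
    obtain j' where "hiso K B' (ten K B' ?FT ?FT) (fob F ?TT) (jj T T) j'" using jj_iso[OF ogT ogT] by (rule exE)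
    then have j': "x \<in> hi (ten K B' ?FT ?FT) \<Longrightarrow> j' (jj T T x) = x" for x by (simp only: hiso_def)
    have "?p = \<zero>\<^bsub>hiV (ten K B' ?FT ?FT)\<^esub>" using j'[OF p] j'[OF P.zero_closed] e by metis
    then show False using t0_tensor_nonzero by (rule notE[rotated])
  qed
  moreover have "jj X Y (vect_pure K (hiV (fob F X)) (hiV (fob F Y)) (th X x) (th Y y)) =
      c \<odot>\<^bsub>hiV (fob F (ten K B X Y))\<^esub> th (ten K B X Y) (vect_pure K (hiV X) (hiV Y) x y)"
    if X: "og X" and Y: "og Y" and x: "x \<in> hi X" and y: "y \<in> hi Y" for X Y x y
  proof -
    note oX = ogob[OF X] and oY = ogob[OF Y] and oXY = ogob[OF og_ten[OF X Y]]
    note tx = tauN[OF oX x] and ty = tauN[OF oY y]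
    note lx = B.hp_lin[OF tx, unfolded B.gT_fob] and ly = B.hp_lin[OF ty, unfolded B.gT_fob]
    note h = B.ten_hp[OF B.gT_pgl obP[OF oX] B.gT_pgl obP[OF oY] tx ty]
    have "B.ten0 T X T Y (tau K X x) (tau K Y y) t =
        c \<odot>\<^bsub>hiV (ten K B X Y)\<^esub> vect_pure K (hiV X) (hiV Y) x y"
      unfolding c(2) B.gT_fob ten_hi
        lin_smult[OF TenA_lin[OF vU vU obV[OF oX] obV[OF oY] lx ly] c(1) vt_pure_closed[OF vU vU o o]]
        TenA_pure[OF vU vU obV[OF oX] obV[OF oY] lx ly o o] B.tau_one[OF obP[OF oX] x] B.tau_one[OF obP[OF oY] y] ..
    then have "th (ten K B X Y) (c \<odot>\<^bsub>hiV (ten K B X Y)\<^esub> vect_pure K (hiV X) (hiV Y) x y) =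
        Fh ?TT (ten K B X Y) (B.ten0 T X T Y (tau K X x) (tau K Y y)) (jj T T ?p)"
      using th_nat[OF oTT oXY h t(1)] t(2) by simp
    also have "\<dots> = jj X Y (B'.ten0 ?FT (fob F X) ?FT (fob F Y) (Fh T X (tau K X x)) (Fh T Y (tau K Y y)) ?p)"
      by (rule jj_nat[OF ogT X ogT Y tx ty p])
    also have "B'.ten0 ?FT (fob F X) ?FT (fob F Y) (Fh T X (tau K X x)) (Fh T Y (tau K Y y)) ?p =
        vect_pure K (hiV (fob F X)) (hiV (fob F Y)) (th X x) (th Y y)"
      unfolding th_def
      by (rule TenA_pure[OF FV[OF obT] FV[OF obT] FV[OF oX] FV[OF oY] B'.hp_lin[OF Fh_hp[OF obT oX tx]]
            B'.hp_lin[OF Fh_hp[OF obT oY ty]] t0_hi t0_hi])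
    finally have "jj X Y (vect_pure K (hiV (fob F X)) (hiV (fob F Y)) (th X x) (th Y y)) =
        th (ten K B X Y) (c \<odot>\<^bsub>hiV (ten K B X Y)\<^esub> vect_pure K (hiV X) (hiV Y) x y)" ..
    also have "\<dots> = c \<odot>\<^bsub>hiV (fob F (ten K B X Y))\<^esub> th (ten K B X Y) (vect_pure K (hiV X) (hiV Y) x y)"
      by (rule lin_smult[OF th_lin[OF oXY] c(1)]) (unfold ten_hi, rule vt_pure_closed[OF obV[OF oX] obV[OF oY] x y])
    finally show ?thesis .
  qed
  ultimately show ?thesis by (rule that[OF c(1)])
qed

text \<open>Let c act on J(r \<otimes> r), where r is \<open>th\<close> of the unit of R. In F(R
  \<otimes> R) it acts as \<open>rho c\<close> does on R \<otimes> R, through the comultiplication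
  of \<open>B\<close>. Before J is applied, it acts on F R \<otimes> F R through the
  comultiplication of \<open>B'\<close>. The scalar of \<open>jj_theta\<close> occurs on both sides
  and cancels.\<close>

lemma rho_comult:
  assumes c: "c \<in> carrier B'"
  shows "comult B (rho c) = tens_lift (tensor K B B) (\<lambda>x y. pure_tensor K B B (rho x) (rho y)) (comult B' c)"
proof -
  let ?N = "ten K B R R" and ?V = "hiV R" and ?FR = "fob F R"
  let ?VV = "vect_tensor K ?V ?V" and ?FV = "hiV ?FR" and ?W = "hiV (fob F (ten K B R R))"
  let ?r = "th R (\<iota> \<one>\<^bsub>B\<^esub>)"
  have ogR: "og R" using RD(1,2) by (simp add: og_def)
  note oN = ogob[OF og_ten[OF ogR ogR]] and vR = obV[OF obR] and vFR = FV[OF obR]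
  note vVV = vt_vs[OF vR vR]
  note sN = B.sat_ten(1)[OF RD(1,1,3,3)] and i1 = iota[OF B.B.one_closed]
  have VN: "hiV ?N = ?VV" by (rule ten_hi)
  have pc: "a \<in> carrier B \<Longrightarrow> b \<in> carrier B \<Longrightarrow> vect_pure K ?V ?V (\<iota> a) (\<iota> b) \<in> carrier ?VV" for a b
    by (rule vt_pure_closed[OF vR vR iota iota])
  \<comment> \<open>\<open>A\<close> and \<open>A'\<close> are the two sides of the claim, carried
    from the tensor square of \<open>B\<close> to that of R(0) by \<iota>.\<close>
  define A where "A = tens_lift ?VV (\<lambda>p q. vect_pure K ?V ?V (\<iota> p) (\<iota> q)) (comult B (rho c))"
  define A' where "A' = tens_lift ?VV (\<lambda>p q. vect_pure K ?V ?V (\<iota> (rho p)) (\<iota> (rho q))) (comult B' c)"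
  have sB: "(p, q) \<in> set (comult B (rho c)) \<Longrightarrow> p \<in> carrier B \<and> q \<in> carrier B" for p q
    using B.comult_set[OF rho_closed[OF c]] by auto
  have sB': "(p, q) \<in> set (comult B' c) \<Longrightarrow> p \<in> carrier B' \<and> q \<in> carrier B'" for p q
    using B'.comult_set[OF c] by auto
  have Ac: "A \<in> carrier ?VV" unfolding A_def by (rule tens_lift_closed[OF vVV]) (auto dest: sB intro: pc)
  have A'c: "A' \<in> carrier ?VV" unfolding A'_def
    by (rule tens_lift_closed[OF vVV]) (auto dest!: sB' intro: pc rho_closed)
  obtain d where d: "d \<in> carrier K" "d \<noteq> \<zero>\<^bsub>K\<^esub>" and J: "\<And>x y. x \<in> hi R \<Longrightarrow> y \<in> hi R \<Longrightarrow>
      jj R R (vect_pure K ?FV ?FV (th R x) (th R y)) = d \<odot>\<^bsub>?W\<^esub> th ?N (vect_pure K ?V ?V x y)"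
    using jj_theta ogR by metis
  have z: "vect_pure K ?V ?V (\<iota> \<one>\<^bsub>B\<^esub>) (\<iota> \<one>\<^bsub>B\<^esub>) \<in> hi ?N" unfolding VN by (rule pc) simp_all
  have zr: "vect_pure K ?FV ?FV ?r ?r \<in> hi (ten K B' ?FR ?FR)"
    unfolding ten_hi by (rule vt_pure_closed[OF vFR vFR r_hi r_hi])
  have sFN: "sat B' (fob F ?N)" by (rule sat_F[OF oN sN]) (use og_ten[OF ogR ogR] in \<open>simp only: og_def\<close>)
  have actA: "act B ?N (rho c) (vect_pure K ?V ?V (\<iota> \<one>\<^bsub>B\<^esub>) (\<iota> \<one>\<^bsub>B\<^esub>)) = A"
    unfolding A_def B.sat_ten(2)[OF RD(1,1,3,3) i1 i1 rho_closed[OF c]]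
    by (rule tens_lift_cong) (auto dest: sB simp: act_R_one)
  have lW: "lin K ?VV ?W (\<lambda>x. d \<odot>\<^bsub>?W\<^esub> th ?N x)"
    unfolding VN[symmetric] by (rule lin_scale[OF obV[OF oN] FV[OF oN] th_lin[OF oN] d(1)])
  have "d \<odot>\<^bsub>?W\<^esub> th ?N A = d \<odot>\<^bsub>?W\<^esub> act B' (fob F ?N) c (th ?N (vect_pure K ?V ?V (\<iota> \<one>\<^bsub>B\<^esub>) (\<iota> \<one>\<^bsub>B\<^esub>)))"
    unfolding th_act[OF oN sN z c] actA ..
  also have "\<dots> = act B' (fob F ?N) c (jj R R (vect_pure K ?FV ?FV ?r ?r))"
    unfolding J[OF i1 i1] B'.act_smult[OF FP[OF oN] sFN th_closed[OF oN z] d(1) c] ..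
  also have "\<dots> = jj R R (act B' (ten K B' ?FR ?FR) c (vect_pure K ?FV ?FV ?r ?r))"
    by (rule B'.hp_act[OF B'.ten_pgl[OF FP[OF obR] FP[OF obR]] FP[OF oN] jj_hp[OF ogR ogR]
          B'.sat_ten(1)[OF FP[OF obR] FP[OF obR] FR_sat FR_sat] zr c, symmetric])
  also have "act B' (ten K B' ?FR ?FR) c (vect_pure K ?FV ?FV ?r ?r) =
      tens_lift (vect_tensor K ?FV ?FV) (\<lambda>p q. vect_pure K ?FV ?FV (th R (\<iota> (rho p))) (th R (\<iota> (rho q)))) (comult B' c)"
    unfolding B'.sat_ten(2)[OF FP[OF obR] FP[OF obR] FR_sat FR_sat r_hi r_hi c]
    by (rule tens_lift_cong) (auto dest: sB' simp: th_rho)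
  also have "jj R R \<dots> = tens_lift ?W (\<lambda>p q. jj R R (vect_pure K ?FV ?FV (th R (\<iota> (rho p))) (th R (\<iota> (rho q))))) (comult B' c)"
    by (rule tens_lift_hom[OF vt_vs[OF vFR vFR] FV[OF oN] B'.hp_lin[OF jj_hp[OF ogR ogR], unfolded ten_hi]])
      (auto dest!: sB' intro!: vt_pure_closed[OF vFR vFR] th_closed[OF obR] iota rho_closed)
  also have "\<dots> = tens_lift ?W (\<lambda>p q. d \<odot>\<^bsub>?W\<^esub> th ?N (vect_pure K ?V ?V (\<iota> (rho p)) (\<iota> (rho q)))) (comult B' c)"
    by (rule tens_lift_cong, rule J) (auto dest!: sB' intro: iota rho_closed)
  also have "\<dots> = d \<odot>\<^bsub>?W\<^esub> th ?N A'"
    unfolding A'_def by (rule tens_lift_hom[OF vVV FV[OF oN] lW, symmetric]) (auto dest!: sB' intro: pc rho_closed)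
  finally have "d \<odot>\<^bsub>?W\<^esub> th ?N A = d \<odot>\<^bsub>?W\<^esub> th ?N A'" .
  then have "th ?N A = th ?N A'"
    by (rule vectorspace_smult_cancel[OF FV[OF oN] d th_closed[OF oN Ac[folded VN]] th_closed[OF oN A'c[folded VN]]])
  then have AA: "A = A'" by (rule inj_onD[OF th_inj[OF oN] _ Ac[folded VN] A'c[folded VN]])
  \<comment> \<open>The inverse of \<iota> leads back from the tensor square of R(0) to that of
    \<open>B\<close>.\<close>
  define k where "k = inv_into (carrier B) \<iota>"
  have bij: "\<iota> ` carrier B = hi R" "inj_on \<iota> (carrier B)" using RD(5) by (auto simp: bij_betw_def)
  have lk: "lin K ?V B k"
    unfolding k_def using bij by (intro lin_inv_into[OF B.vs_B RD(4) _ _ lin_id]) simp_all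
  have ki: "b \<in> carrier B \<Longrightarrow> k (\<iota> b) = b" for b unfolding k_def by (rule inv_into_f_f[OF bij(2)])
  have bl: "bilin K ?V ?V (tensor K B B) (\<lambda>x y. pure_tensor K B B (k x) (k y))"
    by (rule bilin_comp[OF pure_tensor_bilin[OF B.vs_B B.vs_B] lk lk lin_id])
  define G where "G x = tens_lift (tensor K B B) (\<lambda>x y. pure_tensor K B B (k x) (k y)) (terms x)" for x
  have lG: "lin K ?VV (tensor K B B) G" unfolding G_def[abs_def] by (rule vt_lift_lin[OF vR vR B.vs_BB bl])
  have Gp: "G (vect_pure K ?V ?V (\<iota> a) (\<iota> b)) = pure_tensor K B B a b" if "a \<in> carrier B" "b \<in> carrier B" for a b
    unfolding G_def vt_lift_pure[OF vR vR B.vs_BB bl iota[OF that(1)] iota[OF that(2)]] ki[OF that(1)] ki[OF that(2)] ..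
  have "comult B (rho c) \<in> carrier (tensor K B B)" by (rule lin_closed[OF B.comult_lin rho_closed[OF c]])
  then have "comult B (rho c) = tens_lift (tensor K B B) (pure_tensor K B B) (comult B (rho c))"
    using tensor_pure_sum[OF B.vs_B B.vs_B B.comult_set[OF rho_closed[OF c]]] tensor_carrier[OF B.vs_B B.vs_B] by simp
  also have "\<dots> = tens_lift (tensor K B B) (\<lambda>p q. G (vect_pure K ?V ?V (\<iota> p) (\<iota> q))) (comult B (rho c))"
    by (rule tens_lift_cong) (auto dest: sB simp: Gp)
  also have "\<dots> = G A" unfolding A_def
    by (rule tens_lift_hom[OF vVV B.vs_BB lG, symmetric]) (auto dest: sB intro: pc)
  also have "\<dots> = tens_lift (tensor K B B) (\<lambda>p q. G (vect_pure K ?V ?V (\<iota> (rho p)) (\<iota> (rho q)))) (comult B' c)"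
    unfolding AA A'_def by (rule tens_lift_hom[OF vVV B.vs_BB lG]) (auto dest!: sB' intro: pc rho_closed)
  also have "\<dots> = tens_lift (tensor K B B) (\<lambda>x y. pure_tensor K B B (rho x) (rho y)) (comult B' c)"
    by (rule tens_lift_cong) (auto dest!: sB' simp: Gp rho_closed)
  finally show ?thesis .
qed

text \<open>On a glider N with F N isomorphic to R', each c acts as \<open>rho c\<close>.
  Injectivity holds since c is determined by its action on the unit of R'. For surjectivity, every
  vector of R'(0) is of the form c 1, so b n = (rho c) n for the corresponding n in N(0), and a map
  N \<rightarrow> R with n going to 1 yields b = rho c.\<close>

lemma rho_bij: "bij_betw rho (carrier B') (carrier B)"
proof -
  obtain N i i' where N: "ob N" and "hiso K B' (fob F N) R' i i'" by (rule ess_surj[OF RD'(1,2)])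
  then have i: "i \<in> hp K B' (fob F N) R'" "i' \<in> hp K B' R' (fob F N)" and i'i: "\<And>x. x \<in> hi (fob F N) \<Longrightarrow> i' (i x) = x"
    and ii': "\<And>x. x \<in> hi R' \<Longrightarrow> i (i' x) = x" by (auto simp: hiso_def)
  note PN = obP[OF N] and FN = FP[OF N]
  have on: "hi (fob F N) \<subseteq> i' ` hi R'"
  proof
    fix x assume x: "x \<in> hi (fob F N)"
    show "x \<in> i' ` hi R'" by (rule image_eqI[where f = i', OF i'i[OF x, symmetric] B'.hp_closed[OF i(1) x]])
  qed
  have fg: "fgen K (hiV N)"
    unfolding th_fgen[OF N, symmetric]
    by (rule fgen_image[OF B'.hi_vs[OF RD'(1)] FV[OF N] B'.hp_lin[OF i(2)] on RD'(2)])
  have sFN: "sat B' (fob F N)" by (rule B'.sat_hp[OF RD'(1) FN i(2) RD'(3) on])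
  have sN: "sat B N" by (rule sat_reflect[OF N sFN fg])
  have io: "\<iota>' c \<in> hi R'" if "c \<in> carrier B'" for c using that by (rule lin_closed[OF RD'(4)])
  note io1 = io[OF B'.B.one_closed]
  have a1: "act B' R' c (\<iota>' \<one>\<^bsub>B'\<^esub>) = \<iota>' c" if "c \<in> carrier B'" for c
    using that by (simp add: RD'(6) B'.B.one_closed)
  obtain n where n: "n \<in> hi N" "th N n = i' (\<iota>' \<one>\<^bsub>B'\<^esub>)" by (rule th_surj[OF N B'.hp_closed[OF i(2) io1]])
  have ac: "act B' (fob F N) c (th N n) = i' (\<iota>' c)" if c: "c \<in> carrier B'" for c
    unfolding n(2) B'.hp_act[OF RD'(1) FN i(2) RD'(3) io1 c, symmetric] a1[OF c] ..
  \<comment> \<open>\<open>m\<close> exists because R' is free on its unit. Composed with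
    \<open>i\<close> it lifts to \<open>h\<close>: N \<rightarrow> R, and the calculation below
    shows that \<open>h\<close> sends n to the unit.\<close>
  obtain m where m: "m \<in> hp K B' R' (fob F R)" "\<And>c. c \<in> carrier B' \<Longrightarrow> m (\<iota>' c) = act B' (fob F R) c (th R (\<iota> \<one>\<^bsub>B\<^esub>))"
    using B'.regular_map[OF R' FP[OF obR] FR_sat r_hi] by metis
  obtain h where h: "h \<in> hp K B N R" "Fh N R h = compose (hi (fob F N)) m i"
    by (rule Fh_surj[OF N obR B'.hp_comp[OF FN RD'(1) i(1) m(1)]])
  have "th R (h n) = m (i (th N n))"
    unfolding th_nat[OF N obR h(1) n(1), symmetric] h(2) compose_eq[OF th_closed[OF N n(1)]] ..
  also have "\<dots> = th R (\<iota> \<one>\<^bsub>B\<^esub>)"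
    unfolding n(2) ii'[OF io1] m(2)[OF B'.B.one_closed] by (rule B'.act_one[OF FP[OF obR] FR_sat r_hi])
  finally have hn: "h n = \<iota> \<one>\<^bsub>B\<^esub>"
    by (rule inj_onD[OF th_inj[OF obR] _ B.hp_closed[OF h(1) n(1)] iota[OF B.B.one_closed]])
  have iota_inj: "\<iota> a = \<iota> b \<Longrightarrow> a \<in> carrier B \<Longrightarrow> b \<in> carrier B \<Longrightarrow> a = b" for a b
    using th_iota_inj[of a b] by simp
  show ?thesis unfolding bij_betw_def
  proof
    show "inj_on rho (carrier B')"
    proof (rule inj_onI)
      fix c d assume cd: "c \<in> carrier B'" "d \<in> carrier B'" and e: "rho c = rho d"
      have "i' (\<iota>' c) = i' (\<iota>' d)"
        unfolding ac[OF cd(1), symmetric] ac[OF cd(2), symmetric] th_act[OF N sN n(1) cd(1)] th_act[OF N sN n(1) cd(2)] e ..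
      then have "\<iota>' c = \<iota>' d" using ii'[OF io[OF cd(1)]] ii'[OF io[OF cd(2)]] by metis
      then show "c = d" using RD'(5) cd by (auto simp: bij_betw_def inj_on_def)
    qed
    have "b \<in> rho ` carrier B'" if b: "b \<in> carrier B" for b
    proof -
      \<comment> \<open>The vector b n is moved to R'(0), where it becomes some c 1. Moving back
        gives b n = (rho c) n, to which \<open>h\<close> is applied.\<close>
      note an = B.act_closed[OF PN sN n(1) b]
      have "i (th N (act B N b n)) \<in> \<iota>' ` carrier B'"
        using B'.hp_closed[OF i(1) th_closed[OF N an]] RD'(5) by (simp add: bij_betw_def)
      then obtain c where c: "c \<in> carrier B'" "i (th N (act B N b n)) = \<iota>' c" by auto
      have "th N (act B N b n) = th N (act B N (rho c) n)"
        unfolding th_act[OF N sN n(1) c(1), symmetric] ac[OF c(1)] c(2)[symmetric] i'i[OF th_closed[OF N an]] ..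
      then have e: "act B N b n = act B N (rho c) n"
        by (rule inj_onD[OF th_inj[OF N] _ an B.act_closed[OF PN sN n(1) rho_closed[OF c(1)]]])
      have hb: "h (act B N x n) = \<iota> x" if "x \<in> carrier B" for x
        unfolding B.hp_act[OF PN RD(1) h(1) sN n(1) that] hn by (rule act_R_one[OF that])
      have "\<iota> b = \<iota> (rho c)" unfolding hb[OF b, symmetric] hb[OF rho_closed[OF c(1)], symmetric] e ..
      then have "b = rho c" by (rule iota_inj[OF _ b rho_closed[OF c(1)]])
      then show ?thesis using c(1) by blast
    qed
    then show "rho ` carrier B' = carrier B" using rho_closed by blast
  qed
qed

lemma bialgebras_isomorphic: "bialg_isomorphic K B B'"
proof -
  have "bialg_iso K B' B rho (inv_into (carrier B') rho)"
    by (rule bialg_isoI[OF B'.bialgebra_axioms B.bialgebra_axioms rho_bij rho_lin rho_one rho_mult rho_counit rho_comult])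
  then show ?thesis by (intro bialg_iso.isomorphic[OF bialg_iso.symmetric])
qed

end

theorem theorem1p3:
  fixes K :: "'k ring"
    and B :: "('k, 'b) bialg"
    and B' :: "('k, 'c) bialg"
  assumes "field K"
    and "bialgebra K B" and "vectorspace.fin_dim K B"
    and "bialgebra K B'" and "vectorspace.fin_dim K B'"
  shows "linearly_monoidally_equivalent K
      (glid K B (trivial_filtration K B) {-1, 0} :: ('k, 'b, 'a) glid_category)
      (glid K B' (trivial_filtration K B') {-1, 0} :: ('k, 'c, 'a) glid_category)
    \<longleftrightarrow> bialg_isomorphic K B B'"
proof
  interpret B: bialgebra K B by fact
  interpret B': bialgebra K B' by fact
  assume "linearly_monoidally_equivalent K (gld K B :: ('k, 'b, 'a) glid_category) (gld K B' :: ('k, 'c, 'a) glid_category)"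
  then obtain F J u where F: "monoidal_functor K (gld K B :: ('k, 'b, 'a) glid_category) (gld K B' :: ('k, 'c, 'a) glid_category) F J u"
    "linear_equivalence K (gld K B) (gld K B') F" unfolding linearly_monoidally_equivalent_def by blast
  have "fgen K B" "fgen K B'" using assms by (simp_all add: fin_dim_iff_fgen[OF B.vs_B] fin_dim_iff_fgen[OF B'.vs_B])
  obtain R :: "('k, 'b, 'a) glider" and \<iota> where R: "regular K B R \<iota>" by (rule B.regular_glider[OF \<open>fgen K B\<close>])
  obtain R' :: "('k, 'c, 'a) glider" and \<iota>' where R': "regular K B' R' \<iota>'" by (rule B'.regular_glider[OF \<open>fgen K B'\<close>])
  interpret glid_monoidal_equivalence K B B' F J u R \<iota> R' \<iota>' by unfold_locales (fact F R R')+
  show "bialg_isomorphic K B B'" by (rule bialgebras_isomorphic)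
next
  assume "bialg_isomorphic K B B'"
  then show "linearly_monoidally_equivalent K (gld K B :: ('k, 'b, 'a) glid_category) (gld K B' :: ('k, 'c, 'a) glid_category)"
    by (rule equivalent_if_isomorphic[OF assms(2,4)])
qed

end
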